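(* Let $n\geq4$. For the normalized eigenvalue $\eta_m(\Omega)|\partial\Omega|^{1/(n-1)}$ with $0\leq m\leq n$, the Euclidean balls are not minimizers among Euclidean domains: there exists a smooth bounded domain $\Omega\subset\mathbb{R}^n$ with $\eta_m(\Omega)|\partial\Omega|^{1/(n-1)}<\eta_m(\mathbb{B}^n_1)|\partial\mathbb{B}^n_1|^{1/(n-1)}$. For $m\geq n+1$, the Euclidean balls are not maximizers among Euclidean domains: there exists a smooth bounded domain $\Omega\subset\mathbb{R}^n$ with $\eta_m(\Omega)|\partial\Omega|^{1/(n-1)}>\eta_m(\mathbb{B}^n_1)|\partial\mathbb{B}^n_1|^{1/(n-1)}$.
   Context: For a bounded smooth domain $\Omega\subset\mathbb{R}^n$, $0<\eta_0(\Omega)<\eta_1(\Omega)\leq\eta_2(\Omega)\leq\cdots$ are the eigenvalues, counted with multiplicity, of the problem $\Delta^2u=0$ in $\Omega$, $u=0$ and $\Delta u=\eta\,\partial_\nu u$ on $\partial\Omega$, where $\Delta=\sum_i\partial_i^2$ and $\nu$ is the outward unit normal. $|\partial\Omega|$ is the boundary area and $\mathbb{B}^n_1$ the unit ball. *)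

theory Defs
  imports "HOL-Analysis.Analysis"
begin

definition pderiv :: "'n::finite \<Rightarrow> (real^'n \<Rightarrow> real) \<Rightarrow> real^'n \<Rightarrow> real" where
  "pderiv i f x = frechet_derivative f (at x) (axis i 1)"

fun iter_pderiv :: "'n::finite list \<Rightarrow> (real^'n \<Rightarrow> real) \<Rightarrow> real^'n \<Rightarrow> real" where
  "iter_pderiv [] f = f"
| "iter_pderiv (i # is) f = pderiv i (iter_pderiv is f)"

definition smooth :: "(real^'n::finite \<Rightarrow> real) \<Rightarrow> bool" where
  "smooth f \<longleftrightarrow> (\<forall>is x. iter_pderiv is f differentiable (at x))"

definition laplacian :: "(real^'n::finite \<Rightarrow> real) \<Rightarrow> real^'n \<Rightarrow> real" where
  "laplacian f x = (\<Sum>i\<in>UNIV. pderiv i (pderiv i f) x)"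

definition gradient :: "(real^'n::finite \<Rightarrow> real) \<Rightarrow> real^'n \<Rightarrow> real^'n" where
  "gradient f x = (\<chi> i. pderiv i f x)"

definition defining_function :: "(real^'n::finite) set \<Rightarrow> (real^'n \<Rightarrow> real) \<Rightarrow> bool" where
  "defining_function \<Omega> \<phi> \<longleftrightarrow> smooth \<phi> \<and> \<Omega> = {x. \<phi> x < 0} \<and> frontier \<Omega> = {x. \<phi> x = 0}
     \<and> (\<forall>x\<in>frontier \<Omega>. gradient \<phi> x \<noteq> 0)"

definition smooth_bounded_domain :: "(real^'n::finite) set \<Rightarrow> bool" where
  "smooth_bounded_domain \<Omega> \<longleftrightarrow> open \<Omega> \<and> connected \<Omega> \<and> bounded \<Omega> \<and> \<Omega> \<noteq> {}
     \<and> (\<exists>\<phi>. defining_function \<Omega> \<phi>)"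

definition outward_normal :: "(real^'n::finite) set \<Rightarrow> real^'n \<Rightarrow> real^'n" where
  "outward_normal \<Omega> x = (let \<phi> = (SOME \<phi>. defining_function \<Omega> \<phi>)
      in (1 / norm (gradient \<phi> x)) *\<^sub>R gradient \<phi> x)"

definition normal_deriv :: "(real^'n::finite) set \<Rightarrow> (real^'n \<Rightarrow> real) \<Rightarrow> real^'n \<Rightarrow> real" where
  "normal_deriv \<Omega> u x = frechet_derivative u (at x) (outward_normal \<Omega> x)"

definition hausdorff_const :: "real \<Rightarrow> real" where
  "hausdorff_const s = pi powr (s / 2) / Gamma (s / 2 + 1)"

definition hausdorff_measure :: "real \<Rightarrow> ('a::metric_space) set \<Rightarrow> ennreal" where
  "hausdorff_measure s A =
     (SUP \<delta>\<in>{0<..}. INF C\<in>{C :: nat \<Rightarrow> 'a set. A \<subseteq> (\<Union>i. C i) \<and> (\<forall>i. bounded (C i) \<and> diameter (C i) \<le> \<delta>)}.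
        (\<Sum>i. ennreal (hausdorff_const s * (diameter (C i) / 2) powr s)))"

definition boundary_area :: "(real^'n::finite) set \<Rightarrow> real" where
  "boundary_area \<Omega> = enn2real (hausdorff_measure (real CARD('n) - 1) (frontier \<Omega>))"

text \<open>Classical eigenfunctions, smooth up to the boundary (restrictions of smooth functions on R^n).\<close>
definition eigenfunction :: "(real^'n::finite) set \<Rightarrow> real \<Rightarrow> (real^'n \<Rightarrow> real) \<Rightarrow> bool" where
  "eigenfunction \<Omega> \<eta> u \<longleftrightarrow> smooth u
     \<and> (\<forall>x\<in>\<Omega>. laplacian (laplacian u) x = 0)
     \<and> (\<forall>x\<in>frontier \<Omega>. u x = 0 \<and> laplacian u x = \<eta> * normal_deriv \<Omega> u x)"

definition lin_indep_on :: "(real^'n::finite) set \<Rightarrow> (real^'n \<Rightarrow> real) set \<Rightarrow> bool" where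
  "lin_indep_on S F \<longleftrightarrow> (\<forall>c. (\<forall>x\<in>S. (\<Sum>u\<in>F. c u * u x) = 0) \<longrightarrow> (\<forall>u\<in>F. c u = 0))"

definition multiplicity_eig :: "(real^'n::finite) set \<Rightarrow> real \<Rightarrow> nat" where
  "multiplicity_eig \<Omega> \<eta> = Sup {card F | F. finite F \<and> F \<subseteq> {u. eigenfunction \<Omega> \<eta> u}
      \<and> lin_indep_on (closure \<Omega>) F}"

definition eig_count :: "(real^'n::finite) set \<Rightarrow> real \<Rightarrow> nat" where
  "eig_count \<Omega> t = (\<Sum>\<eta>\<in>{\<eta>. \<eta> \<le> t \<and> 0 < multiplicity_eig \<Omega> \<eta>}. multiplicity_eig \<Omega> \<eta>)"

text \<open>eta_m, m = 0,1,2,..., in nondecreasing order counted with multiplicity.\<close>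
definition steklov_eig :: "nat \<Rightarrow> (real^'n::finite) set \<Rightarrow> real" where
  "steklov_eig m \<Omega> = Inf {t. m < eig_count \<Omega> t}"

end

theory Submission
  imports Defs
begin

text \<open>The competitors are the annuli $\epsilon < |x| < 1$ with small $\epsilon$. Expansion in spherical harmonics reduces
  the problem to one radial equation for each degree $k$. On the ball, degree $k$ contributes the single eigenvalue
  $n + 2k$, with the multiplicity of the spherical harmonics. On the annulus it contributes two eigenvalues, the roots
  of a $2 \times 2$ determinant. The inner sphere enlarges the boundary area by the factor $1 + \xi$ with
  $\xi = \epsilon^{n-1}$, so the normalising factor grows by about $1 + \xi/(n-1)$. In degrees $0$ and $1$ the lower
  root is at most $(n + 2k)(1 - \xi)$, which beats this gain; these degrees account for $m \le n$. In degrees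
  $k \ge 2$ the lower root exceeds $(n + 2k)(1 - \xi/(4(n-1)))$, and the gain in area wins.\<close>

section \<open>Infinitely differentiable functions on the line\<close>

text \<open>The split at degree 2 comes from one exponent. In degree k the determinant is A C - B^2:
  A vanishes near the ball eigenvalue, B stays bounded and away from 0, and C is of order
  \<epsilon>^(3-n-2k), the size on the inner sphere of the singular radial harmonic. So the lower
  root drops by a relative amount of order B^2/C, that is \<epsilon>^(n+2k-3). Against \<xi> =
  \<epsilon>^(n-1) this is much larger for k = 0, of the same order for k = 1, where only constants
  decide, and negligible for k >= 2. Several features of the definitions shape the rest.
  Eigenfunctions are smooth on the whole space, so radial solutions must be continued across the
  hole. Multiplicity is a supremum over all independent families, so the list of eigenfunctions must
  be proved complete; profiles of all high degrees are shown to vanish, which keeps the harmonic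
  expansions finite. The normal comes from an arbitrarily chosen defining function and is computed
  for every one of them. Integrals over spheres are replaced by solid integrals with a radial
  weight.\<close>

coinductive cinf :: "(real \<Rightarrow> real) \<Rightarrow> bool" where
  cinfI: "(\<And>x. (g has_real_derivative g' x) (at x)) \<Longrightarrow> cinf g' \<Longrightarrow> cinf g"

lemma cinf_has_deriv: "cinf g \<Longrightarrow> (g has_real_derivative deriv g x) (at x)"
  by (metis DERIV_imp_deriv cinf.cases)

lemma cinf_deriv: "cinf g \<Longrightarrow> cinf (deriv g)"
proof (erule cinf.cases)
  fix f g' assume *: "g = f" "\<And>x. (f has_real_derivative g' x) (at x)" "cinf g'"
  then have "deriv g = g'"
    using DERIV_imp_deriv by blast
  with * show "cinf (deriv g)" by simp
qed

lemma cinf_isCont: "cinf g \<Longrightarrow> isCont g x"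
  using cinf_has_deriv DERIV_isCont by blast

lemma cinf_continuous_on: "cinf g \<Longrightarrow> continuous_on S g"
  using cinf_isCont continuous_at_imp_continuous_on by blast

text \<open>Coinduction up to sums, products and compositions.\<close>

inductive cinf_gen :: "(real \<Rightarrow> real) \<Rightarrow> bool" where
  cinf: "cinf f \<Longrightarrow> cinf_gen f"
| add: "cinf_gen f \<Longrightarrow> cinf_gen g \<Longrightarrow> cinf_gen (\<lambda>x. f x + g x)"
| mult: "cinf_gen f \<Longrightarrow> cinf_gen g \<Longrightarrow> cinf_gen (\<lambda>x. f x * g x)"
| comp: "cinf g \<Longrightarrow> cinf_gen f \<Longrightarrow> cinf_gen (\<lambda>x. g (f x))"
| inverse: "cinf_gen f \<Longrightarrow> (\<And>x. f x > 0) \<Longrightarrow> cinf_gen (\<lambda>x. inverse (f x))"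
| ln: "cinf_gen f \<Longrightarrow> (\<And>x. f x > 0) \<Longrightarrow> cinf_gen (\<lambda>x. ln (f x))"

lemma cinf_const [simp]: "cinf (\<lambda>x. c)"
proof -
  have "cinf f" if "\<exists>c. f = (\<lambda>x. c)" for f
    using that
  proof (coinduction arbitrary: f)
    case (cinf f)
    then obtain c where "f = (\<lambda>x. c)" by blast
    then show ?case by (intro exI[of _ f] exI[of _ "\<lambda>x. 0"]) auto
  qed
  then show ?thesis by blast
qed

lemma cinf_id [simp]: "cinf (\<lambda>x. x)"
  by (rule cinfI[of _ "\<lambda>x. 1"]) auto

lemma cinf_exp [simp]: "cinf exp"
proof -
  have "cinf f" if "f = exp" for f :: "real \<Rightarrow> real"
    using that
  proof (coinduction arbitrary: f)
    case (cinf f)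
    then show ?case by (intro exI[of _ f] exI[of _ exp]) auto
  qed
  then show ?thesis by blast
qed

lemma cinf_gen_deriv:
  "cinf_gen f \<Longrightarrow> \<exists>f'. cinf_gen f' \<and> (\<forall>x. (f has_real_derivative f' x) (at x))"
proof (induction rule: cinf_gen.induct)
  case (cinf f)
  then show ?case using cinf_has_deriv cinf_deriv cinf_gen.cinf by blast
next
  case (add f g)
  then obtain f' g' where "cinf_gen f'" "cinf_gen g'"
    "\<And>x. (f has_real_derivative f' x) (at x)" "\<And>x. (g has_real_derivative g' x) (at x)" by blast
  then show ?case
    by (intro exI[of _ "\<lambda>x. f' x + g' x"]) (auto intro!: cinf_gen.add derivative_eq_intros)
next
  case (mult f g)
  then obtain f' g' where "cinf_gen f'" "cinf_gen g'"
    "\<And>x. (f has_real_derivative f' x) (at x)" "\<And>x. (g has_real_derivative g' x) (at x)" by blast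
  with mult show ?case
    by (intro exI[of _ "\<lambda>x. f' x * g x + f x * g' x"])
       (auto intro!: cinf_gen.add cinf_gen.mult derivative_eq_intros)
next
  case (comp g f)
  then obtain f' where "cinf_gen f'" "\<And>x. (f has_real_derivative f' x) (at x)" by blast
  then have "cinf_gen (\<lambda>x. deriv g (f x) * f' x)"
    using cinf_gen.mult[OF cinf_gen.comp[OF cinf_deriv[OF comp(1)] comp(2)]] by blast
  moreover have "((\<lambda>x. g (f x)) has_real_derivative deriv g (f x) * f' x) (at x)" for x
    using DERIV_chain2[OF cinf_has_deriv[OF comp(1)]] \<open>\<And>x. (f has_real_derivative f' x) (at x)\<close> by blast
  ultimately show ?case by blast
next
  case (inverse f)
  then obtain f' where f': "cinf_gen f'" "\<And>x. (f has_real_derivative f' x) (at x)" by blast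
  then have "cinf_gen (\<lambda>x. (\<lambda>_. - 1) x * (f' x * (inverse (f x) * inverse (f x))))"
    using inverse by (intro cinf_gen.mult cinf_gen.inverse cinf_gen.cinf[OF cinf_const]) auto
  moreover have "((\<lambda>x. inverse (f x)) has_real_derivative - 1 * (f' x * (inverse (f x) * inverse (f x)))) (at x)" for x
    using DERIV_inverse_fun[OF f'(2), of x] inverse(2)[of x] by (simp add: mult.commute)
  ultimately show ?case by blast
next
  case (ln f)
  then obtain f' where "cinf_gen f'" "\<And>x. (f has_real_derivative f' x) (at x)" by blast
  then have "cinf_gen (\<lambda>x. f' x * inverse (f x))"
    using ln by (intro cinf_gen.mult cinf_gen.inverse) auto
  moreover have "((\<lambda>x. ln (f x)) has_real_derivative f' x * inverse (f x)) (at x)" for x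
    using DERIV_chain2[of ln "inverse (f x)" f x "f' x" UNIV] DERIV_ln[OF ln(2)[of x]]
      \<open>\<And>x. (f has_real_derivative f' x) (at x)\<close> by (simp add: mult.commute)
  ultimately show ?case by blast
qed

lemma cinf_gen_cinf: "cinf_gen f \<Longrightarrow> cinf f"
  by (coinduction arbitrary: f) (use cinf_gen_deriv in blast)

lemma cinf_add: "cinf f \<Longrightarrow> cinf g \<Longrightarrow> cinf (\<lambda>x. f x + g x)"
  and cinf_mult: "cinf f \<Longrightarrow> cinf g \<Longrightarrow> cinf (\<lambda>x. f x * g x)"
  and cinf_compose: "cinf g \<Longrightarrow> cinf f \<Longrightarrow> cinf (\<lambda>x. g (f x))"
  and cinf_inverse: "cinf f \<Longrightarrow> (\<And>x. f x > 0) \<Longrightarrow> cinf (\<lambda>x. inverse (f x))"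
  and cinf_ln: "cinf f \<Longrightarrow> (\<And>x. f x > 0) \<Longrightarrow> cinf (\<lambda>x. ln (f x))"
  by (rule cinf_gen_cinf, (rule cinf_gen.intros; simp add: cinf_gen.cinf))+

lemma cinf_diff: "cinf f \<Longrightarrow> cinf g \<Longrightarrow> cinf (\<lambda>x. f x - g x)"
  using cinf_add[of f "\<lambda>x. (-1) * g x"] cinf_mult[of "\<lambda>x. -1" g] by simp

lemma cinf_power: "cinf f \<Longrightarrow> cinf (\<lambda>x. f x ^ k)"
  by (induction k) (auto intro!: cinf_mult)

lemma cinf_powr: "cinf f \<Longrightarrow> (\<And>x. f x > 0) \<Longrightarrow> cinf (\<lambda>x. f x powr p)"
proof -
  assume *: "cinf f" "\<And>x. f x > 0"
  then have "cinf (\<lambda>x. exp (p * ln (f x)))"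
    using cinf_compose[OF cinf_exp cinf_mult[OF cinf_const cinf_ln]] by blast
  moreover have "(\<lambda>x. exp (p * ln (f x))) = (\<lambda>x. f x powr p)"
    using *(2) by (auto simp: powr_def less_imp_neq[THEN not_sym])
  ultimately show ?thesis by simp
qed

section \<open>The flat function exp(-1/t) and a positive smooth modification of the
  identity\<close>

definition bump_aux :: "nat \<Rightarrow> real \<Rightarrow> real" where
  "bump_aux j t = (if t > 0 then inverse t ^ j * exp (- inverse t) else 0)"

text \<open>A single term of the series of exp(1/t), the one of order j + 2, already dominates
  t^(-j) and leaves a spare t^2. This makes the difference quotient at 0 tend to 0.\<close>

lemma bump_aux_bound: "\<bar>bump_aux j t\<bar> \<le> fact (j+2) * t\<^sup>2"
proof (cases "t > 0")
  case True
  have "inverse t ^ (j+2) / fact (j+2) \<le> exp (inverse t)"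
  proof -
    have s: "(\<lambda>n. inverse t ^ n / fact n) sums exp (inverse t)"
      using exp_converges[of "inverse t"] by (simp add: field_simps)
    show ?thesis
      using sum_le_suminf[OF sums_summable[OF s], of "{j+2}"] True sums_unique[OF s] by auto
  qed
  then have "inverse t ^ (j+2) \<le> fact (j+2) * exp (inverse t)"
    by (simp add: pos_divide_le_eq mult.commute del: fact_Suc power_Suc)
  then have "inverse t ^ (j+2) * exp (- inverse t) \<le> (fact (j+2) * exp (inverse t)) * exp (- inverse t)"
    by (rule mult_right_mono) simp
  then have "inverse t ^ (j+2) * exp (- inverse t) \<le> fact (j+2)"
    by (simp add: exp_minus mult.assoc del: fact_Suc power_Suc power_inverse)
  then have "inverse t ^ (j+2) * exp (- inverse t) * t^2 \<le> fact (j+2) * t^2"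
    using mult_right_mono zero_le_power2 by blast
  moreover have "inverse t ^ (j+2) * exp (- inverse t) * t^2 = \<bar>bump_aux j t\<bar>"
    using True by (simp add: bump_aux_def power_add field_simps power2_eq_square)
  ultimately show ?thesis by metis
qed (auto simp: bump_aux_def)

lemma bump_aux_deriv:
  "(bump_aux j has_real_derivative (bump_aux (j+2) t - j * bump_aux (j+1) t)) (at t)"
proof -
  consider "t > 0" | "t < 0" | "t = 0" by linarith
  then show ?thesis
  proof cases
    case 1
    have "((\<lambda>t. inverse t ^ j) has_real_derivative (- real j * inverse t ^ (j+1))) (at t)"
    proof (cases j)
      case (Suc m)
      have "((\<lambda>t. inverse t ^ Suc m) has_real_derivative
          real (Suc m) * (- (inverse t ^ Suc (Suc 0)) * inverse t ^ (Suc m - Suc 0))) (at t)"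
        using 1 by (intro DERIV_power DERIV_inverse) auto
      then show ?thesis using Suc by (simp add: algebra_simps)
    qed auto
    moreover have "((\<lambda>t. exp (- inverse t)) has_real_derivative (exp (- inverse t) * inverse t ^ 2)) (at t)"
    proof -
      have "((\<lambda>t. - inverse t) has_real_derivative - (- (inverse t ^ Suc (Suc 0)))) (at t)"
        using 1 by (intro DERIV_minus DERIV_inverse) auto
      then show ?thesis
        using DERIV_chain2[OF DERIV_exp] by (fastforce simp: numeral_2_eq_2)
    qed
    ultimately have "((\<lambda>t. inverse t ^ j * exp (- inverse t)) has_real_derivative
        (- real j * inverse t ^ (j+1)) * exp (- inverse t)
         + (exp (- inverse t) * inverse t ^ 2) * inverse t ^ j) (at t)"
      by (rule DERIV_mult)
    moreover have "(- real j * inverse t ^ (j+1)) * exp (- inverse t)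
         + (exp (- inverse t) * inverse t ^ 2) * inverse t ^ j = bump_aux (j+2) t - j * bump_aux (j+1) t"
      using 1 by (simp add: bump_aux_def power_add power2_eq_square algebra_simps)
    ultimately have "((\<lambda>t. inverse t ^ j * exp (- inverse t)) has_real_derivative
        (bump_aux (j+2) t - j * bump_aux (j+1) t)) (at t)" by simp
    then show ?thesis
      by (rule has_field_derivative_transform_within_open[where S="{0<..}"])
         (use 1 in \<open>auto simp: bump_aux_def\<close>)
  next
    case 2
    have "((\<lambda>t. 0) has_real_derivative (bump_aux (j+2) t - j * bump_aux (j+1) t)) (at t)"
      using 2 by (simp add: bump_aux_def)
    then show ?thesis
      by (rule has_field_derivative_transform_within_open[where S="{..<0}"])
         (use 2 in \<open>auto simp: bump_aux_def\<close>)
  next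
    case 3
    have "(\<lambda>h. bump_aux j h / h) \<midarrow>0\<rightarrow> 0"
    proof (rule Lim_null_comparison[where g="\<lambda>h. fact (j+2) * \<bar>h\<bar>"])
      show "\<forall>\<^sub>F h in at 0. norm (bump_aux j h / h) \<le> fact (j+2) * \<bar>h\<bar>"
      proof (rule eventuallyI)
        fix h :: real
        show "norm (bump_aux j h / h) \<le> fact (j+2) * \<bar>h\<bar>"
        proof (cases "h = 0")
          case False
          have "\<bar>bump_aux j h\<bar> \<le> (fact (j+2) * \<bar>h\<bar>) * \<bar>h\<bar>"
            using bump_aux_bound[of j h] by (simp add: power2_eq_square abs_mult_self_eq mult.assoc)
          then show ?thesis using False by (simp add: abs_divide divide_le_eq del: fact_Suc)
        qed auto
      qed
      have "((\<lambda>h. fact (j+2) * \<bar>h\<bar>) \<longlongrightarrow> fact (j+2) * \<bar>0::real\<bar>) (at 0)"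
        by (intro tendsto_intros)
      then show "((\<lambda>h. fact (j+2) * \<bar>h\<bar>) \<longlongrightarrow> 0) (at (0::real))" by simp
    qed
    then show ?thesis
      using 3 by (simp add: DERIV_def bump_aux_def)
  qed
qed

text \<open>Linear span of the functions t^(-j) exp(-1/t). It is closed under differentiation, which
  is all that coinduction for \<open>cinf\<close> asks.\<close>

inductive bump_gen :: "(real \<Rightarrow> real) \<Rightarrow> bool" where
  base: "bump_gen (bump_aux j)"
| add: "bump_gen f \<Longrightarrow> bump_gen g \<Longrightarrow> bump_gen (\<lambda>t. f t + g t)"
| scale: "bump_gen f \<Longrightarrow> bump_gen (\<lambda>t. c * f t)"

lemma bump_gen_deriv:
  "bump_gen f \<Longrightarrow> \<exists>f'. bump_gen f' \<and> (\<forall>t. (f has_real_derivative f' t) (at t))"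
proof (induction rule: bump_gen.induct)
  case (base j)
  have "bump_gen (\<lambda>t. bump_aux (j+2) t + (- real j) * bump_aux (j+1) t)"
    by (intro bump_gen.intros)
  then show ?case using bump_aux_deriv[of j] by (intro exI) (auto simp del: One_nat_def)
next
  case (add f g)
  then obtain f' g' where "bump_gen f'" "bump_gen g'"
    "\<And>x. (f has_real_derivative f' x) (at x)" "\<And>x. (g has_real_derivative g' x) (at x)" by blast
  then show ?case
    by (intro exI[of _ "\<lambda>x. f' x + g' x"]) (auto intro!: bump_gen.add derivative_eq_intros)
next
  case (scale f c)
  then obtain f' where "bump_gen f'" "\<And>x. (f has_real_derivative f' x) (at x)" by blast
  then show ?case
    by (intro exI[of _ "\<lambda>x. c * f' x"]) (auto intro!: bump_gen.scale derivative_eq_intros)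
qed

lemma cinf_bump_aux: "cinf (bump_aux j)"
proof -
  have "cinf f" if "bump_gen f" for f
    using that by (coinduction arbitrary: f) (use bump_gen_deriv in blast)
  then show ?thesis using bump_gen.base by blast
qed

definition bump :: "real \<Rightarrow> real" where
  "bump t = (if t > 0 then exp (- inverse t) else 0)"

lemma cinf_bump: "cinf bump"
proof -
  have "bump = bump_aux 0" by (auto simp: bump_aux_def bump_def)
  then show ?thesis using cinf_bump_aux[of 0] by simp
qed

lemma bump_nonneg: "bump t \<ge> 0" and bump_pos: "t > 0 \<Longrightarrow> bump t > 0"
  and bump_zero: "t \<le> 0 \<Longrightarrow> bump t = 0"
  by (auto simp: bump_def)

text \<open>A weighted average of s and the constant \<delta>, with bump weights that switch off the
  constant for s >= \<delta> and the identity for s <= \<delta>/2. Substituting it for s turns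
  powers and logarithms of |x|^2 into functions smooth on the whole space without changing them away
  from the origin.\<close>

lemma cinf_positive_extension:
  assumes "\<delta> > 0"
  obtains \<tau> where "cinf \<tau>" "\<And>s. \<tau> s > 0" "\<And>s. s \<ge> \<delta> \<Longrightarrow> \<tau> s = s"
proof -
  define D where "D s = bump (s - \<delta>/2) + bump (\<delta> - s)" for s
  have D: "D s > 0" for s
  proof (cases "s > \<delta>/2")
    case True then show ?thesis unfolding D_def
      by (intro add_pos_nonneg bump_pos bump_nonneg) auto
  next
    case False then show ?thesis unfolding D_def using assms
      by (intro add_nonneg_pos bump_pos bump_nonneg) auto
  qed
  define \<tau> where "\<tau> s = (s * bump (s - \<delta>/2) + \<delta> * bump (\<delta> - s)) * inverse (D s)" for s
  have "cinf D" unfolding D_def[abs_def]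
    by (intro cinf_add cinf_compose[OF cinf_bump] cinf_diff) auto
  then have "cinf \<tau>" unfolding \<tau>_def[abs_def] using D
    by (intro cinf_mult cinf_add cinf_compose[OF cinf_bump] cinf_diff cinf_inverse) auto
  moreover have "\<tau> s > 0" for s
  proof (cases "s > \<delta>/2")
    case True then show ?thesis unfolding \<tau>_def using D[of s] assms
      by (intro mult_pos_pos add_pos_nonneg mult_nonneg_nonneg bump_pos bump_nonneg) auto
  next
    case False then show ?thesis unfolding \<tau>_def using D[of s] assms
      by (auto simp: bump_zero intro!: bump_pos mult_pos_pos)
  qed
  moreover have "\<tau> s = s" if "s \<ge> \<delta>" for s
    using that D[of s] by (auto simp: \<tau>_def D_def bump_zero)
  ultimately show ?thesis using that by blast
qed

section \<open>Smooth functions and partial derivatives\<close>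

lemma pderiv_eqI: "(f has_derivative D) (at x) \<Longrightarrow> pderiv i f x = D (axis i 1)"
  by (metis frechet_derivative_at pderiv_def)

lemma has_derivative_pderiv:
  fixes f :: "real^'n::finite \<Rightarrow> real"
  assumes "f differentiable (at x)"
  shows "(f has_derivative (\<lambda>h. \<Sum>i\<in>UNIV. h $ i * pderiv i f x)) (at x)"
proof -
  let ?D = "frechet_derivative f (at x)"
  have D: "(f has_derivative ?D) (at x)"
    using assms frechet_derivative_works by blast
  have "?D h = (\<Sum>i\<in>UNIV. h $ i * pderiv i f x)" for h
  proof -
    interpret bounded_linear ?D using D by (rule has_derivative_bounded_linear)
    have "?D h = ?D (\<Sum>i\<in>UNIV. h $ i *\<^sub>R axis i 1)"
      using basis_expansion[of h] by (simp add: scalar_mult_eq_scaleR)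
    then show ?thesis by (simp add: sum scaleR pderiv_def)
  qed
  then have "?D = (\<lambda>h. \<Sum>i\<in>UNIV. h $ i * pderiv i f x)" by blast
  with D show ?thesis by simp
qed

lemma pderiv_const [simp]: "pderiv i (\<lambda>x. c) = (\<lambda>x. 0)"
  by (rule ext, subst pderiv_eqI[where D="\<lambda>h. 0"]) auto

lemma pderiv_nth: "pderiv i (\<lambda>x. x $ j) = (\<lambda>x. if i = j then 1 else 0)"
  by (rule ext, subst pderiv_eqI[where D="\<lambda>h. h $ j"])
     (auto simp: axis_def intro!: bounded_linear_imp_has_derivative bounded_linear_vec_nth)

lemma pderiv_add_at:
  "f differentiable (at x) \<Longrightarrow> g differentiable (at x) \<Longrightarrow>
    pderiv i (\<lambda>x. f x + g x) x = pderiv i f x + pderiv i g x"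
  unfolding frechet_derivative_works
  by (subst pderiv_eqI, rule has_derivative_add, assumption+) (simp add: pderiv_def)

lemma pderiv_mult_at:
  "f differentiable (at x) \<Longrightarrow> g differentiable (at x) \<Longrightarrow>
    pderiv i (\<lambda>x. f x * g x) x = f x * pderiv i g x + pderiv i f x * g x"
  unfolding frechet_derivative_works
  by (subst pderiv_eqI, rule has_derivative_mult, assumption+) (simp add: pderiv_def)

lemma has_derivative_real_compose:
  fixes f :: "real^'n::finite \<Rightarrow> real"
  assumes "(g has_real_derivative g') (at (f x))" "(f has_derivative D) (at x)"
  shows "((\<lambda>x. g (f x)) has_derivative (\<lambda>h. g' * D h)) (at x)"
  using diff_chain_at[OF assms(2), of g "times g'"] assms(1)
  by (simp add: has_field_derivative_def o_def)

lemma pderiv_compose_at: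
  "(g has_real_derivative g') (at (f x)) \<Longrightarrow> f differentiable (at x) \<Longrightarrow>
    pderiv i (\<lambda>x. g (f x)) x = g' * pderiv i f x"
  unfolding frechet_derivative_works
  by (subst pderiv_eqI, rule has_derivative_real_compose, assumption+) (simp add: pderiv_def)

lemma smooth_differentiable: "smooth f \<Longrightarrow> f differentiable (at x)"
  unfolding smooth_def by (metis iter_pderiv.simps(1))

lemma smooth_pderiv: "smooth f \<Longrightarrow> smooth (pderiv i f)"
proof -
  have "iter_pderiv is (pderiv i f) = iter_pderiv (is @ [i]) f" for "is"
    by (induction "is") auto
  then show "smooth f \<Longrightarrow> smooth (pderiv i f)" by (simp add: smooth_def)
qed

lemma smooth_coinduct:
  assumes "P f" and P: "\<And>f. P f \<Longrightarrow> (\<forall>x. f differentiable (at x)) \<and> (\<forall>i. P (pderiv i f))"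
  shows "smooth f"
proof -
  have "P (iter_pderiv is f)" for "is"
    by (induction "is") (use assms in auto)
  then show ?thesis using P by (auto simp: smooth_def)
qed

text \<open>Coinduction up to sums, products and compositions with functions of one variable.\<close>

inductive smooth_gen :: "(real^'n::finite \<Rightarrow> real) \<Rightarrow> bool" where
  smooth: "smooth f \<Longrightarrow> smooth_gen f"
| add: "smooth_gen f \<Longrightarrow> smooth_gen g \<Longrightarrow> smooth_gen (\<lambda>x. f x + g x)"
| mult: "smooth_gen f \<Longrightarrow> smooth_gen g \<Longrightarrow> smooth_gen (\<lambda>x. f x * g x)"
| comp: "cinf g \<Longrightarrow> smooth_gen f \<Longrightarrow> smooth_gen (\<lambda>x. g (f x))"
| vcomp: "smooth (v :: real^'n \<Rightarrow> real) \<Longrightarrow> (\<And>j. smooth (\<lambda>x :: real^'n. \<Phi> x $ j)) \<Longrightarrow> smooth_gen (\<lambda>x. v (\<Phi> x))"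

lemma has_derivative_vec_compose:
  fixes v :: "real^'n::finite \<Rightarrow> real" and \<Phi> :: "real^'n \<Rightarrow> real^'n"
  assumes v: "v differentiable (at (\<Phi> x))"
    and \<Phi>: "\<And>j. (\<lambda>x. \<Phi> x $ j) differentiable (at x)"
  shows "((\<lambda>x. v (\<Phi> x)) has_derivative
      (\<lambda>h. \<Sum>j\<in>UNIV. frechet_derivative (\<lambda>x. \<Phi> x $ j) (at x) h * pderiv j v (\<Phi> x))) (at x)"
proof -
  let ?D = "\<lambda>h. \<Sum>j\<in>UNIV. frechet_derivative (\<lambda>x. \<Phi> x $ j) (at x) h *\<^sub>R (axis j 1 :: real^'n)"
  have "\<Phi> = (\<lambda>x. \<Sum>j\<in>UNIV. (\<Phi> x $ j) *\<^sub>R axis j 1)"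
  proof
    fix x show "\<Phi> x = (\<Sum>j\<in>UNIV. (\<Phi> x $ j) *\<^sub>R axis j 1)"
      using basis_expansion[of "\<Phi> x"] by (simp add: scalar_mult_eq_scaleR)
  qed
  moreover have "((\<lambda>x. \<Sum>j\<in>UNIV. (\<Phi> x $ j) *\<^sub>R (axis j 1 :: real^'n)) has_derivative ?D) (at x)"
    by (intro has_derivative_sum has_derivative_scaleR_left) (use \<Phi> frechet_derivative_works in blast)
  ultimately have "(\<Phi> has_derivative ?D) (at x)" by simp
  from diff_chain_at[OF this has_derivative_pderiv[OF v]] show ?thesis
    by (simp add: o_def axis_def if_distrib if_distribR cong: if_cong)
qed

lemma pderiv_vec_compose_at:
  fixes v :: "real^'n::finite \<Rightarrow> real" and \<Phi> :: "real^'n \<Rightarrow> real^'n"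
  assumes "v differentiable (at (\<Phi> x))" "\<And>j. (\<lambda>x. \<Phi> x $ j) differentiable (at x)"
  shows "pderiv i (\<lambda>x. v (\<Phi> x)) x = (\<Sum>j\<in>UNIV. pderiv i (\<lambda>x. \<Phi> x $ j) x * pderiv j v (\<Phi> x))"
  using pderiv_eqI[OF has_derivative_vec_compose[of v \<Phi> x, OF assms], of i] by (simp add: pderiv_def)

lemma smooth_gen_zero_sum:
  fixes F :: "'i \<Rightarrow> real^'n::finite \<Rightarrow> real"
  assumes "finite I" "\<And>j. j \<in> I \<Longrightarrow> smooth_gen (F j)" "smooth (\<lambda>x::real^'n. 0)"
  shows "smooth_gen (\<lambda>x. \<Sum>j\<in>I. F j x)"
  using assms by (induction I) (auto intro: smooth_gen.smooth intro!: smooth_gen.add)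

lemma smooth_const [simp]: "smooth (\<lambda>x. c)"
  by (rule smooth_coinduct[of "\<lambda>f. \<exists>c. f = (\<lambda>x. c)"]) auto

lemma smooth_gen_pderiv:
  "smooth_gen f \<Longrightarrow> (\<forall>x. f differentiable (at x)) \<and> (\<forall>i. smooth_gen (pderiv i f))"
proof (induction rule: smooth_gen.induct)
  case (smooth f)
  then show ?case using smooth_differentiable smooth_pderiv smooth_gen.smooth by blast
next
  case (add f g)
  then have "pderiv i (\<lambda>x. f x + g x) = (\<lambda>x. pderiv i f x + pderiv i g x)" for i
    by (intro ext pderiv_add_at) auto
  moreover have "smooth_gen (\<lambda>x. pderiv i f x + pderiv i g x)" for i
    using add by (intro smooth_gen.add) auto
  ultimately show ?case using add differentiable_add by auto
next
  case (mult f g)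
  then have "pderiv i (\<lambda>x. f x * g x) = (\<lambda>x. f x * pderiv i g x + pderiv i f x * g x)" for i
    by (intro ext pderiv_mult_at) auto
  moreover have "smooth_gen (\<lambda>x. f x * pderiv i g x + pderiv i f x * g x)" for i
    using mult by (intro smooth_gen.add smooth_gen.mult) auto
  ultimately show ?case using mult differentiable_mult by auto
next
  case (comp g f)
  then have "pderiv i (\<lambda>x. g (f x)) = (\<lambda>x. deriv g (f x) * pderiv i f x)" for i
    by (intro ext pderiv_compose_at cinf_has_deriv) auto
  moreover have "smooth_gen (\<lambda>x. deriv g (f x) * pderiv i f x)" for i
    using smooth_gen.mult[OF smooth_gen.comp[OF cinf_deriv[OF comp(1)] comp(2)]] comp(3) by blast
  moreover have "(\<lambda>x. g (f x)) differentiable (at x)" for x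
  proof -
    have f: "f differentiable (at x)" using comp by blast
    show ?thesis
      by (rule differentiableI)
         (rule has_derivative_real_compose[OF cinf_has_deriv[OF comp(1)] has_derivative_pderiv[OF f]])
  qed
  ultimately show ?case by metis
next
  case (vcomp v \<Phi>)
  have d: "v differentiable (at y)" "\<And>j. (\<lambda>x. \<Phi> x $ j) differentiable (at y)" for y
    using vcomp smooth_differentiable by blast+
  have "pderiv i (\<lambda>x. v (\<Phi> x)) = (\<lambda>x. \<Sum>j\<in>UNIV. pderiv i (\<lambda>x. \<Phi> x $ j) x * pderiv j v (\<Phi> x))" for i
    by (rule ext, rule pderiv_vec_compose_at) (rule d)+
  moreover have "smooth_gen (\<lambda>x. \<Sum>j\<in>UNIV. pderiv i (\<lambda>x. \<Phi> x $ j) x * pderiv j v (\<Phi> x))" for i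
    by (rule smooth_gen_zero_sum; (rule smooth_gen.mult)?)
       (auto intro: smooth_gen.smooth smooth_gen.vcomp[OF smooth_pderiv[OF vcomp(1)] vcomp(2)] smooth_pderiv[OF vcomp(2)])
  moreover have "(\<lambda>x. v (\<Phi> x)) differentiable (at x)" for x
    by (rule differentiableI, rule has_derivative_vec_compose) (rule d)+
  ultimately show ?case by simp
qed

lemma smooth_gen_smooth: "smooth_gen f \<Longrightarrow> smooth f"
  using smooth_coinduct[of smooth_gen] smooth_gen_pderiv by blast

lemma smooth_vec_compose:
  fixes \<Phi> :: "real^'n::finite \<Rightarrow> real^'n"
  shows "smooth v \<Longrightarrow> (\<And>j. smooth (\<lambda>x. \<Phi> x $ j)) \<Longrightarrow> smooth (\<lambda>x. v (\<Phi> x))"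
  using smooth_gen_smooth[OF smooth_gen.vcomp] .

lemma smooth_add: "smooth f \<Longrightarrow> smooth g \<Longrightarrow> smooth (\<lambda>x. f x + g x)"
  and smooth_mult: "smooth f \<Longrightarrow> smooth g \<Longrightarrow> smooth (\<lambda>x. f x * g x)"
  and smooth_compose: "cinf h \<Longrightarrow> smooth f \<Longrightarrow> smooth (\<lambda>x. h (f x))"
  by (rule smooth_gen_smooth, (rule smooth_gen.intros; simp add: smooth_gen.smooth))+

lemma smooth_nth [simp]: "smooth (\<lambda>x. x $ j)"
proof (rule smooth_coinduct[of "\<lambda>f. f = (\<lambda>x. x $ j) \<or> smooth f"], blast)
  fix f :: "real^'a \<Rightarrow> real"
  have d: "(\<lambda>x. x $ j) differentiable (at x)" for x :: "real^'a"
    using bounded_linear_imp_has_derivative[OF bounded_linear_vec_nth] differentiableI by blast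
  assume "f = (\<lambda>x. x $ j) \<or> smooth f"
  then show "(\<forall>x. f differentiable (at x)) \<and> (\<forall>i. pderiv i f = (\<lambda>x. x $ j) \<or> smooth (pderiv i f))"
  proof
    assume "f = (\<lambda>x. x $ j)"
    then show ?thesis using d by (auto simp: pderiv_nth)
  next
    assume "smooth f"
    then show ?thesis using smooth_differentiable smooth_pderiv by blast
  qed
qed

lemma smooth_cmult: "smooth f \<Longrightarrow> smooth (\<lambda>x. c * f x)"
  by (intro smooth_mult smooth_const)

lemma smooth_diff: "smooth f \<Longrightarrow> smooth g \<Longrightarrow> smooth (\<lambda>x. f x - g x)"
  using smooth_add[of f "\<lambda>x. (-1) * g x"] smooth_cmult[of g "-1"] by simp

lemma smooth_sum: "(\<And>i. i \<in> I \<Longrightarrow> smooth (f i)) \<Longrightarrow> smooth (\<lambda>x. \<Sum>i\<in>I. f i x)"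
  by (induction I rule: infinite_finite_induct) (auto intro!: smooth_add)

lemma inner_sum_squares: "(x :: real^'n::finite) \<bullet> x = (\<Sum>i\<in>UNIV. x $ i * x $ i)"
  by (simp add: inner_vec_def)

lemma smooth_inner [simp]: "smooth (\<lambda>x. x \<bullet> x)"
  unfolding inner_sum_squares by (intro smooth_sum smooth_mult smooth_nth)

lemma smooth_continuous: "smooth f \<Longrightarrow> continuous_on S f"
  using differentiable_imp_continuous_within smooth_differentiable
  by (metis continuous_at_imp_continuous_on)

lemma pderiv_add: "smooth f \<Longrightarrow> smooth g \<Longrightarrow> pderiv i (\<lambda>x. f x + g x) = (\<lambda>x. pderiv i f x + pderiv i g x)"
  using pderiv_add_at smooth_differentiable by blast

lemma pderiv_mult: "smooth f \<Longrightarrow> smooth g \<Longrightarrow>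
    pderiv i (\<lambda>x. f x * g x) = (\<lambda>x. f x * pderiv i g x + pderiv i f x * g x)"
  using pderiv_mult_at smooth_differentiable by blast

lemma pderiv_compose: "cinf g \<Longrightarrow> smooth f \<Longrightarrow>
    pderiv i (\<lambda>x. g (f x)) = (\<lambda>x. deriv g (f x) * pderiv i f x)"
  using pderiv_compose_at smooth_differentiable cinf_has_deriv by blast

lemma pderiv_cmult: "smooth f \<Longrightarrow> pderiv i (\<lambda>x. c * f x) = (\<lambda>x. c * pderiv i f x)"
  by (simp add: pderiv_mult)

lemma pderiv_diff: "smooth f \<Longrightarrow> smooth g \<Longrightarrow> pderiv i (\<lambda>x. f x - g x) = (\<lambda>x. pderiv i f x - pderiv i g x)"
  using pderiv_add[of f "\<lambda>x. (-1) * g x"] pderiv_cmult[of g i "-1"] smooth_cmult[of g "-1"] by simp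

lemma pderiv_sum: "(\<And>j. j \<in> I \<Longrightarrow> smooth (f j)) \<Longrightarrow>
    pderiv i (\<lambda>x. \<Sum>j\<in>I. f j x) = (\<lambda>x. \<Sum>j\<in>I. pderiv i (f j) x)"
  by (induction I rule: infinite_finite_induct) (auto simp: pderiv_add smooth_sum)

lemma pderiv_inner: "pderiv i (\<lambda>x. x \<bullet> x) = (\<lambda>x. 2 * x $ i)"
  unfolding inner_sum_squares
  by (subst pderiv_sum) (auto simp: pderiv_mult pderiv_nth smooth_mult sum.distrib if_distrib if_distribR cong: if_cong)

lemma laplacian_add: "smooth f \<Longrightarrow> smooth g \<Longrightarrow> laplacian (\<lambda>x. f x + g x) = (\<lambda>x. laplacian f x + laplacian g x)"
  by (simp add: laplacian_def[abs_def] pderiv_add smooth_pderiv sum.distrib)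

lemma laplacian_diff: "smooth f \<Longrightarrow> smooth g \<Longrightarrow> laplacian (\<lambda>x. f x - g x) = (\<lambda>x. laplacian f x - laplacian g x)"
  by (simp add: laplacian_def[abs_def] pderiv_diff smooth_pderiv sum_subtractf)

lemma laplacian_cmult: "smooth f \<Longrightarrow> laplacian (\<lambda>x. c * f x) = (\<lambda>x. c * laplacian f x)"
  by (simp add: laplacian_def[abs_def] pderiv_cmult smooth_pderiv sum_distrib_left)

lemma smooth_laplacian: "smooth f \<Longrightarrow> smooth (laplacian f)"
  unfolding laplacian_def[abs_def] by (intro smooth_sum smooth_pderiv)

section \<open>The Euler field, the rotation fields and the Laplacian in polar form\<close>

definition euler :: "(real^'n::finite \<Rightarrow> real) \<Rightarrow> real^'n \<Rightarrow> real" where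
  "euler u x = (\<Sum>i\<in>UNIV. x $ i * pderiv i u x)"

text \<open>The generator of rotations in the (i,j) plane. These fields are tangent to spheres and
  stand in for angular derivatives, so no coordinates on the sphere are needed.\<close>

definition rotf :: "'n::finite \<Rightarrow> 'n \<Rightarrow> (real^'n \<Rightarrow> real) \<Rightarrow> real^'n \<Rightarrow> real" where
  "rotf i j u x = x $ i * pderiv j u x - x $ j * pderiv i u x"

lemma smooth_euler: "smooth f \<Longrightarrow> smooth (euler f)"
  unfolding euler_def[abs_def] by (intro smooth_sum smooth_mult smooth_nth smooth_pderiv)

lemma smooth_rotf: "smooth f \<Longrightarrow> smooth (rotf i j f)"
  unfolding rotf_def[abs_def] by (intro smooth_diff smooth_mult smooth_nth smooth_pderiv)

lemma euler_mult: "smooth f \<Longrightarrow> smooth g \<Longrightarrow> euler (\<lambda>x. f x * g x) = (\<lambda>x. euler f x * g x + f x * euler g x)"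
  by (auto simp: euler_def pderiv_mult sum_distrib_left sum_distrib_right algebra_simps sum.distrib)

lemma rotf_mult: "smooth f \<Longrightarrow> smooth g \<Longrightarrow> rotf i j (\<lambda>x. f x * g x) = (\<lambda>x. rotf i j f x * g x + f x * rotf i j g x)"
  by (auto simp: rotf_def pderiv_mult algebra_simps)

lemma euler_add: "smooth f \<Longrightarrow> smooth g \<Longrightarrow> euler (\<lambda>x. f x + g x) = (\<lambda>x. euler f x + euler g x)"
  by (auto simp: euler_def pderiv_add algebra_simps sum.distrib)

lemma euler_cmult: "smooth f \<Longrightarrow> euler (\<lambda>x. c * f x) = (\<lambda>x. c * euler f x)"
  by (auto simp: euler_def pderiv_cmult sum_distrib_left algebra_simps)

text \<open>This is |x|^2 times the Laplacian = E^2 + (n-2) E + spherical Laplacian, where E is the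
  Euler field. The factor 2 arises because the double sum meets every coordinate plane
  twice.\<close>

lemma sum_rotf_squared:
  fixes u :: "real^'n::finite \<Rightarrow> real"
  assumes u: "smooth u"
  shows "(\<Sum>i\<in>UNIV. \<Sum>j\<in>UNIV. rotf i j (rotf i j u) x)
     = 2 * ((x \<bullet> x) * laplacian u x - euler (euler u) x - (real CARD('n) - 2) * euler u x)"
proof -
  define S where "S = (\<Sum>i\<in>UNIV. \<Sum>j\<in>UNIV. x $ i * x $ j * pderiv i (pderiv j u) x)"
  \<comment> \<open>The last term corrects the diagonal i = j, where the rotation field is
    zero.\<close>
  have r: "rotf i j (rotf i j u) x = (x$i * x$i * pderiv j (pderiv j u) x + x$j * x$j * pderiv i (pderiv i u) x)
      - (x$i * pderiv i u x + x$j * pderiv j u x)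
      - (x $ i * x $ j * pderiv i (pderiv j u) x + x $ i * x $ j * pderiv j (pderiv i u) x)
      + (if i = j then 2 * (x $ i * pderiv i u x) else 0)" for i j
    by (simp add: rotf_def[abs_def] pderiv_diff pderiv_mult pderiv_nth smooth_mult smooth_pderiv u algebra_simps)
  have 1: "(\<Sum>i\<in>UNIV. \<Sum>j\<in>UNIV. rotf i j (rotf i j u) x)
    = 2 * ((x \<bullet> x) * laplacian u x) - 2 * (real CARD('n) * euler u x) - 2 * S + 2 * euler u x"
  proof -
    have a: "(\<Sum>i\<in>UNIV. \<Sum>j\<in>UNIV. x$i * x$i * pderiv j (pderiv j u) x) = (x \<bullet> x) * laplacian u x"
      by (simp add: inner_sum_squares laplacian_def sum_product)
    have b: "(\<Sum>i\<in>UNIV. \<Sum>j\<in>UNIV. x$j * x$j * pderiv i (pderiv i u) x) = (x \<bullet> x) * laplacian u x"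
      by (subst sum.swap) (rule a)
    have c: "(\<Sum>i\<in>UNIV. \<Sum>j\<in>(UNIV :: 'n set). x$i * pderiv i u x) = real CARD('n) * euler u x"
      by (simp add: euler_def sum_distrib_left)
    have d: "(\<Sum>i\<in>(UNIV :: 'n set). \<Sum>j\<in>(UNIV :: 'n set). x$j * pderiv j u x) = real CARD('n) * euler u x"
      by (simp add: euler_def)
    have e: "(\<Sum>i\<in>UNIV. \<Sum>j\<in>UNIV. x $ i * x $ j * pderiv j (pderiv i u) x) = S"
      unfolding S_def by (subst sum.swap, simp add: mult.commute)
    have f: "(\<Sum>i\<in>UNIV. \<Sum>j\<in>UNIV. if i = j then 2 * (x $ i * pderiv i u x) else 0) = 2 * euler u x"
      by (simp add: euler_def sum_distrib_left)
    show ?thesis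
      by (simp only: r sum.distrib sum_subtractf a b c d e f S_def[symmetric])
  qed
  have "euler (euler u) x = (\<Sum>i\<in>UNIV. x $ i * (pderiv i u x + (\<Sum>j\<in>UNIV. x $ j * pderiv i (pderiv j u) x)))"
  proof -
    have "pderiv i (euler u) x = (\<Sum>j\<in>UNIV. x $ j * pderiv i (pderiv j u) x + (if i = j then pderiv j u x else 0))" for i
      unfolding euler_def[abs_def]
      by (simp add: pderiv_sum pderiv_mult pderiv_nth smooth_mult smooth_pderiv u if_distrib if_distribR cong: if_cong sum.cong)
    then have "pderiv i (euler u) x = pderiv i u x + (\<Sum>j\<in>UNIV. x $ j * pderiv i (pderiv j u) x)" for i
      by (simp add: sum.distrib)
    then show ?thesis by (simp add: euler_def[of "euler u"])
  qed
  also have "\<dots> = euler u x + S"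
    by (simp add: euler_def S_def distrib_left sum.distrib sum_distrib_left mult.assoc)
  finally have "euler (euler u) x = euler u x + S" .
  with 1 show ?thesis by (simp add: algebra_simps)
qed

lemma pderiv_radial: "cinf g \<Longrightarrow> pderiv i (\<lambda>x. g (x \<bullet> x)) = (\<lambda>x. deriv g (x \<bullet> x) * (2 * x $ i))"
  using pderiv_compose[of g "\<lambda>x. x \<bullet> x" i] by (simp add: pderiv_inner)

lemma smooth_radial: "cinf g \<Longrightarrow> smooth (\<lambda>x. g (x \<bullet> x))"
  by (rule smooth_compose) auto

text \<open>Radial factors are written in s = |x|^2 instead of |x|: s is a polynomial in x, so no
  singularity arises at the origin and only the chain rule and homogeneity of Y enter.\<close>

lemma laplacian_radial_mult:
  fixes Y :: "real^'n::finite \<Rightarrow> real"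
  assumes g: "cinf g" and Y: "smooth Y" "\<And>x. euler Y x = k * Y x"
  shows "laplacian (\<lambda>x. g (x \<bullet> x) * Y x) x =
     (4 * (x \<bullet> x) * deriv (deriv g) (x \<bullet> x) + (2 * real CARD('n) + 4 * k) * deriv g (x \<bullet> x)) * Y x
      + g (x \<bullet> x) * laplacian Y x"
proof -
  note sm = smooth_radial[OF g] smooth_radial[OF cinf_deriv[OF g]]
  have "pderiv i (pderiv i (\<lambda>x. g (x \<bullet> x) * Y x)) x =
     4 * (x$i * x$i) * (deriv (deriv g) (x \<bullet> x) * Y x) + 2 * (deriv g (x \<bullet> x) * Y x)
      + 4 * deriv g (x \<bullet> x) * (x $ i * pderiv i Y x) + g (x \<bullet> x) * pderiv i (pderiv i Y) x" for i
  proof -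
    have p1: "pderiv i (\<lambda>x. g (x \<bullet> x) * Y x)
        = (\<lambda>x. g (x \<bullet> x) * pderiv i Y x + deriv g (x \<bullet> x) * (2 * x $ i * Y x))"
      by (simp only: pderiv_mult[OF sm(1) Y(1)] pderiv_radial[OF g] mult.assoc)
    have p2: "pderiv i (\<lambda>x. g (x \<bullet> x) * pderiv i Y x + deriv g (x \<bullet> x) * (2 * x $ i * Y x)) x = g (x \<bullet> x) * pderiv i (pderiv i Y) x + deriv g (x \<bullet> x) * (2 * x $ i) * pderiv i Y x
       + (deriv g (x \<bullet> x) * (2 * x $ i * pderiv i Y x + 2 * Y x)
          + deriv (deriv g) (x \<bullet> x) * (2 * x $ i) * (2 * x $ i * Y x))"
    proof -
      have l: "smooth (\<lambda>x. 2 * x $ i * Y x)"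
        and dl: "pderiv i (\<lambda>x. 2 * x $ i * Y x) = (\<lambda>x. 2 * x $ i * pderiv i Y x + 2 * Y x)"
        by (simp_all add: smooth_mult Y pderiv_mult pderiv_nth)
      show ?thesis
        by (subst pderiv_add[OF smooth_mult[OF sm(1) smooth_pderiv[OF Y(1)]] smooth_mult[OF sm(2) l]])
           (simp only: pderiv_mult[OF sm(1) smooth_pderiv[OF Y(1)]] pderiv_mult[OF sm(2) l] dl
             pderiv_radial[OF g] pderiv_radial[OF cinf_deriv[OF g]])
    qed
    show ?thesis unfolding p1 p2 by (simp add: algebra_simps)
  qed
  then have "laplacian (\<lambda>x. g (x \<bullet> x) * Y x) x = 4 * (x \<bullet> x) * (deriv (deriv g) (x \<bullet> x) * Y x)
     + 2 * real CARD('n) * (deriv g (x \<bullet> x) * Y x) + 4 * deriv g (x \<bullet> x) * euler Y x + g (x \<bullet> x) * laplacian Y x"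
    by (simp add: laplacian_def sum.distrib euler_def inner_sum_squares flip: sum_distrib_left sum_distrib_right)
  then show ?thesis by (simp add: Y(2) algebra_simps)
qed

lemma euler_radial_mult:
  fixes Y :: "real^'n::finite \<Rightarrow> real"
  assumes g: "cinf g" and Y: "smooth Y" "\<And>x. euler Y x = k * Y x"
  shows "euler (\<lambda>x. g (x \<bullet> x) * Y x) x = (2 * (x \<bullet> x) * deriv g (x \<bullet> x) + k * g (x \<bullet> x)) * Y x"
proof -
  have "euler (\<lambda>x. g (x \<bullet> x)) x = 2 * (x \<bullet> x) * deriv g (x \<bullet> x)"
    by (simp add: euler_def pderiv_radial g)
       (simp add: inner_sum_squares sum_distrib_left algebra_simps)
  then show ?thesis using Y by (simp add: euler_mult smooth_radial g algebra_simps)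
qed

section \<open>Hausdorff measure of spheres\<close>

abbreviation hcover :: "real \<Rightarrow> 'a::metric_space set \<Rightarrow> (nat \<Rightarrow> 'a set) set" where
  "hcover \<delta> A \<equiv> {C. A \<subseteq> (\<Union>i. C i) \<and> (\<forall>i. bounded (C i) \<and> diameter (C i) \<le> \<delta>)}"

definition hsum :: "real \<Rightarrow> (nat \<Rightarrow> 'a::metric_space set) \<Rightarrow> ennreal" where
  "hsum s C = (\<Sum>i. ennreal (hausdorff_const s * (diameter (C i) / 2) powr s))"

definition hpre :: "real \<Rightarrow> real \<Rightarrow> 'a::metric_space set \<Rightarrow> ennreal" where
  "hpre s \<delta> A = (INF C\<in>hcover \<delta> A. hsum s C)"

lemma hausdorff_measure_hpre: "hausdorff_measure s A = (SUP \<delta>\<in>{0<..}. hpre s \<delta> A)"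
  unfolding hausdorff_measure_def hpre_def hsum_def ..

lemma hpre_antimono: "\<delta> \<le> \<delta>' \<Longrightarrow> hpre s \<delta>' A \<le> hpre s \<delta> A"
  unfolding hpre_def by (rule INF_superset_mono) (auto intro: order_trans)

lemma hpre_le_hausdorff: "\<delta> > 0 \<Longrightarrow> hpre s \<delta> A \<le> hausdorff_measure s A"
  unfolding hausdorff_measure_hpre by (rule SUP_upper) simp

lemma hausdorff_const_pos: "s \<ge> 0 \<Longrightarrow> hausdorff_const s > 0"
  unfolding hausdorff_const_def by (intro divide_pos_pos) (auto intro!: Gamma_real_pos)

lemma ennreal_le_mult_INF:
  fixes f :: "'b \<Rightarrow> ennreal"
  assumes "k > 0" and "\<And>c. c \<in> S \<Longrightarrow> X \<le> ennreal k * f c"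
  shows "X \<le> ennreal k * (INF c\<in>S. f c)"
proof -
  have "ennreal (1/k) * X \<le> (INF c\<in>S. f c)"
  proof (rule INF_greatest)
    fix c assume "c \<in> S"
    have "ennreal (1/k) * X \<le> ennreal (1/k) * (ennreal k * f c)"
      by (intro mult_left_mono assms \<open>c \<in> S\<close>) simp
    then show "ennreal (1/k) * X \<le> f c"
      using \<open>k > 0\<close> by (simp add: mult.assoc[symmetric] flip: ennreal_mult)
  qed
  then have "ennreal k * (ennreal (1/k) * X) \<le> ennreal k * (INF c\<in>S. f c)"
    by (rule mult_left_mono) simp
  then show ?thesis
    using \<open>k > 0\<close> by (simp add: mult.assoc[symmetric] flip: ennreal_mult)
qed

lemma diameter_scaleR_le:
  fixes S :: "'a::real_normed_vector set"
  assumes "bounded S" "c > 0"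
  shows "diameter (scaleR c ` S) \<le> c * diameter S"
proof (rule diameter_le)
  show "scaleR c ` S \<noteq> {} \<or> 0 \<le> c * diameter S"
    using assms diameter_ge_0 by (metis mult_nonneg_nonneg less_imp_le)
next
  fix x y assume "x \<in> scaleR c ` S" "y \<in> scaleR c ` S"
  then obtain a b where "a \<in> S" "b \<in> S" "x = c *\<^sub>R a" "y = c *\<^sub>R b" by blast
  then have "norm (x - y) = c * norm (a - b)"
    using assms by (simp flip: scaleR_diff_right)
  also have "\<dots> \<le> c * diameter S"
    using diameter_bounded_bound[OF assms(1) \<open>a \<in> S\<close> \<open>b \<in> S\<close>] assms by (simp add: dist_norm)
  finally show "norm (x - y) \<le> c * diameter S" .
qed

lemma hausdorff_measure_scaleR_le:
  fixes A :: "'a::real_normed_vector set"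
  assumes "c > 0" "s \<ge> 0"
  shows "hausdorff_measure s (scaleR c ` A) \<le> ennreal (c powr s) * hausdorff_measure s A"
  unfolding hausdorff_measure_hpre[of s "scaleR c ` A"]
proof (rule SUP_least)
  fix \<delta> :: real assume "\<delta> \<in> {0<..}"
  have "hpre s \<delta> (scaleR c ` A) \<le> ennreal (c powr s) * hpre s (\<delta>/c) A"
    unfolding hpre_def[of s "\<delta>/c"]
  proof (rule ennreal_le_mult_INF)
    show "c powr s > 0" using assms by simp
    fix C assume C: "C \<in> hcover (\<delta>/c) A"
    define D where "D i = scaleR c ` C i" for i
    have dD: "diameter (D i) \<le> c * diameter (C i)" for i
      using C assms unfolding D_def by (intro diameter_scaleR_le) auto
    have bD: "bounded (D i)" for i
      using C unfolding D_def by (intro bounded_scaling) auto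
    have "D \<in> hcover \<delta> (scaleR c ` A)"
    proof -
      have "diameter (D i) \<le> \<delta>" for i
      proof -
        have "c * diameter (C i) \<le> \<delta>"
          using C assms by (auto simp: field_simps)
        then show ?thesis using dD[of i] by linarith
      qed
      moreover have "scaleR c ` A \<subseteq> (\<Union>i. D i)"
        using C unfolding D_def by blast
      ultimately show ?thesis using bD by auto
    qed
    then have "hpre s \<delta> (scaleR c ` A) \<le> hsum s D"
      unfolding hpre_def by (rule INF_lower)
    also have "\<dots> \<le> (\<Sum>i. ennreal (c powr s) * ennreal (hausdorff_const s * (diameter (C i) / 2) powr s))"
      unfolding hsum_def
    proof (rule suminf_le)
      fix i
      have "(diameter (D i) / 2) powr s \<le> (c * (diameter (C i) / 2)) powr s"
        using dD[of i] bD[of i] assms by (intro powr_mono2) (auto simp: diameter_ge_0)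
      also have "\<dots> = c powr s * (diameter (C i) / 2) powr s"
        using assms C by (subst powr_mult) (auto simp: diameter_ge_0)
      finally have "hausdorff_const s * (diameter (D i) / 2) powr s
          \<le> hausdorff_const s * (c powr s * (diameter (C i) / 2) powr s)"
        using hausdorff_const_pos[OF assms(2)] by (intro mult_left_mono) auto
      then show "ennreal (hausdorff_const s * (diameter (D i) / 2) powr s)
         \<le> ennreal (c powr s) * ennreal (hausdorff_const s * (diameter (C i) / 2) powr s)"
        using assms hausdorff_const_pos[OF assms(2)]
        by (subst ennreal_mult[symmetric]) (auto intro!: ennreal_leI simp: algebra_simps)
    qed auto
    also have "\<dots> = ennreal (c powr s) * hsum s C"
      unfolding hsum_def by simp
    finally show "hpre s \<delta> (scaleR c ` A) \<le> ennreal (c powr s) * hsum s C" .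
  qed
  also have "\<dots> \<le> ennreal (c powr s) * hausdorff_measure s A"
    using \<open>\<delta> \<in> {0<..}\<close> assms by (intro mult_left_mono hpre_le_hausdorff) auto
  finally show "hpre s \<delta> (scaleR c ` A) \<le> ennreal (c powr s) * hausdorff_measure s A" .
qed

lemma hausdorff_measure_scaleR:
  fixes A :: "'a::real_normed_vector set"
  assumes c: "c > 0" and s: "s \<ge> 0"
  shows "hausdorff_measure s (scaleR c ` A) = ennreal (c powr s) * hausdorff_measure s A"
proof (rule antisym[OF hausdorff_measure_scaleR_le[OF assms]])
  have "scaleR (1/c) ` scaleR c ` A = A"
    using c by (auto simp: image_image)
  then have "hausdorff_measure s A \<le> ennreal ((1/c) powr s) * hausdorff_measure s (scaleR c ` A)"
    using hausdorff_measure_scaleR_le[of "1/c" s "scaleR c ` A"] assms by simp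
  then have "ennreal (c powr s) * hausdorff_measure s A
      \<le> ennreal (c powr s) * (ennreal ((1/c) powr s) * hausdorff_measure s (scaleR c ` A))"
    by (rule mult_left_mono) simp
  also have "\<dots> = hausdorff_measure s (scaleR c ` A)"
    using c by (simp add: mult.assoc[symmetric] powr_divide flip: ennreal_mult)
  finally show "ennreal (c powr s) * hausdorff_measure s A \<le> hausdorff_measure s (scaleR c ` A)" .
qed

lemma ennreal_less_add_real:
  fixes x :: ennreal
  assumes "x \<noteq> top" "0 < e"
  shows "x < x + ennreal e"
  using assms by (cases x) (auto simp: ennreal_less_iff simp flip: ennreal_plus)

text \<open>Two covers are interleaved at even and odd indices; partial sums up to 2N split into the
  partial sums of both.\<close>

lemma hpre_Un_le: "hpre s \<delta> (A \<union> B) \<le> hpre s \<delta> A + hpre s \<delta> B"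
proof -
  have "hpre s \<delta> (A \<union> B) \<le> hsum s C + hsum s D" if C: "C \<in> hcover \<delta> A" and D: "D \<in> hcover \<delta> B" for C D
  proof -
    define E where "E i = (if even i then C (i div 2) else D (i div 2))" for i
    have E: "E (2*i) = C i" "E (Suc (2*i)) = D i" for i by (auto simp: E_def)
    then have "C i \<subseteq> (\<Union>i. E i)" "D i \<subseteq> (\<Union>i. E i)" for i
      by (metis UNIV_I UN_upper)+
    then have "(\<Union>i. C i) \<union> (\<Union>i. D i) \<subseteq> (\<Union>i. E i)"
      by blast
    moreover have "bounded (E i) \<and> diameter (E i) \<le> \<delta>" for i using C D by (auto simp: E_def)
    ultimately have "E \<in> hcover \<delta> (A \<union> B)" using C D by blast
    then have "hpre s \<delta> (A \<union> B) \<le> hsum s E" unfolding hpre_def by (rule INF_lower)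
    also have "hsum s E \<le> hsum s C + hsum s D"
    proof -
      define f where "f X = ennreal (hausdorff_const s * (diameter X / 2) powr s)" for X :: "'a set"
      have eq: "(\<Sum>i<2*N. f (E i)) = (\<Sum>i<N. f (C i)) + (\<Sum>i<N. f (D i))" for N
      proof (induction N)
        case (Suc N)
        have "(\<Sum>i<2 * Suc N. f (E i)) = (\<Sum>i<2*N. f (E i)) + f (C N) + f (D N)"
          by (simp add: E)
        with Suc show ?case by (simp add: ac_simps)
      qed simp
      have "(\<Sum>i. f (E i)) \<le> (\<Sum>i. f (C i)) + (\<Sum>i. f (D i))"
      proof (rule suminf_le_const)
        fix N
        have "(\<Sum>i<N. f (E i)) \<le> (\<Sum>i<2*N. f (E i))" by (rule sum_mono2) auto
        also have "\<dots> \<le> (\<Sum>i. f (C i)) + (\<Sum>i. f (D i))"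
          unfolding eq by (intro add_mono sum_le_suminf) auto
        finally show "(\<Sum>i<N. f (E i)) \<le> (\<Sum>i. f (C i)) + (\<Sum>i. f (D i))" .
      qed auto
      then show ?thesis by (simp add: hsum_def f_def)
    qed
    finally show ?thesis .
  qed
  note le = this
  show ?thesis
  proof (cases "hpre s \<delta> A = top \<or> hpre s \<delta> B = top")
    case False
    show ?thesis
    proof (rule ennreal_le_epsilon)
      fix e :: real assume "0 < e"
      have "hpre s \<delta> A < hpre s \<delta> A + ennreal (e/2)" "hpre s \<delta> B < hpre s \<delta> B + ennreal (e/2)"
        using False \<open>0 < e\<close> by (auto intro!: ennreal_less_add_real)
      then obtain C D where "C \<in> hcover \<delta> A" "hsum s C < hpre s \<delta> A + ennreal (e/2)"
          "D \<in> hcover \<delta> B" "hsum s D < hpre s \<delta> B + ennreal (e/2)"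
        unfolding hpre_def INF_less_iff by blast
      then have "hpre s \<delta> (A \<union> B) \<le> (hpre s \<delta> A + ennreal (e/2)) + (hpre s \<delta> B + ennreal (e/2))"
        using le[of C D] by (meson add_mono less_imp_le order_trans)
      also have "\<dots> = hpre s \<delta> A + hpre s \<delta> B + (ennreal (e/2) + ennreal (e/2))"
        by (simp add: ac_simps)
      also have "ennreal (e/2) + ennreal (e/2) = ennreal e"
        using \<open>0 < e\<close> by (simp flip: ennreal_plus)
      finally show "hpre s \<delta> (A \<union> B) \<le> hpre s \<delta> A + hpre s \<delta> B + ennreal e" .
    qed
  qed auto
qed

lemma hausdorff_measure_Un_le:
  "hausdorff_measure s (A \<union> B) \<le> hausdorff_measure s A + hausdorff_measure s B"
  unfolding hausdorff_measure_hpre[of s "A \<union> B"]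
proof (rule SUP_least)
  fix \<delta> :: real assume "\<delta> \<in> {0<..}"
  then show "hpre s \<delta> (A \<union> B) \<le> hausdorff_measure s A + hausdorff_measure s B"
    using hpre_Un_le[of s \<delta> A B] hpre_le_hausdorff[of \<delta> s A] hpre_le_hausdorff[of \<delta> s B]
    by (meson add_mono greaterThan_iff order_trans)
qed

text \<open>Once \<delta> is below the distance d, no set of a cover meets both parts, so every
  cover of the union splits into a cover of each part at no extra cost.\<close>

lemma hausdorff_measure_Un_ge:
  assumes d: "d > 0" "\<And>x y. x \<in> A \<Longrightarrow> y \<in> B \<Longrightarrow> dist x y \<ge> d"
  shows "hausdorff_measure s A + hausdorff_measure s B \<le> hausdorff_measure s (A \<union> B)"
proof -
  have *: "hpre s \<delta> A + hpre s \<delta> B \<le> hpre s \<delta> (A \<union> B)" if \<delta>: "0 < \<delta>" "\<delta> < d" for \<delta>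
    unfolding hpre_def[of s \<delta> "A \<union> B"]
  proof (rule INF_greatest)
    fix C assume C: "C \<in> hcover \<delta> (A \<union> B)"
    define CA where "CA i = (if C i \<inter> A \<noteq> {} then C i else {})" for i
    define CB where "CB i = (if C i \<inter> B \<noteq> {} then C i else {})" for i
    define f where "f X = ennreal (hausdorff_const s * (diameter X / 2) powr s)" for X :: "'a set"
    have "CA \<in> hcover \<delta> A" "CB \<in> hcover \<delta> B"
      using C \<delta> by (fastforce simp: CA_def CB_def)+
    then have "hpre s \<delta> A \<le> hsum s CA" "hpre s \<delta> B \<le> hsum s CB"
      unfolding hpre_def by (auto intro: INF_lower)
    then have "hpre s \<delta> A + hpre s \<delta> B \<le> hsum s CA + hsum s CB" by (rule add_mono)
    also have "\<dots> = (\<Sum>i. f (CA i) + f (CB i))"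
      unfolding hsum_def f_def by (rule suminf_add) auto
    also have "\<dots> \<le> (\<Sum>i. f (C i))"
    proof (rule suminf_le)
      fix i
      have "CA i = {} \<or> CB i = {}"
      proof (rule ccontr)
        assume "\<not> ?thesis"
        then obtain x y where "x \<in> C i" "x \<in> A" "y \<in> C i" "y \<in> B"
          by (auto simp: CA_def CB_def split: if_splits)
        then have "dist x y \<le> diameter (C i)" "d \<le> dist x y"
          using C d(2) by (auto intro: diameter_bounded_bound)
        then show False using C \<delta> by (smt (verit) mem_Collect_eq)
      qed
      moreover have "f {} = 0" by (simp add: f_def)
      ultimately show "f (CA i) + f (CB i) \<le> f (C i)"
        by (auto simp: CA_def CB_def split: if_splits)
    qed auto
    finally show "hpre s \<delta> A + hpre s \<delta> B \<le> hsum s C" by (simp add: hsum_def f_def)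
  qed
  have "hausdorff_measure s A + hausdorff_measure s B = (SUP \<delta>\<in>{0<..}. hpre s \<delta> A + hpre s \<delta> B)"
    unfolding hausdorff_measure_hpre
  proof (rule SUP_add_directed_ennreal[symmetric])
    fix i j :: real assume "i \<in> {0<..}" "j \<in> {0<..}"
    then show "\<exists>k\<in>{0<..}. hpre s i A + hpre s j B \<le> hpre s k A + hpre s k B"
      by (intro bexI[of _ "min i j"] add_mono hpre_antimono) auto
  qed
  also have "\<dots> \<le> hausdorff_measure s (A \<union> B)"
  proof (rule SUP_least)
    fix \<delta> :: real assume "\<delta> \<in> {0<..}"
    define \<delta>' where "\<delta>' = min \<delta> (d/2)"
    have \<delta>': "0 < \<delta>'" "\<delta>' < d" "\<delta>' \<le> \<delta>" using \<open>\<delta> \<in> {0<..}\<close> d by (auto simp: \<delta>'_def)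
    have "hpre s \<delta> A + hpre s \<delta> B \<le> hpre s \<delta>' A + hpre s \<delta>' B"
      by (intro add_mono hpre_antimono \<delta>')
    also have "\<dots> \<le> hpre s \<delta>' (A \<union> B)" using * \<delta>' by blast
    also have "\<dots> \<le> hausdorff_measure s (A \<union> B)" using \<delta>' by (intro hpre_le_hausdorff)
    finally show "hpre s \<delta> A + hpre s \<delta> B \<le> hausdorff_measure s (A \<union> B)" .
  qed
  finally show ?thesis .
qed

lemma powr_nat_nonneg: "0 \<le> (x::real) \<Longrightarrow> 0 < m \<Longrightarrow> x powr real m = x ^ m"
  by (cases "x = 0") (auto simp: powr_realpow)

text \<open>The sphere projects onto the unit ball of the hyperplane orthogonal to one axis. So a
  cover of the sphere by sets of diameter d_i yields a cover of the solid ball by boxes of fixed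
  height along that axis and width 2 d_i in the other n-1 directions; comparing volumes bounds the
  cost from below.\<close>

lemma hausdorff_measure_sphere_pos:
  assumes n: "CARD('n::finite) \<ge> 2"
  shows "hausdorff_measure (real CARD('n) - 1) (sphere (0::real^'n) 1) > 0"
proof -
  define s where "s = real CARD('n) - 1"
  define m where "m = CARD('n) - 1"
  have m: "m > 0" "s = real m" "CARD('n) = Suc m" using n by (auto simp: m_def s_def)
  define h where "h = hausdorff_const s"
  have h: "h > 0" unfolding h_def using m by (intro hausdorff_const_pos) auto
  \<comment> \<open>A box has volume 2 (2d)^m = 2 * 4^m * (d/2)^m, and its cover set costs h
    (d/2)^m; \<open>K\<close> is the quotient.\<close>
  define K where "K = 2 * 4 ^ m / h"
  have K: "K > 0" using h by (simp add: K_def)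
  obtain k0 :: 'n where True by blast
  have "emeasure lborel (ball (0::real^'n) 1) \<le> ennreal K * hpre s 1 (sphere (0::real^'n) 1)"
    unfolding hpre_def
  proof (rule ennreal_le_mult_INF[OF K])
    fix C assume C: "C \<in> hcover 1 (sphere (0::real^'n) 1)"
    define p where "p i = (SOME x. x \<in> C i)" for i
    define d where "d i = diameter (C i)" for i
    have d: "d i \<ge> 0" for i using C by (auto simp: d_def diameter_ge_0)
    \<comment> \<open>Height 2 along the axis \<open>k0\<close>, so that the box contains the whole
      part of the ball lying over the projection of \<open>C i\<close>.\<close>
    define B where "B i = cbox (\<chi> j. if j = k0 then -1 else p i $ j - d i) (\<chi> j. if j = k0 then 1 else p i $ j + d i)" for i
    have "ball 0 1 \<subseteq> (\<Union>i. B i)"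
    proof
      fix x :: "real^'n" assume "x \<in> ball 0 1"
      then have x: "norm x < 1" by simp
      define t where "t = (\<Sum>j\<in>UNIV - {k0}. (x $ j)\<^sup>2)"
      have nx: "(norm x)\<^sup>2 = (x $ k0)\<^sup>2 + t"
        by (simp add: norm_vec_def L2_set_def sum_nonneg t_def sum.remove[of UNIV k0])
      then have t: "t \<le> 1" using x by (smt (verit) norm_ge_zero power_le_one zero_le_power2)
      \<comment> \<open>The lift of x along the axis \<open>k0\<close> to the sphere; it agrees with
        x in all other coordinates.\<close>
      define y where "y = (\<chi> j. if j = k0 then sqrt (1 - t) else x $ j)"
      have "(norm y)\<^sup>2 = (y $ k0)\<^sup>2 + (\<Sum>j\<in>UNIV - {k0}. (y $ j)\<^sup>2)"
        by (simp add: norm_vec_def L2_set_def sum_nonneg sum.remove[of UNIV k0])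
      also have "(\<Sum>j\<in>UNIV - {k0}. (y $ j)\<^sup>2) = t" by (simp add: y_def t_def)
      finally have "(norm y)\<^sup>2 = 1" using t by (simp add: y_def)
      then have "norm y = 1" by (smt (verit) norm_ge_zero power2_eq_1_iff)
      then have "y \<in> sphere 0 1" by simp
      then obtain i where i: "y \<in> C i" using C by blast
      then have "p i \<in> C i" unfolding p_def by (rule someI)
      then have "norm (y - p i) \<le> d i"
        using i C diameter_bounded_bound[of "C i" y "p i"] by (simp add: d_def dist_norm)
      then have "\<bar>y $ j - p i $ j\<bar> \<le> d i" for j
        by (metis component_le_norm_cart order_trans vector_minus_component)
      then have *: "\<bar>x $ j - p i $ j\<bar> \<le> d i" if "j \<noteq> k0" for j
        using that by (simp add: y_def split: if_splits) (metis (full_types))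
      have "\<bar>x $ k0\<bar> \<le> 1" using component_le_norm_cart[of x k0] x by linarith
      then have "x \<in> B i"
      proof -
        have "p i $ j - d i \<le> x $ j \<and> x $ j \<le> p i $ j + d i" if "j \<noteq> k0" for j
          using *[OF that] by linarith
        then show ?thesis using \<open>\<bar>x $ k0\<bar> \<le> 1\<close> by (auto simp: B_def mem_box_cart)
      qed
      then show "x \<in> (\<Union>i. B i)" by blast
    qed
    then have "emeasure lborel (ball (0::real^'n) 1) \<le> emeasure lborel (\<Union>i. B i)"
      by (rule emeasure_mono) (auto simp: B_def)
    also have "\<dots> \<le> (\<Sum>i. emeasure lborel (B i))"
      by (rule emeasure_subadditive_countably) (auto simp: B_def)
    also have "\<dots> = (\<Sum>i. ennreal K * ennreal (h * (diameter (C i) / 2) powr s))"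
    proof (rule arg_cong[where f=suminf], rule ext)
      fix i
      have "B i \<noteq> {}" using d[of i] by (auto simp: B_def interval_ne_empty_cart)
      then have "measure lborel (B i) = (\<Prod>j\<in>UNIV. if j = k0 then 2 else 2 * d i)"
        using d[of i] unfolding B_def
        by (subst content_cbox_cart; (intro prod.cong refl)?; simp)
      also have "\<dots> = 2 * (2 * d i) ^ m"
        using m by (subst prod.remove[of UNIV k0]) (auto simp: card_Diff_singleton)
      also have "\<dots> = K * (h * (d i / 2) powr s)"
      proof -
        have "(2 * d i) ^ m = 4 ^ m * (d i / 2) ^ m"
          using power_mult_distrib[of 4 "d i / 2" m] by simp
        moreover have "(d i / 2) powr s = (d i / 2) ^ m"
          using powr_nat_nonneg[of "d i / 2" m] d[of i] m by simp
        ultimately show ?thesis using h by (simp only: K_def) (simp add: field_simps)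
      qed
      finally have "measure lborel (B i) = K * (h * (d i / 2) powr s)" .
      moreover have "emeasure lborel (B i) = ennreal (measure lborel (B i))"
        unfolding B_def by (rule emeasure_eq_ennreal_measure) (use emeasure_lborel_cbox_finite[THEN less_imp_neq] in \<open>auto simp: infinity_ennreal_def\<close>)
      ultimately show "emeasure lborel (B i) = ennreal K * ennreal (h * (diameter (C i) / 2) powr s)"
        using K h by (simp add: d_def flip: ennreal_mult)
    qed
    also have "\<dots> = ennreal K * hsum s C"
      by (simp add: hsum_def h_def)
    finally show "emeasure lborel (ball (0::real^'n) 1) \<le> ennreal K * hsum s C" .
  qed
  also have "\<dots> \<le> ennreal K * hausdorff_measure s (sphere (0::real^'n) 1)"
    by (intro mult_left_mono hpre_le_hausdorff) auto
  finally have "emeasure lborel (ball (0::real^'n) 1) \<le> ennreal K * hausdorff_measure s (sphere (0::real^'n) 1)" .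
  moreover have "emeasure lborel (ball (0::real^'n) 1) \<noteq> 0"
    using content_ball_pos[of 1 "0::real^'n"] by (auto simp: measure_def)
  ultimately show ?thesis unfolding s_def[symmetric] using zero_less_iff_neq_zero by fastforce
qed

lemma power_diff_le_linear:
  fixes a b :: real
  assumes "0 \<le> b" "b \<le> a" "a \<le> 2"
  shows "a ^ n - b ^ n \<le> real n * 2 ^ n * (a - b)"
proof (induction n)
  case (Suc n)
  have "a ^ Suc n - b ^ Suc n = a * (a ^ n - b ^ n) + b ^ n * (a - b)" by (simp add: algebra_simps)
  also have "\<dots> \<le> 2 * (real n * 2 ^ n * (a - b)) + 2 ^ n * (a - b)"
    using assms Suc by (intro add_mono mult_mono mult_right_mono power_mono) (auto intro: power_mono)
  also have "\<dots> \<le> 2 * (real n * 2 ^ n * (a - b)) + 2 * (2 ^ n * (a - b))"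
    using assms by simp
  also have "\<dots> = real (Suc n) * 2 ^ Suc n * (a - b)" by (simp add: algebra_simps)
  finally show ?case .
qed simp

text \<open>The balls of radius \<rho> about the points are disjoint and lie in a shell of thickness
  2\<rho>, whose volume is of order \<rho>; each ball has volume of order \<rho>^n.\<close>

lemma separated_sphere_card_le:
  fixes P :: "(real^'n::finite) set"
  assumes P: "finite P" "P \<subseteq> sphere 0 1" "\<And>p q. p \<in> P \<Longrightarrow> q \<in> P \<Longrightarrow> p \<noteq> q \<Longrightarrow> dist p q \<ge> 2 * \<rho>"
    and \<rho>: "0 < \<rho>" "\<rho> \<le> 1"
  shows "real (card P) * \<rho> ^ (CARD('n) - 1) \<le> real CARD('n) * 2 ^ CARD('n) * 2"
proof -
  let ?n = "CARD('n)"
  define V where "V = measure lborel (ball (0::real^'n) 1)"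
  have V: "V > 0" by (simp add: V_def)
  have cb: "measure lborel (ball (p::real^'n) r) = V * r ^ ?n" if "r \<ge> 0" for p r
    using content_ball[of r p] content_ball[of 1 "0::real^'n"] that by (simp add: V_def)
  have "real (card P) * (V * \<rho> ^ ?n) = (\<Sum>p\<in>P. measure lborel (ball p \<rho>))" using cb \<rho> by simp
  also have "\<dots> = measure lborel (\<Union>p\<in>P. ball p \<rho>)"
  proof (rule measure_finite_Union[symmetric])
    show "disjoint_family_on (\<lambda>p. ball p \<rho>) P"
      unfolding disjoint_family_on_def
    proof (intro ballI impI)
      fix p q assume "p \<in> P" "q \<in> P" "p \<noteq> q"
      then have "dist p q \<ge> 2 * \<rho>" using P by blast
      then show "ball p \<rho> \<inter> ball q \<rho> = {}"
        using dist_triangle_less_add[of p _ \<rho> q \<rho>] by (fastforce simp: disjoint_iff)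
    qed
  qed (use P emeasure_lborel_ball_finite in \<open>auto simp: less_top\<close>)
  also have "\<dots> \<le> measure lborel (ball (0::real^'n) (1+\<rho>) - ball 0 (1-\<rho>))"
  proof (rule measure_mono_fmeasurable)
    show "(\<Union>p\<in>P. ball p \<rho>) \<subseteq> ball (0::real^'n) (1+\<rho>) - ball 0 (1-\<rho>)"
    proof
      fix x assume "x \<in> (\<Union>p\<in>P. ball p \<rho>)"
      then obtain p where "p \<in> P" "norm (p - x) < \<rho>" by (auto simp: dist_norm)
      moreover have "norm p = 1" using \<open>p \<in> P\<close> P by auto
      ultimately show "x \<in> ball 0 (1+\<rho>) - ball 0 (1-\<rho>)"
        using norm_triangle_ineq3[of p x] by auto
    qed
    have fb: "ball c r \<in> fmeasurable lborel" for c :: "real^'n" and r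
      using emeasure_lborel_ball_finite by (auto simp: fmeasurable_def)
    show "ball (0::real^'n) (1+\<rho>) - ball 0 (1-\<rho>) \<in> fmeasurable lborel"
      by (intro fmeasurable.Diff fb)
  qed (use P in \<open>auto intro!: sets.finite_UN\<close>)
  also have "\<dots> = V * (1+\<rho>)^?n - V * (1-\<rho>)^?n"
    using \<rho> emeasure_lborel_ball_finite
    by (subst measure_Diff) (auto simp: cb less_top)
  also have "\<dots> = V * ((1+\<rho>)^?n - (1-\<rho>)^?n)" by (simp add: right_diff_distrib)
  also have "\<dots> \<le> V * (real ?n * 2 ^ ?n * ((1+\<rho>) - (1-\<rho>)))"
    using V \<rho> by (intro mult_left_mono power_diff_le_linear) auto
  finally have "V * (real (card P) * \<rho> ^ ?n) \<le> V * (real ?n * 2 ^ ?n * (2 * \<rho>))" by (simp add: algebra_simps)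
  then have "real (card P) * \<rho> ^ ?n \<le> real ?n * 2 ^ ?n * (2 * \<rho>)" using V by simp
  moreover have "\<rho> ^ ?n = \<rho> ^ (?n - 1) * \<rho>" by (metis power_minus_mult zero_less_card_finite)
  ultimately have "(real (card P) * \<rho> ^ (?n - 1)) * \<rho> \<le> (real ?n * 2 ^ ?n * 2) * \<rho>" by (simp add: algebra_simps)
  then show ?thesis using \<rho> by simp
qed

text \<open>A largest 2\<rho>-separated subset of the sphere is also a net: balls of radius 2\<rho>
  about it cover. Their number, of order \<rho>^(1-n), cancels the cost \<rho>^(n-1) of each, so the
  bound \<open>K\<close> does not depend on \<delta>.\<close>

lemma hausdorff_measure_sphere_finite:
  assumes n: "CARD('n::finite) \<ge> 2"
  shows "hausdorff_measure (real CARD('n) - 1) (sphere (0::real^'n) 1) < top"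
proof -
  define s where "s = real CARD('n) - 1"
  define m where "m = CARD('n) - 1"
  have m: "m > 0" "s = real m" using n by (auto simp: m_def s_def)
  define h where "h = hausdorff_const s"
  have h: "h > 0" unfolding h_def using m by (intro hausdorff_const_pos) auto
  define L where "L = real CARD('n) * 2 ^ CARD('n) * 2"
  define K where "K = h * 2 ^ m * L"
  have small: "hpre s \<delta> (sphere (0::real^'n) 1) \<le> ennreal K" if \<delta>: "0 < \<delta>" "\<delta> \<le> 1" for \<delta>
  proof -
    \<comment> \<open>The covering balls have radius 2\<rho>, hence diameter 4\<rho> =
      \<delta>.\<close>
    define \<rho> where "\<rho> = \<delta> / 4"
    have \<rho>: "0 < \<rho>" "\<rho> \<le> 1" "\<delta> = 4 * \<rho>" using \<delta> by (auto simp: \<rho>_def)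
    define Q where "Q P \<longleftrightarrow> finite P \<and> P \<subseteq> sphere (0::real^'n) 1 \<and> (\<forall>p\<in>P. \<forall>q\<in>P. p \<noteq> q \<longrightarrow> dist p q \<ge> 2 * \<rho>)" for P
    have card: "real (card P) * \<rho> ^ m \<le> L" if "Q P" for P
      using separated_sphere_card_le[of P \<rho>] that \<rho> by (auto simp: Q_def m_def L_def)
    have "Q {}" by (simp add: Q_def)
    moreover have "\<forall>P. Q P \<longrightarrow> card P < Suc (nat \<lceil>L / \<rho> ^ m\<rceil>)"
    proof (intro allI impI)
      fix P assume "Q P"
      then have "real (card P) \<le> L / \<rho> ^ m" using card \<rho> by (simp add: pos_le_divide_eq)
      then show "card P < Suc (nat \<lceil>L / \<rho> ^ m\<rceil>)" by linarith
    qed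
    ultimately obtain P where P: "Q P" "\<And>P'. Q P' \<Longrightarrow> card P' \<le> card P"
      using ex_has_greatest_nat[of Q "{}" card "Suc (nat \<lceil>L / \<rho> ^ m\<rceil>)"] by (auto simp: less_imp_le)
    then have fin: "finite P" by (simp add: Q_def)
    have cov: "sphere 0 1 \<subseteq> (\<Union>p\<in>P. cball p (2 * \<rho>))"
    proof
      fix x :: "real^'n" assume x: "x \<in> sphere 0 1"
      show "x \<in> (\<Union>p\<in>P. cball p (2 * \<rho>))"
      proof (rule ccontr)
        assume "\<not> ?thesis"
        then have far: "\<And>p. p \<in> P \<Longrightarrow> dist p x > 2 * \<rho>" by auto
        then have "x \<notin> P" using \<rho> by fastforce
        moreover have "Q (insert x P)"
          using P(1) x far unfolding Q_def by (auto simp: dist_commute less_imp_le)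
        ultimately show False using P(2)[of "insert x P"] fin by simp
      qed
    qed
    obtain f where f: "bij_betw f {0..<card P} P"
      using ex_bij_betw_nat_finite[OF fin] by blast
    define C where "C i = (if i < card P then cball (f i) (2 * \<rho>) else {})" for i
    have dC: "diameter (C i) \<le> \<delta>" for i
      unfolding C_def using \<rho> by (auto simp: diameter_cball)
    have "cball p (2 * \<rho>) \<subseteq> (\<Union>i. C i)" if "p \<in> P" for p
    proof -
      have "p \<in> f ` {0..<card P}" using f that by (simp add: bij_betw_def)
      then obtain i where "i < card P" "f i = p" by auto
      then have "C i = cball p (2 * \<rho>)" by (simp add: C_def)
      then show ?thesis by blast
    qed
    then have "(\<Union>p\<in>P. cball p (2 * \<rho>)) \<subseteq> (\<Union>i. C i)" by (rule UN_least)
    then have "sphere 0 1 \<subseteq> (\<Union>i. C i)" using cov by (rule order_trans[rotated])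
    then have "C \<in> hcover \<delta> (sphere 0 1)" using dC by (auto simp: C_def)
    then have "hpre s \<delta> (sphere (0::real^'n) 1) \<le> hsum s C" unfolding hpre_def by (rule INF_lower)
    also have "\<dots> = (\<Sum>i<card P. ennreal (h * (diameter (C i) / 2) powr s))"
      unfolding hsum_def h_def by (rule suminf_finite) (auto simp: C_def)
    also have "\<dots> \<le> (\<Sum>i<card P. ennreal (h * (2 * \<rho>) ^ m))"
    proof (intro sum_mono ennreal_leI mult_left_mono)
      fix i
      have "(diameter (C i) / 2) powr s \<le> (2 * \<rho>) powr s"
        using dC[of i] m \<rho> by (intro powr_mono2) (auto simp: C_def diameter_ge_0)
      then show "(diameter (C i) / 2) powr s \<le> (2 * \<rho>) ^ m"
        using \<rho> m by (simp add: powr_nat_nonneg)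
    qed (use h in auto)
    also have "\<dots> = ennreal (real (card P) * (h * (2 * \<rho>) ^ m))"
      using h \<rho> by (simp add: ennreal_mult ennreal_of_nat_eq_real_of_nat)
    also have "\<dots> \<le> ennreal K"
    proof (rule ennreal_leI)
      have "real (card P) * (h * (2 * \<rho>) ^ m) = h * 2 ^ m * (real (card P) * \<rho> ^ m)"
        by (simp add: power_mult_distrib)
      also have "\<dots> \<le> K" unfolding K_def using card[OF P(1)] h by (intro mult_left_mono) auto
      finally show "real (card P) * (h * (2 * \<rho>) ^ m) \<le> K" .
    qed
    finally show ?thesis .
  qed
  have "hausdorff_measure s (sphere (0::real^'n) 1) \<le> ennreal K"
    unfolding hausdorff_measure_hpre
  proof (rule SUP_least)
    fix \<delta> :: real assume "\<delta> \<in> {0<..}"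
    then have "hpre s (min \<delta> 1) (sphere (0::real^'n) 1) \<le> ennreal K" by (intro small) auto
    then show "hpre s \<delta> (sphere (0::real^'n) 1) \<le> ennreal K"
      using hpre_antimono[of "min \<delta> 1" \<delta> s "sphere (0::real^'n) 1"] by (metis min.cobounded1 order_trans)
  qed
  then show ?thesis unfolding s_def[symmetric] using ennreal_less_top le_less_trans by blast
qed

section \<open>The annulus, its closure and its boundary area\<close>

definition annulus :: "real \<Rightarrow> (real^'n::finite) set" where
  "annulus \<epsilon> = {x. \<epsilon> < norm x \<and> norm x < 1}"

lemma open_annulus: "open (annulus \<epsilon>)"
  unfolding annulus_def by (intro open_Collect_conj open_Collect_less continuous_intros)

lemma closure_annulus:
  assumes \<epsilon>: "0 < \<epsilon>" "\<epsilon> < 1"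
  shows "closure (annulus \<epsilon>) = {x :: real^'n::finite. \<epsilon> \<le> norm x \<and> norm x \<le> 1}"
proof
  show "closure (annulus \<epsilon>) \<subseteq> {x :: real^'n. \<epsilon> \<le> norm x \<and> norm x \<le> 1}"
    by (rule closure_minimal)
       (auto simp: annulus_def intro!: closed_Collect_conj closed_Collect_le continuous_intros)
  show "{x :: real^'n. \<epsilon> \<le> norm x \<and> norm x \<le> 1} \<subseteq> closure (annulus \<epsilon>)"
  proof
    fix x :: "real^'n" assume "x \<in> {x. \<epsilon> \<le> norm x \<and> norm x \<le> 1}"
    then have x: "\<epsilon> \<le> norm x" "norm x \<le> 1" by auto
    \<comment> \<open>Scaling by \<open>c\<close> moves x to the middle radius (\<epsilon> + 1)/2.
      The open radial segment from there to x stays in the annulus and has x in its closure; it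
      degenerates only if x already has that radius.\<close>
    define c where "c = (\<epsilon> + 1) / (2 * norm x)"
    have nx: "norm x > 0" using x \<epsilon> by linarith
    have "x \<in> closure (open_segment (c *\<^sub>R x) x) \<or> c *\<^sub>R x = x"
      by (metis closure_open_segment ends_in_segment(2))
    moreover have "norm (c *\<^sub>R x) = (\<epsilon> + 1) / 2" using nx \<epsilon> by (simp add: c_def)
    moreover have "open_segment (c *\<^sub>R x) x \<subseteq> annulus \<epsilon>"
    proof
      fix y assume "y \<in> open_segment (c *\<^sub>R x) x"
      then obtain u where u: "0 < u" "u < 1" "y = (1 - u) *\<^sub>R (c *\<^sub>R x) + u *\<^sub>R x" by (auto simp: in_segment)
      then have "y = ((1 - u) * c + u) *\<^sub>R x" by (simp add: algebra_simps)
      moreover have "(1 - u) * c + u > 0" using u nx \<epsilon> by (intro add_nonneg_pos) (auto simp: c_def)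
      ultimately have "norm y = ((1 - u) * c + u) * norm x" by (metis abs_of_pos norm_scaleR)
      then have "norm y = (1 - u) * ((\<epsilon> + 1) / 2) + u * norm x"
        using nx by (simp add: c_def distrib_right) (simp add: field_simps)?
      moreover have "(1 - u) * ((\<epsilon> + 1) / 2) + u * norm x > (1 - u) * \<epsilon> + u * \<epsilon>"
        using u \<epsilon> x by (intro add_less_le_mono mult_strict_left_mono mult_left_mono) auto
      moreover have "(1 - u) * ((\<epsilon> + 1) / 2) + u * norm x < (1 - u) * 1 + u * 1"
        using u \<epsilon> x by (intro add_less_le_mono mult_strict_left_mono mult_left_mono) auto
      ultimately show "y \<in> annulus \<epsilon>" by (simp add: annulus_def algebra_simps)
    qed
    ultimately show "x \<in> closure (annulus \<epsilon>)"
    proof (elim disjE)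
      assume "c *\<^sub>R x = x" "norm (c *\<^sub>R x) = (\<epsilon> + 1) / 2"
      then have "x \<in> annulus \<epsilon>" using \<epsilon> by (auto simp: annulus_def)
      then show ?thesis using closure_subset by blast
    qed (use closure_mono in blast)
  qed
qed

lemma frontier_annulus:
  assumes \<epsilon>: "0 < \<epsilon>" "\<epsilon> < 1"
  shows "frontier (annulus \<epsilon>) = sphere 0 1 \<union> sphere 0 \<epsilon>"
  unfolding frontier_def closure_annulus[OF assms] interior_open[OF open_annulus]
  using assms by (auto simp: annulus_def)

lemma boundary_area_ball_pos:
  assumes "CARD('n::finite) \<ge> 2"
  shows "boundary_area (ball (0::real^'n) 1) > 0"
  using hausdorff_measure_sphere_pos[OF assms] hausdorff_measure_sphere_finite[OF assms]
  by (simp add: boundary_area_def enn2real_positive_iff)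

text \<open>The two boundary spheres have distance 1 - \<epsilon> > 0, so their measures add, and
  the inner one is the unit sphere scaled by \<epsilon>.\<close>

lemma boundary_area_annulus:
  assumes n: "CARD('n::finite) \<ge> 2" and \<epsilon>: "0 < \<epsilon>" "\<epsilon> < 1"
  shows "boundary_area (annulus \<epsilon> :: (real^'n) set)
    = boundary_area (ball (0::real^'n) 1) * (1 + \<epsilon> ^ (CARD('n) - 1))"
proof -
  define s where "s = real CARD('n) - 1"
  let ?H = "hausdorff_measure s :: (real^'n) set \<Rightarrow> ennreal"
  have s: "s \<ge> 0" "s = real (CARD('n) - 1)" using n by (auto simp: s_def)
  have "scaleR \<epsilon> ` sphere (0::real^'n) 1 = sphere 0 \<epsilon>"
  proof -
    have "x \<in> scaleR \<epsilon> ` sphere (0::real^'n) 1" if "norm x = \<epsilon>" for x :: "real^'n"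
      using that \<epsilon> by (intro image_eqI[of _ _ "(1/\<epsilon>) *\<^sub>R x"]) auto
    then show ?thesis using \<epsilon> by auto
  qed
  then have 1: "?H (sphere 0 \<epsilon>) = ennreal (\<epsilon> ^ (CARD('n) - 1)) * ?H (sphere 0 1)"
    using hausdorff_measure_scaleR[OF \<epsilon>(1) s(1), of "sphere (0::real^'n) 1"] \<epsilon> s n
    by (simp only: s(2) powr_realpow)
  have "?H (sphere 0 1 \<union> sphere 0 \<epsilon>) = ?H (sphere 0 1) + ?H (sphere 0 \<epsilon>)"
  proof (rule antisym[OF hausdorff_measure_Un_le hausdorff_measure_Un_ge])
    show "1 - \<epsilon> > 0" using \<epsilon> by simp
    fix x y :: "real^'n" assume "x \<in> sphere 0 1" "y \<in> sphere 0 \<epsilon>"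
    then show "dist x y \<ge> 1 - \<epsilon>" using norm_triangle_ineq2[of x y] by (simp add: dist_norm)
  qed
  also have "\<dots> = ?H (sphere 0 1) * (1 + ennreal (\<epsilon> ^ (CARD('n) - 1)))"
    by (simp add: 1 distrib_left mult.commute)
  also have "(1 + ennreal (\<epsilon> ^ (CARD('n) - 1))) = ennreal (1 + \<epsilon> ^ (CARD('n) - 1))"
    using \<epsilon> by (simp add: ennreal_plus)
  finally have "enn2real (?H (sphere 0 1 \<union> sphere 0 \<epsilon>)) = enn2real (?H (sphere 0 1)) * (1 + \<epsilon> ^ (CARD('n) - 1))"
    using \<epsilon> by (simp only: enn2real_mult enn2real_ennreal add_nonneg_nonneg zero_le_power less_imp_le zero_le_one)
  then show ?thesis
    by (simp add: boundary_area_def frontier_annulus[OF \<epsilon>] s_def)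
qed

section \<open>Harmonic polynomials\<close>

inductive hpoly :: "nat \<Rightarrow> (real^'n::finite \<Rightarrow> real) \<Rightarrow> bool" where
  const: "hpoly 0 (\<lambda>x. c)"
| step: "hpoly k p \<Longrightarrow> hpoly (Suc k) (\<lambda>x. x $ i * p x)"
| add: "hpoly k p \<Longrightarrow> hpoly k q \<Longrightarrow> hpoly k (\<lambda>x. p x + q x)"

lemma hpoly_smooth: "hpoly k p \<Longrightarrow> smooth p"
  by (induction rule: hpoly.induct) (auto intro: smooth_add smooth_mult)

lemma hpoly_zero: "hpoly k (\<lambda>x. 0)"
proof (induction k)
  case (Suc k)
  from hpoly.step[OF this, of undefined] show ?case by simp
qed (rule hpoly.const)

lemma hpoly_cmult: "hpoly k p \<Longrightarrow> hpoly k (\<lambda>x. c * p x)"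
proof (induction rule: hpoly.induct)
  case (const d) show ?case by (rule hpoly.const)
next
  case (step k p i)
  from hpoly.step[OF step(2), of i] show ?case by (simp add: mult.left_commute)
next
  case (add k p q)
  from hpoly.add[OF add(3,4)] show ?case by (simp add: distrib_left)
qed

lemma hpoly_diff: "hpoly k p \<Longrightarrow> hpoly k q \<Longrightarrow> hpoly k (\<lambda>x. p x - q x)"
  using hpoly.add[OF _ hpoly_cmult[of k q "-1"], of p] by simp

lemma hpoly_sum: "(\<And>i. i \<in> I \<Longrightarrow> hpoly k (f i)) \<Longrightarrow> hpoly k (\<lambda>x. \<Sum>i\<in>I. f i x)"
  by (induction I rule: infinite_finite_induct) (auto intro: hpoly_zero hpoly.add)

lemma hpoly_mult: "hpoly j p \<Longrightarrow> hpoly k q \<Longrightarrow> hpoly (j + k) (\<lambda>x. p x * q x)"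
proof (induction rule: hpoly.induct)
  case (const c) then show ?case by (simp add: hpoly_cmult)
next
  case (step j p i)
  from hpoly.step[OF step(2)[OF step(3)], of i] show ?case by (simp add: mult.assoc)
next
  case (add j p p')
  from hpoly.add[OF add(3)[OF add(5)] add(4)[OF add(5)]] show ?case by (simp add: distrib_right)
qed

lemma hpoly_nth: "hpoly 1 (\<lambda>x. x $ i)"
  using hpoly.step[OF hpoly.const[of 1], of i] by simp

lemma hpoly_inner: "hpoly 2 (\<lambda>x. x \<bullet> x)"
  unfolding inner_sum_squares using hpoly_mult[OF hpoly_nth hpoly_nth]
  by (intro hpoly_sum) (simp add: numeral_2_eq_2)

lemma hpoly_inner_power: "hpoly (2 * i) (\<lambda>x. (x \<bullet> x) ^ i)"
proof (induction i)
  case (Suc i)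
  from hpoly_mult[OF hpoly_inner this] show ?case by simp
qed (simp add: hpoly.const)

lemma hpoly_0_const: "hpoly k p \<Longrightarrow> k = 0 \<Longrightarrow> \<exists>c. p = (\<lambda>x. c)"
  by (induction rule: hpoly.induct) auto

lemma hpoly_pderiv: "hpoly k p \<Longrightarrow> k = Suc m \<Longrightarrow> hpoly m (pderiv i p)"
proof (induction arbitrary: m rule: hpoly.induct)
  case (step k p j)
  have p: "pderiv i (\<lambda>x. x $ j * p x) = (\<lambda>x. x $ j * pderiv i p x + (if i = j then 1 else 0) * p x)"
    using step(1) by (simp add: pderiv_mult hpoly_smooth pderiv_nth)
  have "hpoly k (\<lambda>x. x $ j * pderiv i p x)"
  proof (cases k)
    case 0
    with hpoly_0_const[OF step(1)] have "pderiv i p = (\<lambda>x. 0)" by auto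
    then show ?thesis by (simp add: hpoly_zero)
  next
    case (Suc l)
    then show ?thesis using hpoly.step[OF step(2)[OF Suc]] by simp
  qed
  with step hpoly.add[OF this hpoly_cmult[OF step(1)]] show ?case unfolding p by simp
next
  case (add k p q)
  then show ?case using hpoly.add[OF add(3)[OF add(5)] add(4)[OF add(5)]]
    by (simp add: pderiv_add hpoly_smooth)
qed auto

lemma hpoly_laplacian: "hpoly (k + 2) p \<Longrightarrow> hpoly k (laplacian p)"
  unfolding laplacian_def[abs_def] by (intro hpoly_sum hpoly_pderiv) auto

lemma hpoly_laplacian_zero: "hpoly k p \<Longrightarrow> k < 2 \<Longrightarrow> laplacian p x = 0"
proof -
  assume p: "hpoly k p" "k < 2"
  have "pderiv i (pderiv i p) = (\<lambda>x. 0)" for i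
  proof (cases k)
    case 0 then show ?thesis using hpoly_0_const[OF p(1)] by auto
  next
    case (Suc m)
    with p have "k = Suc 0" by simp
    then show ?thesis using hpoly_0_const[OF hpoly_pderiv[OF p(1)]] pderiv_const by metis
  qed
  then show ?thesis by (simp add: laplacian_def)
qed

lemma euler_hpoly: "hpoly k p \<Longrightarrow> euler p x = real k * p x"
proof (induction arbitrary: x rule: hpoly.induct)
  case (const c) show ?case by (simp add: euler_def)
next
  case (step k p i)
  have "euler (\<lambda>x. x $ i) x = x $ i" for x :: "real^'a"
    by (simp add: euler_def pderiv_nth if_distrib cong: if_cong)
  with step show ?case by (simp add: euler_mult hpoly_smooth algebra_simps)
next
  case (add k p q) then show ?case by (simp add: euler_add hpoly_smooth algebra_simps)
qed

lemma hpoly_scaleR: "hpoly k p \<Longrightarrow> p (c *\<^sub>R x) = c ^ k * p x"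
  by (induction rule: hpoly.induct) (auto simp: algebra_simps)

definition harm :: "nat \<Rightarrow> (real^'n::finite \<Rightarrow> real) \<Rightarrow> bool" where
  "harm k Y \<longleftrightarrow> hpoly k Y \<and> (\<forall>x. laplacian Y x = 0)"

lemma harm_hpoly: "harm k Y \<Longrightarrow> hpoly k Y" and harm_smooth: "harm k Y \<Longrightarrow> smooth Y"
  by (auto simp: harm_def hpoly_smooth)

lemma harm_cmult: "harm k Y \<Longrightarrow> harm k (\<lambda>x. c * Y x)"
  using harm_smooth[of k Y] by (simp add: harm_def hpoly_cmult laplacian_cmult)

lemma harm_add: "harm k Y \<Longrightarrow> harm k Z \<Longrightarrow> harm k (\<lambda>x. Y x + Z x)"
  using harm_smooth[of k Y] harm_smooth[of k Z] by (simp add: harm_def hpoly.add laplacian_add)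

lemma harm_diff: "harm k Y \<Longrightarrow> harm k Z \<Longrightarrow> harm k (\<lambda>x. Y x - Z x)"
  using harm_smooth[of k Y] harm_smooth[of k Z] by (simp add: harm_def hpoly_diff laplacian_diff)

lemma harm_zero: "harm k (\<lambda>x. 0)"
  by (simp add: harm_def hpoly_zero laplacian_def)

lemma harm_sum: "(\<And>i. i \<in> I \<Longrightarrow> harm k (f i)) \<Longrightarrow> harm k (\<lambda>x. \<Sum>i\<in>I. f i x)"
  by (induction I rule: infinite_finite_induct) (auto intro: harm_zero harm_add)

text \<open>The shape of Fischer's decomposition: sums of |x|^(2i) times harmonic polynomials of
  complementary degree.\<close>

inductive hdec :: "nat \<Rightarrow> (real^'n::finite \<Rightarrow> real) \<Rightarrow> bool" where
  base: "harm m h \<Longrightarrow> hdec (m + 2 * i) (\<lambda>x. (x \<bullet> x) ^ i * h x)"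
| add: "hdec k p \<Longrightarrow> hdec k q \<Longrightarrow> hdec k (\<lambda>x. p x + q x)"

lemma hdec_hpoly: "hdec k p \<Longrightarrow> hpoly k p"
proof (induction rule: hdec.induct)
  case (base m h i)
  from hpoly_mult[OF hpoly_inner_power harm_hpoly[OF base]] show ?case by (simp add: add.commute)
qed (rule hpoly.add)

lemma laplacian_inner_power_harm:
  fixes h :: "real^'n::finite \<Rightarrow> real"
  assumes "harm m h"
  shows "laplacian (\<lambda>x. (x \<bullet> x) ^ Suc i * h x) x
    = (real (Suc i) * (4 * real i + 2 * real CARD('n) + 4 * real m)) * ((x \<bullet> x) ^ i * h x)"
proof -
  have d1: "deriv (\<lambda>s::real. s ^ Suc i) = (\<lambda>s. real (Suc i) * s ^ i)"
    by (rule ext, rule DERIV_imp_deriv) (use DERIV_pow[of "Suc i"] in simp)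
  have d2: "s * deriv (\<lambda>s::real. real (Suc i) * s ^ i) s = real (Suc i) * real i * s ^ i" for s :: real
  proof -
    have "deriv (\<lambda>s::real. real (Suc i) * s ^ i) s = real (Suc i) * (real i * s ^ (i - Suc 0))"
      by (rule DERIV_imp_deriv, rule DERIV_cmult) (rule DERIV_pow)
    then show ?thesis by (cases i) auto
  qed
  have "cinf (\<lambda>s. s ^ Suc i)" by (intro cinf_power cinf_id)
  from laplacian_radial_mult[OF this harm_smooth[OF assms] euler_hpoly[OF harm_hpoly[OF assms]], of x]
  have "laplacian (\<lambda>x. (x \<bullet> x) ^ Suc i * h x) x =
    (4 * ((x \<bullet> x) * deriv (\<lambda>s. real (Suc i) * s ^ i) (x \<bullet> x))
     + (2 * real CARD('n) + 4 * real m) * (real (Suc i) * (x \<bullet> x) ^ i)) * h x"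
    using assms unfolding d1 by (simp add: harm_def mult.assoc)
  then show ?thesis unfolding d2 by (simp add: algebra_simps)
qed

text \<open>The Laplacian sends |x|^(2i+2) h to a positive multiple of |x|^(2i) h when h is harmonic
  and homogeneous, so a preimage of each summand is explicit.\<close>

lemma hdec_laplacian_surj: "hdec k p \<Longrightarrow> \<exists>q. hdec (k + 2) q \<and> laplacian q = p"
proof (induction rule: hdec.induct)
  case (base m h i)
  define c where "c = real (Suc i) * (4 * real i + 2 * real CARD('a) + 4 * real m)"
  have c: "c > 0" unfolding c_def by (intro mult_pos_pos add_nonneg_pos add_pos_nonneg) auto
  let ?q = "\<lambda>x. (x \<bullet> x) ^ Suc i * (1 / c * h x)"
  have h: "harm m (\<lambda>x. 1 / c * h x)" using base by (rule harm_cmult)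
  have "hdec (m + 2 * i + 2) ?q" using hdec.base[OF h, of "Suc i"] by simp
  moreover have "laplacian ?q = (\<lambda>x. (x \<bullet> x) ^ i * h x)"
    using c by (intro ext, subst laplacian_inner_power_harm[OF h, of i])
      (simp add: c_def[symmetric] del: of_nat_Suc)
  ultimately show ?case by blast
next
  case (add k p q)
  then obtain p' q' where *: "hdec (k + 2) p'" "laplacian p' = p" "hdec (k + 2) q'" "laplacian q' = q" by blast
  then have "laplacian (\<lambda>x. p' x + q' x) = (\<lambda>x. p x + q x)"
    by (simp add: laplacian_add hdec_hpoly[THEN hpoly_smooth])
  with * hdec.add show ?case by blast
qed

text \<open>Fischer's decomposition by induction in steps of two: the Laplacian of p is decomposable
  by induction, hence equals that of some decomposable q, and p - q is harmonic.\<close>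

lemma hpoly_hdec: "hpoly k p \<Longrightarrow> hdec k p"
proof (induction k arbitrary: p rule: less_induct)
  case (less k)
  have base0: "hdec k h" if "harm k h" for h :: "real^'a \<Rightarrow> real"
    using hdec.base[OF that, of 0] by simp
  show ?case
  proof (cases "k < 2")
    case True
    then show ?thesis using less.prems hpoly_laplacian_zero by (intro base0) (auto simp: harm_def)
  next
    case False
    then obtain j where j: "k = j + 2" by (metis add.commute le_Suc_ex not_less)
    then have "hdec j (laplacian p)" using less by (intro less.IH hpoly_laplacian) auto
    then obtain q where q: "hdec k q" "laplacian q = laplacian p" using hdec_laplacian_surj j by blast
    then have "harm k (\<lambda>x. p x - q x)"
      using less.prems hpoly_smooth[OF less.prems] hpoly_smooth[OF hdec_hpoly[OF q(1)]]
      by (simp add: harm_def hpoly_diff hdec_hpoly laplacian_diff)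
    from hdec.add[OF base0[OF this] q(1)] show ?thesis by simp
  qed
qed

text \<open>\<open>a\<close> and \<open>b\<close> are the real and imaginary parts of (x_i +
  sqrt(-1) x_j)^k. The two derivative relations carried through the induction are the Cauchy-Riemann
  equations, which make the next power harmonic.\<close>

lemma harm_nontrivial:
  assumes "CARD('n::finite) \<ge> 2"
  shows "\<exists>Y :: real^'n \<Rightarrow> real. harm k Y \<and> (\<exists>x. Y x \<noteq> 0)"
proof -
  have "\<not> (\<forall>a b :: 'n. a = b)"
    using assms card_le_Suc0_iff_eq[of "UNIV :: 'n set"] by auto
  then obtain i j :: 'n where ij: "i \<noteq> j" by blast
  have "\<exists>a b :: real^'n \<Rightarrow> real. harm k a \<and> harm k b \<and> pderiv i a = pderiv j b
     \<and> (\<forall>x. pderiv j a x = - pderiv i b x) \<and> a (axis i 1) = 1"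
  proof (induction k)
    case 0
    show ?case
      by (rule exI[of _ "\<lambda>x. 1"], rule exI[of _ "\<lambda>x. 0"]) (auto simp: harm_def hpoly.const laplacian_def)
  next
    case (Suc k)
    then obtain a b :: "real^'n \<Rightarrow> real" where ab: "harm k a" "harm k b" "pderiv i a = pderiv j b"
      "\<And>x. pderiv j a x = - pderiv i b x" "a (axis i 1) = 1" by blast
    note sm = ab(1,2)[THEN harm_smooth]
    have lap: "laplacian (\<lambda>x. x $ l * f x) x = 2 * pderiv l f x + x $ l * laplacian f x" if f: "smooth f" for f l and x :: "real^'n"
    proof -
      have "pderiv m (\<lambda>x. x $ l * f x) = (\<lambda>x. x $ l * pderiv m f x + (if m = l then 1 else 0) * f x)" for m
        using f by (simp add: pderiv_mult pderiv_nth)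
      then have "pderiv m (pderiv m (\<lambda>x. x $ l * f x)) x
          = x $ l * pderiv m (pderiv m f) x + 2 * (if m = l then pderiv m f x else 0)" for m
        using f by (simp add: pderiv_add pderiv_mult pderiv_cmult pderiv_nth smooth_pderiv smooth_mult)
      then show ?thesis
        by (simp add: laplacian_def sum.distrib sum_distrib_left[symmetric])
    qed
    \<comment> \<open>Multiplication of a + sqrt(-1) b by x_i + sqrt(-1) x_j.\<close>
    define a' where "a' x = x $ i * a x - x $ j * b x" for x
    define b' where "b' x = x $ i * b x + x $ j * a x" for x
    have "hpoly (Suc k) a'" "hpoly (Suc k) b'"
      using ab unfolding a'_def[abs_def] b'_def[abs_def] harm_def
      by (auto intro!: hpoly_diff hpoly.add hpoly.step)
    moreover have "laplacian a' x = 0" "laplacian b' x = 0" for x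
      using ab sm unfolding a'_def[abs_def] b'_def[abs_def]
      by (simp_all add: laplacian_diff laplacian_add smooth_mult lap harm_def)
    moreover have "pderiv i a' = pderiv j b'" "pderiv j a' x = - pderiv i b' x" for x
      using ab sm ij unfolding a'_def[abs_def] b'_def[abs_def]
      by (simp_all add: pderiv_diff pderiv_add pderiv_mult pderiv_nth smooth_mult algebra_simps)
    moreover have "a' (axis i 1) = 1" using ab(5) ij by (simp add: a'_def axis_def)
    ultimately show ?case unfolding harm_def by blast
  qed
  then show ?thesis by (metis zero_neq_one)
qed

section \<open>Spherical means\<close>

text \<open>Supported in 1 < |x|^2 < 4: away from the origin, where radial projection is singular,
  and with compact support, so that integration by parts leaves no boundary terms.\<close>

definition shell_weight :: "real \<Rightarrow> real" where
  "shell_weight s = bump (s - 1) * bump (4 - s)"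

lemma cinf_shell_weight: "cinf shell_weight"
  unfolding shell_weight_def[abs_def]
  by (intro cinf_mult cinf_compose[OF cinf_bump] cinf_diff cinf_const cinf_id)

lemma shell_weight_nonneg: "shell_weight s \<ge> 0"
  by (simp add: shell_weight_def bump_nonneg)

lemma shell_weight_support: "shell_weight s \<noteq> 0 \<Longrightarrow> 1 < s \<and> s < 4"
  unfolding shell_weight_def using bump_zero[of "s - 1"] bump_zero[of "4 - s"] by force

text \<open>A globally smooth substitute for 1/sqrt(s), exact for s >= 1 and hence wherever
  \<open>shell_weight\<close> is nonzero. With it \<open>sphere_proj\<close> is smooth on the whole
  space and is the true radial projection on the support of the weight.\<close>

definition inv_sqrt_ext :: "real \<Rightarrow> real" where
  "inv_sqrt_ext = (SOME g. cinf g \<and> (\<forall>s\<ge>1. g s = 1 / sqrt s))"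

lemma inv_sqrt_ext: "cinf inv_sqrt_ext" "s \<ge> 1 \<Longrightarrow> inv_sqrt_ext s = 1 / sqrt s"
proof -
  obtain \<tau> where \<tau>: "cinf \<tau>" "\<And>s. \<tau> s > 0" "\<And>s. s \<ge> 1 \<Longrightarrow> \<tau> s = s"
    using cinf_positive_extension[of 1] by auto
  have "cinf (\<lambda>s. \<tau> s powr (- (1/2)))" using \<tau> by (intro cinf_powr)
  moreover have "\<tau> s powr (- (1/2)) = 1 / sqrt s" if "s \<ge> 1" for s
    unfolding \<tau>(3)[OF that] powr_minus using powr_half_sqrt[of s] that by (simp add: inverse_eq_divide)
  ultimately have "\<exists>g. cinf g \<and> (\<forall>s\<ge>1. g s = 1 / sqrt s)"
    by (intro exI[of _ "\<lambda>s. \<tau> s powr (- (1/2))"]) simp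
  from someI_ex[OF this] show "cinf inv_sqrt_ext" "s \<ge> 1 \<Longrightarrow> inv_sqrt_ext s = 1 / sqrt s"
    unfolding inv_sqrt_ext_def by auto
qed

definition sphere_proj :: "real \<Rightarrow> real^'n::finite \<Rightarrow> real^'n" where
  "sphere_proj r x = (r * inv_sqrt_ext (x \<bullet> x)) *\<^sub>R x"

text \<open>The shell fits into the cube of half-side 2; the extra unit leaves room for translations
  of length at most 1 in \<open>integral_pderiv_compact_support\<close>.\<close>

definition shell_box :: "(real^'n::finite) set" where
  "shell_box = cbox (\<chi> i. -3) (\<chi> i. 3)"

text \<open>The spherical mean without surface measure: the values of the function on the sphere of radius $r$
  are spread over the shell $1 \le |x| \le 2$ and integrated against a smooth radial weight.\<close>

definition smean :: "(real^'n::finite \<Rightarrow> real) \<Rightarrow> real \<Rightarrow> real" where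
  "smean v r = integral shell_box (\<lambda>x. shell_weight (x \<bullet> x) * v (sphere_proj r x))"

lemma norm_sphere_proj: "x \<bullet> x \<ge> 1 \<Longrightarrow> norm (sphere_proj 1 x) = 1"
  by (cases "x = 0") (auto simp: sphere_proj_def inv_sqrt_ext norm_eq_sqrt_inner[symmetric])

lemma sphere_proj_scale: "sphere_proj r x = r *\<^sub>R sphere_proj 1 x"
  by (simp add: sphere_proj_def)

lemma continuous_on_sphere_proj: "continuous_on S (\<lambda>z. sphere_proj (fst z) (snd z))"
proof -
  have "continuous_on S (\<lambda>z. inv_sqrt_ext (snd z \<bullet> snd z))"
    by (rule continuous_on_compose2[OF cinf_continuous_on[OF inv_sqrt_ext(1), of UNIV]])
       (auto intro!: continuous_intros)
  then show ?thesis unfolding sphere_proj_def by (intro continuous_intros)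
qed

lemma continuous_on_shell:
  assumes "continuous_on UNIV v"
  shows "continuous_on S (\<lambda>z. shell_weight (snd z \<bullet> snd z) * v (sphere_proj (fst z) (snd z)))"
proof (intro continuous_on_mult)
  show "continuous_on S (\<lambda>z. shell_weight (snd z \<bullet> snd z))"
    by (rule continuous_on_compose2[OF cinf_continuous_on[OF cinf_shell_weight, of UNIV]])
       (auto intro!: continuous_intros)
  show "continuous_on S (\<lambda>z. v (sphere_proj (fst z) (snd z)))"
    by (rule continuous_on_compose2[OF assms continuous_on_sphere_proj]) auto
qed

lemma continuous_on_shell_x:
  assumes "continuous_on UNIV v"
  shows "continuous_on S (\<lambda>x. shell_weight (x \<bullet> x) * v (sphere_proj r x))"
proof -
  have "continuous_on S (\<lambda>x. (r, x))" by (intro continuous_intros)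
  from continuous_on_compose2[OF continuous_on_shell[OF assms, of UNIV] this] show ?thesis by simp
qed

lemma integrable_shell:
  "continuous_on UNIV v \<Longrightarrow> (\<lambda>x. shell_weight (x \<bullet> x) * v (sphere_proj r x)) integrable_on shell_box"
  unfolding shell_box_def by (intro integrable_continuous continuous_on_shell_x)

lemma smean_add: "continuous_on UNIV v \<Longrightarrow> continuous_on UNIV w \<Longrightarrow> smean (\<lambda>x. v x + w x) r = smean v r + smean w r"
  unfolding smean_def by (simp add: distrib_left integral_add integrable_shell)

lemma smean_cmult: "smean (\<lambda>x. c * v x) r = c * smean v r"
  unfolding smean_def by (simp add: mult.left_commute flip: integral_mult_right)

lemma smean_diff: "continuous_on UNIV v \<Longrightarrow> continuous_on UNIV w \<Longrightarrow> smean (\<lambda>x. v x - w x) r = smean v r - smean w r"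
  unfolding smean_def by (simp add: right_diff_distrib integral_diff integrable_shell)

lemma smean_zero: "smean (\<lambda>x. 0) r = 0"
  by (simp add: smean_def)

lemma smean_sum: "(\<And>i. i \<in> I \<Longrightarrow> continuous_on UNIV (f i)) \<Longrightarrow> smean (\<lambda>x. \<Sum>i\<in>I. f i x) r = (\<Sum>i\<in>I. smean (f i) r)"
  by (induction I rule: infinite_finite_induct) (auto simp: smean_zero smean_add continuous_on_sum)

lemma smean_cong:
  assumes "\<And>\<theta>. norm \<theta> = 1 \<Longrightarrow> v (r *\<^sub>R \<theta>) = w (r *\<^sub>R \<theta>)"
  shows "smean v r = smean w r"
  unfolding smean_def
proof (rule integral_cong)
  fix x :: "real^'a"
  show "shell_weight (x \<bullet> x) * v (sphere_proj r x) = shell_weight (x \<bullet> x) * w (sphere_proj r x)"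
  proof (cases "shell_weight (x \<bullet> x) = 0")
    case False
    then have "norm (sphere_proj 1 x) = 1" using norm_sphere_proj[of x] shell_weight_support[of "x \<bullet> x"] by simp
    then show ?thesis using assms sphere_proj_scale[of r x] by simp
  qed simp
qed

lemma smean_scale: "smean (\<lambda>x. v (r *\<^sub>R x)) 1 = smean v r"
  by (simp add: smean_def sphere_proj_scale[of r])

lemma smean_abs_le:
  fixes v :: "real^'n::finite \<Rightarrow> real"
  assumes v: "continuous_on UNIV v" and B: "\<And>\<theta>. norm \<theta> = 1 \<Longrightarrow> \<bar>v (r *\<^sub>R \<theta>)\<bar> \<le> B"
  shows "\<bar>smean v r\<bar> \<le> B * smean (\<lambda>x::real^'n. 1) r"
proof -
  have b: "\<bar>shell_weight (x \<bullet> x) * v (sphere_proj r x)\<bar> \<le> shell_weight (x \<bullet> x) * B" for x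
  proof (cases "shell_weight (x \<bullet> x) = 0")
    case False
    then have "norm (sphere_proj 1 x) = 1" using norm_sphere_proj[of x] shell_weight_support[of "x \<bullet> x"] by simp
    then show ?thesis using B sphere_proj_scale[of r x] shell_weight_nonneg[of "x \<bullet> x"]
      by (simp add: abs_mult mult_left_mono)
  qed simp
  have "(\<lambda>x. shell_weight (x \<bullet> x) * B) integrable_on (shell_box :: (real^'n) set)"
    using integrable_shell[of "\<lambda>x. B"] by simp
  from Henstock_Kurzweil_Integration.integral_norm_bound_integral[OF integrable_shell[OF v, of r] this] b
  have "norm (smean v r) \<le> integral shell_box (\<lambda>x :: real^'n. shell_weight (x \<bullet> x) * B)"
    by (simp add: smean_def)
  also have "\<dots> = smean (\<lambda>x::real^'n. B * 1) r" by (simp add: smean_def)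
  finally show ?thesis by (simp only: smean_cmult real_norm_def)
qed

lemma smean_square_eq_0:
  fixes w :: "real^'n::finite \<Rightarrow> real"
  assumes w: "continuous_on UNIV w" and z: "smean (\<lambda>x. w x * w x) 1 = 0" and \<theta>: "norm \<theta> = 1"
  shows "w \<theta> = 0"
proof -
  let ?f = "\<lambda>x. shell_weight (x \<bullet> x) * (w (sphere_proj 1 x) * w (sphere_proj 1 x))"
  have "\<forall>x\<in>cbox (\<chi> i. -3) (\<chi> i. 3). ?f x = 0"
  proof (subst integral_cbox_eq_0_iff[symmetric])
    show "continuous_on (cbox (\<chi> i. -3) (\<chi> i. 3)) ?f"
      by (rule continuous_on_shell_x) (intro continuous_on_mult w)
    show "box (\<chi> i. -3) (\<chi> i. 3) \<noteq> ({} :: (real^'n) set)"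
      by (simp add: interval_ne_empty_cart)
    show "?f x \<ge> 0" for x by (intro mult_nonneg_nonneg[OF shell_weight_nonneg] zero_le_square)
    show "integral (cbox (\<chi> i. -3) (\<chi> i. 3)) ?f = 0" using z by (simp add: smean_def shell_box_def)
  qed
  \<comment> \<open>The point of radius 3/2 lies in the open shell, where the weight is positive,
    and projects to \<theta>.\<close>
  moreover have "(3/2) *\<^sub>R \<theta> \<in> cbox (\<chi> i. -3) (\<chi> i. 3)"
  proof -
    have "3/2 * \<theta> $ i \<le> 3 \<and> -3 \<le> 3/2 * \<theta> $ i" for i
      using component_le_norm_cart[of \<theta> i] \<theta> by linarith
    then show ?thesis unfolding mem_box_cart by simp
  qed
  moreover have t: "((3/2) *\<^sub>R \<theta>) \<bullet> ((3/2) *\<^sub>R \<theta>) = 9/4"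
    using \<theta> by (simp add: norm_eq_sqrt_inner)
  moreover have "sqrt (9/4) = 3/2" by (rule real_sqrt_unique) (auto simp: power2_eq_square)
  moreover have "sphere_proj 1 ((3/2) *\<^sub>R \<theta>) = \<theta>"
    using inv_sqrt_ext(2)[of "9/4"] \<open>sqrt (9/4) = 3/2\<close> unfolding sphere_proj_def t by simp
  ultimately have "shell_weight (9/4) * (w \<theta> * w \<theta>) = 0" by metis
  moreover have "shell_weight (9/4) > 0" by (simp add: shell_weight_def bump_pos)
  ultimately show ?thesis by simp
qed

lemma smooth_sphere_proj: "smooth (\<lambda>x. sphere_proj r x $ j)"
  unfolding sphere_proj_def
  by (simp, intro smooth_mult smooth_const smooth_radial[OF inv_sqrt_ext(1)] smooth_nth)

lemma smooth_compose_sphere_proj: "smooth v \<Longrightarrow> smooth (\<lambda>x. v (sphere_proj r x))"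
  by (rule smooth_vec_compose) (auto intro: smooth_sphere_proj)

text \<open>Rotations commute with radial projection. In coordinates, the derivative of the
  projection is a multiple of the identity plus a multiple of x_m x_l, and the latter cancels in the
  antisymmetric expression.\<close>

lemma rotf_sphere_proj:
  assumes "smooth v"
  shows "rotf i j (\<lambda>x. v (sphere_proj r x)) x = rotf i j v (sphere_proj r x)"
proof -
  let ?k = "\<lambda>x. r * inv_sqrt_ext (x \<bullet> x)"
  have k: "pderiv m (\<lambda>x. sphere_proj r x $ l) x = (if m = l then ?k x else 0) + 2 * r * deriv inv_sqrt_ext (x \<bullet> x) * x $ m * x $ l" for m l
  proof -
    have "(\<lambda>x. sphere_proj r x $ l) = (\<lambda>x. r * (inv_sqrt_ext (x \<bullet> x) * x $ l))"
      by (auto simp: sphere_proj_def)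
    then show ?thesis
      using pderiv_cmult[OF smooth_mult[OF smooth_radial[OF inv_sqrt_ext(1)] smooth_nth], of m r l]
        pderiv_mult[OF smooth_radial[OF inv_sqrt_ext(1)] smooth_nth, of m l]
      by (simp add: pderiv_radial[OF inv_sqrt_ext(1)] pderiv_nth algebra_simps)
  qed
  have pd: "pderiv m (\<lambda>x. v (sphere_proj r x)) x = (\<Sum>l\<in>UNIV. pderiv m (\<lambda>x. sphere_proj r x $ l) x * pderiv l v (sphere_proj r x))" for m
    by (rule pderiv_vec_compose_at) (auto intro: smooth_differentiable assms smooth_sphere_proj)
  have p: "pderiv m (\<lambda>x. v (sphere_proj r x)) x = ?k x * pderiv m v (sphere_proj r x)
     + x $ m * (\<Sum>l\<in>UNIV. 2 * r * deriv inv_sqrt_ext (x \<bullet> x) * x $ l * pderiv l v (sphere_proj r x))" for m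
  proof -
    have "(\<Sum>l\<in>UNIV. ((if m = l then ?k x else 0) + 2 * r * deriv inv_sqrt_ext (x \<bullet> x) * x $ m * x $ l) * P l)
      = (\<Sum>l\<in>UNIV. if m = l then ?k x * P l else 0) + x $ m * (\<Sum>l\<in>UNIV. 2 * r * deriv inv_sqrt_ext (x \<bullet> x) * x $ l * P l)" for P
      unfolding sum_distrib_left sum.distrib[symmetric] by (rule sum.cong) (auto simp: algebra_simps)
    then show ?thesis unfolding pd k by simp
  qed
  show ?thesis unfolding rotf_def p by (simp add: sphere_proj_def algebra_simps)
qed

text \<open>For |t| <= 1 the translate of G by t along the j-th axis keeps its support inside the
  box, so its integral does not depend on t. Differentiating under the integral at t = 0 gives the
  claim.\<close>

lemma integral_pderiv_compact_support:
  fixes G :: "real^'n::finite \<Rightarrow> real"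
  assumes G: "smooth G" and supp: "\<And>x. norm x \<ge> 2 \<Longrightarrow> G x = 0"
  shows "integral shell_box (pderiv j G) = 0"
proof -
  let ?e = "axis j 1 :: real^'n"
  let ?a = "(\<chi> i. -2) :: real^'n" and ?b = "(\<chi> i. 2) :: real^'n"
  define I where "I = integral (cbox ?a ?b) G"
  have G0: "G x = 0" if "x \<notin> cbox ?a ?b" for x
  proof -
    obtain i where "\<not> (- 2 \<le> x $ i \<and> x $ i \<le> 2)" using \<open>x \<notin> _\<close> by (auto simp: mem_box_cart)
    then have "norm x \<ge> 2" using component_le_norm_cart[of x i] by linarith
    then show ?thesis by (rule supp)
  qed
  have hI: "(G has_integral I) (cbox ?a ?b)"
    unfolding I_def by (intro integrable_integral integrable_continuous smooth_continuous G)
  have const: "integral shell_box (\<lambda>x. G (x + t *\<^sub>R ?e)) = I" if t: "t \<in> {-1..1}" for t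
  proof -
    have "((\<lambda>x. G (x + t *\<^sub>R ?e)) has_integral I) (cbox (?a - t *\<^sub>R ?e) (?b - t *\<^sub>R ?e))"
      using hI by (rule has_integral_shift_cbox)
    then have "((\<lambda>x. G (x + t *\<^sub>R ?e)) has_integral I) shell_box"
    proof (rule has_integral_on_superset)
      fix x assume "x \<notin> cbox (?a - t *\<^sub>R ?e) (?b - t *\<^sub>R ?e)"
      then have "x + t *\<^sub>R ?e \<notin> cbox ?a ?b" by (auto simp: mem_box_cart algebra_simps)
      then show "G (x + t *\<^sub>R ?e) = 0" by (rule G0)
    next
      show "cbox (?a - t *\<^sub>R ?e) (?b - t *\<^sub>R ?e) \<subseteq> shell_box"
        unfolding shell_box_def
      proof
        fix x assume x: "x \<in> cbox (?a - t *\<^sub>R ?e) (?b - t *\<^sub>R ?e)"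
        have "-3 \<le> x $ i \<and> x $ i \<le> 3" for i
        proof -
          have "-2 - t * ?e $ i \<le> x $ i" "x $ i \<le> 2 - t * ?e $ i"
            using x by (auto simp: mem_box_cart)
          moreover have "\<bar>t * ?e $ i\<bar> \<le> 1" using t by (auto simp: axis_def)
          ultimately show ?thesis by linarith
        qed
        then show "x \<in> cbox (\<chi> i. -3) (\<chi> i. 3)" by (simp add: mem_box_cart)
      qed
    qed
    then show ?thesis by (rule integral_unique)
  qed
  have "((\<lambda>t. integral (cbox (\<chi> i. -3) (\<chi> i. 3)) (\<lambda>x. G (x + t *\<^sub>R ?e))) has_field_derivative
     integral (cbox (\<chi> i. -3) (\<chi> i. 3)) (\<lambda>x. pderiv j G (x + 0 *\<^sub>R ?e))) (at 0 within {-1..1})"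
  proof (rule leibniz_rule_field_derivative)
    fix t :: real and x :: "real^'n"
    have "((\<lambda>t. G (x + t *\<^sub>R ?e)) has_derivative (\<lambda>h. \<Sum>i\<in>UNIV. (h *\<^sub>R ?e) $ i * pderiv i G (x + t *\<^sub>R ?e))) (at t within {-1..1})"
      by (rule has_derivative_compose[of "\<lambda>t. x + t *\<^sub>R ?e" _ _ _ G, OF _ has_derivative_pderiv[OF smooth_differentiable[OF G]]])
         (auto intro!: derivative_eq_intros)
    moreover have "(\<Sum>i\<in>UNIV. (h *\<^sub>R ?e) $ i * pderiv i G (x + t *\<^sub>R ?e)) = pderiv j G (x + t *\<^sub>R ?e) * h" for h
      by (simp add: axis_def if_distrib if_distribR cong: if_cong)
    ultimately show "((\<lambda>t. G (x + t *\<^sub>R ?e)) has_real_derivative pderiv j G (x + t *\<^sub>R ?e)) (at t within {-1..1})"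
      by (simp add: has_field_derivative_def)
  next
    fix t :: real
    show "(\<lambda>x. G (x + t *\<^sub>R ?e)) integrable_on cbox (\<chi> i. -3) (\<chi> i. 3)"
      by (intro integrable_continuous continuous_on_compose2[OF smooth_continuous[OF G, of UNIV]] continuous_intros) auto
  next
    show "continuous_on ({-1..1} \<times> cbox (\<chi> i. -3) (\<chi> i. 3)) (\<lambda>(t, x). pderiv j G (x + t *\<^sub>R ?e))"
      unfolding split_beta
      by (intro continuous_on_compose2[OF smooth_continuous[OF smooth_pderiv[OF G], of UNIV]] continuous_intros) auto
  qed auto
  then have "((\<lambda>t. integral shell_box (\<lambda>x. G (x + t *\<^sub>R ?e))) has_field_derivative integral shell_box (pderiv j G)) (at 0 within {-1..1})"
    by (simp add: shell_box_def)
  then have "((\<lambda>t. integral shell_box (\<lambda>x. G (x + t *\<^sub>R ?e))) has_field_derivative integral shell_box (pderiv j G)) (at 0)"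
    by (subst (asm) at_within_interior) auto
  then have "((\<lambda>t. I) has_field_derivative integral shell_box (pderiv j G)) (at 0)"
    by (rule has_field_derivative_transform_within_open[where S="{-1<..<1}"]) (auto intro: const)
  then show ?thesis using DERIV_unique DERIV_const by blast
qed

text \<open>Rotation fields are divergence free and annihilate the radial weight, so the integrand
  is a combination of partial derivatives of compactly supported functions. This is the only
  integration by parts on spheres that is used.\<close>

lemma smean_rotf:
  assumes v: "smooth v"
  shows "smean (rotf i j v) r = 0"
proof -
  define G where "G x = shell_weight (x \<bullet> x) * v (sphere_proj r x)" for x
  have smw: "smooth (\<lambda>x. shell_weight (x \<bullet> x))" by (rule smooth_radial[OF cinf_shell_weight])
  have G: "smooth G" unfolding G_def[abs_def]
    by (intro smooth_mult smw smooth_compose_sphere_proj v)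
  have zero: "x $ m * G x = 0" if "norm x \<ge> 2" for x m
  proof -
    have "x \<bullet> x \<ge> 4" using that power_mono[of 2 "norm x" 2] by (simp add: power2_norm_eq_inner)
    then have "shell_weight (x \<bullet> x) = 0" using shell_weight_support[of "x \<bullet> x"] by linarith
    then show ?thesis by (simp add: G_def)
  qed
  have "rotf i j (\<lambda>x. shell_weight (x \<bullet> x)) x = 0" for x
    by (simp add: rotf_def pderiv_radial[OF cinf_shell_weight])
  then have "rotf i j G x = shell_weight (x \<bullet> x) * rotf i j v (sphere_proj r x)" for x
    unfolding G_def[abs_def]
    by (simp add: rotf_mult[OF smw smooth_compose_sphere_proj[OF v]] rotf_sphere_proj[OF v])
  moreover have "rotf i j G x = pderiv j (\<lambda>x. x $ i * G x) x - pderiv i (\<lambda>x. x $ j * G x) x" for x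
    by (simp add: rotf_def pderiv_mult G pderiv_nth)
  ultimately have "smean (rotf i j v) r = integral shell_box (\<lambda>x. pderiv j (\<lambda>x. x $ i * G x) x - pderiv i (\<lambda>x. x $ j * G x) x)"
    unfolding smean_def by (metis (no_types, lifting))
  also have "\<dots> = integral shell_box (pderiv j (\<lambda>x. x $ i * G x)) - integral shell_box (pderiv i (\<lambda>x. x $ j * G x))"
    unfolding shell_box_def
    by (intro integral_diff integrable_continuous smooth_continuous smooth_pderiv smooth_mult smooth_nth G)
  also have "\<dots> = 0"
    using zero by (simp add: integral_pderiv_compact_support smooth_mult G)
  finally show ?thesis .
qed

lemma smean_has_derivative:
  fixes v :: "real^'n::finite \<Rightarrow> real"
  assumes v: "smooth v" and r: "r \<noteq> 0"
  shows "(smean v has_real_derivative smean (euler v) r / r) (at r)"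
proof -
  let ?B = "cbox (\<chi> i. -3) (\<chi> i. 3) :: (real^'n) set"
  define D where "D r x = shell_weight (x \<bullet> x) * (\<Sum>i\<in>UNIV. sphere_proj 1 x $ i * pderiv i v (sphere_proj r x))" for r x
  have "((\<lambda>r. integral ?B (\<lambda>x. shell_weight (x \<bullet> x) * v (sphere_proj r x))) has_field_derivative integral ?B (D r)) (at r within UNIV)"
  proof (rule leibniz_rule_field_derivative)
    fix r :: real and x :: "real^'n"
    define y where "y = sphere_proj 1 x"
    have y: "sphere_proj r x = r *\<^sub>R y" for r
      by (simp add: y_def sphere_proj_def)
    have "((\<lambda>r. v (r *\<^sub>R y)) has_derivative (\<lambda>h. \<Sum>i\<in>UNIV. (h *\<^sub>R y) $ i * pderiv i v (r *\<^sub>R y))) (at r)"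
      by (rule has_derivative_compose[of "\<lambda>r. r *\<^sub>R y" _ _ _ v, OF _ has_derivative_pderiv[OF smooth_differentiable[OF v]]])
         (auto intro!: derivative_eq_intros)
    moreover have "(\<Sum>i\<in>UNIV. (h *\<^sub>R y) $ i * pderiv i v (r *\<^sub>R y))
       = (\<Sum>i\<in>UNIV. y $ i * pderiv i v (r *\<^sub>R y)) * h" for h
      unfolding sum_distrib_right by (rule sum.cong) auto
    ultimately have "((\<lambda>r. v (sphere_proj r x)) has_real_derivative
       (\<Sum>i\<in>UNIV. sphere_proj 1 x $ i * pderiv i v (sphere_proj r x))) (at r)"
      unfolding has_field_derivative_def y_def[symmetric] y by simp
    then show "((\<lambda>r. shell_weight (x \<bullet> x) * v (sphere_proj r x)) has_real_derivative D r x) (at r within UNIV)"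
      unfolding D_def by (intro DERIV_cmult)
  next
    show "(\<lambda>x. shell_weight (x \<bullet> x) * v (sphere_proj r x)) integrable_on ?B" for r
      using integrable_shell[OF smooth_continuous[OF v], of r] by (simp add: shell_box_def)
  next
    have "continuous_on (UNIV \<times> ?B) (\<lambda>z. shell_weight (snd z \<bullet> snd z) * (\<Sum>i\<in>UNIV. sphere_proj 1 (snd z) $ i * pderiv i v (sphere_proj (fst z) (snd z))))"
    proof (intro continuous_on_mult continuous_on_sum)
      show "continuous_on (UNIV \<times> ?B) (\<lambda>z. shell_weight (snd z \<bullet> snd z))"
        by (rule continuous_on_compose2[OF cinf_continuous_on[OF cinf_shell_weight, of UNIV]])
           (auto intro!: continuous_intros)
      show "continuous_on (UNIV \<times> ?B) (\<lambda>z. sphere_proj 1 (snd z) $ i)" for i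
        by (rule continuous_on_compose2[OF smooth_continuous[OF smooth_sphere_proj, of UNIV]])
           (auto intro!: continuous_intros)
      show "continuous_on (UNIV \<times> ?B) (\<lambda>z. pderiv i v (sphere_proj (fst z) (snd z)))" for i
        by (rule continuous_on_compose2[OF smooth_continuous[OF smooth_pderiv[OF v], of UNIV] continuous_on_sphere_proj]) auto
    qed
    then show "continuous_on (UNIV \<times> ?B) (\<lambda>(r, x). D r x)"
      by (simp add: D_def split_beta)
  qed auto
  moreover have "integral ?B (D r) = smean (euler v) r / r"
  proof -
    have "shell_weight (x \<bullet> x) * euler v (sphere_proj r x) = r * D r x" for x
      by (simp add: D_def euler_def sphere_proj_scale[of r x] sum_distrib_left ac_simps)
    then have "smean (euler v) r = r * integral ?B (D r)"
      by (simp add: smean_def shell_box_def flip: integral_mult_right)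
    then show ?thesis using r by simp
  qed
  ultimately show ?thesis by (simp add: smean_def[abs_def] shell_box_def)
qed

section \<open>Expansion in spherical harmonics\<close>

text \<open>Gaussian elimination: more unknowns than homogeneous equations. It does the work of
  dimension arguments for spaces of functions throughout.\<close>

lemma nontrivial_relation:
  fixes a :: "'u \<Rightarrow> 'e \<Rightarrow> real"
  assumes "finite E" "finite F" "card E < card F"
  shows "\<exists>c. (\<exists>u\<in>F. c u \<noteq> 0) \<and> (\<forall>e\<in>E. (\<Sum>u\<in>F. c u * a u e) = 0)"
  using assms
proof (induction E arbitrary: F a rule: finite_induct)
  case empty
  then have "F \<noteq> {}" by auto
  then show ?case by (intro exI[of _ "\<lambda>_. 1"]) auto
next
  case (insert e E)
  show ?case
  proof (cases "\<forall>u\<in>F. a u e = 0")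
    case True
    have "card E < card F" using insert by simp
    from insert.IH[OF insert.prems(1) this, of a] True show ?thesis by (auto intro!: sum.neutral)
  next
    case False
    then obtain u0 where u0: "u0 \<in> F" "a u0 e \<noteq> 0" by blast
    define F' where "F' = F - {u0}"
    have F': "finite F'" "card E < card F'" "F = insert u0 F'" "u0 \<notin> F'"
      using insert u0 by (auto simp: F'_def)
    \<comment> \<open>The equation e is used to eliminate the unknown \<open>u0\<close>; its value
      is restored in \<open>c'\<close>.\<close>
    define a' where "a' u f = a u f - a u e / a u0 e * a u0 f" for u f
    from insert.IH[OF F'(1,2), of a'] obtain c where
      c: "\<exists>u\<in>F'. c u \<noteq> 0" "\<And>f. f \<in> E \<Longrightarrow> (\<Sum>u\<in>F'. c u * a' u f) = 0" by blast
    define c' where "c' u = (if u = u0 then - (\<Sum>u\<in>F'. c u * a u e) / a u0 e else c u)" for u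
    have s: "(\<Sum>u\<in>F. c' u * a u f) = - (\<Sum>u\<in>F'. c u * a u e) / a u0 e * a u0 f + (\<Sum>u\<in>F'. c u * a u f)" for f
    proof -
      have "(\<Sum>u\<in>F'. c' u * a u f) = (\<Sum>u\<in>F'. c u * a u f)"
        using F' by (intro sum.cong) (auto simp: c'_def)
      then show ?thesis using F' by (simp add: c'_def)
    qed
    have "(\<Sum>u\<in>F. c' u * a u f) = 0" if "f \<in> insert e E" for f
    proof (cases "f = e")
      case True then show ?thesis using u0 by (simp add: s)
    next
      case False
      then have "0 = (\<Sum>u\<in>F'. c u * a' u f)" using c(2) that by auto
      also have "\<dots> = (\<Sum>u\<in>F'. c u * a u f) - (\<Sum>u\<in>F'. c u * a u e * (a u0 f / a u0 e))"
        by (simp add: a'_def right_diff_distrib sum_subtractf mult.assoc)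
      also have "\<dots> = (\<Sum>u\<in>F. c' u * a u f)"
        unfolding s sum_distrib_right[symmetric] by simp
      finally show ?thesis by simp
    qed
    moreover have "\<exists>u\<in>F. c' u \<noteq> 0" using c(1) F' by (auto simp: c'_def)
    ultimately show ?thesis by blast
  qed
qed

text \<open>The L2 inner product on the unit sphere up to a fixed positive factor, because the
  weight of \<open>smean\<close> is radial.\<close>

definition ip :: "(real^'n::finite \<Rightarrow> real) \<Rightarrow> (real^'n \<Rightarrow> real) \<Rightarrow> real" where
  "ip f g = smean (\<lambda>x. f x * g x) 1"

abbreviation cont :: "(real^'n::finite \<Rightarrow> real) \<Rightarrow> bool" where
  "cont f \<equiv> continuous_on UNIV f"

lemma ip_commute: "ip f g = ip g f"
  by (simp add: ip_def mult.commute)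

lemma ip_add_left: "cont f \<Longrightarrow> cont g \<Longrightarrow> cont h \<Longrightarrow> ip (\<lambda>x. f x + g x) h = ip f h + ip g h"
  unfolding ip_def by (simp add: distrib_right smean_add continuous_on_mult)

lemma ip_diff_left: "cont f \<Longrightarrow> cont g \<Longrightarrow> cont h \<Longrightarrow> ip (\<lambda>x. f x - g x) h = ip f h - ip g h"
  unfolding ip_def by (simp add: left_diff_distrib smean_diff continuous_on_mult)

lemma ip_cmult_left: "ip (\<lambda>x. c * f x) h = c * ip f h"
  unfolding ip_def by (simp add: mult.assoc smean_cmult)

lemma ip_sum_left: "(\<And>i. i \<in> I \<Longrightarrow> cont (f i)) \<Longrightarrow> cont h \<Longrightarrow> ip (\<lambda>x. \<Sum>i\<in>I. f i x) h = (\<Sum>i\<in>I. ip (f i) h)"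
  unfolding ip_def by (simp add: sum_distrib_right smean_sum continuous_on_mult)

lemma ip_cong:
  "(\<And>\<theta>. norm \<theta> = 1 \<Longrightarrow> f \<theta> = f' \<theta>) \<Longrightarrow> (\<And>\<theta>. norm \<theta> = 1 \<Longrightarrow> g \<theta> = g' \<theta>) \<Longrightarrow> ip f g = ip f' g'"
  unfolding ip_def by (rule smean_cong) simp

lemma ip_nonneg: "ip f f \<ge> 0"
proof (cases "(\<lambda>x. shell_weight (x \<bullet> x) * (f (sphere_proj 1 x) * f (sphere_proj 1 x))) integrable_on shell_box")
  case True
  then show ?thesis unfolding ip_def smean_def
    by (rule integral_nonneg) (intro mult_nonneg_nonneg[OF shell_weight_nonneg] zero_le_square)
next
  case False then show ?thesis by (simp add: ip_def smean_def not_integrable_integral)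
qed

lemma ip_eq_0: "cont f \<Longrightarrow> ip f f = 0 \<Longrightarrow> norm \<theta> = 1 \<Longrightarrow> f \<theta> = 0"
  unfolding ip_def by (rule smean_square_eq_0)

lemma harm_cont: "harm k Y \<Longrightarrow> cont Y"
  by (rule smooth_continuous[OF harm_smooth])

definition orthonormal :: "(real^'n::finite \<Rightarrow> real) set \<Rightarrow> bool" where
  "orthonormal B \<longleftrightarrow> finite B \<and> (\<forall>f\<in>B. cont f) \<and> (\<forall>f\<in>B. \<forall>g\<in>B. ip f g = (if f = g then 1 else 0))"

lemma orthonormal_ip_sum:
  assumes B: "orthonormal B" and b: "b \<in> B"
  shows "ip (\<lambda>x. \<Sum>f\<in>B. c f * f x) b = c b"
proof -
  have "ip (\<lambda>x. \<Sum>f\<in>B. c f * f x) b = (\<Sum>f\<in>B. c f * ip f b)"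
    using B b by (subst ip_sum_left) (auto simp: orthonormal_def ip_cmult_left intro!: continuous_on_mult continuous_on_const)
  also have "\<dots> = (\<Sum>f\<in>B. if f = b then c f else 0)"
    using B b by (intro sum.cong) (auto simp: orthonormal_def)
  also have "\<dots> = c b" using B b by (simp add: orthonormal_def)
  finally show ?thesis .
qed

definition spanned :: "(real^'n::finite \<Rightarrow> real) set \<Rightarrow> (real^'n \<Rightarrow> real) \<Rightarrow> bool" where
  "spanned S p \<longleftrightarrow> (\<exists>a. p = (\<lambda>x. \<Sum>s\<in>S. a s * s x))"

lemma spanned_add: "spanned S p \<Longrightarrow> spanned S q \<Longrightarrow> spanned S (\<lambda>x. p x + q x)"
proof -
  assume "spanned S p" "spanned S q"
  then obtain a b where "p = (\<lambda>x. \<Sum>s\<in>S. a s * s x)" "q = (\<lambda>x. \<Sum>s\<in>S. b s * s x)"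
    unfolding spanned_def by blast
  then show ?thesis unfolding spanned_def
    by (intro exI[of _ "\<lambda>s. a s + b s"]) (simp add: distrib_right sum.distrib)
qed

lemma spanned_cmult: "spanned S p \<Longrightarrow> spanned S (\<lambda>x. c * p x)"
proof -
  assume "spanned S p"
  then obtain a where "p = (\<lambda>x. \<Sum>s\<in>S. a s * s x)"
    unfolding spanned_def by blast
  then show ?thesis unfolding spanned_def
    by (intro exI[of _ "\<lambda>s. c * a s"]) (simp add: sum_distrib_left mult.assoc)
qed

lemma spanned_zero: "spanned S (\<lambda>x. 0)"
  unfolding spanned_def by (intro exI[of _ "\<lambda>s. 0"]) simp

lemma spanned_mem: "finite S \<Longrightarrow> s \<in> S \<Longrightarrow> spanned S s"
  unfolding spanned_def
  by (intro exI[of _ "\<lambda>t. if t = s then 1 else 0"]) (auto simp: if_distrib if_distribR cong: if_cong)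

lemma spanned_sum: "(\<And>i. i \<in> I \<Longrightarrow> spanned S (f i)) \<Longrightarrow> spanned S (\<lambda>x. \<Sum>i\<in>I. f i x)"
  by (induction I rule: infinite_finite_induct) (auto intro: spanned_zero spanned_add)

text \<open>The spanning monomials are products of k ordered coordinates. The count n^k is crude in
  general but exact for k = 0 and k = 1, the two degrees whose dimension matters for the range of
  m.\<close>

lemma hpoly_finite_span:
  "\<exists>S :: (real^'n::finite \<Rightarrow> real) set. finite S \<and> card S \<le> CARD('n) ^ k \<and> (\<forall>p. hpoly k p \<longrightarrow> spanned S p)"
proof (induction k)
  case 0
  have "spanned {\<lambda>x. 1} (\<lambda>x. c)" for c :: real
    unfolding spanned_def by (intro exI[of _ "\<lambda>_. c"]) simp
  then have "hpoly 0 p \<longrightarrow> spanned {\<lambda>x. 1} p" for p :: "real^'n \<Rightarrow> real"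
    using hpoly_0_const[of 0 p] by auto
  then show ?case by (intro exI[of _ "{\<lambda>x. 1}"]) auto
next
  case (Suc k)
  then obtain S :: "(real^'n \<Rightarrow> real) set" where S: "finite S" "card S \<le> CARD('n) ^ k" "\<And>p. hpoly k p \<Longrightarrow> spanned S p" by blast
  define S' where "S' = (\<lambda>(i, s) x. x $ i * s x) ` ((UNIV :: 'n set) \<times> S)"
  have S': "finite S'" using S by (simp add: S'_def)
  have "card S' \<le> card ((UNIV :: 'n set) \<times> S)" unfolding S'_def by (rule card_image_le) (use S in simp)
  then have "card S' \<le> CARD('n) ^ Suc k"
    using S(2) by (simp add: card_cartesian_product) (meson le_trans mult_le_mono2)
  moreover have "spanned S' p" if "hpoly m p" "m = Suc k" for m and p :: "real^'n \<Rightarrow> real"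
    using that
  proof (induction rule: hpoly.induct)
    case (step m p i)
    then obtain a where p: "p = (\<lambda>x. \<Sum>s\<in>S. a s * s x)" using S(3) unfolding spanned_def by blast
    have "(\<lambda>x. x $ i * p x) = (\<lambda>x. \<Sum>s\<in>S. a s * (x $ i * s x))"
      by (simp add: p sum_distrib_left mult.left_commute)
    moreover have "spanned S' (\<lambda>x. x $ i * s x)" if "s \<in> S" for s
      by (rule spanned_mem[OF S']) (use that in \<open>auto simp: S'_def\<close>)
    ultimately show ?case by (simp only:) (intro spanned_sum spanned_cmult)
  next
    case (add m p q) then show ?case by (intro spanned_add) auto
  qed simp
  ultimately show ?case using S' by blast
qed

lemma orthonormal_card_le:
  assumes B: "orthonormal B" and S: "finite S" "\<And>b. b \<in> B \<Longrightarrow> spanned S b"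
  shows "card B \<le> card S"
proof (rule ccontr)
  assume "\<not> card B \<le> card S"
  obtain a where a: "\<And>b. b \<in> B \<Longrightarrow> b = (\<lambda>x. \<Sum>s\<in>S. a b s * s x)"
    using S(2) unfolding spanned_def by metis
  obtain c where c: "\<exists>b\<in>B. c b \<noteq> 0" "\<And>s. s \<in> S \<Longrightarrow> (\<Sum>b\<in>B. c b * a b s) = 0"
    using nontrivial_relation[of S B a] S(1) B \<open>\<not> card B \<le> card S\<close> by (auto simp: orthonormal_def)
  have "(\<Sum>b\<in>B. c b * b x) = 0" for x
  proof -
    have "(\<Sum>b\<in>B. c b * b x) = (\<Sum>b\<in>B. \<Sum>s\<in>S. c b * a b s * s x)"
    proof (rule sum.cong)
      fix b assume "b \<in> B"
      have "b x = (\<Sum>s\<in>S. a b s * s x)" using a[OF \<open>b \<in> B\<close>] by (rule fun_cong)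
      then show "c b * b x = (\<Sum>s\<in>S. c b * a b s * s x)" by (simp add: sum_distrib_left mult.assoc)
    qed simp
    also have "\<dots> = (\<Sum>s\<in>S. (\<Sum>b\<in>B. c b * a b s) * s x)"
      by (subst sum.swap) (simp add: sum_distrib_right)
    finally show ?thesis using c(2) by simp
  qed
  then have "c b = 0" if "b \<in> B" for b
    using orthonormal_ip_sum[OF B that, of c] by (simp add: ip_def smean_zero)
  with c(1) show False by blast
qed

text \<open>Orthonormal sets of harmonics have bounded cardinality, so one of largest cardinality
  exists. If some Y differed from its projection on the sphere, the normalised remainder would
  enlarge that set.\<close>

lemma harm_basis_exists:
  "\<exists>B :: (real^'n::finite \<Rightarrow> real) set. orthonormal B \<and> (\<forall>b\<in>B. harm k b)
     \<and> (\<forall>Y. harm k Y \<longrightarrow> (\<forall>\<theta>. norm \<theta> = 1 \<longrightarrow> Y \<theta> = (\<Sum>b\<in>B. ip Y b * b \<theta>)))"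
proof -
  obtain S :: "(real^'n \<Rightarrow> real) set" where S: "finite S" "\<And>p. hpoly k p \<Longrightarrow> spanned S p"
    using hpoly_finite_span by blast
  define Q where "Q B \<longleftrightarrow> orthonormal B \<and> (\<forall>b\<in>B. harm k b)" for B :: "(real^'n \<Rightarrow> real) set"
  have bd: "card B \<le> card S" if "Q B" for B
    using orthonormal_card_le[of B S] S that harm_hpoly by (auto simp: Q_def)
  have "Q {}" by (simp add: Q_def orthonormal_def)
  then obtain B where B: "Q B" "\<And>B'. Q B' \<Longrightarrow> card B' \<le> card B"
    using ex_has_greatest_nat[of Q "{}" card "Suc (card S)"] bd by (auto simp: less_Suc_eq_le)
  have "Y \<theta> = (\<Sum>b\<in>B. ip Y b * b \<theta>)" if Y: "harm k Y" and \<theta>: "norm \<theta> = 1" for Y \<theta>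
  proof -
    define Y' where "Y' x = Y x - (\<Sum>b\<in>B. ip Y b * b x)" for x
    have hY': "harm k Y'" unfolding Y'_def[abs_def]
      using B(1) by (intro harm_diff Y harm_sum harm_cmult) (auto simp: Q_def)
    have cY': "cont Y'" by (rule harm_cont[OF hY'])
    have cb: "cont b" if "b \<in> B" for b using B(1) that by (auto simp: Q_def orthonormal_def)
    have perp: "ip Y' b = 0" if "b \<in> B" for b
    proof -
      have "ip Y' b = ip Y b - ip (\<lambda>x. \<Sum>b\<in>B. ip Y b * b x) b"
        unfolding Y'_def[abs_def] using cb that Y
        by (intro ip_diff_left harm_cont[OF Y] continuous_on_sum continuous_on_mult continuous_on_const) auto
      then show ?thesis using orthonormal_ip_sum[of B b "ip Y"] B(1) that by (simp add: Q_def)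
    qed
    have "ip Y' Y' = 0"
    proof (rule ccontr)
      assume "ip Y' Y' \<noteq> 0"
      then have c: "ip Y' Y' > 0" using ip_nonneg[of Y'] by simp
      define Z where "Z x = (1 / sqrt (ip Y' Y')) * Y' x" for x
      have hZ: "harm k Z" unfolding Z_def[abs_def] by (rule harm_cmult[OF hY'])
      have Zb: "ip Z b = 0" if "b \<in> B" for b
        unfolding Z_def[abs_def] using perp[OF that] by (simp only: ip_cmult_left mult_zero_right)
      have ipZ: "ip Z f = (1 / sqrt (ip Y' Y')) * ip Y' f" for f
        unfolding Z_def[abs_def] by (rule ip_cmult_left)
      have "ip Z Z = (1 / sqrt (ip Y' Y')) * ((1 / sqrt (ip Y' Y')) * ip Y' Y')"
        by (subst ipZ, subst ip_commute, subst ipZ) (rule refl)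
      then have ZZ: "ip Z Z = 1" using c by simp
      have "Z \<notin> B" using Zb ZZ by force
      moreover have "Q (insert Z B)"
        unfolding Q_def orthonormal_def
      proof (intro conjI ballI)
        show "finite (insert Z B)" using B(1) by (simp add: Q_def orthonormal_def)
        show "harm k b" if "b \<in> insert Z B" for b using that hZ B(1) by (auto simp: Q_def)
        show "cont b" if "b \<in> insert Z B" for b using that harm_cont[OF hZ] cb by auto
        show "ip f g = (if f = g then 1 else 0)" if "f \<in> insert Z B" "g \<in> insert Z B" for f g
          using that ZZ Zb \<open>Z \<notin> B\<close> B(1) ip_commute[of f g] unfolding Q_def orthonormal_def by (metis insertE)
      qed
      ultimately show False using B by (metis Q_def card_insert_disjoint not_less_eq_eq orthonormal_def order_refl)
    qed
    then have "Y' \<theta> = 0" by (rule ip_eq_0[OF cY' _ \<theta>])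
    then show ?thesis by (simp add: Y'_def)
  qed
  with B show ?thesis unfolding Q_def by blast
qed

text \<open>A basis of the spherical harmonics of degree $k$, orthonormal on the unit sphere.\<close>

definition hb :: "nat \<Rightarrow> (real^'n::finite \<Rightarrow> real) set" where
  "hb k = (SOME B. orthonormal B \<and> (\<forall>b\<in>B. harm k b)
     \<and> (\<forall>Y. harm k Y \<longrightarrow> (\<forall>\<theta>. norm \<theta> = 1 \<longrightarrow> Y \<theta> = (\<Sum>b\<in>B. ip Y b * b \<theta>))))"

lemma hb_orthonormal: "orthonormal (hb k)"
  and hb_harm: "b \<in> hb k \<Longrightarrow> harm k b"
  and hb_expand: "harm k Y \<Longrightarrow> norm \<theta> = 1 \<Longrightarrow> Y \<theta> = (\<Sum>b\<in>hb k. ip Y b * b \<theta>)"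
  using someI_ex[OF harm_basis_exists[of k]] unfolding hb_def[symmetric] by blast+

lemma finite_hb: "finite (hb k)"
  using hb_orthonormal by (auto simp: orthonormal_def)

lemma hpoly_zero_on_sphere: "hpoly k p \<Longrightarrow> (\<And>\<theta>. norm \<theta> = 1 \<Longrightarrow> p \<theta> = 0) \<Longrightarrow> p x = 0"
proof -
  assume p: "hpoly k p" "\<And>\<theta>. norm \<theta> = 1 \<Longrightarrow> p \<theta> = 0"
  obtain \<theta> where "x = norm x *\<^sub>R \<theta>" "norm \<theta> = 1"
  proof (cases "x = 0")
    case True
    then show ?thesis using that[of "axis undefined 1"] by simp
  next
    case False
    then show ?thesis using that[of "(1 / norm x) *\<^sub>R x"] by simp
  qed
  then show "p x = 0" using hpoly_scaleR[OF p(1), of "norm x" \<theta>] p(2) by simp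
qed

lemma card_hb_pos:
  assumes "CARD('n::finite) \<ge> 2"
  shows "card (hb k :: (real^'n \<Rightarrow> real) set) > 0"
proof (rule ccontr)
  assume "\<not> ?thesis"
  then have e: "hb k = ({} :: (real^'n \<Rightarrow> real) set)" by (metis card_gt_0_iff finite_hb)
  obtain Y :: "real^'n \<Rightarrow> real" and x where Y: "harm k Y" "Y x \<noteq> 0" using harm_nontrivial[OF assms, of k] by blast
  then show False using hpoly_zero_on_sphere[OF harm_hpoly[OF Y(1)], of x] hb_expand[OF Y(1)] e by simp
qed

lemma card_hb_le: "card (hb k :: (real^'n::finite \<Rightarrow> real) set) \<le> CARD('n) ^ k"
proof -
  obtain S :: "(real^'n \<Rightarrow> real) set" where "finite S" "card S \<le> CARD('n) ^ k" "\<And>p. hpoly k p \<Longrightarrow> spanned S p"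
    using hpoly_finite_span by blast
  then show ?thesis using orthonormal_card_le[OF hb_orthonormal, of S k] hb_harm harm_hpoly
    by (metis le_trans)
qed

text \<open>The coordinate functions are harmonic of degree 1. A basis with fewer than n elements
  would produce a linear relation among them, refuted by evaluation at the unit vectors.\<close>

lemma card_hb_1: "card (hb 1 :: (real^'n::finite \<Rightarrow> real) set) = CARD('n)"
proof (rule antisym)
  show "card (hb 1 :: (real^'n \<Rightarrow> real) set) \<le> CARD('n)" using card_hb_le[of 1] by simp
  show "CARD('n) \<le> card (hb 1 :: (real^'n \<Rightarrow> real) set)"
  proof (rule ccontr)
    assume "\<not> ?thesis"
    then have "card (hb 1 :: (real^'n \<Rightarrow> real) set) < card (UNIV :: 'n set)" by simp
    from nontrivial_relation[OF finite_hb _ this, of "\<lambda>i b. ip (\<lambda>x. x $ i) b"]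
    obtain c where c: "\<exists>i. c i \<noteq> 0" "\<And>b. b \<in> hb 1 \<Longrightarrow> (\<Sum>i\<in>UNIV. c i * ip (\<lambda>x :: real^'n. x $ i) b) = 0"
      by auto
    have h: "harm 1 (\<lambda>x :: real^'n. x $ i)" for i
      using hpoly_laplacian_zero[OF hpoly_nth[of i]] hpoly_nth[of i] by (auto simp: harm_def)
    have "c i = 0" for i
    proof -
      let ?\<theta> = "axis i 1 :: real^'n"
      have "?\<theta> $ j = (\<Sum>b\<in>hb 1. ip (\<lambda>x. x $ j) b * b ?\<theta>)" for j
        using hb_expand[OF h[of j], of ?\<theta>] by simp
      then have "(\<Sum>j\<in>UNIV. c j * ?\<theta> $ j) = (\<Sum>j\<in>UNIV. \<Sum>b\<in>hb 1. c j * ip (\<lambda>x. x $ j) b * b ?\<theta>)"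
        by (simp only:) (simp add: sum_distrib_left mult.assoc)
      also have "\<dots> = (\<Sum>b\<in>hb 1. (\<Sum>j\<in>UNIV. c j * ip (\<lambda>x. x $ j) b) * b ?\<theta>)"
        by (subst sum.swap) (simp add: sum_distrib_right)
      also have "\<dots> = 0" using c(2) by simp
      finally show ?thesis by (simp add: axis_def if_distrib cong: if_cong)
    qed
    with c(1) show False by blast
  qed
qed

lemma card_hb_0: "CARD('n::finite) \<ge> 2 \<Longrightarrow> card (hb 0 :: (real^'n \<Rightarrow> real) set) = 1"
  using card_hb_le[of 0, where ?'n='n] card_hb_pos[of 0, where ?'n='n] by simp

section \<open>Completeness of the harmonics on the sphere, and the radial profiles of a
  function\<close>

inductive hgen :: "(real^'n::finite \<Rightarrow> real) \<Rightarrow> bool" where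
  base: "hpoly k p \<Longrightarrow> hgen p"
| add: "hgen p \<Longrightarrow> hgen q \<Longrightarrow> hgen (\<lambda>x. p x + q x)"

lemma hgen_mult_hpoly: "hgen q \<Longrightarrow> hpoly k p \<Longrightarrow> hgen (\<lambda>x. p x * q x)"
proof (induction rule: hgen.induct)
  case (base j q) then show ?case using hgen.base[OF hpoly_mult] by blast
next
  case (add q q')
  from hgen.add[OF add(3)[OF add(5)] add(4)[OF add(5)]] show ?case by (simp add: distrib_left)
qed

lemma hgen_mult: "hgen p \<Longrightarrow> hgen q \<Longrightarrow> hgen (\<lambda>x. p x * q x)"
proof (induction rule: hgen.induct)
  case (base j p) then show ?case by (intro hgen_mult_hpoly)
next
  case (add p p')
  from hgen.add[OF add(3)[OF add(5)] add(4)[OF add(5)]] show ?case by (simp add: distrib_right)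
qed

lemma polynomial_hgen: "real_polynomial_function p \<Longrightarrow> hgen (p :: real^'n::finite \<Rightarrow> real)"
proof (induction rule: real_polynomial_function.induct)
  case (linear f)
  interpret bounded_linear f by fact
  have "f x = (\<Sum>i\<in>UNIV. f (axis i 1) * x $ i)" for x
  proof -
    have "f x = f (\<Sum>i\<in>UNIV. x $ i *\<^sub>R axis i 1)"
      using basis_expansion[of x] by (simp add: scalar_mult_eq_scaleR)
    then show ?thesis by (simp add: sum scaleR mult.commute)
  qed
  then have "f = (\<lambda>x. \<Sum>i\<in>UNIV. f (axis i 1) * x $ i)" by blast
  moreover have "hpoly 1 (\<lambda>x. \<Sum>i\<in>UNIV. f (axis i 1) * x $ i)"
    by (intro hpoly_sum hpoly_cmult hpoly_nth)
  ultimately show ?case using hgen.base by metis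
qed (auto intro: hgen.base[OF hpoly.const] hgen.add hgen_mult)

text \<open>On the unit sphere the factors |x|^(2i) in Fischer's decomposition are 1, so w is
  orthogonal to every polynomial. Stone-Weierstrass approximates w uniformly by polynomials, hence w
  is orthogonal to itself.\<close>

lemma harmonics_complete:
  fixes w :: "real^'n::finite \<Rightarrow> real"
  assumes w: "cont w" and orth: "\<And>k Y. harm k Y \<Longrightarrow> ip w Y = 0" and \<theta>: "norm \<theta> = 1"
  shows "w \<theta> = 0"
proof -
  have ip_hdec: "ip w p = 0" if "hdec k p" for k p
    using that
  proof (induction rule: hdec.induct)
    case (base m h i)
    have "ip w (\<lambda>x. (x \<bullet> x) ^ i * h x) = ip w h"
      by (rule ip_cong) (auto simp: dot_square_norm)
    then show ?case using orth[OF base] by simp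
  next
    case (add k p q)
    then show ?case using w hpoly_smooth[OF hdec_hpoly] smooth_continuous
      by (subst ip_commute, subst ip_add_left) (auto simp: ip_commute[of _ w])
  qed
  have ip_hgen: "ip w p = 0 \<and> cont p" if "hgen p" for p
    using that
  proof (induction rule: hgen.induct)
    case (base k p)
    then show ?case using ip_hdec[OF hpoly_hdec] hpoly_smooth smooth_continuous by blast
  next
    case (add p q)
    then show ?case using w
      by (subst ip_commute, subst ip_add_left) (auto simp: ip_commute[of _ w] intro: continuous_on_add)
  qed
  let ?S = "sphere (0::real^'n) 1"
  have "compact (w ` ?S)" by (intro compact_continuous_image continuous_on_subset[OF w]) auto
  then have "bounded (w ` ?S)" by (rule compact_imp_bounded)
  then obtain B where "\<forall>y\<in>w ` ?S. norm y \<le> B" unfolding bounded_iff by blast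
  then have B: "\<And>x. x \<in> ?S \<Longrightarrow> \<bar>w x\<bar> \<le> B" by simp
  define m where "m = smean (\<lambda>x :: real^'n. 1) 1"
  have "\<bar>ip w w\<bar> \<le> e * (B * m)" if "e > 0" for e
  proof -
    obtain p where p: "real_polynomial_function p" "\<And>x. x \<in> ?S \<Longrightarrow> \<bar>w x - p x\<bar> < e"
      using Stone_Weierstrass_real_polynomial_function[OF _ continuous_on_subset[OF w] \<open>e > 0\<close>, of ?S] by auto
    have pc: "ip w p = 0" "cont p" using ip_hgen polynomial_hgen p(1) by blast+
    have "ip w w = ip (\<lambda>x. w x - p x) w"
      using pc w by (simp add: ip_diff_left ip_commute[of p])
    also have "\<bar>\<dots>\<bar> \<le> (e * B) * m"
      unfolding ip_def m_def
    proof (rule smean_abs_le)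
      show "continuous_on UNIV (\<lambda>x. (w x - p x) * w x)"
        by (intro continuous_on_mult continuous_on_diff w pc)
      fix x :: "real^'n" assume "norm x = 1"
      then have "\<bar>w x - p x\<bar> \<le> e" "\<bar>w x\<bar> \<le> B" using p(2)[of x] B[of x] by auto
      then show "\<bar>(w (1 *\<^sub>R x) - p (1 *\<^sub>R x)) * w (1 *\<^sub>R x)\<bar> \<le> e * B"
        using \<open>e > 0\<close> by (simp add: abs_mult mult_mono)
    qed
    finally show ?thesis by simp
  qed
  then have "\<bar>ip w w\<bar> \<le> 0 + e" if "e > 0" for e
  proof (cases "B * m \<le> 0")
    case True
    then have "1 * (B * m) \<le> 0" by simp
    then show ?thesis using \<open>\<And>e. e > 0 \<Longrightarrow> \<bar>ip w w\<bar> \<le> e * (B * m)\<close>[of 1] that by linarith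
  next
    case False
    then have "B * m > 0" by simp
    then have "e / (B * m) * (B * m) = e" "e / (B * m) > 0" using that by (auto simp: zero_less_mult_iff)
    then show ?thesis using \<open>\<And>e. e > 0 \<Longrightarrow> \<bar>ip w w\<bar> \<le> e * (B * m)\<close>[of "e / (B * m)"] by simp
  qed
  then have "\<bar>ip w w\<bar> \<le> 0" by (rule field_le_epsilon)
  then show ?thesis using ip_eq_0[OF w _ \<theta>] by simp
qed

lemma smean_rotf_by_parts:
  assumes "smooth u" "smooth v"
  shows "smean (\<lambda>x. rotf i j u x * v x) r = - smean (\<lambda>x. u x * rotf i j v x) r"
proof -
  have "0 = smean (rotf i j (\<lambda>x. u x * v x)) r"
    using assms by (simp add: smean_rotf smooth_mult)
  also have "\<dots> = smean (\<lambda>x. rotf i j u x * v x) r + smean (\<lambda>x. u x * rotf i j v x) r"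
    using assms by (simp add: rotf_mult smean_add smooth_continuous smooth_mult smooth_rotf)
  finally show ?thesis by simp
qed

text \<open>Each rotation field is antisymmetric for the spherical mean, so its square is symmetric.
  This is self-adjointness of the spherical Laplacian.\<close>

lemma smean_sum_rotf_symmetric:
  fixes u v :: "real^'n::finite \<Rightarrow> real"
  assumes "smooth u" "smooth v"
  shows "smean (\<lambda>x. (\<Sum>i\<in>UNIV. \<Sum>j\<in>UNIV. rotf i j (rotf i j u) x) * v x) r
    = smean (\<lambda>x. u x * (\<Sum>i\<in>UNIV. \<Sum>j\<in>UNIV. rotf i j (rotf i j v) x)) r"
proof -
  have 1: "smean (\<lambda>x. rotf i j (rotf i j u) x * v x) r = smean (\<lambda>x. u x * rotf i j (rotf i j v) x) r" for i j
    using assms by (simp add: smean_rotf_by_parts smooth_rotf)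
  have 2: "smean (\<lambda>x. \<Sum>i\<in>UNIV. \<Sum>j\<in>UNIV. f i j x) r = (\<Sum>i\<in>UNIV. \<Sum>j\<in>UNIV. smean (f i j) r)"
    if f: "\<And>i j. smooth (f i j)" for f :: "'n \<Rightarrow> 'n \<Rightarrow> real^'n \<Rightarrow> real"
  proof -
    have "smean (\<lambda>x. \<Sum>i\<in>UNIV. \<Sum>j\<in>UNIV. f i j x) r = (\<Sum>i\<in>UNIV. smean (\<lambda>x. \<Sum>j\<in>UNIV. f i j x) r)"
      by (rule smean_sum) (intro smooth_continuous smooth_sum f)
    also have "\<dots> = (\<Sum>i\<in>UNIV. \<Sum>j\<in>UNIV. smean (f i j) r)"
      by (intro sum.cong refl smean_sum smooth_continuous f)
    finally show ?thesis .
  qed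
  have "smooth (\<lambda>x. rotf i j (rotf i j u) x * v x)" "smooth (\<lambda>x. u x * rotf i j (rotf i j v) x)" for i j
    using assms by (auto intro!: smooth_mult smooth_rotf)
  from 2[OF this(1)] 2[OF this(2)] show ?thesis
    unfolding sum_distrib_right sum_distrib_left by (simp only: 1)
qed

text \<open>The spherical eigenvalue -k (k + n - 2), doubled because the double sum counts every
  plane twice. It is read off from harmonicity and homogeneity.\<close>

lemma sum_rotf_harm:
  fixes Y :: "real^'n::finite \<Rightarrow> real"
  assumes Y: "harm k Y"
  shows "(\<Sum>i\<in>UNIV. \<Sum>j\<in>UNIV. rotf i j (rotf i j Y) x) = - 2 * (real k * (real k + real CARD('n) - 2)) * Y x"
proof -
  have e: "euler Y = (\<lambda>x. real k * Y x)" using euler_hpoly[OF harm_hpoly[OF Y]] by blast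
  have "euler (euler Y) x = real k * (real k * Y x)"
    unfolding e by (simp add: euler_cmult[OF harm_smooth[OF Y]] e)
  then show ?thesis using Y
    by (subst sum_rotf_squared[OF harm_smooth[OF Y]]) (simp add: e harm_def algebra_simps)
qed

text \<open>Projecting the polar form of the Laplacian onto Y: the spherical part is moved onto Y by
  symmetry, where it acts as a scalar, and an equation in the radius remains.\<close>

lemma smean_laplacian_harm:
  fixes u :: "real^'n::finite \<Rightarrow> real"
  assumes u: "smooth u" and Y: "harm k Y"
  shows "r\<^sup>2 * smean (\<lambda>x. laplacian u x * Y x) r = smean (\<lambda>x. euler (euler u) x * Y x) r
     + (real CARD('n) - 2) * smean (\<lambda>x. euler u x * Y x) r
     - real k * (real k + real CARD('n) - 2) * smean (\<lambda>x. u x * Y x) r"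
proof -
  let ?n = "real CARD('n)"
  note sm = u harm_smooth[OF Y] smooth_euler smooth_laplacian smooth_mult smooth_cmult smooth_add smooth_diff
  have "r\<^sup>2 * smean (\<lambda>x. laplacian u x * Y x) r = smean (\<lambda>x. (x \<bullet> x) * laplacian u x * Y x) r"
    unfolding smean_cmult[symmetric]
    by (rule smean_cong) (simp add: dot_square_norm power2_eq_square mult.assoc)
  also have "\<dots> = smean (\<lambda>x. (euler (euler u) x * Y x + (?n - 2) * (euler u x * Y x))
      + 1/2 * ((\<Sum>i\<in>UNIV. \<Sum>j\<in>UNIV. rotf i j (rotf i j u) x) * Y x)) r"
    by (rule arg_cong[where f="\<lambda>f. smean f r"], rule ext, subst sum_rotf_squared[OF u]) (simp add: algebra_simps)
  also have "\<dots> = smean (\<lambda>x. euler (euler u) x * Y x) r + (?n - 2) * smean (\<lambda>x. euler u x * Y x) r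
      + 1/2 * smean (\<lambda>x. (\<Sum>i\<in>UNIV. \<Sum>j\<in>UNIV. rotf i j (rotf i j u) x) * Y x) r"
  proof -
    have s: "smooth (\<lambda>x. (\<Sum>i\<in>UNIV. \<Sum>j\<in>UNIV. rotf i j (rotf i j u) x) * Y x)"
      by (intro smooth_mult smooth_sum smooth_rotf sm)
    show ?thesis
      by (subst smean_add, (intro smooth_continuous sm s)+, subst smean_add, (intro smooth_continuous sm)+)
         (simp only: smean_cmult)
  qed
  also have "smean (\<lambda>x. (\<Sum>i\<in>UNIV. \<Sum>j\<in>UNIV. rotf i j (rotf i j u) x) * Y x) r
      = - 2 * (real k * (real k + ?n - 2)) * smean (\<lambda>x. u x * Y x) r"
    unfolding smean_sum_rotf_symmetric[OF u harm_smooth[OF Y]] sum_rotf_harm[OF Y] smean_cmult[symmetric]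
    by (simp add: mult.left_commute)
  finally show ?thesis by simp
qed

text \<open>Eigenfunctions of a symmetric operator for different eigenvalues: k (k + n - 2) is
  strictly increasing in k when n >= 2.\<close>

lemma harm_orthogonal:
  fixes Y Z :: "real^'n::finite \<Rightarrow> real"
  assumes n: "CARD('n) \<ge> 2" and Y: "harm j Y" and Z: "harm k Z" and ne: "j \<noteq> k"
  shows "ip Y Z = 0"
proof -
  define e where "e k = real k * (real k + real CARD('n) - 2)" for k :: nat
  have mono: "e a < e b" if "a < b" for a b
    unfolding e_def using that n by (intro mult_strict_mono') auto
  have "- 2 * e j * ip Y Z = - 2 * e k * ip Y Z"
    using smean_sum_rotf_symmetric[OF harm_smooth[OF Y] harm_smooth[OF Z], of 1]
    unfolding sum_rotf_harm[OF Y] sum_rotf_harm[OF Z] ip_def e_def smean_cmult[symmetric]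
    by (simp add: mult.assoc mult.left_commute)
  moreover have "e j \<noteq> e k" using mono[of j k] mono[of k j] ne by (cases "j < k") auto
  ultimately show ?thesis by simp
qed

text \<open>The radial profile of the sector of $Y$, as a function of $s = |x|^2$ and with the factor $|x|^k$ of $Y$ removed.\<close>

definition prof :: "nat \<Rightarrow> (real^'n::finite \<Rightarrow> real) \<Rightarrow> (real^'n \<Rightarrow> real) \<Rightarrow> real \<Rightarrow> real" where
  "prof k u Y s = smean (\<lambda>x. u x * Y x) (sqrt s) / s ^ k"

text \<open>Assuming the profiles of degree at least K vanish turns the harmonic expansion into a
  finite sum, so no convergence has to be discussed; for eigenfunctions this assumption is verified
  from the radial equation.\<close>

lemma prof_expansion:
  fixes u :: "real^'n::finite \<Rightarrow> real"
  assumes n: "CARD('n) \<ge> 2" and u: "cont u" and x: "x \<noteq> 0"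
    and high: "\<And>k b. k \<ge> K \<Longrightarrow> b \<in> hb k \<Longrightarrow> prof k u b (x \<bullet> x) = 0"
  shows "u x = (\<Sum>k<K. \<Sum>b\<in>hb k. prof k u b (x \<bullet> x) * b x)"
proof -
  define r where "r = norm x"
  have r: "r > 0" "sqrt (x \<bullet> x) = r" "x \<bullet> x = r\<^sup>2"
    using x dot_square_norm[of x] by (simp_all add: r_def norm_eq_sqrt_inner[symmetric])
  define v where "v y = u (r *\<^sub>R y)" for y
  have v: "cont v" unfolding v_def[abs_def]
    by (rule continuous_on_compose2[OF u]) (auto intro!: continuous_intros)
  have ipv: "ip v b = r ^ k * prof k u b (x \<bullet> x)" if "hpoly k b" for k b
  proof -
    have "r ^ k * ip v b = smean (\<lambda>y. u (r *\<^sub>R y) * b (r *\<^sub>R y)) 1"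
      unfolding ip_def smean_cmult[symmetric] v_def hpoly_scaleR[OF that] by (simp add: mult.left_commute)
    also have "\<dots> = smean (\<lambda>y. u y * b y) r" by (rule smean_scale)
    also have "\<dots> = r ^ (2 * k) * prof k u b (x \<bullet> x)"
      using r by (simp add: prof_def power_mult)
    finally have "r ^ k * ip v b = r ^ k * (r ^ k * prof k u b (x \<bullet> x))" by (simp add: power_add mult_2)
    then show ?thesis using r by simp
  qed
  define P where "P y = (\<Sum>k<K. \<Sum>b\<in>hb k. ip v b * b y)" for y
  have hc: "cont b" if "b \<in> hb k" for b :: "real^'n \<Rightarrow> real" and k using harm_cont[OF hb_harm[OF that]] .
  have P: "cont P" unfolding P_def[abs_def]
    by (intro continuous_on_sum continuous_on_mult continuous_on_const hc)
  have ipP: "ip P b = (if k < K then ip v b else 0)" if b: "b \<in> hb k" for k b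
  proof -
    have "ip P b = (\<Sum>j<K. ip (\<lambda>y. \<Sum>b'\<in>hb j. ip v b' * b' y) b)"
      unfolding P_def[abs_def]
      by (rule ip_sum_left) (intro continuous_on_sum continuous_on_mult continuous_on_const hc, assumption, rule hc[OF b])
    also have "\<dots> = (\<Sum>j<K. if j = k then ip v b else 0)"
    proof (rule sum.cong)
      fix j
      show "ip (\<lambda>y. \<Sum>b'\<in>hb j. ip v b' * b' y) b = (if j = k then ip v b else 0)"
      proof (cases "j = k")
        case True then show ?thesis using orthonormal_ip_sum[OF hb_orthonormal b] by simp
      next
        case False
        have "harm j (\<lambda>y. \<Sum>b'\<in>hb j. ip v b' * b' y)" by (intro harm_sum harm_cmult hb_harm)
        then show ?thesis using harm_orthogonal[OF n _ hb_harm[OF b]] False by simp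
      qed
    qed simp
    finally show ?thesis by simp
  qed
  \<comment> \<open>The remainder on the sphere through x is orthogonal to all harmonics: in degrees
    below K by subtraction, from K on by \<open>high\<close>.\<close>
  have "v \<theta> - P \<theta> = 0" if \<theta>: "norm \<theta> = 1" for \<theta>
  proof (rule harmonics_complete[OF _ _ \<theta>])
    show c: "cont (\<lambda>y. v y - P y)" by (intro continuous_on_diff v P)
    fix k Y assume Y: "harm k (Y :: real^'n \<Rightarrow> real)"
    have "ip (\<lambda>y. v y - P y) Y = ip (\<lambda>y. \<Sum>b\<in>hb k. ip Y b * b y) (\<lambda>y. v y - P y)"
      by (subst ip_commute, rule ip_cong) (simp_all add: hb_expand[OF Y])
    also have "\<dots> = (\<Sum>b\<in>hb k. ip Y b * ip b (\<lambda>y. v y - P y))"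
    proof -
      have "cont (\<lambda>y. ip Y b * b y)" if "b \<in> hb k" for b :: "real^'n \<Rightarrow> real"
        using hc[OF that] by (intro continuous_on_mult continuous_on_const)
      from ip_sum_left[OF this c] show ?thesis by (simp add: ip_cmult_left)
    qed
    also have "\<dots> = 0"
    proof (intro sum.neutral ballI)
      fix b :: "real^'n \<Rightarrow> real" assume b: "b \<in> hb k"
      have "ip b (\<lambda>y. v y - P y) = ip v b - ip P b"
        by (subst ip_commute) (intro ip_diff_left v P hc[OF b])
      also have "\<dots> = 0"
        using ipP[OF b] high[OF _ b] ipv[OF harm_hpoly[OF hb_harm[OF b]]] by (cases "k < K") auto
      finally show "ip Y b * ip b (\<lambda>y. v y - P y) = 0" by simp
    qed
    finally show "ip (\<lambda>y. v y - P y) Y = 0" .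
  qed
  from this[of "(1/r) *\<^sub>R x"] have "u x = P ((1/r) *\<^sub>R x)"
    using r by (simp add: v_def r_def)
  also have "\<dots> = (\<Sum>k<K. \<Sum>b\<in>hb k. prof k u b (x \<bullet> x) * b x)"
    unfolding P_def
  proof (intro sum.cong refl)
    fix k b assume b: "b \<in> (hb k :: (real^'n \<Rightarrow> real) set)"
    show "ip v b * b ((1/r) *\<^sub>R x) = prof k u b (x \<bullet> x) * b x"
      using r by (simp add: ipv[OF harm_hpoly[OF hb_harm[OF b]]] hpoly_scaleR[OF harm_hpoly[OF hb_harm[OF b]]] power_one_over)
  qed
  finally show ?thesis .
qed

text \<open>With s = r^2, the operator 2 s d/ds is r d/dr. Homogeneity of Y contributes +k and the
  divisor r^(2k) contributes -2k, which leaves -k.\<close>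

lemma prof_has_derivative:
  fixes u :: "real^'n::finite \<Rightarrow> real"
  assumes u: "smooth u" and Y: "harm k Y" and s: "s > 0"
  shows "(prof k u Y has_real_derivative (prof k (euler u) Y s - real k * prof k u Y s) / (2 * s)) (at s)"
proof -
  define F where "F = smean (\<lambda>x. u x * Y x)"
  define D where "D = smean (\<lambda>x. euler u x * Y x) (sqrt s) + real k * F (sqrt s)"
  have "euler (\<lambda>x. u x * Y x) = (\<lambda>x. euler u x * Y x + real k * (u x * Y x))"
    using euler_mult[OF u harm_smooth[OF Y]] euler_hpoly[OF harm_hpoly[OF Y]] by (auto simp: algebra_simps)
  then have "smean (euler (\<lambda>x. u x * Y x)) (sqrt s) = D"
    unfolding D_def F_def
    by (simp add: smean_add smean_cmult smooth_continuous smooth_mult smooth_euler smooth_cmult u harm_smooth[OF Y])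
  then have "(F has_real_derivative D / sqrt s) (at (sqrt s))"
    using smean_has_derivative[OF smooth_mult[OF u harm_smooth[OF Y]], of "sqrt s"] s by (simp add: F_def)
  moreover have "(sqrt has_real_derivative inverse (sqrt s) / 2) (at s)"
    by (rule DERIV_real_sqrt[OF s])
  ultimately have "((\<lambda>s. F (sqrt s)) has_real_derivative (D / sqrt s) * (inverse (sqrt s) / 2)) (at s)"
    by (rule DERIV_chain2)
  moreover have "(D / sqrt s) * (inverse (sqrt s) / 2) = D / (2 * s)" using s by (simp add: field_simps)
  ultimately have F: "((\<lambda>s. F (sqrt s)) has_real_derivative D / (2 * s)) (at s)" by simp
  have "((\<lambda>s. F (sqrt s) / s ^ k) has_real_derivative
      (D / (2 * s) * s ^ k - F (sqrt s) * (real k * s ^ (k - Suc 0))) / (s ^ k * s ^ k)) (at s)"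
    using s by (intro DERIV_divide F DERIV_pow) auto
  moreover have "real k * s ^ (k - Suc 0) = real k * s ^ k / s" using s by (cases k) auto
  moreover have "(D / (2 * s) * s ^ k - F (sqrt s) * (real k * s ^ k / s)) / (s ^ k * s ^ k)
      = (prof k (euler u) Y s - real k * prof k u Y s) / (2 * s)"
    using s by (simp add: prof_def D_def F_def[symmetric] divide_simps) (simp add: algebra_simps)
  ultimately show ?thesis by (simp add: prof_def[abs_def] F_def)
qed

lemma prof_laplacian:
  fixes u :: "real^'n::finite \<Rightarrow> real"
  assumes u: "smooth u" and Y: "harm k Y" and s: "s > 0"
  shows "s * prof k (laplacian u) Y s = prof k (euler (euler u)) Y s + (real CARD('n) - 2) * prof k (euler u) Y s
    - real k * (real k + real CARD('n) - 2) * prof k u Y s"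
proof -
  have E: "s * smean (\<lambda>x. laplacian u x * Y x) (sqrt s) = smean (\<lambda>x. euler (euler u) x * Y x) (sqrt s)
     + (real CARD('n) - 2) * smean (\<lambda>x. euler u x * Y x) (sqrt s)
     - real k * (real k + real CARD('n) - 2) * smean (\<lambda>x. u x * Y x) (sqrt s)"
    using smean_laplacian_harm[OF u Y, of "sqrt s"] s by simp
  show ?thesis unfolding prof_def times_divide_eq_right E add_divide_distrib diff_divide_distrib ..
qed

text \<open>With q = \<open>qexp\<close>, the function s^(-q) is the profile of |x|^(2-n-2k) Y, the
  singular harmonic companion (Kelvin transform) of Y. The type argument only carries the dimension
  n.\<close>

definition qexp :: "'n::finite itself \<Rightarrow> nat \<Rightarrow> real" where
  "qexp _ k = real CARD('n) / 2 - 1 + real k"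

text \<open>By \<open>prof_has_derivative\<close> this is 2 s^(q+1) times the derivative of the
  profile, the quantity in Sturm-Liouville form whose derivative involves only the
  Laplacian.\<close>

definition flux :: "nat \<Rightarrow> (real^'n::finite \<Rightarrow> real) \<Rightarrow> (real^'n \<Rightarrow> real) \<Rightarrow> real \<Rightarrow> real" where
  "flux k u Y s = s powr qexp TYPE('n) k * (prof k (euler u) Y s - real k * prof k u Y s)"

text \<open>The radial Laplacian 4 s g'' + 4 (q+1) g' equals 4 s^(-q) (s^(q+1) g')'. The biharmonic
  equation can therefore be solved by successive integration.\<close>

lemma flux_has_derivative:
  fixes u :: "real^'n::finite \<Rightarrow> real"
  assumes u: "smooth u" and Y: "harm k Y" and s: "s > 0"
  shows "(flux k u Y has_real_derivative s powr qexp TYPE('n) k * prof k (laplacian u) Y s / 2) (at s)"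
proof -
  define q where "q = qexp TYPE('n) k"
  define A where "A = prof k u Y s"
  define B where "B = prof k (euler u) Y s"
  define C where "C = prof k (euler (euler u)) Y s"
  have "(flux k u Y has_real_derivative
     s powr q * ((C - real k * B) / (2 * s) - real k * ((B - real k * A) / (2 * s)))
     + q * s powr (q - 1) * (B - real k * A)) (at s)"
    unfolding flux_def[abs_def] q_def[symmetric] A_def B_def C_def
    using s by (intro DERIV_mult' DERIV_diff DERIV_cmult prof_has_derivative smooth_euler u Y has_real_derivative_powr)
  moreover have "s powr q * ((C - real k * B) / (2 * s) - real k * ((B - real k * A) / (2 * s)))
     + q * s powr (q - 1) * (B - real k * A)
    = s powr q / (2 * s) * (C - 2 * real k * B + real k * real k * A + 2 * q * (B - real k * A))"
    using s by (simp add: powr_diff field_simps)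
  also have "C - 2 * real k * B + real k * real k * A + 2 * q * (B - real k * A) = s * prof k (laplacian u) Y s"
    unfolding prof_laplacian[OF u Y s] A_def[symmetric] B_def[symmetric] C_def[symmetric]
    by (simp add: q_def qexp_def algebra_simps)
  finally show ?thesis using s by (simp add: q_def)
qed

section \<open>Counting eigenvalues sector by sector\<close>

text \<open>The counting principle shared by ball and annulus: up to \<open>T\<close>, degree k < K
  owns a single eigenvalue \<open>lam k\<close> with a single profile \<open>g k\<close>.
  \<open>Sup\<close> of a set of naturals is informative only when attained, so both bounds are
  proved: an independent family of that size is exhibited, and any larger family is shown dependent.
  \<open>I\<close> collects squared radii that are dense in the closure.\<close>

lemma eig_count_of_profiles:
  fixes \<Omega> :: "(real^'n::finite) set"
  assumes n: "CARD('n) \<ge> 2"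
    and I: "I \<subseteq> {0<..}"
    and sub: "{x. x \<bullet> x \<in> I} \<subseteq> closure \<Omega>" and dense: "closure \<Omega> \<subseteq> closure {x. x \<bullet> x \<in> I}"
    and prof: "\<And>\<eta> u k b. \<eta> \<le> T \<Longrightarrow> eigenfunction \<Omega> \<eta> u \<Longrightarrow> b \<in> hb k \<Longrightarrow>
        \<exists>c. (\<forall>s\<in>I. prof k u b s = c * g k s) \<and> (c \<noteq> 0 \<longrightarrow> k < K \<and> lam k = \<eta>)"
    and eig: "\<And>k b. k < K \<Longrightarrow> b \<in> hb k \<Longrightarrow> eigenfunction \<Omega> (lam k) (\<lambda>x. g k (x \<bullet> x) * b x)"
    and nz: "\<And>k. k < K \<Longrightarrow> \<exists>s\<in>I. g k s \<noteq> 0"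
    and lamT: "\<And>k. k < K \<Longrightarrow> lam k \<le> T"
    and t: "t \<le> T"
  shows "eig_count \<Omega> t = (\<Sum>k | k < K \<and> lam k \<le> t. card (hb k :: (real^'n \<Rightarrow> real) set))"
proof -
  let ?h = "hb :: nat \<Rightarrow> (real^'n \<Rightarrow> real) set"
  have disj: "j = k" if "b \<in> ?h j" "b \<in> ?h k" for b j k
  proof (rule ccontr)
    assume "j \<noteq> k"
    then have "ip b b = 0" using harm_orthogonal[OF n hb_harm[OF that(1)] hb_harm[OF that(2)]] by simp
    then show False using hb_orthonormal[of j] that(1) by (auto simp: orthonormal_def)
  qed
  have mult: "multiplicity_eig \<Omega> \<eta> = (\<Sum>k | k < K \<and> lam k = \<eta>. card (?h k))" if \<eta>: "\<eta> \<le> T" for \<eta>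
  proof -
    define J where "J = {k. k < K \<and> lam k = \<eta>}"
    define BB where "BB = (\<Union>k\<in>J. ?h k)"
    \<comment> \<open>The degree of a basis element is determined, since an element of two bases of
      different degrees would be orthogonal to itself.\<close>
    define deg where "deg b = (THE k. b \<in> ?h k)" for b
    define e where "e b = (\<lambda>x. g (deg b) (x \<bullet> x) * b x)" for b
    have J: "finite J" by (simp add: J_def)
    have BB: "finite BB" using J finite_hb by (auto simp: BB_def)
    have cardBB: "card BB = (\<Sum>k\<in>J. card (?h k))"
      unfolding BB_def using J finite_hb disj by (intro card_UN_disjoint) blast+
    have deg: "deg b = k" if "b \<in> ?h k" for b k
      unfolding deg_def using that disj by (intro the_equality) auto
    have ortho: "orthonormal BB"
      unfolding orthonormal_def
    proof (intro conjI ballI BB)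
      fix f assume "f \<in> BB"
      then obtain j where j: "f \<in> ?h j" by (auto simp: BB_def)
      show "cont f" by (rule harm_cont[OF hb_harm[OF j]])
      fix f' assume "f' \<in> BB"
      then obtain k where k: "f' \<in> ?h k" by (auto simp: BB_def)
      show "ip f f' = (if f = f' then 1 else 0)"
      proof (cases "j = k")
        case True
        then show ?thesis using j k hb_orthonormal[of k] by (auto simp: orthonormal_def)
      next
        case False
        then have "f \<noteq> f'" using disj j k by blast
        then show ?thesis using harm_orthogonal[OF n hb_harm[OF j] hb_harm[OF k] False] by simp
      qed
    qed
    have eige: "eigenfunction \<Omega> \<eta> (e b)" if "b \<in> BB" for b
      using that eig deg by (auto simp: BB_def J_def e_def)
    have indep: "c b = 0" if c: "\<And>x. x \<in> closure \<Omega> \<Longrightarrow> (\<Sum>b\<in>BB. c b * e b x) = 0" and b: "b \<in> BB" for c b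
    proof -
      obtain k where k: "k \<in> J" "b \<in> ?h k" using b by (auto simp: BB_def)
      then obtain s where s: "s \<in> I" "g k s \<noteq> 0" using nz by (auto simp: J_def)
      then have s0: "s > 0" using I by auto
      \<comment> \<open>Coefficients after restriction to the sphere of radius sqrt s, where
        \<open>g k\<close> does not vanish; there the relation becomes one among orthonormal
        functions.\<close>
      define a where "a b = c b * g (deg b) s * sqrt s ^ deg b" for b
      have z: "(\<Sum>b\<in>BB. a b * b \<theta>) = 0" if "norm \<theta> = 1" for \<theta>
      proof -
        have xx: "(sqrt s *\<^sub>R \<theta>) \<bullet> (sqrt s *\<^sub>R \<theta>) = s"
          using that s0 by (simp add: dot_square_norm)
        then have "sqrt s *\<^sub>R \<theta> \<in> closure \<Omega>" using sub s by auto
        then have "(\<Sum>b\<in>BB. c b * e b (sqrt s *\<^sub>R \<theta>)) = 0" by (rule c)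
        moreover have "c b * e b (sqrt s *\<^sub>R \<theta>) = a b * b \<theta>" if bb: "b \<in> BB" for b
        proof -
          obtain k where "b \<in> ?h k" using bb by (auto simp: BB_def)
          then show ?thesis unfolding e_def xx
            using hpoly_scaleR[OF harm_hpoly[OF hb_harm], of b k "sqrt s" \<theta>] by (simp add: a_def deg)
        qed
        ultimately show ?thesis by simp
      qed
      have "a b = ip (\<lambda>x. \<Sum>b\<in>BB. a b * b x) b" by (rule orthonormal_ip_sum[OF ortho b, symmetric])
      also have "\<dots> = ip (\<lambda>x. 0) b" by (rule ip_cong) (use z in auto)
      also have "\<dots> = 0" by (simp add: ip_def smean_zero)
      finally show "c b = 0" using s s0 deg[OF k(2)] by (simp add: a_def)
    qed
    \<comment> \<open>Independence of the indexed family also separates its members, so the image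
      under \<open>e\<close> keeps the cardinality.\<close>
    have inj: "inj_on e BB"
    proof (rule inj_onI, rule ccontr)
      fix b b' assume b: "b \<in> BB" "b' \<in> BB" "e b = e b'" "b \<noteq> b'"
      define c where "c f = (if f = b then 1 else if f = b' then -1 else (0::real))" for f
      have "(\<Sum>f\<in>BB. c f * e f x) = 0" for x
      proof -
        have "(\<Sum>f\<in>BB. c f * e f x) = (\<Sum>f\<in>{b,b'}. c f * e f x)"
          by (rule sum.mono_neutral_right) (use b BB in \<open>auto simp: c_def\<close>)
        then show ?thesis using b by (simp add: c_def)
      qed
      from indep[OF this b(1)] show False by (simp add: c_def)
    qed
    define A where "A = {card F | F. finite F \<and> F \<subseteq> {u. eigenfunction \<Omega> \<eta> u} \<and> lin_indep_on (closure \<Omega>) F}"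
    have "card BB \<in> A"
    proof -
      have "lin_indep_on (closure \<Omega>) (e ` BB)"
        unfolding lin_indep_on_def
      proof (intro allI impI ballI)
        fix c u assume c: "\<forall>x\<in>closure \<Omega>. (\<Sum>u\<in>e ` BB. c u * u x) = 0" and "u \<in> e ` BB"
        then obtain b where b: "b \<in> BB" "u = e b" by blast
        have "(\<Sum>b\<in>BB. (c \<circ> e) b * e b x) = 0" if "x \<in> closure \<Omega>" for x
          using c that by (simp add: sum.reindex[OF inj])
        from indep[OF this b(1)] b show "c u = 0" by simp
      qed
      moreover have "card (e ` BB) = card BB" by (rule card_image[OF inj])
      ultimately show ?thesis unfolding A_def using eige BB
        by (intro CollectI exI[of _ "e ` BB"]) auto
    qed
    moreover have "m \<le> card BB" if mA: "m \<in> A" for m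
    proof (rule ccontr)
      assume "\<not> m \<le> card BB"
      obtain F where F: "m = card F" "finite F" "\<And>u. u \<in> F \<Longrightarrow> eigenfunction \<Omega> \<eta> u" "lin_indep_on (closure \<Omega>) F"
        using mA unfolding A_def by auto
      have ex: "\<exists>a. \<forall>x. x \<bullet> x \<in> I \<longrightarrow> u x = (\<Sum>b\<in>BB. a b * e b x)" if u: "u \<in> F" for u
      proof -
        \<comment> \<open>Every sector of u is a multiple of the common profile \<open>g k\<close>,
          and only sectors with \<open>lam k = \<eta>\<close> survive; hence u is a combination of
          the functions \<open>e b\<close>.\<close>
        define c where "c k b = (SOME c. (\<forall>s\<in>I. prof k u b s = c * g k s) \<and> (c \<noteq> 0 \<longrightarrow> k < K \<and> lam k = \<eta>))" for k b
        have c': "(\<forall>s\<in>I. prof k u b s = c k b * g k s) \<and> (c k b \<noteq> 0 \<longrightarrow> k < K \<and> lam k = \<eta>)" if "b \<in> ?h k" for k b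
          unfolding c_def by (rule someI_ex[OF prof[OF \<eta> F(3)[OF u] that]])
        have c: "\<And>k b s. b \<in> ?h k \<Longrightarrow> s \<in> I \<Longrightarrow> prof k u b s = c k b * g k s"
          "\<And>k b. b \<in> ?h k \<Longrightarrow> c k b \<noteq> 0 \<Longrightarrow> k < K \<and> lam k = \<eta>"
          using c' by blast+
        have "u x = (\<Sum>b\<in>BB. c (deg b) b * e b x)" if x: "x \<bullet> x \<in> I" for x
        proof -
          have "x \<noteq> 0" using x I by auto
          have "cont u" using F(3)[OF u] smooth_continuous by (auto simp: eigenfunction_def)
          moreover have "prof k u b (x \<bullet> x) = 0" if "K \<le> k" "b \<in> ?h k" for k b
            using c(1)[OF that(2) x] c(2)[OF that(2)] that(1) by auto
          ultimately have "u x = (\<Sum>k<K. \<Sum>b\<in>?h k. prof k u b (x \<bullet> x) * b x)"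
            by (intro prof_expansion[OF n _ \<open>x \<noteq> 0\<close>]) auto
          also have "\<dots> = (\<Sum>k<K. \<Sum>b\<in>?h k. c k b * (g k (x \<bullet> x) * b x))"
            by (intro sum.cong refl) (simp add: c(1) x)
          also have "\<dots> = (\<Sum>k\<in>J. \<Sum>b\<in>?h k. c k b * (g k (x \<bullet> x) * b x))"
            by (rule sum.mono_neutral_right) (use c(2) in \<open>auto simp: J_def intro!: sum.neutral\<close>)
          also have "\<dots> = (\<Sum>k\<in>J. \<Sum>b\<in>?h k. c (deg b) b * e b x)"
            by (intro sum.cong refl) (simp add: e_def deg)
          also have "\<dots> = (\<Sum>b\<in>BB. c (deg b) b * e b x)"
            unfolding BB_def using J finite_hb disj by (intro sum.UNION_disjoint[symmetric]) blast+
          finally show ?thesis .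
        qed
        then show ?thesis by (intro exI[of _ "\<lambda>b. c (deg b) b"] allI impI)
      qed
      define a where "a u = (SOME a. \<forall>x. x \<bullet> x \<in> I \<longrightarrow> u x = (\<Sum>b\<in>BB. a b * e b x))" for u
      have a: "u x = (\<Sum>b\<in>BB. a u b * e b x)" if "u \<in> F" "x \<bullet> x \<in> I" for u x
        using someI_ex[OF ex[OF that(1)]] that(2) unfolding a_def by blast
      obtain c where c: "\<exists>u\<in>F. c u \<noteq> 0" "\<And>b. b \<in> BB \<Longrightarrow> (\<Sum>u\<in>F. c u * a u b) = 0"
        using nontrivial_relation[of BB F a] BB F \<open>\<not> m \<le> card BB\<close> by auto
      have "x \<in> {x. (\<Sum>u\<in>F. c u * u x) = 0}" if "x \<in> closure {x. x \<bullet> x \<in> I}" for x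
      proof -
        \<comment> \<open>The relation is found on spheres with squared radius in \<open>I\<close>
          and passes to the closure of the domain by continuity.\<close>
        have "closure {x. x \<bullet> x \<in> I} \<subseteq> {x. (\<Sum>u\<in>F. c u * u x) = 0}"
        proof (rule closure_minimal)
          have "cont u" if "u \<in> F" for u
            using F(3)[OF that] smooth_continuous by (auto simp: eigenfunction_def)
          then show "closed {x. (\<Sum>u\<in>F. c u * u x) = 0}"
            by (intro closed_Collect_eq continuous_intros)
          show "{x. x \<bullet> x \<in> I} \<subseteq> {x. (\<Sum>u\<in>F. c u * u x) = 0}"
          proof safe
            fix x :: "real^'n" assume x: "x \<bullet> x \<in> I"
            have "(\<Sum>u\<in>F. c u * u x) = (\<Sum>u\<in>F. \<Sum>b\<in>BB. c u * a u b * e b x)"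
              by (intro sum.cong refl) (simp add: a x sum_distrib_left mult.assoc)
            also have "\<dots> = (\<Sum>b\<in>BB. (\<Sum>u\<in>F. c u * a u b) * e b x)"
              by (subst sum.swap) (simp add: sum_distrib_right)
            finally show "(\<Sum>u\<in>F. c u * u x) = 0" by (simp add: c(2))
          qed
        qed
        then show ?thesis using that by blast
      qed
      then have "\<forall>x\<in>closure \<Omega>. (\<Sum>u\<in>F. c u * u x) = 0" using dense by blast
      then show False using F(4) c(1) unfolding lin_indep_on_def by blast
    qed
    ultimately have "Sup A = card BB" by (intro cSup_eq_maximum) auto
    then show ?thesis unfolding multiplicity_eig_def A_def[symmetric] cardBB J_def .
  qed
  have pos: "card (?h k) > 0" for k by (rule card_hb_pos[OF n])
  define S where "S = {k. k < K \<and> lam k \<le> t}"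
  have S: "finite S" by (simp add: S_def)
  have set: "{\<eta>. \<eta> \<le> t \<and> 0 < multiplicity_eig \<Omega> \<eta>} = lam ` S"
  proof (intro set_eqI iffI)
    fix \<eta> assume "\<eta> \<in> {\<eta>. \<eta> \<le> t \<and> 0 < multiplicity_eig \<Omega> \<eta>}"
    then have "\<eta> \<le> t" "0 < (\<Sum>k | k < K \<and> lam k = \<eta>. card (?h k))" using mult[of \<eta>] t by auto
    then obtain k where "k < K" "lam k = \<eta>" by (metis (mono_tags, lifting) bot_nat_0.not_eq_extremum mem_Collect_eq sum.neutral)
    then show "\<eta> \<in> lam ` S" using \<open>\<eta> \<le> t\<close> by (auto simp: S_def)
  next
    fix \<eta> assume "\<eta> \<in> lam ` S"
    then obtain k where k: "k < K" "lam k = \<eta>" "\<eta> \<le> t" by (auto simp: S_def)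
    have "card (?h k) \<le> (\<Sum>k | k < K \<and> lam k = \<eta>. card (?h k))"
      by (rule member_le_sum) (use k in auto)
    then show "\<eta> \<in> {\<eta>. \<eta> \<le> t \<and> 0 < multiplicity_eig \<Omega> \<eta>}" using mult[of \<eta>] t k pos[of k] by auto
  qed
  have "eig_count \<Omega> t = (\<Sum>\<eta>\<in>lam ` S. \<Sum>k | k \<in> S \<and> lam k = \<eta>. card (?h k))"
    unfolding eig_count_def set
  proof (rule sum.cong)
    fix \<eta> assume "\<eta> \<in> lam ` S"
    then have "\<eta> \<le> t" by (auto simp: S_def)
    then have "{k. k < K \<and> lam k = \<eta>} = {k. k \<in> S \<and> lam k = \<eta>}" by (auto simp: S_def)
    then show "multiplicity_eig \<Omega> \<eta> = (\<Sum>k | k \<in> S \<and> lam k = \<eta>. card (?h k))"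
      using mult[of \<eta>] t \<open>\<eta> \<le> t\<close> by simp
  qed simp
  also have "\<dots> = (\<Sum>k\<in>S. card (?h k))"
    by (rule sum.image_gen[OF S, symmetric])
  finally show ?thesis by (simp add: S_def)
qed

section \<open>Defining functions and normals\<close>

lemma smooth_imp_radial_derivative:
  assumes "smooth u"
  shows "((\<lambda>t. u (t *\<^sub>R x)) has_real_derivative euler u x) (at 1)"
proof -
  have "((\<lambda>t. u (t *\<^sub>R x)) has_derivative (\<lambda>h. \<Sum>i\<in>UNIV. (h *\<^sub>R x) $ i * pderiv i u (1 *\<^sub>R x))) (at 1)"
    by (rule has_derivative_compose[of "\<lambda>t. t *\<^sub>R x" _ _ _ u, OF _ has_derivative_pderiv[OF smooth_differentiable[OF assms]]])
       (auto intro!: derivative_eq_intros)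
  moreover have "(\<Sum>i\<in>UNIV. (h *\<^sub>R x) $ i * pderiv i u (1 *\<^sub>R x)) = euler u x * h" for h
    unfolding euler_def sum_distrib_right by (rule sum.cong) auto
  ultimately show ?thesis by (simp add: has_field_derivative_def)
qed

text \<open>\<gamma> rotates x in the (i,j) plane and so stays on the sphere where \<phi> vanishes;
  its velocity at 0 is the rotation field.\<close>

lemma rotf_zero_of_zero_on_sphere:
  fixes \<phi> :: "real^'n::finite \<Rightarrow> real"
  assumes \<phi>: "smooth \<phi>" and z: "\<And>y. norm y = norm x \<Longrightarrow> \<phi> y = 0"
  shows "rotf i j \<phi> x = 0"
proof (cases "i = j")
  case True then show ?thesis by (simp add: rotf_def)
next
  case False
  \<comment> \<open>\<open>?p\<close> is the projection of x to the (i,j) plane and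
    \<open>?q\<close> is \<open>?p\<close> turned by a right angle.\<close>
  let ?p = "x $ i *\<^sub>R axis i 1 + x $ j *\<^sub>R axis j 1 :: real^'n"
  let ?q = "x $ i *\<^sub>R axis j 1 - x $ j *\<^sub>R axis i 1 :: real^'n"
  define \<gamma> where "\<gamma> t = x + (cos t - 1) *\<^sub>R ?p + sin t *\<^sub>R ?q" for t
  have 1: "x \<bullet> ?p = (x $ i)\<^sup>2 + (x $ j)\<^sup>2" "x \<bullet> ?q = 0" "?p \<bullet> ?q = 0"
     "?p \<bullet> ?p = (x $ i)\<^sup>2 + (x $ j)\<^sup>2" "?q \<bullet> ?q = (x $ i)\<^sup>2 + (x $ j)\<^sup>2"
  proof -
    have ax: "axis a (1::real) $ b = (if b = a then 1 else 0)" for a b :: 'n by (simp add: axis_def)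
    show "x \<bullet> ?p = (x $ i)\<^sup>2 + (x $ j)\<^sup>2" "x \<bullet> ?q = 0" "?p \<bullet> ?q = 0"
      "?p \<bullet> ?p = (x $ i)\<^sup>2 + (x $ j)\<^sup>2" "?q \<bullet> ?q = (x $ i)\<^sup>2 + (x $ j)\<^sup>2"
      using False by (simp_all add: inner_add_left inner_add_right inner_diff_left inner_diff_right
        inner_axis inner_axis' ax power2_eq_square)
  qed
  have "\<gamma> t \<bullet> \<gamma> t = x \<bullet> x" for t
  proof -
    define R where "R = (x $ i)\<^sup>2 + (x $ j)\<^sup>2"
    have "\<gamma> t \<bullet> \<gamma> t = x \<bullet> x + 2 * (cos t - 1) * (x \<bullet> ?p) + 2 * sin t * (x \<bullet> ?q)
        + (cos t - 1)\<^sup>2 * (?p \<bullet> ?p) + 2 * (cos t - 1) * sin t * (?p \<bullet> ?q) + (sin t)\<^sup>2 * (?q \<bullet> ?q)"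
    proof -
      have "(x + c *\<^sub>R p + d *\<^sub>R q) \<bullet> (x + c *\<^sub>R p + d *\<^sub>R q) = x \<bullet> x + 2 * c * (x \<bullet> p) + 2 * d * (x \<bullet> q)
        + c\<^sup>2 * (p \<bullet> p) + 2 * c * d * (p \<bullet> q) + d\<^sup>2 * (q \<bullet> q)" for c d and p q :: "real^'n"
        by (simp add: inner_add_left inner_add_right inner_commute power2_eq_square algebra_simps)
      then show ?thesis unfolding \<gamma>_def .
    qed
    also have "\<dots> = x \<bullet> x + (2 * (cos t - 1) + (cos t - 1)\<^sup>2 + (sin t)\<^sup>2) * R"
      unfolding 1 R_def[symmetric] by (simp add: algebra_simps)
    also have "2 * (cos t - 1) + (cos t - 1)\<^sup>2 + (sin t)\<^sup>2 = 0"
      using sin_cos_squared_add[of t] by (simp add: power2_eq_square algebra_simps)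
    finally show ?thesis by simp
  qed
  then have "norm (\<gamma> t) = norm x" for t by (simp add: norm_eq_sqrt_inner)
  then have zero: "(\<lambda>t. \<phi> (\<gamma> t)) = (\<lambda>t. 0)" using z by blast
  have "(\<gamma> has_derivative (\<lambda>h. h *\<^sub>R ?q)) (at 0)"
    unfolding \<gamma>_def[abs_def] by (auto intro!: derivative_eq_intros)
  moreover have "\<gamma> 0 = x" by (simp add: \<gamma>_def)
  ultimately have "((\<lambda>t. \<phi> (\<gamma> t)) has_derivative (\<lambda>h. \<Sum>l\<in>UNIV. (h *\<^sub>R ?q) $ l * pderiv l \<phi> x)) (at 0)"
    using has_derivative_compose[of \<gamma> "\<lambda>h. h *\<^sub>R ?q" 0 UNIV \<phi>, OF _ has_derivative_pderiv[OF smooth_differentiable[OF \<phi>]]]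
    by simp
  then have "((\<lambda>t. 0) has_derivative (\<lambda>h. \<Sum>l\<in>UNIV. (h *\<^sub>R ?q) $ l * pderiv l \<phi> x)) (at (0::real))"
    unfolding zero .
  then have "(\<lambda>h. \<Sum>l\<in>UNIV. (h *\<^sub>R ?q) $ l * pderiv l \<phi> x) = (\<lambda>h::real. 0)"
    using has_derivative_unique has_derivative_const by blast
  then have "(\<Sum>l\<in>UNIV. (1 *\<^sub>R ?q) $ l * pderiv l \<phi> x) = 0" by (rule fun_cong)
  moreover have "(\<Sum>l\<in>UNIV. (1 *\<^sub>R ?q) $ l * pderiv l \<phi> x) = rotf i j \<phi> x"
  proof -
    have "(1 *\<^sub>R ?q) $ l * pderiv l \<phi> x
        = (if l = j then x $ i * pderiv j \<phi> x else 0) - (if l = i then x $ j * pderiv i \<phi> x else 0)" for l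
      by (auto simp: axis_def)
    then show ?thesis by (simp only: sum_subtractf) (simp add: rotf_def)
  qed
  ultimately show ?thesis by simp
qed

text \<open>All rotation derivatives vanish, so the gradient is radial; summing x_i times these
  relations recovers the radial coefficient.\<close>

lemma gradient_on_sphere:
  fixes \<phi> :: "real^'n::finite \<Rightarrow> real"
  assumes "smooth \<phi>" "\<And>y. norm y = norm x \<Longrightarrow> \<phi> y = 0"
  shows "(x \<bullet> x) *\<^sub>R gradient \<phi> x = euler \<phi> x *\<^sub>R x"
proof -
  have r: "x $ i * pderiv j \<phi> x = x $ j * pderiv i \<phi> x" for i j
    using rotf_zero_of_zero_on_sphere[OF assms, where i=i and j=j] by (simp add: rotf_def)
  have "(x \<bullet> x) * pderiv j \<phi> x = euler \<phi> x * x $ j" for j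
  proof -
    have "(x \<bullet> x) * pderiv j \<phi> x = (\<Sum>i\<in>UNIV. x $ i * (x $ i * pderiv j \<phi> x))"
      by (simp add: inner_sum_squares sum_distrib_right mult.assoc)
    also have "\<dots> = euler \<phi> x * x $ j"
      unfolding euler_def sum_distrib_right
    proof (rule sum.cong)
      fix i show "x $ i * (x $ i * pderiv j \<phi> x) = x $ i * pderiv i \<phi> x * x $ j"
        unfolding r[of i j] by simp
    qed simp
    finally show ?thesis .
  qed
  then show ?thesis by (simp add: vec_eq_iff gradient_def)
qed

lemma normalized_gradient:
  fixes x g :: "real^'n::finite"
  assumes "(x \<bullet> x) *\<^sub>R g = e *\<^sub>R x" "x \<noteq> 0"
  shows "(1 / norm g) *\<^sub>R g = (sgn e / norm x) *\<^sub>R x"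
proof (cases "e = 0")
  case True
  then show ?thesis using assms by auto
next
  case False
  have g: "g = (e / (x \<bullet> x)) *\<^sub>R x"
    using assms by (metis divide_inverse inner_eq_zero_iff left_inverse mult.commute scaleR_one scaleR_scaleR)
  have "norm g = \<bar>e\<bar> / norm x"
    using assms(2) unfolding g by (simp add: dot_square_norm power2_eq_square)
  then show ?thesis using False assms(2)
    by (subst g) (simp add: dot_square_norm power2_eq_square sgn_if)
qed

lemma frechet_radial:
  assumes "smooth u"
  shows "frechet_derivative u (at x) (c *\<^sub>R x) = c * euler u x"
proof -
  have "frechet_derivative u (at x) = (\<lambda>h. \<Sum>i\<in>UNIV. h $ i * pderiv i u x)"
    by (rule frechet_derivative_at[OF has_derivative_pderiv[OF smooth_differentiable[OF assms]], symmetric])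
  then show ?thesis by (simp add: euler_def sum_distrib_left mult.assoc)
qed

lemma defining_functionD:
  assumes "defining_function \<Omega> \<phi>"
  shows "smooth \<phi>" "x \<in> \<Omega> \<longleftrightarrow> \<phi> x < 0" "x \<in> frontier \<Omega> \<Longrightarrow> \<phi> x = 0" "x \<in> frontier \<Omega> \<Longrightarrow> gradient \<phi> x \<noteq> 0"
  using assms by (auto simp: defining_function_def)

text \<open>\<open>outward_normal\<close> picks some defining function by choice, and nothing else
  is known about it. The normalised gradient is therefore required to be the same for all of
  them.\<close>

lemma normal_deriv_eq:
  assumes "defining_function \<Omega> \<psi>"
    and "\<And>\<phi>. defining_function \<Omega> \<phi> \<Longrightarrow> (1 / norm (gradient \<phi> x)) *\<^sub>R gradient \<phi> x = c *\<^sub>R x"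
    and "smooth u"
  shows "normal_deriv \<Omega> u x = c * euler u x"
proof -
  have "defining_function \<Omega> (SOME \<phi>. defining_function \<Omega> \<phi>)" using assms(1) by (rule someI[of "defining_function \<Omega>"])
  then have "outward_normal \<Omega> x = c *\<^sub>R x" using assms(2) by (simp add: outward_normal_def Let_def)
  then show ?thesis by (simp add: normal_deriv_def frechet_radial assms(3))
qed

text \<open>The gradient is radial and nonzero on the sphere. Its radial coefficient cannot be
  negative, since a defining function vanishing on the sphere would then be positive just inside, at
  points of the domain. A one-sided shell suffices, so ball and annulus are covered
  together.\<close>

lemma normal_deriv_outer:
  fixes \<Omega> :: "(real^'n::finite) set"
  assumes ex: "defining_function \<Omega> \<psi>"
    and sph: "sphere 0 1 \<subseteq> frontier \<Omega>"
    and inside: "d > 0" "\<And>y. 1 - d < norm y \<Longrightarrow> norm y < 1 \<Longrightarrow> y \<in> \<Omega>"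
    and x: "norm x = 1" and u: "smooth u"
  shows "normal_deriv \<Omega> u x = euler u x"
proof -
  have "(1 / norm (gradient \<phi> x)) *\<^sub>R gradient \<phi> x = 1 *\<^sub>R x" if "defining_function \<Omega> \<phi>" for \<phi>
  proof -
    note \<phi> = defining_functionD[OF that]
    have xx: "x \<bullet> x = 1" using x by (simp add: norm_eq_1)
    have fr: "y \<in> frontier \<Omega>" if "norm y = norm x" for y using that sph x by auto
    have g: "(x \<bullet> x) *\<^sub>R gradient \<phi> x = euler \<phi> x *\<^sub>R x"
      by (rule gradient_on_sphere[OF \<phi>(1)]) (use fr \<phi>(3) in blast)
    have "euler \<phi> x \<noteq> 0" using g \<phi>(4)[OF fr] xx by auto
    moreover have "\<not> euler \<phi> x < 0"
    proof
      assume "euler \<phi> x < 0"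
      from DERIV_neg_dec_left[OF smooth_imp_radial_derivative[OF \<phi>(1)] this]
      obtain e where e: "e > 0" "\<And>h. h > 0 \<Longrightarrow> h < e \<Longrightarrow> \<phi> (1 *\<^sub>R x) < \<phi> ((1 - h) *\<^sub>R x)" by blast
      define h where "h = min (e/2) (min (d/2) (1/2))"
      have h: "h > 0" "h < e" "h < d" "h < 1" using e(1) inside(1) by (auto simp: h_def min_def)
      have "norm ((1 - h) *\<^sub>R x) = 1 - h" using h x by simp
      then have "(1 - h) *\<^sub>R x \<in> \<Omega>" using h by (intro inside(2)) auto
      then show False using e(2)[OF h(1,2)] \<phi>(2,3) fr[of x] by (simp add: not_less[symmetric])
    qed
    ultimately have "sgn (euler \<phi> x) = 1" by simp
    then show ?thesis using normalized_gradient[OF g] x by (metis div_by_1 norm_zero zero_neq_one)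
  qed
  from normal_deriv_eq[OF ex this u] show ?thesis by simp
qed

text \<open>Here the domain lies outside the sphere, which reverses the sign: the outward normal is
  -x/\<epsilon>.\<close>

lemma normal_deriv_inner:
  fixes \<Omega> :: "(real^'n::finite) set"
  assumes ex: "defining_function \<Omega> \<psi>" and \<epsilon>: "\<epsilon> > 0"
    and sph: "sphere 0 \<epsilon> \<subseteq> frontier \<Omega>"
    and inside: "d > 0" "\<And>y. \<epsilon> < norm y \<Longrightarrow> norm y < \<epsilon> + d \<Longrightarrow> y \<in> \<Omega>"
    and x: "norm x = \<epsilon>" and u: "smooth u"
  shows "normal_deriv \<Omega> u x = - euler u x / \<epsilon>"
proof -
  have x0: "x \<noteq> 0" using x \<epsilon> by auto
  have "(1 / norm (gradient \<phi> x)) *\<^sub>R gradient \<phi> x = (- 1 / \<epsilon>) *\<^sub>R x" if "defining_function \<Omega> \<phi>" for \<phi>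
  proof -
    note \<phi> = defining_functionD[OF that]
    have fr: "y \<in> frontier \<Omega>" if "norm y = norm x" for y using that sph x by auto
    have g: "(x \<bullet> x) *\<^sub>R gradient \<phi> x = euler \<phi> x *\<^sub>R x"
      by (rule gradient_on_sphere[OF \<phi>(1)]) (use fr \<phi>(3) in blast)
    have "euler \<phi> x \<noteq> 0" using g \<phi>(4)[OF fr] x0 by auto
    moreover have "\<not> euler \<phi> x > 0"
    proof
      assume "euler \<phi> x > 0"
      from DERIV_pos_inc_right[OF smooth_imp_radial_derivative[OF \<phi>(1)] this]
      obtain e where e: "e > 0" "\<And>h. h > 0 \<Longrightarrow> h < e \<Longrightarrow> \<phi> (1 *\<^sub>R x) < \<phi> ((1 + h) *\<^sub>R x)" by blast
      define h where "h = min (e/2) (d / (2 * \<epsilon>))"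
      have h: "h > 0" "h < e" "h * \<epsilon> < d" using e(1) inside(1) \<epsilon> by (auto simp: h_def min_def field_simps)
      have "norm ((1 + h) *\<^sub>R x) = (1 + h) * \<epsilon>" using h x by simp
      then have "(1 + h) *\<^sub>R x \<in> \<Omega>" using h \<epsilon> by (intro inside(2)) (auto simp: algebra_simps)
      then show False using e(2)[OF h(1,2)] \<phi>(2,3) fr[of x] by (simp add: not_less[symmetric])
    qed
    ultimately have "sgn (euler \<phi> x) = - 1" by simp
    then show ?thesis using normalized_gradient[OF g x0] x by simp
  qed
  from normal_deriv_eq[OF ex this u] show ?thesis by simp
qed

lemma gradient_radial:
  assumes "cinf g"
  shows "gradient (\<lambda>x. g (x \<bullet> x)) x = (2 * deriv g (x \<bullet> x)) *\<^sub>R x"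
  by (simp add: vec_eq_iff gradient_def pderiv_radial[OF assms])

lemma inner_self_less_1: "x \<bullet> x < 1 \<longleftrightarrow> norm x < 1" and inner_self_eq_1: "x \<bullet> x = 1 \<longleftrightarrow> norm x = 1"
  for x :: "'a::real_inner"
  by (auto simp: norm_eq_sqrt_inner)

lemma defining_function_ball: "defining_function (ball (0::real^'n::finite) 1) (\<lambda>x. x \<bullet> x - 1)"
proof -
  have c: "cinf (\<lambda>s. s - 1)" by (intro cinf_diff) auto
  have d: "deriv (\<lambda>s::real. s - 1) s = 1" for s
    by (rule DERIV_imp_deriv) (auto intro!: derivative_eq_intros)
  have "gradient (\<lambda>x. x \<bullet> x - 1) x \<noteq> 0" if "norm x = 1" for x :: "real^'n"
    using gradient_radial[OF c, of x] that by (auto simp: d)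
  then show ?thesis unfolding defining_function_def
    using smooth_radial[OF c]
    by (auto simp: inner_self_less_1 inner_self_eq_1 dist_norm)
qed

lemma defining_function_annulus:
  assumes \<epsilon>: "0 < \<epsilon>" "\<epsilon> < 1"
  shows "defining_function (annulus \<epsilon> :: (real^'n::finite) set) (\<lambda>x. (x \<bullet> x - 1) * (x \<bullet> x - \<epsilon>\<^sup>2))"
proof -
  have c: "cinf (\<lambda>s. (s - 1) * (s - \<epsilon>\<^sup>2))" by (intro cinf_mult cinf_diff) auto
  have d: "deriv (\<lambda>s. (s - 1) * (s - \<epsilon>\<^sup>2)) s = 2 * s - 1 - \<epsilon>\<^sup>2" for s
    by (rule DERIV_imp_deriv) (auto intro!: derivative_eq_intros)
  have e2: "\<epsilon>\<^sup>2 < 1" using \<epsilon> by (simp add: power_less_one_iff)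
  have sgn: "(x \<bullet> x - 1) * (x \<bullet> x - \<epsilon>\<^sup>2) < 0 \<longleftrightarrow> \<epsilon> < norm x \<and> norm x < 1"
    "(x \<bullet> x - 1) * (x \<bullet> x - \<epsilon>\<^sup>2) = 0 \<longleftrightarrow> norm x = 1 \<or> norm x = \<epsilon>" for x :: "real^'n"
  proof -
    have a: "\<epsilon>\<^sup>2 < x \<bullet> x \<longleftrightarrow> \<epsilon> < norm x" "x \<bullet> x = \<epsilon>\<^sup>2 \<longleftrightarrow> norm x = \<epsilon>"
    proof -
      show "x \<bullet> x = \<epsilon>\<^sup>2 \<longleftrightarrow> norm x = \<epsilon>"
        unfolding dot_square_norm using \<epsilon> by (intro power2_eq_iff_nonneg) auto
      show "\<epsilon>\<^sup>2 < x \<bullet> x \<longleftrightarrow> \<epsilon> < norm x"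
        unfolding dot_square_norm using \<epsilon>
        by (intro iffI power_strict_mono) (auto intro: power2_less_imp_less[of \<epsilon>])
    qed
    show "(x \<bullet> x - 1) * (x \<bullet> x - \<epsilon>\<^sup>2) < 0 \<longleftrightarrow> \<epsilon> < norm x \<and> norm x < 1"
      unfolding a(1)[symmetric] inner_self_less_1[symmetric] using e2 by (auto simp: mult_less_0_iff)
    show "(x \<bullet> x - 1) * (x \<bullet> x - \<epsilon>\<^sup>2) = 0 \<longleftrightarrow> norm x = 1 \<or> norm x = \<epsilon>"
      unfolding a(2)[symmetric] inner_self_eq_1[symmetric] by auto
  qed
  have "gradient (\<lambda>x. (x \<bullet> x - 1) * (x \<bullet> x - \<epsilon>\<^sup>2)) x \<noteq> 0" if "norm x = 1 \<or> norm x = \<epsilon>" for x :: "real^'n"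
  proof -
    have "x \<noteq> 0" using that \<epsilon> by auto
    moreover have "2 * (x \<bullet> x) - 1 - \<epsilon>\<^sup>2 \<noteq> 0"
      using that e2 by (auto simp: dot_square_norm)
    ultimately show ?thesis using gradient_radial[OF c, of x] by (simp add: d)
  qed
  then show ?thesis unfolding defining_function_def frontier_annulus[OF assms]
    using smooth_radial[OF c] sgn by (auto simp: annulus_def)
qed

lemma smooth_bounded_domain_annulus:
  assumes \<epsilon>: "0 < \<epsilon>" "\<epsilon> < 1" and n: "CARD('n::finite) \<ge> 2"
  shows "smooth_bounded_domain (annulus \<epsilon> :: (real^'n) set)"
  unfolding smooth_bounded_domain_def
proof (intro conjI)
  show "open (annulus \<epsilon> :: (real^'n) set)" by (rule open_annulus)
  show "connected (annulus \<epsilon> :: (real^'n) set)"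
    using connected_annulus(1)[of \<epsilon> "0 :: real^'n" 1] n by (simp add: annulus_def)
  show "bounded (annulus \<epsilon> :: (real^'n) set)"
    by (rule bounded_subset[of "ball 0 1"]) (auto simp: annulus_def)
  have "((\<epsilon> + 1) / 2) *\<^sub>R axis undefined 1 \<in> (annulus \<epsilon> :: (real^'n) set)"
    using \<epsilon> by (simp add: annulus_def)
  then show "annulus \<epsilon> \<noteq> ({} :: (real^'n) set)" by blast
  show "\<exists>\<phi>. defining_function (annulus \<epsilon> :: (real^'n) set) \<phi>"
    using defining_function_annulus[OF \<epsilon>] by blast
qed

lemma normal_deriv_ball:
  assumes "norm (x::real^'n::finite) = 1" "smooth u"
  shows "normal_deriv (ball 0 1) u x = euler u x"
  using assms by (intro normal_deriv_outer[OF defining_function_ball, where d=1]) auto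

lemma normal_deriv_annulus_outer:
  assumes \<epsilon>: "0 < \<epsilon>" "\<epsilon> < 1" and "norm (x::real^'n::finite) = 1" "smooth u"
  shows "normal_deriv (annulus \<epsilon>) u x = euler u x"
  using assms by (intro normal_deriv_outer[OF defining_function_annulus[OF \<epsilon>], where d="1-\<epsilon>"])
    (auto simp: frontier_annulus, auto simp: annulus_def)

lemma normal_deriv_annulus_inner:
  assumes \<epsilon>: "0 < \<epsilon>" "\<epsilon> < 1" and "norm (x::real^'n::finite) = \<epsilon>" "smooth u"
  shows "normal_deriv (annulus \<epsilon>) u x = - euler u x / \<epsilon>"
  using assms by (intro normal_deriv_inner[OF defining_function_annulus[OF \<epsilon>], where d="1-\<epsilon>"])
    (auto simp: frontier_annulus, auto simp: annulus_def)

section \<open>The spectrum of the ball\<close>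

text \<open>A primitive of s^(-q). For n >= 4 the logarithmic case q = 1 occurs exactly for n = 4 in
  degree 0.\<close>

definition jint :: "real \<Rightarrow> real \<Rightarrow> real" where
  "jint q s = (if q = 1 then ln s else s powr (1 - q) / (1 - q))"

lemma jint_has_derivative: "s > 0 \<Longrightarrow> (jint q has_real_derivative s powr (- q)) (at s)"
proof (cases "q = 1")
  case True
  assume "s > 0"
  then have "(ln has_real_derivative s powr (- q)) (at s)"
    using DERIV_ln[of s] True by (simp add: powr_minus)
  then show ?thesis using True by (simp add: jint_def[abs_def])
next
  case False
  assume "s > 0"
  then have "((\<lambda>s. s powr (1 - q) / (1 - q)) has_real_derivative (1 - q) * s powr (1 - q - 1) / (1 - q)) (at s)"
    by (intro DERIV_cdivide has_real_derivative_powr)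
  then show ?thesis using False by (simp add: jint_def[abs_def])
qed

text \<open>A common identity for both cases of \<open>jint\<close>: the constant 1 of the
  logarithmic case cancels in differences, so Green's identity later needs no case
  distinction.\<close>

lemma jint_relation: "s > 0 \<Longrightarrow> q * jint q s + s powr (1 - q) = jint q s + (if q = 1 then 1 else 0)"
  by (simp add: jint_def field_simps)

lemma eq_up_to_const:
  fixes f g :: "real \<Rightarrow> real"
  assumes "convex I" "\<And>s. s \<in> I \<Longrightarrow> (f has_real_derivative D s) (at s)"
    "\<And>s. s \<in> I \<Longrightarrow> (g has_real_derivative D s) (at s)"
  shows "\<exists>c. \<forall>s\<in>I. f s = g s + c"
proof -
  have "\<exists>c. \<forall>s\<in>I. f s - g s = c"
  proof (rule has_field_derivative_zero_constant[OF assms(1)])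
    fix s assume s: "s \<in> I"
    show "((\<lambda>s. f s - g s) has_real_derivative 0) (at s within I)"
      using DERIV_diff[OF assms(2,3)[OF s]] by (simp add: has_field_derivative_at_within)
  qed
  then obtain c where "\<And>s. s \<in> I \<Longrightarrow> f s - g s = c" by blast
  then show ?thesis by (intro exI[of _ c] ballI) (simp add: algebra_simps)
qed

lemma prof_eq_cmult:
  fixes v w :: "real^'n::finite \<Rightarrow> real"
  assumes s: "s > 0" and vw: "\<And>x. x \<bullet> x = s \<Longrightarrow> v x = c * w x"
  shows "prof k v Y s = c * prof k w Y s"
proof -
  have "smean (\<lambda>x. v x * Y x) (sqrt s) = smean (\<lambda>x. c * (w x * Y x)) (sqrt s)"
  proof (rule smean_cong)
    fix \<theta> :: "real^'n" assume "norm \<theta> = 1"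
    then have "(sqrt s *\<^sub>R \<theta>) \<bullet> (sqrt s *\<^sub>R \<theta>) = s" using s by (simp add: dot_square_norm)
    then show "v (sqrt s *\<^sub>R \<theta>) * Y (sqrt s *\<^sub>R \<theta>) = c * (w (sqrt s *\<^sub>R \<theta>) * Y (sqrt s *\<^sub>R \<theta>))"
      by (simp add: vw)
  qed
  then show ?thesis by (simp only: prof_def smean_cmult) simp
qed

lemma prof_eq_0: "s > 0 \<Longrightarrow> (\<And>x. x \<bullet> x = s \<Longrightarrow> v x = 0) \<Longrightarrow> prof k v Y s = 0"
  using prof_eq_cmult[of s v 0 "\<lambda>x. 0" k Y] by simp

lemma qexp_pos: "CARD('n::finite) \<ge> 4 \<Longrightarrow> qexp TYPE('n) k \<ge> 1"
  by (simp add: qexp_def)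

lemma flux_times_powr:
  fixes s q \<alpha> \<beta> \<kappa> :: real
  assumes "s > 0"
  shows "(\<alpha> * s powr (q + 1) / (2 * (q + 1)) + \<beta> * s / 2 - 2 * q * \<kappa>) * s powr (- q - 1) / 2
    = \<alpha> / (4 * (q + 1)) + \<beta> * s powr (- q) / 4 - q * \<kappa> * s powr (- q - 1)"
proof -
  have e: "(\<alpha> * X / (2 * Q) + \<beta> * s / 2 - 2 * q * \<kappa>) * w / 2 = \<alpha> / (4 * Q) * (X * w) + \<beta> / 4 * (s * w) - q * \<kappa> * w" for X Q w :: real
    by (simp add: algebra_simps add_divide_distrib diff_divide_distrib)
  have w1: "s powr (q + 1) * s powr (- q - 1) = 1"
    using assms by (simp flip: powr_add)
  have w2: "s * s powr (- q - 1) = s powr (- q)"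
    using assms powr_mult_base[of s "- q - 1"] by simp
  show ?thesis unfolding e w1 w2 by simp
qed

text \<open>Four successive integrations: the flux of the Laplacian is constant, then its profile,
  then the flux of u, then the profile of u. The constants are normalised so that \<alpha> and
  \<beta> are the coefficients of the two radial harmonics in the Laplacian, and \<kappa> and d
  those in u.\<close>

lemma prof_ode:
  fixes u :: "real^'n::finite \<Rightarrow> real"
  assumes n: "CARD('n) \<ge> 4" and I: "convex I" "I \<subseteq> {0<..}"
    and u: "smooth u" and Y: "harm k Y"
    and lap: "\<And>x. x \<bullet> x \<in> I \<Longrightarrow> laplacian (laplacian u) x = 0"
    and q: "q = qexp TYPE('n) k"
  shows "\<exists>\<alpha> \<beta> \<kappa> d. \<forall>s\<in>I.
    prof k (laplacian u) Y s = \<alpha> + \<beta> * s powr (- q) \<and>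
    flux k u Y s = \<alpha> * s powr (q + 1) / (2 * (q + 1)) + \<beta> * s / 2 - 2 * q * \<kappa> \<and>
    prof k u Y s = \<alpha> * s / (4 * (q + 1)) + \<beta> * jint q s / 4 + \<kappa> * s powr (- q) + d \<and>
    flux k (laplacian u) Y s = - 2 * q * \<beta>"
proof -
  let ?h = "laplacian u"
  have q1: "q \<ge> 1" using qexp_pos[OF n] q by simp
  have h: "smooth ?h" by (rule smooth_laplacian[OF u])
  have pos: "s > 0" if "s \<in> I" for s using I that by auto
  have pd: "(prof k v Y has_real_derivative flux k v Y s * s powr (- q - 1) / 2) (at s)" if "smooth v" "s \<in> I" for v s
  proof -
    have eq: "(prof k (euler v) Y s - real k * prof k v Y s) / (2 * s) = flux k v Y s * s powr (- q - 1) / 2"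
      using pos[OF that(2)] by (simp add: flux_def q[symmetric] powr_diff powr_minus field_simps)
    show ?thesis using prof_has_derivative[OF that(1) Y pos[OF that(2)]] by (simp only: eq)
  qed
  have "\<exists>c. \<forall>s\<in>I. flux k ?h Y s = 0 + c"
  proof (rule eq_up_to_const[OF I(1), where D="\<lambda>s. 0"])
    fix s assume s: "s \<in> I"
    have "prof k (laplacian ?h) Y s = 0" using lap s pos[OF s] by (intro prof_eq_0) auto
    then show "(flux k ?h Y has_real_derivative 0) (at s)"
      using flux_has_derivative[OF h Y pos[OF s]] by simp
  qed auto
  then obtain \<gamma> where \<gamma>: "\<And>s. s \<in> I \<Longrightarrow> flux k ?h Y s = \<gamma>" by auto
  define \<beta> where "\<beta> = - \<gamma> / (2 * q)"
  have \<gamma>\<beta>: "\<gamma> = - 2 * q * \<beta>" using q1 by (simp add: \<beta>_def)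
  have "\<exists>c. \<forall>s\<in>I. prof k ?h Y s = \<beta> * s powr (- q) + c"
  proof (rule eq_up_to_const[OF I(1)])
    fix s assume s: "s \<in> I"
    show "(prof k ?h Y has_real_derivative \<gamma> * s powr (- q - 1) / 2) (at s)"
      using pd[OF h s] \<gamma>[OF s] by simp
    have "((\<lambda>s. \<beta> * s powr (- q)) has_real_derivative \<beta> * (- q * s powr (- q - 1))) (at s)"
      using pos[OF s] by (intro DERIV_cmult has_real_derivative_powr)
    then show "((\<lambda>s. \<beta> * s powr (- q)) has_real_derivative \<gamma> * s powr (- q - 1) / 2) (at s)"
      by (simp add: \<gamma>\<beta> algebra_simps)
  qed
  then obtain \<alpha> where \<alpha>: "\<And>s. s \<in> I \<Longrightarrow> prof k ?h Y s = \<alpha> + \<beta> * s powr (- q)"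
    by (auto simp: add.commute)
  have "\<exists>c. \<forall>s\<in>I. flux k u Y s = (\<alpha> * s powr (q + 1) / (2 * (q + 1)) + \<beta> * s / 2) + c"
  proof (rule eq_up_to_const[OF I(1)])
    fix s assume s: "s \<in> I"
    show "(flux k u Y has_real_derivative s powr q * (\<alpha> + \<beta> * s powr (- q)) / 2) (at s)"
      using flux_has_derivative[OF u Y pos[OF s]] \<alpha>[OF s] by (simp add: q)
    have "((\<lambda>s. \<alpha> * s powr (q + 1) / (2 * (q + 1)) + \<beta> * s / 2) has_real_derivative
        \<alpha> * ((q + 1) * s powr (q + 1 - 1)) / (2 * (q + 1)) + \<beta> * 1 / 2) (at s)"
      using pos[OF s] by (intro DERIV_add DERIV_cdivide DERIV_cmult has_real_derivative_powr DERIV_ident)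
    moreover have eq: "\<alpha> * ((q + 1) * s powr (q + 1 - 1)) / (2 * (q + 1)) + \<beta> * 1 / 2 = s powr q * (\<alpha> + \<beta> * s powr (- q)) / 2"
      using pos[OF s] q1 by (simp add: powr_minus field_simps)
    ultimately show "((\<lambda>s. \<alpha> * s powr (q + 1) / (2 * (q + 1)) + \<beta> * s / 2) has_real_derivative s powr q * (\<alpha> + \<beta> * s powr (- q)) / 2) (at s)"
      by (simp only: eq)
  qed
  then obtain c where c: "\<And>s. s \<in> I \<Longrightarrow> flux k u Y s = \<alpha> * s powr (q + 1) / (2 * (q + 1)) + \<beta> * s / 2 + c" by blast
  define \<kappa> where "\<kappa> = - c / (2 * q)"
  have c\<kappa>: "c = - 2 * q * \<kappa>" using q1 by (simp add: \<kappa>_def)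
  have "\<exists>d. \<forall>s\<in>I. prof k u Y s = (\<alpha> * s / (4 * (q + 1)) + \<beta> * jint q s / 4 + \<kappa> * s powr (- q)) + d"
  proof (rule eq_up_to_const[OF I(1)])
    fix s assume s: "s \<in> I"
    have eq: "flux k u Y s * s powr (- q - 1) / 2 = \<alpha> / (4 * (q + 1)) + \<beta> * s powr (- q) / 4 + \<kappa> * (- q * s powr (- q - 1))"
      using flux_times_powr[OF pos[OF s], of \<alpha> q \<beta> \<kappa>] by (simp add: c[OF s] c\<kappa>)
    show "(prof k u Y has_real_derivative \<alpha> / (4 * (q + 1)) + \<beta> * s powr (- q) / 4 + \<kappa> * (- q * s powr (- q - 1))) (at s)"
      using pd[OF u s] by (simp only: eq)
    have "((\<lambda>s. \<alpha> * s / (4 * (q + 1)) + \<beta> * jint q s / 4 + \<kappa> * s powr (- q)) has_real_derivative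
      \<alpha> * 1 / (4 * (q + 1)) + \<beta> * s powr (- q) / 4 + \<kappa> * (- q * s powr (- q - 1))) (at s)"
      using pos[OF s] by (intro DERIV_add DERIV_cdivide DERIV_cmult has_real_derivative_powr DERIV_ident jint_has_derivative)
    then show "((\<lambda>s. \<alpha> * s / (4 * (q + 1)) + \<beta> * jint q s / 4 + \<kappa> * s powr (- q)) has_real_derivative
      \<alpha> / (4 * (q + 1)) + \<beta> * s powr (- q) / 4 + \<kappa> * (- q * s powr (- q - 1))) (at s)" by simp
  qed
  then obtain d where d: "\<And>s. s \<in> I \<Longrightarrow> prof k u Y s = \<alpha> * s / (4 * (q + 1)) + \<beta> * jint q s / 4 + \<kappa> * s powr (- q) + d" by blast
  show ?thesis
    by (intro exI[of _ \<alpha>] exI[of _ \<beta>] exI[of _ \<kappa>] exI[of _ d] ballI conjI)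
       (auto simp: \<alpha> d c c\<kappa> \<gamma> \<gamma>\<beta>)
qed

text \<open>The Laplacian of $g(|x|^2)\,Y(x)$ in terms of $g$, with $q = n/2 - 1 + k$ and $k$ the degree of $Y$.\<close>

definition radial_op :: "real \<Rightarrow> (real \<Rightarrow> real) \<Rightarrow> real \<Rightarrow> real" where
  "radial_op q g s = 4 * s * deriv (deriv g) s + 4 * (q + 1) * deriv g s"

lemma cinf_radial_op: "cinf g \<Longrightarrow> cinf (radial_op q g)"
  unfolding radial_op_def[abs_def] by (intro cinf_add cinf_mult cinf_const cinf_id cinf_deriv)

lemma laplacian_radial_harm:
  fixes Y :: "real^'n::finite \<Rightarrow> real"
  assumes g: "cinf g" and Y: "harm k Y"
  shows "laplacian (\<lambda>x. g (x \<bullet> x) * Y x) = (\<lambda>x. radial_op (qexp TYPE('n) k) g (x \<bullet> x) * Y x)"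
proof
  fix x
  show "laplacian (\<lambda>x. g (x \<bullet> x) * Y x) x = radial_op (qexp TYPE('n) k) g (x \<bullet> x) * Y x"
    using laplacian_radial_mult[OF g harm_smooth[OF Y] euler_hpoly[OF harm_hpoly[OF Y]], of x] Y
    by (simp add: radial_op_def qexp_def harm_def algebra_simps)
qed

lemma smooth_radial_harm: "cinf g \<Longrightarrow> harm k Y \<Longrightarrow> smooth (\<lambda>x. g (x \<bullet> x) * Y x)"
  by (intro smooth_mult smooth_radial harm_smooth)

lemma euler_radial_harm:
  assumes "cinf g" "harm k Y"
  shows "euler (\<lambda>x. g (x \<bullet> x) * Y x) x = (2 * (x \<bullet> x) * deriv g (x \<bullet> x) + real k * g (x \<bullet> x)) * Y x"
  using euler_radial_mult[OF assms(1) harm_smooth euler_hpoly[OF harm_hpoly]] assms(2) by blast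

text \<open>The Laplacian of (|x|^2 - 1) Y is (2n + 4k) Y, which is harmonic, and its normal
  derivative on the unit sphere is 2Y; the eigenvalue is the quotient.\<close>

lemma eigenfunction_ball_radial:
  fixes Y :: "real^'n::finite \<Rightarrow> real"
  assumes Y: "harm k Y"
  shows "eigenfunction (ball 0 1) (real CARD('n) + 2 * real k) (\<lambda>x. (x \<bullet> x - 1) * Y x)"
proof -
  define q where "q = qexp TYPE('n) k"
  let ?g = "\<lambda>s::real. s - 1"
  have g: "cinf ?g" by (intro cinf_diff) auto
  have d: "deriv ?g = (\<lambda>s. 1)"
    by (rule ext, rule DERIV_imp_deriv) (auto intro!: derivative_eq_intros)
  have "radial_op q ?g = (\<lambda>s. 4 * (q + 1))"
    by (simp add: radial_op_def[abs_def] d)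
  then have lap: "laplacian (\<lambda>x. (x \<bullet> x - 1) * Y x) = (\<lambda>x. 4 * (q + 1) * Y x)"
    using laplacian_radial_harm[OF g Y] by (simp add: q_def)
  have sm: "smooth (\<lambda>x. (x \<bullet> x - 1) * Y x)" by (rule smooth_radial_harm[OF g Y])
  have "laplacian (\<lambda>x. 4 * (q + 1) * Y x) x = 0" for x
    using Y by (simp only: laplacian_cmult[OF harm_smooth[OF Y]]) (simp add: harm_def)
  moreover have "4 * (q + 1) * Y x = (real CARD('n) + 2 * real k) * normal_deriv (ball 0 1) (\<lambda>x. (x \<bullet> x - 1) * Y x) x" if "norm x = 1" for x
  proof -
    have "normal_deriv (ball 0 1) (\<lambda>x. (x \<bullet> x - 1) * Y x) x = 2 * Y x"
      unfolding normal_deriv_ball[OF that sm] euler_radial_harm[OF g Y] d inner_self_eq_1[THEN iffD2, OF that] by simp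
    then show ?thesis by (simp only:) (simp add: q_def qexp_def algebra_simps)
  qed
  ultimately show ?thesis unfolding eigenfunction_def lap using sm
    by (auto simp: inner_self_eq_1[THEN iffD2])
qed

text \<open>The factor s^q / s^k is s^(n/2 - 1), at most s for s <= 1 when n >= 4, and the spherical
  mean of a smooth function is bounded. This growth bound excludes the singular solutions at the
  centre of the ball.\<close>

lemma prof_bound:
  fixes v :: "real^'n::finite \<Rightarrow> real"
  assumes n: "CARD('n) \<ge> 4" and v: "smooth v" and Y: "harm k Y"
  shows "\<exists>C. \<forall>s\<in>{0<..1}. \<bar>s powr qexp TYPE('n) k * prof k v Y s\<bar> \<le> C * s"
proof -
  have bd: "\<exists>B. \<forall>x\<in>cball 0 1. \<bar>f x\<bar> \<le> B" if "smooth f" for f :: "real^'n \<Rightarrow> real"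
  proof -
    have "compact (f ` cball 0 1)"
      by (intro compact_continuous_image smooth_continuous that) auto
    then have "bounded (f ` cball 0 1)" by (rule compact_imp_bounded)
    then show ?thesis by (auto simp: bounded_iff)
  qed
  obtain B where B: "\<And>x. x \<in> cball 0 1 \<Longrightarrow> \<bar>v x * Y x\<bar> \<le> B"
    using bd[OF smooth_mult[OF v harm_smooth[OF Y]]] by blast
  define C where "C = B * smean (\<lambda>x::real^'n. 1) 1"
  have "\<bar>s powr qexp TYPE('n) k * prof k v Y s\<bar> \<le> \<bar>C\<bar> * s" if s: "s \<in> {0<..1}" for s
  proof -
    have "\<bar>smean (\<lambda>x. v x * Y x) (sqrt s)\<bar> \<le> B * smean (\<lambda>x::real^'n. 1) (sqrt s)"
    proof (rule smean_abs_le)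
      show "cont (\<lambda>x. v x * Y x)" by (intro smooth_continuous smooth_mult v harm_smooth[OF Y])
      fix \<theta> :: "real^'n" assume "norm \<theta> = 1"
      then show "\<bar>v (sqrt s *\<^sub>R \<theta>) * Y (sqrt s *\<^sub>R \<theta>)\<bar> \<le> B" using s by (intro B) auto
    qed
    also have "smean (\<lambda>x::real^'n. 1) (sqrt s) = smean (\<lambda>x::real^'n. 1) 1"
      by (simp add: smean_def)
    finally have 1: "\<bar>smean (\<lambda>x. v x * Y x) (sqrt s)\<bar> \<le> \<bar>C\<bar>" by (simp add: C_def)
    have "s powr qexp TYPE('n) k = s powr (real CARD('n) / 2 - 1) * s ^ k"
      using s by (simp add: qexp_def powr_add powr_realpow)
    then have "\<bar>s powr qexp TYPE('n) k * prof k v Y s\<bar> = s powr (real CARD('n) / 2 - 1) * \<bar>smean (\<lambda>x. v x * Y x) (sqrt s)\<bar>"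
      using s by (simp add: prof_def abs_mult)
    also have "\<dots> \<le> s powr 1 * \<bar>C\<bar>"
      using s n 1 by (intro mult_mono powr_mono') auto
    finally show ?thesis using s by (simp add: mult.commute)
  qed
  then show ?thesis by blast
qed

lemma zero_of_le_linear:
  fixes c C :: real
  assumes "\<And>s. s \<in> {0<..1} \<Longrightarrow> \<bar>c\<bar> \<le> C * s"
  shows "c = 0"
proof (rule ccontr)
  assume "c \<noteq> 0"
  have C: "\<bar>c\<bar> \<le> C" using assms[of 1] by simp
  then have "\<bar>c\<bar> / (2 * C) \<in> {0<..1}" using \<open>c \<noteq> 0\<close> by (auto simp: field_simps)
  from assms[OF this] have "\<bar>c\<bar> \<le> C * (\<bar>c\<bar> / (2 * C))" .
  moreover have "C * (\<bar>c\<bar> / (2 * C)) = \<bar>c\<bar> / 2" using C \<open>c \<noteq> 0\<close> by auto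
  ultimately show False using \<open>c \<noteq> 0\<close> by linarith
qed

text \<open>Smoothness at the origin makes both fluxes O(s), which forces \<beta> = 0 and then
  \<kappa> = 0. Vanishing at s = 1 fixes d, and the remaining boundary condition leaves \<alpha> = 0
  or \<eta> = 2 (q + 1) = n + 2k.\<close>

lemma ball_profile:
  fixes u :: "real^'n::finite \<Rightarrow> real"
  assumes n: "CARD('n) \<ge> 4" and eig: "eigenfunction (ball 0 1) \<eta> u" and Y: "harm k Y"
  shows "\<exists>c. (\<forall>s\<in>{0<..1}. prof k u Y s = c * (s - 1)) \<and> (c \<noteq> 0 \<longrightarrow> real CARD('n) + 2 * real k = \<eta>)"
proof -
  define q where "q = qexp TYPE('n) k"
  have q1: "q \<ge> 1" using qexp_pos[OF n] q_def by simp
  have u: "smooth u" using eig by (simp add: eigenfunction_def)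
  have bd: "u x = 0" "laplacian u x = \<eta> * euler u x" if "norm x = 1" for x
    using eig that normal_deriv_ball[OF that u] by (auto simp: eigenfunction_def)
  have "{x. norm x \<le> 1} \<subseteq> {x. laplacian (laplacian u) x = 0}"
  proof -
    have "closure (ball 0 1) \<subseteq> {x. laplacian (laplacian u) x = 0}"
    proof (rule closure_minimal)
      show "ball 0 1 \<subseteq> {x. laplacian (laplacian u) x = 0}" using eig by (auto simp: eigenfunction_def)
      show "closed {x. laplacian (laplacian u) x = 0}"
        by (intro closed_Collect_eq smooth_continuous smooth_laplacian u continuous_on_const)
    qed
    then show ?thesis by (auto simp: cball_def)
  qed
  then have lap: "laplacian (laplacian u) x = 0" if "x \<bullet> x \<in> {0<..1}" for x
    using that by (auto simp: norm_eq_sqrt_inner)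
  have I: "convex {0<..1::real}" "{0<..1::real} \<subseteq> {0<..}"
    by (auto simp: convex_real_interval)
  obtain \<alpha> \<beta> \<kappa> d where ode:
    "\<And>s. s \<in> {0<..1} \<Longrightarrow> prof k (laplacian u) Y s = \<alpha> + \<beta> * s powr (- q)"
    "\<And>s. s \<in> {0<..1} \<Longrightarrow> flux k u Y s = \<alpha> * s powr (q + 1) / (2 * (q + 1)) + \<beta> * s / 2 - 2 * q * \<kappa>"
    "\<And>s. s \<in> {0<..1} \<Longrightarrow> prof k u Y s = \<alpha> * s / (4 * (q + 1)) + \<beta> * jint q s / 4 + \<kappa> * s powr (- q) + d"
    "\<And>s. s \<in> {0<..1} \<Longrightarrow> flux k (laplacian u) Y s = - 2 * q * \<beta>"
    using prof_ode[OF n I u Y lap q_def] by blast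
  have fl: "\<exists>C. \<forall>s\<in>{0<..1}. \<bar>flux k v Y s\<bar> \<le> C * s" if v: "smooth v" for v :: "real^'n \<Rightarrow> real"
  proof -
    obtain C1 C2 where C: "\<And>s. s \<in> {0<..1} \<Longrightarrow> \<bar>s powr q * prof k (euler v) Y s\<bar> \<le> C1 * s"
       "\<And>s. s \<in> {0<..1} \<Longrightarrow> \<bar>s powr q * prof k v Y s\<bar> \<le> C2 * s"
      using prof_bound[OF n smooth_euler[OF v] Y] prof_bound[OF n v Y] unfolding q_def by blast
    have "\<bar>flux k v Y s\<bar> \<le> (C1 + real k * C2) * s" if s: "s \<in> {0<..1}" for s
    proof -
      have "flux k v Y s = s powr q * prof k (euler v) Y s - real k * (s powr q * prof k v Y s)"
        by (simp add: flux_def q_def algebra_simps)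
      also have "\<bar>\<dots>\<bar> \<le> \<bar>s powr q * prof k (euler v) Y s\<bar> + real k * \<bar>s powr q * prof k v Y s\<bar>"
        by (metis abs_mult abs_of_nat abs_triangle_ineq4)
      also have "\<dots> \<le> C1 * s + real k * (C2 * s)" using C s by (intro add_mono mult_left_mono) auto
      finally show ?thesis by (simp add: algebra_simps)
    qed
    then show ?thesis by blast
  qed
  obtain C where C: "\<And>s. s \<in> {0<..1} \<Longrightarrow> \<bar>- 2 * q * \<beta>\<bar> \<le> C * s"
    using fl[OF smooth_laplacian[OF u]] ode(4) by force
  then have "- 2 * q * \<beta> = 0" by (rule zero_of_le_linear)
  then have \<beta>: "\<beta> = 0" using q1 by simp
  obtain C' where C': "\<And>s. s \<in> {0<..1} \<Longrightarrow> \<bar>flux k u Y s\<bar> \<le> C' * s" using fl[OF u] by blast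
  have "\<bar>2 * q * \<kappa>\<bar> \<le> (C' + \<bar>\<alpha> / (2 * (q + 1))\<bar>) * s" if s: "s \<in> {0<..1}" for s
  proof -
    have "s powr (q + 1) \<le> s powr 1" using s q1 by (intro powr_mono') auto
    then have "\<bar>\<alpha> / (2 * (q + 1))\<bar> * s powr (q + 1) \<le> \<bar>\<alpha> / (2 * (q + 1))\<bar> * s"
      using s by (intro mult_left_mono) auto
    moreover have "2 * q * \<kappa> = \<alpha> / (2 * (q + 1)) * s powr (q + 1) - flux k u Y s"
      using ode(2)[OF s] \<beta> by simp
    moreover have "\<bar>\<alpha> / (2 * (q + 1)) * s powr (q + 1)\<bar> = \<bar>\<alpha> / (2 * (q + 1))\<bar> * s powr (q + 1)"
      by (simp add: abs_mult)
    ultimately show ?thesis using C'[OF s] by (simp only: distrib_right)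
  qed
  then have "2 * q * \<kappa> = 0" by (rule zero_of_le_linear)
  then have \<kappa>: "\<kappa> = 0" using q1 by simp
  have one: "(1::real) \<in> {0<..1}" by simp
  have p1: "prof k u Y 1 = 0" using bd by (intro prof_eq_0) (auto simp: inner_self_eq_1)
  have d: "d = - \<alpha> / (4 * (q + 1))" using ode(3)[OF one] p1 \<beta> \<kappa> by simp
  have "prof k u Y s = \<alpha> / (4 * (q + 1)) * (s - 1)" if "s \<in> {0<..1}" for s
    using ode(3)[OF that] \<beta> \<kappa> d by (simp add: algebra_simps diff_divide_distrib)
  moreover have "real CARD('n) + 2 * real k = \<eta>" if "\<alpha> / (4 * (q + 1)) \<noteq> 0"
  proof -
    have "prof k (laplacian u) Y 1 = \<eta> * prof k (euler u) Y 1"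
      using bd by (intro prof_eq_cmult) (auto simp: inner_self_eq_1)
    then have "\<alpha> = \<eta> * flux k u Y 1" using ode(1)[OF one] \<beta> p1 by (simp add: flux_def)
    then have "\<alpha> = \<eta> * (\<alpha> / (2 * (q + 1)))" using ode(2)[OF one] \<beta> \<kappa> by simp
    then have "\<eta> * \<alpha> = (2 * (q + 1)) * \<alpha>" using q1 by (simp add: field_simps)
    moreover have "\<alpha> \<noteq> 0" using that by auto
    ultimately have "\<eta> = 2 * (q + 1)" using mult_right_cancel[of \<alpha> \<eta> "2 * (q + 1)"] by blast
    then show ?thesis by (simp add: q_def qexp_def)
  qed
  ultimately show ?thesis by blast
qed

lemma eig_count_ball:
  assumes n: "CARD('n::finite) \<ge> 4" and K: "t < real CARD('n) + 2 * real K"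
  shows "eig_count (ball (0::real^'n) 1) t
    = (\<Sum>k | k < K \<and> real CARD('n) + 2 * real k \<le> t. card (hb k :: (real^'n \<Rightarrow> real) set))"
proof -
  let ?n = "real CARD('n)"
  have sq: "{x :: real^'n. x \<bullet> x \<in> {0<..1}} = cball 0 1 - {0}"
    by (auto simp: norm_eq_sqrt_inner)
  have "eig_count (ball (0::real^'n) 1) t = (\<Sum>k | k < K \<and> ?n + 2 * real k \<le> t. card (hb k :: (real^'n \<Rightarrow> real) set))"
  \<comment> \<open>The origin is left out of \<open>I\<close> because profiles divide by s^k.
    \<open>T\<close> exceeds every n + 2k with k < K but stays below n + 2K, so no further degree
    enters.\<close>
  proof (rule eig_count_of_profiles[where I="{0<..1}" and T="max t (?n + 2 * real K - 1)" and g="\<lambda>k s. s - 1"])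
    show "CARD('n) \<ge> 2" using n by simp
    show "{x :: real^'n. x \<bullet> x \<in> {0<..1}} \<subseteq> closure (ball 0 1)" unfolding sq by auto
    have "(0::real^'n) \<in> closure (cball 0 1 - {0})"
      unfolding closure_approachable
    proof (intro allI impI)
      fix e :: real assume "e > 0"
      then show "\<exists>y\<in>cball 0 1 - {0}. dist y (0::real^'n) < e"
        by (intro bexI[of _ "min (e/2) 1 *\<^sub>R axis undefined 1"]) (auto simp: min_def)
    qed
    then show "closure (ball 0 1) \<subseteq> closure {x :: real^'n. x \<bullet> x \<in> {0<..1}}"
      unfolding sq using closure_subset[of "cball (0::real^'n) 1 - {0}"] by auto
    fix \<eta> k and u b :: "real^'n \<Rightarrow> real"
    assume "\<eta> \<le> max t (?n + 2 * real K - 1)" "eigenfunction (ball 0 1) \<eta> u" "b \<in> hb k"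
    then show "\<exists>c. (\<forall>s\<in>{0<..1}. prof k u b s = c * (s - 1)) \<and> (c \<noteq> 0 \<longrightarrow> k < K \<and> ?n + 2 * real k = \<eta>)"
      using ball_profile[OF n _ hb_harm, of \<eta> u b k] K by fastforce
  next
    show "\<exists>s\<in>{0<..1}. s - 1 \<noteq> (0::real)" by (rule bexI[of _ "1/2"]) auto
  qed (use eigenfunction_ball_radial[OF hb_harm] in \<open>auto simp: max_def\<close>)
  then show ?thesis .
qed

section \<open>The radial problem on the annulus\<close>

text \<open>The radial solution whose Laplacian has profile $\alpha + \beta s^{-q}$ and which vanishes at $s = 1$; the constant
  \<open>bcoef\<close> makes it vanish at $s = \epsilon^2$ as well. The entries below express the remaining boundary conditions as a
  symmetric linear system for $(\alpha, \beta)$.\<close>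

definition bcoef :: "real \<Rightarrow> real \<Rightarrow> real \<Rightarrow> real \<Rightarrow> real" where
  "bcoef q \<epsilon> \<alpha> \<beta> = (\<alpha> * (1 - \<epsilon>\<^sup>2) / (4 * (q + 1)) + \<beta> * (jint q 1 - jint q (\<epsilon>\<^sup>2)) / 4) / ((\<epsilon>\<^sup>2) powr (- q) - 1)"

definition gsol :: "real \<Rightarrow> real \<Rightarrow> real \<Rightarrow> real \<Rightarrow> real \<Rightarrow> real" where
  "gsol q \<epsilon> \<alpha> \<beta> s = \<alpha> * (s - 1) / (4 * (q + 1)) + \<beta> * (jint q s - jint q 1) / 4 + bcoef q \<epsilon> \<alpha> \<beta> * (s powr (- q) - 1)"

definition entA :: "real \<Rightarrow> real \<Rightarrow> real \<Rightarrow> real" where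
  "entA q \<epsilon> t = 1 + \<epsilon> * (\<epsilon>\<^sup>2) powr q - t * (1 - (\<epsilon>\<^sup>2) powr (q + 1)) / (2 * (q + 1))"

definition entB :: "real \<Rightarrow> real \<Rightarrow> real" where
  "entB \<epsilon> t = 1 + \<epsilon> - t * (1 - \<epsilon>\<^sup>2) / 2"

definition entC :: "real \<Rightarrow> real \<Rightarrow> real \<Rightarrow> real" where
  "entC q \<epsilon> t = 1 + \<epsilon> * (\<epsilon>\<^sup>2) powr (- q) - t * (jint q 1 - jint q (\<epsilon>\<^sup>2)) / 2"

text \<open>Up to a common factor, the matrix is the boundary Gram matrix of the harmonics Y and
  |x|^(2-n-2k) Y minus t times their L2 Gram matrix on the annulus. This is the dual form of the
  problem, in terms of the harmonic function \<Delta>u.\<close>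

definition ker :: "real \<Rightarrow> real \<Rightarrow> real \<Rightarrow> real \<Rightarrow> real \<Rightarrow> bool" where
  "ker q \<epsilon> t \<alpha> \<beta> \<longleftrightarrow> entA q \<epsilon> t * \<alpha> + entB \<epsilon> t * \<beta> = 0 \<and> entB \<epsilon> t * \<alpha> + entC q \<epsilon> t * \<beta> = 0"

lemma gsol_cmult: "gsol q \<epsilon> (c * \<alpha>) (c * \<beta>) s = c * gsol q \<epsilon> \<alpha> \<beta> s"
proof -
  have "bcoef q \<epsilon> (c * \<alpha>) (c * \<beta>) = c * bcoef q \<epsilon> \<alpha> \<beta>"
    by (simp add: bcoef_def algebra_simps add_divide_distrib)
  then show ?thesis by (simp add: gsol_def algebra_simps)
qed

context
  fixes q \<epsilon> :: real
  assumes q: "q \<ge> 1" and \<epsilon>: "0 < \<epsilon>" "\<epsilon> < 1"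
begin

lemma eps_sq: "0 < \<epsilon>\<^sup>2" "\<epsilon>\<^sup>2 < 1"
  using \<epsilon> by (auto simp: power_less_one_iff)

lemma powr_neg_q_gt_1: "(\<epsilon>\<^sup>2) powr (- q) > 1"
  using powr_less_mono'[of "\<epsilon>\<^sup>2" "- q" 0] eps_sq q by simp

lemma bcoef_eq: "bcoef q \<epsilon> \<alpha> \<beta> * ((\<epsilon>\<^sup>2) powr (- q) - 1)
    = \<alpha> * (1 - \<epsilon>\<^sup>2) / (4 * (q + 1)) + \<beta> * (jint q 1 - jint q (\<epsilon>\<^sup>2)) / 4"
  using powr_neg_q_gt_1 by (simp add: bcoef_def)

lemma gsol_boundary: "gsol q \<epsilon> \<alpha> \<beta> 1 = 0" "gsol q \<epsilon> \<alpha> \<beta> (\<epsilon>\<^sup>2) = 0"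
proof -
  show "gsol q \<epsilon> \<alpha> \<beta> 1 = 0" by (simp add: gsol_def)
  have "gsol q \<epsilon> \<alpha> \<beta> (\<epsilon>\<^sup>2) = \<alpha> * (\<epsilon>\<^sup>2 - 1) / (4 * (q + 1)) + \<beta> * (jint q (\<epsilon>\<^sup>2) - jint q 1) / 4
     + (\<alpha> * (1 - \<epsilon>\<^sup>2) / (4 * (q + 1)) + \<beta> * (jint q 1 - jint q (\<epsilon>\<^sup>2)) / 4)"
    by (simp only: gsol_def bcoef_eq)
  also have "\<dots> = \<alpha> * ((\<epsilon>\<^sup>2 - 1) + (1 - \<epsilon>\<^sup>2)) / (4 * (q + 1)) + \<beta> * ((jint q (\<epsilon>\<^sup>2) - jint q 1) + (jint q 1 - jint q (\<epsilon>\<^sup>2))) / 4"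
    by (simp only: distrib_left add_divide_distrib)
  finally show "gsol q \<epsilon> \<alpha> \<beta> (\<epsilon>\<^sup>2) = 0" by simp
qed

text \<open>2 s^(q+1) times the derivative of \<open>gsol\<close>, the counterpart of
  \<open>flux\<close> for the explicit solution.\<close>

definition gflux :: "real \<Rightarrow> real \<Rightarrow> real \<Rightarrow> real" where
  "gflux \<alpha> \<beta> s = \<alpha> * s powr (q + 1) / (2 * (q + 1)) + \<beta> * s / 2 - 2 * q * bcoef q \<epsilon> \<alpha> \<beta>"

text \<open>These are Green's identities for the profile against the two radial harmonic profiles
  $1$ and $s^{-q}$; their right hand sides are the rows of the mass matrix.\<close>

lemma gflux_green_1:
  "gflux \<alpha> \<beta> 1 - gflux \<alpha> \<beta> (\<epsilon>\<^sup>2) = \<alpha> * (1 - (\<epsilon>\<^sup>2) powr (q + 1)) / (2 * (q + 1)) + \<beta> * (1 - \<epsilon>\<^sup>2) / 2"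
  by (simp add: gflux_def right_diff_distrib diff_divide_distrib)

lemma gflux_green_2:
  "gflux \<alpha> \<beta> 1 - (\<epsilon>\<^sup>2) powr (- q) * gflux \<alpha> \<beta> (\<epsilon>\<^sup>2)
    = \<alpha> * (1 - \<epsilon>\<^sup>2) / 2 + \<beta> * (jint q 1 - jint q (\<epsilon>\<^sup>2)) / 2"
proof -
  define a where "a = \<epsilon>\<^sup>2"
  have a: "a > 0" using eps_sq by (simp add: a_def)
  define b where "b = bcoef q \<epsilon> \<alpha> \<beta>"
  define J where "J = jint q 1 - jint q a"
  have b: "b * (a powr (- q) - 1) = \<alpha> * (1 - a) / (4 * (q + 1)) + \<beta> * J / 4"
    using bcoef_eq by (simp add: a_def b_def J_def)
  have p: "a powr (- q) * a powr (q + 1) = a" "a powr (- q) * a = a powr (1 - q)"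
    using a powr_mult_base[of a "- q"] by (simp_all add: powr_add[symmetric] mult.commute[of _ a])
  have jr: "1 - a powr (1 - q) + q * J = J"
    using jint_relation[of 1 q] jint_relation[OF a, of q] by (simp add: J_def algebra_simps)
  have "gflux \<alpha> \<beta> 1 - a powr (- q) * gflux \<alpha> \<beta> a
    = \<alpha> / (2 * (q + 1)) * (1 - a powr (- q) * a powr (q + 1)) + \<beta> / 2 * (1 - a powr (- q) * a) + 2 * q * (b * (a powr (- q) - 1))"
    by (simp add: gflux_def b_def[symmetric] algebra_simps)
  also have "\<dots> = \<alpha> * (1 - a) * (1 / (2 * (q + 1)) + 2 * q / (4 * (q + 1))) + \<beta> / 2 * (1 - a powr (1 - q) + q * J)"
    unfolding p b by (simp add: algebra_simps add_divide_distrib)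
  also have "1 / (2 * (q + 1)) + 2 * q / (4 * (q + 1)) = 1 / 2"
  proof -
    have "1 / (2 * Q) + 2 * (Q - 1) / (4 * Q) = 1 / 2" if "Q > 0" for Q :: real
      using that by (simp add: field_simps)
    from this[of "q + 1"] q show ?thesis by simp
  qed
  also have "\<alpha> * (1 - a) * (1 / 2) + \<beta> / 2 * (1 - a powr (1 - q) + q * J) = \<alpha> * (1 - a) / 2 + \<beta> * J / 2"
    unfolding jr by simp
  finally show ?thesis by (simp add: a_def J_def)
qed

text \<open>Let F and G be the defects of the boundary conditions at s = 1 and s = \<epsilon>^2. By
  Green's identities the rows of the system are -(F - G) and -(F - Z G) with Z =
  (\<epsilon>^2)^(-q). As Z > 1, they vanish together exactly when F and G do.\<close>

lemma ker_iff_boundary: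
  "ker q \<epsilon> t \<alpha> \<beta> \<longleftrightarrow> t * gflux \<alpha> \<beta> 1 = \<alpha> + \<beta> \<and>
     t * gflux \<alpha> \<beta> (\<epsilon>\<^sup>2) = - \<epsilon> * (\<epsilon>\<^sup>2) powr q * (\<alpha> + \<beta> * (\<epsilon>\<^sup>2) powr (- q))"
proof -
  define X where "X = (\<epsilon>\<^sup>2) powr q"
  define Z where "Z = (\<epsilon>\<^sup>2) powr (- q)"
  have XZ: "X * Z = 1" using eps_sq by (simp add: X_def Z_def powr_minus)
  have Z1: "Z > 1" using powr_neg_q_gt_1 by (simp add: Z_def)
  define F where "F = t * gflux \<alpha> \<beta> 1 - (\<alpha> + \<beta>)"
  define G where "G = t * gflux \<alpha> \<beta> (\<epsilon>\<^sup>2) + \<epsilon> * X * (\<alpha> + \<beta> * Z)"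
  have XXZ: "X * (\<beta> * Z) = \<beta>" "Z * X = 1" using XZ by (auto simp: mult.left_commute mult.commute)
  have 1: "entA q \<epsilon> t * \<alpha> + entB \<epsilon> t * \<beta> = - (F - G)"
  proof -
    have "t * gflux \<alpha> \<beta> 1 - t * gflux \<alpha> \<beta> (\<epsilon>\<^sup>2) = t * (\<alpha> * (1 - (\<epsilon>\<^sup>2) powr (q + 1)) / (2 * (q + 1)) + \<beta> * (1 - \<epsilon>\<^sup>2) / 2)"
      using gflux_green_1[of \<alpha> \<beta>] by (simp only: right_diff_distrib[symmetric])
    moreover have "entA q \<epsilon> t * \<alpha> + entB \<epsilon> t * \<beta> = \<alpha> + \<beta> + \<epsilon> * (X * \<alpha>) + \<epsilon> * \<beta>
        - t * (\<alpha> * (1 - (\<epsilon>\<^sup>2) powr (q + 1)) / (2 * (q + 1)) + \<beta> * (1 - \<epsilon>\<^sup>2) / 2)"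
      by (simp add: entA_def entB_def X_def algebra_simps)
    moreover have "\<epsilon> * X * (\<alpha> + \<beta> * Z) = \<epsilon> * (X * \<alpha>) + \<epsilon> * \<beta>"
      using XXZ by (simp add: distrib_left mult.assoc)
    ultimately show ?thesis by (simp add: F_def G_def)
  qed
  have 2: "entB \<epsilon> t * \<alpha> + entC q \<epsilon> t * \<beta> = - (F - Z * G)"
  proof -
    have "t * gflux \<alpha> \<beta> 1 - Z * (t * gflux \<alpha> \<beta> (\<epsilon>\<^sup>2)) = t * (gflux \<alpha> \<beta> 1 - Z * gflux \<alpha> \<beta> (\<epsilon>\<^sup>2))"
      by (simp add: algebra_simps)
    also have "\<dots> = t * (\<alpha> * (1 - \<epsilon>\<^sup>2) / 2 + \<beta> * (jint q 1 - jint q (\<epsilon>\<^sup>2)) / 2)"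
      unfolding Z_def gflux_green_2 ..
    finally have "t * gflux \<alpha> \<beta> 1 - Z * (t * gflux \<alpha> \<beta> (\<epsilon>\<^sup>2)) = \<dots>" .
    moreover have "entB \<epsilon> t * \<alpha> + entC q \<epsilon> t * \<beta> = \<alpha> + \<beta> + \<epsilon> * \<alpha> + \<epsilon> * (Z * \<beta>)
        - t * (\<alpha> * (1 - \<epsilon>\<^sup>2) / 2 + \<beta> * (jint q 1 - jint q (\<epsilon>\<^sup>2)) / 2)"
      by (simp add: entB_def entC_def Z_def algebra_simps)
    moreover have "Z * (\<epsilon> * X * (\<alpha> + \<beta> * Z)) = \<epsilon> * \<alpha> + \<epsilon> * (Z * \<beta>)"
    proof -
      have "Z * (\<epsilon> * X * (\<alpha> + \<beta> * Z)) = \<epsilon> * (Z * X) * (\<alpha> + \<beta> * Z)" by (simp only: ac_simps)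
      then show ?thesis unfolding XXZ by (simp add: algebra_simps)
    qed
    ultimately show ?thesis unfolding F_def G_def distrib_left[of Z] by simp
  qed
  have "F - G = 0 \<and> F - Z * G = 0 \<longleftrightarrow> F = 0 \<and> G = 0"
  proof
    assume "F - G = 0 \<and> F - Z * G = 0"
    then have "(Z - 1) * G = 0" "F = G" by (auto simp: algebra_simps)
    then show "F = 0 \<and> G = 0" using Z1 by auto
  qed simp
  then show ?thesis unfolding ker_def 1 2 by (auto simp: F_def G_def X_def Z_def)
qed

lemma gsol_has_derivative:
  assumes "s > 0"
  shows "(gsol q \<epsilon> \<alpha> \<beta> has_real_derivative
    \<alpha> / (4 * (q + 1)) + \<beta> * s powr (- q) / 4 - q * bcoef q \<epsilon> \<alpha> \<beta> * s powr (- q - 1)) (at s)"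
proof -
  have "(gsol q \<epsilon> \<alpha> \<beta> has_real_derivative
     \<alpha> * (1 - 0) / (4 * (q + 1)) + \<beta> * (s powr (- q) - 0) / 4 + bcoef q \<epsilon> \<alpha> \<beta> * (- q * s powr (- q - 1) - 0)) (at s)"
    unfolding gsol_def[abs_def] using assms
    by (intro DERIV_add DERIV_cdivide DERIV_cmult DERIV_diff DERIV_ident DERIV_const jint_has_derivative has_real_derivative_powr)
  then show ?thesis by (simp add: algebra_simps)
qed

text \<open>If the profile vanished on the interval, differentiating, multiplying by s^(q+1) and
  differentiating again would leave \<alpha> s^q + \<beta> = 0; one more derivative gives \<alpha> =
  0 and then \<beta> = 0.\<close>

lemma gsol_nontrivial:
  assumes "\<alpha> \<noteq> 0 \<or> \<beta> \<noteq> 0"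
  shows "\<exists>s\<in>{\<epsilon>\<^sup>2..1}. gsol q \<epsilon> \<alpha> \<beta> s \<noteq> 0"
proof (rule ccontr)
  assume "\<not> ?thesis"
  then have z0: "\<And>s. s \<in> {\<epsilon>\<^sup>2<..<1} \<Longrightarrow> gsol q \<epsilon> \<alpha> \<beta> s = 0" by auto
  have dz: "D = 0" if f: "\<And>s. s \<in> {\<epsilon>\<^sup>2<..<1} \<Longrightarrow> f s = 0" and D: "(f has_real_derivative D) (at s)" and s: "s \<in> {\<epsilon>\<^sup>2<..<1}" for f D s
  proof -
    have "((\<lambda>_. 0) has_real_derivative D) (at s)"
      by (rule has_field_derivative_transform_within_open[OF D, of "{\<epsilon>\<^sup>2<..<1}"]) (use f s in auto)
    then show ?thesis using DERIV_unique DERIV_const by blast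
  qed
  have pos: "s > 0" if "s \<in> {\<epsilon>\<^sup>2<..<1}" for s
    using less_trans[OF eps_sq(1), of s] that by simp
  let ?b = "bcoef q \<epsilon> \<alpha> \<beta>"
  have z1: "\<alpha> / (4 * (q + 1)) * s powr (q + 1) + \<beta> / 4 * s - q * ?b = 0" if s: "s \<in> {\<epsilon>\<^sup>2<..<1}" for s
  proof -
    have "0 = s powr (q + 1) * (\<alpha> / (4 * (q + 1)) + \<beta> * s powr (- q) / 4 - q * ?b * s powr (- q - 1))"
      using dz[OF z0 gsol_has_derivative[OF pos[OF s]] s] by simp
    also have "\<dots> = \<alpha> / (4 * (q + 1)) * s powr (q + 1) + \<beta> / 4 * (s powr (q + 1) * s powr (- q)) - q * ?b * (s powr (q + 1) * s powr (- q - 1))"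
      by (simp add: algebra_simps)
    finally show ?thesis using pos[OF s] by (simp flip: powr_add)
  qed
  have z2: "\<alpha> / (4 * (q + 1)) * ((q + 1) * s powr (q + 1 - 1)) + \<beta> / 4 * 1 - 0 = 0" if s: "s \<in> {\<epsilon>\<^sup>2<..<1}" for s
    by (rule dz[of "\<lambda>s. \<alpha> / (4 * (q + 1)) * s powr (q + 1) + \<beta> / 4 * s - q * ?b", OF z1 _ s], assumption) (use pos[OF s] in \<open>intro DERIV_add DERIV_diff DERIV_cmult DERIV_ident DERIV_const has_real_derivative_powr\<close>)
  have z2': "\<alpha> * s powr q + \<beta> = 0" if "s \<in> {\<epsilon>\<^sup>2<..<1}" for s
  proof -
    have e: "\<alpha> / (4 * Q) * (Q * s powr q) + \<beta> / 4 = (\<alpha> * s powr q + \<beta>) / 4" if "Q \<noteq> 0" for Q :: real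
      using that by (simp add: field_simps)
    have "q + 1 \<noteq> 0" using q by simp
    from z2[OF that] e[OF this] have "(\<alpha> * s powr q + \<beta>) / 4 = 0"
      unfolding add_diff_cancel_right' mult_1_right diff_zero by (metis (no_types))
    then show ?thesis by simp
  qed
  define s where "s = (\<epsilon>\<^sup>2 + 1) / 2"
  have s: "s \<in> {\<epsilon>\<^sup>2<..<1}" using eps_sq by (simp add: s_def)
  have "\<alpha> * (q * s powr (q - 1)) + 0 = 0"
    by (rule dz[of "\<lambda>s. \<alpha> * s powr q + \<beta>", OF z2' _ s], assumption) (use pos[OF s] in \<open>intro DERIV_add DERIV_cmult DERIV_const has_real_derivative_powr\<close>)
  then have "\<alpha> = 0" using q pos[OF s] by simp
  then show False using z2'[OF s] assms by simp
qed

text \<open>\<open>eigenfunction\<close> asks for smoothness on all of space, while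
  \<open>gsol\<close> is singular at s = 0. Composing it with a positive smooth modification of the
  identity changes it only inside the hole.\<close>

lemma smooth_radial_solution:
  "\<exists>g. cinf g \<and> (\<forall>s\<in>{\<epsilon>\<^sup>2..1}. g s = gsol q \<epsilon> \<alpha> \<beta> s
      \<and> deriv g s = gflux \<alpha> \<beta> s * s powr (- q - 1) / 2
      \<and> radial_op q g s = \<alpha> + \<beta> * s powr (- q) \<and> radial_op q (radial_op q g) s = 0)"
proof -
  define b where "b = bcoef q \<epsilon> \<alpha> \<beta>"
  \<comment> \<open>Starting at half of \<epsilon>^2 gives an open set around the closed interval,
    so the derivatives agree at its endpoints too.\<close>
  define S where "S = {\<epsilon>\<^sup>2/2<..}"
  have S: "open S" by (simp add: S_def)
  have pos: "s > 0" if "s \<in> S" for s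
    using less_trans[OF half_gt_zero[OF eps_sq(1)], of s] that by (simp add: S_def)
  obtain \<tau> where \<tau>: "cinf \<tau>" "\<And>s. \<tau> s > 0" "\<And>s. s \<ge> \<epsilon>\<^sup>2/2 \<Longrightarrow> \<tau> s = s"
    using cinf_positive_extension[of "\<epsilon>\<^sup>2/2"] eps_sq by auto
  define g where "g s = gsol q \<epsilon> \<alpha> \<beta> (\<tau> s)" for s
  have "cinf (\<lambda>s. jint q (\<tau> s))"
  proof (cases "q = 1")
    case True then show ?thesis using \<tau> by (simp add: jint_def cinf_ln)
  next
    case False
    have "cinf (\<lambda>s. \<tau> s powr (1 - q) * (1 / (1 - q)))" using \<tau> by (intro cinf_mult cinf_powr cinf_const)
    then show ?thesis using False by (simp add: jint_def)
  qed
  then have "cinf (\<lambda>s. \<alpha> / (4 * (q + 1)) * (\<tau> s - 1) + \<beta> / 4 * (jint q (\<tau> s) - jint q 1) + b * (\<tau> s powr (- q) - 1))"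
    using \<tau> by (intro cinf_add cinf_mult cinf_diff cinf_powr cinf_const)
  then have g: "cinf g" by (simp add: g_def[abs_def] gsol_def b_def)
  have de: "deriv f s = D" if "\<And>s. s \<in> S \<Longrightarrow> f s = h s" "(h has_real_derivative D) (at s)" "s \<in> S" for f h D s
    by (rule DERIV_imp_deriv, rule has_field_derivative_transform_within_open[OF that(2) S that(3)]) (simp add: that(1))
  have gS: "g s = gsol q \<epsilon> \<alpha> \<beta> s" if "s \<in> S" for s
    using that \<tau>(3) by (simp add: g_def S_def)
  have d1: "deriv g s = \<alpha> / (4 * (q + 1)) + \<beta> * s powr (- q) / 4 - q * b * s powr (- q - 1)" if "s \<in> S" for s
    using de[OF gS gsol_has_derivative[OF pos[OF that]] that] by (simp add: b_def)
  have d2: "deriv (deriv g) s = - q * \<beta> * s powr (- q - 1) / 4 + q * (q + 1) * b * s powr (- q - 2)" if s: "s \<in> S" for s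
  proof -
    have "((\<lambda>s. \<alpha> / (4 * (q + 1)) + \<beta> * s powr (- q) / 4 - q * b * s powr (- q - 1)) has_real_derivative
        0 + \<beta> * (- q * s powr (- q - 1)) / 4 - q * b * ((- q - 1) * s powr (- q - 1 - 1))) (at s)"
      using pos[OF s] by (intro DERIV_add DERIV_diff DERIV_cdivide DERIV_cmult DERIV_const has_real_derivative_powr)
    from de[OF d1 this s] show ?thesis by (simp add: algebra_simps)
  qed
  have sp: "s * s powr (- q - 1) = s powr (- q)" "s * s powr (- q - 2) = s powr (- q - 1)" if "s \<in> S" for s
  proof -
    have "1 + (- q - 1) = - q" "1 + (- q - 2) = - q - 1" by simp_all
    then show "s * s powr (- q - 1) = s powr (- q)" "s * s powr (- q - 2) = s powr (- q - 1)"
      using powr_mult_base[of s "- q - 1"] powr_mult_base[of s "- q - 2"] pos[OF that] by (simp_all only: less_imp_le)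
  qed
  have r1: "radial_op q g s = \<alpha> + \<beta> * s powr (- q)" if s: "s \<in> S" for s
  proof -
    define A where "A = \<alpha> / (4 * (q + 1))"
    have A: "4 * (q + 1) * A = \<alpha>" using q by (simp add: A_def)
    have "radial_op q g s = 4 * (q + 1) * A - q * \<beta> * (s * s powr (- q - 1)) + 4 * q * (q + 1) * b * (s * s powr (- q - 2))
        + (q + 1) * \<beta> * s powr (- q) - 4 * (q + 1) * q * b * s powr (- q - 1)"
      unfolding radial_op_def d1[OF s] d2[OF s] A_def[symmetric] by (simp add: algebra_simps)
    then show ?thesis unfolding sp[OF s] A by (simp add: algebra_simps)
  qed
  have e1: "deriv (radial_op q g) s = - q * \<beta> * s powr (- q - 1)" if s: "s \<in> S" for s
  proof -
    have "((\<lambda>s. \<alpha> + \<beta> * s powr (- q)) has_real_derivative 0 + \<beta> * (- q * s powr (- q - 1))) (at s)"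
      using pos[OF s] by (intro DERIV_add DERIV_cmult DERIV_const has_real_derivative_powr)
    from de[OF r1 this s] show ?thesis by simp
  qed
  have e2: "deriv (deriv (radial_op q g)) s = q * (q + 1) * \<beta> * s powr (- q - 2)" if s: "s \<in> S" for s
  proof -
    have "((\<lambda>s. - q * \<beta> * s powr (- q - 1)) has_real_derivative - q * \<beta> * ((- q - 1) * s powr (- q - 1 - 1))) (at s)"
      using pos[OF s] by (intro DERIV_cmult has_real_derivative_powr)
    from de[OF e1 this s] show ?thesis by (simp add: algebra_simps)
  qed
  have r2: "radial_op q (radial_op q g) s = 0" if s: "s \<in> S" for s
  proof -
    have "radial_op q (radial_op q g) s = 4 * q * (q + 1) * \<beta> * (s * s powr (- q - 2)) - 4 * (q + 1) * q * \<beta> * s powr (- q - 1)"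
      by (simp only: radial_op_def[of q "radial_op q g"] e1[OF s] e2[OF s]) (simp add: algebra_simps)
    then show ?thesis unfolding sp[OF s] by simp
  qed
  have fl: "deriv g s = gflux \<alpha> \<beta> s * s powr (- q - 1) / 2" if s: "s \<in> S" for s
    using flux_times_powr[OF pos[OF s], of \<alpha> q \<beta> b] by (simp add: d1[OF s] gflux_def b_def[symmetric])
  have "{\<epsilon>\<^sup>2..1} \<subseteq> S"
  proof
    fix s assume "s \<in> {\<epsilon>\<^sup>2..1}"
    then have "\<epsilon>\<^sup>2 / 2 < s" using eps_sq(1) unfolding atLeastAtMost_iff by linarith
    then show "s \<in> S" by (simp add: S_def)
  qed
  then show ?thesis using g gS fl r1 r2 by (intro exI[of _ g]) blast
qed

end

text \<open>Of the four constants of the radial equation, \<kappa> and d are fixed by vanishing on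
  the two spheres, which produces \<open>gsol\<close>. The two conditions on the Laplacian then say
  that (\<alpha>, \<beta>) lies in the kernel.\<close>

lemma annulus_profile:
  fixes u :: "real^'n::finite \<Rightarrow> real"
  assumes n: "CARD('n) \<ge> 4" and \<epsilon>: "0 < \<epsilon>" "\<epsilon> < 1"
    and eig: "eigenfunction (annulus \<epsilon>) \<eta> u" and Y: "harm k Y" and q: "q = qexp TYPE('n) k"
  shows "\<exists>\<alpha> \<beta>. ker q \<epsilon> \<eta> \<alpha> \<beta> \<and> (\<forall>s\<in>{\<epsilon>\<^sup>2..1}. prof k u Y s = gsol q \<epsilon> \<alpha> \<beta> s)"
proof -
  have q1: "q \<ge> 1" using qexp_pos[OF n] q by simp
  define a where "a = \<epsilon>\<^sup>2"
  have a: "0 < a" "a < 1" using eps_sq[OF q1 \<epsilon>] by (auto simp: a_def)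
  have u: "smooth u" using eig by (simp add: eigenfunction_def)
  have sq: "norm x = \<epsilon>" if "x \<bullet> x = a" for x :: "real^'n"
    using that \<epsilon> by (simp add: norm_eq_sqrt_inner a_def)
  have outer: "u x = 0" "laplacian u x = \<eta> * euler u x" if "norm x = 1" for x
    using eig that normal_deriv_annulus_outer[OF \<epsilon> that u] by (auto simp: eigenfunction_def frontier_annulus[OF \<epsilon>])
  have inner: "u x = 0" "laplacian u x = (- \<eta> / \<epsilon>) * euler u x" if "norm x = \<epsilon>" for x
    using eig that normal_deriv_annulus_inner[OF \<epsilon> that u] by (auto simp: eigenfunction_def frontier_annulus[OF \<epsilon>])
  have cl: "closure (annulus \<epsilon>) \<subseteq> {x. laplacian (laplacian u) x = 0}"
  proof (rule closure_minimal)
    show "annulus \<epsilon> \<subseteq> {x. laplacian (laplacian u) x = 0}" using eig by (auto simp: eigenfunction_def)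
    show "closed {x. laplacian (laplacian u) x = 0}"
      by (intro closed_Collect_eq smooth_continuous smooth_laplacian u continuous_on_const)
  qed
  have lap: "laplacian (laplacian u) x = 0" if "x \<bullet> x \<in> {a..1}" for x
  proof -
    have "\<epsilon> \<le> norm x" "norm x \<le> 1"
      using that \<epsilon> by (auto simp: norm_eq_sqrt_inner a_def intro: real_le_rsqrt)
    then have "x \<in> closure (annulus \<epsilon>)" by (simp add: closure_annulus[OF \<epsilon>])
    then show ?thesis using cl by blast
  qed
  have I: "convex {a..1}" "{a..1} \<subseteq> {0<..}" using a by auto
  obtain \<alpha> \<beta> \<kappa> d where ode:
    "\<And>s. s \<in> {a..1} \<Longrightarrow> prof k (laplacian u) Y s = \<alpha> + \<beta> * s powr (- q)"
    "\<And>s. s \<in> {a..1} \<Longrightarrow> flux k u Y s = \<alpha> * s powr (q + 1) / (2 * (q + 1)) + \<beta> * s / 2 - 2 * q * \<kappa>"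
    "\<And>s. s \<in> {a..1} \<Longrightarrow> prof k u Y s = \<alpha> * s / (4 * (q + 1)) + \<beta> * jint q s / 4 + \<kappa> * s powr (- q) + d"
    using prof_ode[OF n I u Y lap q] by blast
  have ends: "1 \<in> {a..1}" "a \<in> {a..1}" using a by auto
  have p1: "prof k u Y 1 = 0" using outer by (intro prof_eq_0) (auto simp: inner_self_eq_1)
  have pa: "prof k u Y a = 0" using inner sq a by (intro prof_eq_0) auto
  have e1: "\<alpha> / (4 * (q + 1)) + \<beta> * jint q 1 / 4 + \<kappa> + d = 0" using ode(3)[OF ends(1)] p1 by simp
  have e2: "\<alpha> * a / (4 * (q + 1)) + \<beta> * jint q a / 4 + \<kappa> * a powr (- q) + d = 0" using ode(3)[OF ends(2)] pa by simp
  have "\<kappa> * (a powr (- q) - 1) = \<alpha> * (1 - a) / (4 * (q + 1)) + \<beta> * (jint q 1 - jint q a) / 4"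
  proof -
    have "\<kappa> * (a powr (- q) - 1) = \<kappa> * a powr (- q) - \<kappa>" by (simp add: algebra_simps)
    also have "\<dots> = (\<alpha> / (4 * (q + 1)) - \<alpha> * a / (4 * (q + 1))) + (\<beta> * jint q 1 / 4 - \<beta> * jint q a / 4)"
      using e1 e2 by linarith
    finally show ?thesis by (simp add: right_diff_distrib diff_divide_distrib)
  qed
  then have \<kappa>: "\<kappa> = bcoef q \<epsilon> \<alpha> \<beta>"
    using powr_neg_q_gt_1[OF q1 \<epsilon>] by (simp add: bcoef_def a_def eq_divide_eq)
  have sol: "prof k u Y s = gsol q \<epsilon> \<alpha> \<beta> s" if "s \<in> {a..1}" for s
  proof -
    have "prof k u Y s = (\<alpha> * s / (4 * (q + 1)) - \<alpha> / (4 * (q + 1))) + (\<beta> * jint q s / 4 - \<beta> * jint q 1 / 4) + (\<kappa> * s powr (- q) - \<kappa>)"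
      using ode(3)[OF that] e1 by linarith
    then show ?thesis by (simp add: gsol_def \<kappa> right_diff_distrib diff_divide_distrib)
  qed
  have fl: "flux k u Y s = gflux q \<epsilon> \<alpha> \<beta> s" if "s \<in> {a..1}" for s
    using ode(2)[OF that] by (simp add: gflux_def[OF q1 \<epsilon>] \<kappa>)
  have "prof k (laplacian u) Y 1 = \<eta> * prof k (euler u) Y 1"
    using outer by (intro prof_eq_cmult) (auto simp: inner_self_eq_1)
  then have b1: "\<eta> * gflux q \<epsilon> \<alpha> \<beta> 1 = \<alpha> + \<beta>"
    using ode(1)[OF ends(1)] fl[OF ends(1)] p1 by (simp add: flux_def)
  have "prof k (laplacian u) Y a = (- \<eta> / \<epsilon>) * prof k (euler u) Y a"
    using inner sq a by (intro prof_eq_cmult) auto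
  then have "\<alpha> + \<beta> * a powr (- q) = (- \<eta> / \<epsilon>) * prof k (euler u) Y a"
    using ode(1)[OF ends(2)] by simp
  then have "- \<epsilon> * (\<alpha> + \<beta> * a powr (- q)) = \<eta> * prof k (euler u) Y a" using \<epsilon> by simp
  moreover have "gflux q \<epsilon> \<alpha> \<beta> a = a powr q * prof k (euler u) Y a"
    using fl[OF ends(2)] pa by (simp add: flux_def q)
  ultimately have "\<eta> * gflux q \<epsilon> \<alpha> \<beta> a = - \<epsilon> * a powr q * (\<alpha> + \<beta> * a powr (- q))"
    by (metis mult.assoc mult.left_commute)
  with b1 have "ker q \<epsilon> \<eta> \<alpha> \<beta>" unfolding ker_iff_boundary[OF q1 \<epsilon>] by (simp add: a_def)
  with sol show ?thesis unfolding a_def by blast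
qed

lemma eigenfunction_annulus_radial:
  fixes Y :: "real^'n::finite \<Rightarrow> real"
  assumes n: "CARD('n) \<ge> 4" and \<epsilon>: "0 < \<epsilon>" "\<epsilon> < 1"
    and q: "q = qexp TYPE('n) k" and Y: "harm k Y" and ker: "ker q \<epsilon> \<eta> \<alpha> \<beta>"
    and g: "cinf g" and gsol: "\<forall>s\<in>{\<epsilon>\<^sup>2..1}. g s = gsol q \<epsilon> \<alpha> \<beta> s
      \<and> deriv g s = gflux q \<epsilon> \<alpha> \<beta> s * s powr (- q - 1) / 2
      \<and> radial_op q g s = \<alpha> + \<beta> * s powr (- q) \<and> radial_op q (radial_op q g) s = 0"
  shows "eigenfunction (annulus \<epsilon>) \<eta> (\<lambda>x. g (x \<bullet> x) * Y x)"
proof -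
  have q1: "q \<ge> 1" using qexp_pos[OF n] q by simp
  let ?u = "\<lambda>x. g (x \<bullet> x) * Y x"
  have a: "0 < \<epsilon>\<^sup>2" "\<epsilon>\<^sup>2 < 1" using eps_sq[OF q1 \<epsilon>] by auto
  have sm: "smooth ?u" by (rule smooth_radial_harm[OF g Y])
  have lap: "laplacian ?u = (\<lambda>x. radial_op q g (x \<bullet> x) * Y x)"
    using laplacian_radial_harm[OF g Y] by (simp add: q)
  have lap2: "laplacian (laplacian ?u) = (\<lambda>x. radial_op q (radial_op q g) (x \<bullet> x) * Y x)"
    unfolding lap using laplacian_radial_harm[OF cinf_radial_op[OF g] Y] by (simp add: q)
  note bd = ker[unfolded ker_iff_boundary[OF q1 \<epsilon>]] gsol_boundary[OF q1 \<epsilon>, of \<alpha> \<beta>]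
  have in1: "1 \<in> {\<epsilon>\<^sup>2..1}" and ina: "\<epsilon>\<^sup>2 \<in> {\<epsilon>\<^sup>2..1}" using a by auto
  have outer: "?u x = 0 \<and> laplacian ?u x = \<eta> * normal_deriv (annulus \<epsilon>) ?u x" if x: "norm x = 1" for x
  proof -
    have xx: "x \<bullet> x = 1" using x by (simp add: inner_self_eq_1)
    have "euler ?u x = gflux q \<epsilon> \<alpha> \<beta> 1 * Y x"
      using bspec[OF gsol in1] bd by (simp add: euler_radial_harm[OF g Y] xx)
    then have "\<eta> * normal_deriv (annulus \<epsilon>) ?u x = (\<eta> * gflux q \<epsilon> \<alpha> \<beta> 1) * Y x"
      using normal_deriv_annulus_outer[OF \<epsilon> x sm] by simp
    then show ?thesis using bspec[OF gsol in1] bd by (simp add: lap xx)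
  qed
  have inner: "?u x = 0 \<and> laplacian ?u x = \<eta> * normal_deriv (annulus \<epsilon>) ?u x" if x: "norm x = \<epsilon>" for x
  proof -
    have xx: "x \<bullet> x = \<epsilon>\<^sup>2" using x by (simp add: dot_square_norm)
    define A where "A = \<epsilon>\<^sup>2"
    have A: "A > 0" using a by (simp add: A_def)
    have "1 + (- q - 1) = - q" by simp
    then have p: "A * A powr (- q - 1) = A powr (- q)"
      using powr_mult_base[of A "- q - 1"] A by (simp only: less_imp_le)
    have pp: "A powr q * A powr (- q) = 1" using A by (simp flip: powr_add)
    have "euler ?u x = (2 * A * (gflux q \<epsilon> \<alpha> \<beta> A * A powr (- q - 1) / 2)) * Y x"
      using bspec[OF gsol ina] bd by (simp add: euler_radial_harm[OF g Y] xx A_def)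
    also have "2 * A * (gflux q \<epsilon> \<alpha> \<beta> A * A powr (- q - 1) / 2) = gflux q \<epsilon> \<alpha> \<beta> A * (A * A powr (- q - 1))"
      by simp
    finally have "euler ?u x = gflux q \<epsilon> \<alpha> \<beta> A * A powr (- q) * Y x" unfolding p .
    then have "\<eta> * normal_deriv (annulus \<epsilon>) ?u x = - (\<eta> * gflux q \<epsilon> \<alpha> \<beta> A) * A powr (- q) / \<epsilon> * Y x"
      using normal_deriv_annulus_inner[OF \<epsilon> x sm] by simp
    also have "\<eta> * gflux q \<epsilon> \<alpha> \<beta> A = - \<epsilon> * A powr q * (\<alpha> + \<beta> * A powr (- q))"
      using bd by (simp add: A_def)
    also have "- (- \<epsilon> * A powr q * (\<alpha> + \<beta> * A powr (- q))) * A powr (- q) / \<epsilon> * Y x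
       = (A powr q * A powr (- q)) * (\<alpha> + \<beta> * A powr (- q)) * Y x"
      using \<epsilon> by simp
    finally have "\<eta> * normal_deriv (annulus \<epsilon>) ?u x = (\<alpha> + \<beta> * A powr (- q)) * Y x" unfolding pp by simp
    then show ?thesis using bspec[OF gsol ina] bd by (simp add: lap xx A_def)
  qed
  have "laplacian (laplacian ?u) x = 0" if "x \<in> annulus \<epsilon>" for x
  proof -
    have "\<epsilon> \<le> norm x" "norm x \<le> 1" using that by (auto simp: annulus_def)
    then have "x \<bullet> x \<in> {\<epsilon>\<^sup>2..1}"
      using \<epsilon> by (auto simp: dot_square_norm power_mono power_le_one)
    then show ?thesis using gsol by (simp add: lap2)
  qed
  note biharmonic = this
  show ?thesis unfolding eigenfunction_def frontier_annulus[OF \<epsilon>]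
  proof (intro conjI ballI)
    show "smooth ?u" by (rule sm)
    show "laplacian (laplacian ?u) x = 0" if "x \<in> annulus \<epsilon>" for x by (rule biharmonic[OF that])
    fix x :: "real^'n" assume "x \<in> sphere 0 1 \<union> sphere 0 \<epsilon>"
    then have "norm x = 1 \<or> norm x = \<epsilon>" by auto
    then show "?u x = 0" "laplacian ?u x = \<eta> * normal_deriv (annulus \<epsilon>) ?u x"
      using outer inner by blast+
  qed
qed

text \<open>The kernel at \<open>lam k\<close> is assumed one-dimensional, so that degree k
  contributes one profile and multiplicity exactly \<open>card (hb k)\<close>. This reduces the
  spectrum up to \<open>T\<close> to statements about 2 x 2 matrices.\<close>

lemma eig_count_annulus:
  assumes n: "CARD('n::finite) \<ge> 4" and \<epsilon>: "0 < \<epsilon>" "\<epsilon> < 1"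
    and low: "\<And>k. k < K \<Longrightarrow> lam k \<le> T \<and> (\<exists>\<alpha> \<beta>. (\<alpha> \<noteq> 0 \<or> \<beta> \<noteq> 0) \<and> ker (qexp TYPE('n) k) \<epsilon> (lam k) \<alpha> \<beta>
        \<and> (\<forall>\<alpha>' \<beta>'. ker (qexp TYPE('n) k) \<epsilon> (lam k) \<alpha>' \<beta>' \<longrightarrow> (\<exists>c. \<alpha>' = c * \<alpha> \<and> \<beta>' = c * \<beta>)))"
    and uniq: "\<And>k \<eta> \<alpha> \<beta>. k < K \<Longrightarrow> \<eta> \<le> T \<Longrightarrow> ker (qexp TYPE('n) k) \<epsilon> \<eta> \<alpha> \<beta> \<Longrightarrow> \<alpha> \<noteq> 0 \<or> \<beta> \<noteq> 0 \<Longrightarrow> \<eta> = lam k"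
    and high: "\<And>k \<eta> \<alpha> \<beta>. k \<ge> K \<Longrightarrow> \<eta> \<le> T \<Longrightarrow> ker (qexp TYPE('n) k) \<epsilon> \<eta> \<alpha> \<beta> \<Longrightarrow> \<alpha> = 0 \<and> \<beta> = 0"
    and t: "t \<le> T"
  shows "eig_count (annulus \<epsilon> :: (real^'n) set) t = (\<Sum>k | k < K \<and> lam k \<le> t. card (hb k :: (real^'n \<Rightarrow> real) set))"
proof -
  let ?q = "qexp TYPE('n)"
  have q1: "?q k \<ge> 1" for k by (rule qexp_pos[OF n])
  have a: "0 < \<epsilon>\<^sup>2" "\<epsilon>\<^sup>2 < 1" using eps_sq[OF q1 \<epsilon>] by auto
  define R where "R k z \<longleftrightarrow> (fst z \<noteq> 0 \<or> snd z \<noteq> 0) \<and> ker (?q k) \<epsilon> (lam k) (fst z) (snd z)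
        \<and> (\<forall>\<alpha>' \<beta>'. ker (?q k) \<epsilon> (lam k) \<alpha>' \<beta>' \<longrightarrow> (\<exists>c. \<alpha>' = c * fst z \<and> \<beta>' = c * snd z))" for k z
  define p where "p k = (SOME z. R k z)" for k
  have R: "R k (p k)" if k: "k < K" for k
  proof -
    obtain \<alpha> \<beta> where "(\<alpha> \<noteq> 0 \<or> \<beta> \<noteq> 0) \<and> ker (?q k) \<epsilon> (lam k) \<alpha> \<beta>
        \<and> (\<forall>\<alpha>' \<beta>'. ker (?q k) \<epsilon> (lam k) \<alpha>' \<beta>' \<longrightarrow> (\<exists>c. \<alpha>' = c * \<alpha> \<and> \<beta>' = c * \<beta>))"
      using low[OF k] by blast
    then have "R k (\<alpha>, \<beta>)" unfolding R_def fst_conv snd_conv .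
    then show ?thesis unfolding p_def by (rule someI)
  qed
  have p: "\<And>k. k < K \<Longrightarrow> fst (p k) \<noteq> 0 \<or> snd (p k) \<noteq> 0"
    "\<And>k. k < K \<Longrightarrow> ker (?q k) \<epsilon> (lam k) (fst (p k)) (snd (p k))"
    "\<And>k \<alpha>' \<beta>'. k < K \<Longrightarrow> ker (?q k) \<epsilon> (lam k) \<alpha>' \<beta>' \<Longrightarrow> \<exists>c. \<alpha>' = c * fst (p k) \<and> \<beta>' = c * snd (p k)"
    using R unfolding R_def by blast+
  define P where "P k g \<longleftrightarrow> cinf g \<and> (\<forall>s\<in>{\<epsilon>\<^sup>2..1}. g s = gsol (?q k) \<epsilon> (fst (p k)) (snd (p k)) s
      \<and> deriv g s = gflux (?q k) \<epsilon> (fst (p k)) (snd (p k)) s * s powr (- ?q k - 1) / 2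
      \<and> radial_op (?q k) g s = fst (p k) + snd (p k) * s powr (- ?q k) \<and> radial_op (?q k) (radial_op (?q k) g) s = 0)" for k g
  define g where "g k = (SOME g. P k g)" for k
  have g: "P k (g k)" for k
  proof -
    have "\<exists>g. P k g" unfolding P_def by (rule smooth_radial_solution[OF q1 \<epsilon>])
    then show ?thesis unfolding g_def by (rule someI_ex)
  qed
  have gs: "g k s = gsol (?q k) \<epsilon> (fst (p k)) (snd (p k)) s" if "s \<in> {\<epsilon>\<^sup>2..1}" for k s
    using g[of k] that unfolding P_def by blast
  have set: "{x :: real^'n. x \<bullet> x \<in> {\<epsilon>\<^sup>2..1}} = closure (annulus \<epsilon>)"
  proof -
    have "\<epsilon>\<^sup>2 \<le> x \<bullet> x \<and> x \<bullet> x \<le> 1 \<longleftrightarrow> \<epsilon> \<le> norm x \<and> norm x \<le> 1" for x :: "real^'n"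
      unfolding dot_square_norm using \<epsilon> by (auto simp: abs_le_square_iff[symmetric] abs_square_le_1)
    then show ?thesis unfolding closure_annulus[OF \<epsilon>] by auto
  qed
  show ?thesis
  proof (rule eig_count_of_profiles[where I="{\<epsilon>\<^sup>2..1}" and T=T and g=g])
    show "CARD('n) \<ge> 2" using n by simp
    show "{\<epsilon>\<^sup>2..1} \<subseteq> {0<..}" unfolding subset_iff atLeastAtMost_iff greaterThan_iff
      using a(1) by (blast intro: less_le_trans)
    show "{x :: real^'n. x \<bullet> x \<in> {\<epsilon>\<^sup>2..1}} \<subseteq> closure (annulus \<epsilon>)" unfolding set ..
    show "closure (annulus \<epsilon>) \<subseteq> closure {x :: real^'n. x \<bullet> x \<in> {\<epsilon>\<^sup>2..1}}" unfolding set by simp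
    show "lam k \<le> T" if "k < K" for k using low[OF that] by blast
    show "t \<le> T" by (rule t)
  next
    fix k assume k: "k < K"
    show "\<exists>s\<in>{\<epsilon>\<^sup>2..1}. g k s \<noteq> 0"
      using gsol_nontrivial[OF q1 \<epsilon> p(1)[OF k], of k] gs by auto
    fix b :: "real^'n \<Rightarrow> real" assume b: "b \<in> hb k"
    show "eigenfunction (annulus \<epsilon>) (lam k) (\<lambda>x. g k (x \<bullet> x) * b x)"
      using g[of k] unfolding P_def
      by (intro eigenfunction_annulus_radial[OF n \<epsilon> refl hb_harm[OF b] p(2)[OF k]]) auto
  next
    fix \<eta> k and u b :: "real^'n \<Rightarrow> real"
    assume \<eta>: "\<eta> \<le> T" and u: "eigenfunction (annulus \<epsilon>) \<eta> u" and b: "b \<in> hb k"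
    obtain \<alpha> \<beta> where ab: "ker (?q k) \<epsilon> \<eta> \<alpha> \<beta>" "\<And>s. s \<in> {\<epsilon>\<^sup>2..1} \<Longrightarrow> prof k u b s = gsol (?q k) \<epsilon> \<alpha> \<beta> s"
      using annulus_profile[OF n \<epsilon> u hb_harm[OF b] refl] by blast
    show "\<exists>c. (\<forall>s\<in>{\<epsilon>\<^sup>2..1}. prof k u b s = c * g k s) \<and> (c \<noteq> 0 \<longrightarrow> k < K \<and> lam k = \<eta>)"
    proof (cases "\<alpha> = 0 \<and> \<beta> = 0")
      case True
      then have "prof k u b s = 0" if "s \<in> {\<epsilon>\<^sup>2..1}" for s
        using ab(2)[OF that] gsol_cmult[of "?q k" \<epsilon> 0 0 0 s] by simp
      then show ?thesis by (intro exI[of _ 0]) simp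
    next
      case False
      then have k: "k < K" using high[OF _ \<eta> ab(1)] by (meson not_less)
      then have \<eta>k: "\<eta> = lam k" using uniq[OF k \<eta> ab(1)] False by blast
      then obtain c where "\<alpha> = c * fst (p k)" "\<beta> = c * snd (p k)" using p(3)[OF k] ab(1) by blast
      then have "prof k u b s = c * g k s" if "s \<in> {\<epsilon>\<^sup>2..1}" for s
        using ab(2)[OF that] gs[OF that] gsol_cmult by simp
      then show ?thesis using k \<eta>k by blast
    qed
  qed
qed

section \<open>The characteristic determinant\<close>

context
  fixes q \<epsilon> :: real
  assumes q: "q \<ge> 1" and \<epsilon>: "0 < \<epsilon>" "\<epsilon> < 1"
begin

text \<open>Half the integral of s^q (x + y s^(-q))^2 over [\<epsilon>^2, 1]; \<open>W\<close> is a
  primitive of the integrand.\<close>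

lemma mass_form_nonneg:
  "x\<^sup>2 * (1 - (\<epsilon>\<^sup>2) powr (q + 1)) / (2 * (q + 1)) + 2 * x * y * ((1 - \<epsilon>\<^sup>2) / 2) + y\<^sup>2 * ((jint q 1 - jint q (\<epsilon>\<^sup>2)) / 2) \<ge> 0"
proof -
  define W where "W s = x\<^sup>2 / (q + 1) * s powr (q + 1) + 2 * x * y * s + y\<^sup>2 * jint q s" for s
  have "W (\<epsilon>\<^sup>2) \<le> W 1"
  proof (rule DERIV_nonneg_imp_nondecreasing[of "\<epsilon>\<^sup>2" 1 W])
    show "\<epsilon>\<^sup>2 \<le> 1" using eps_sq[OF q \<epsilon>] by simp
    fix s assume "\<epsilon>\<^sup>2 \<le> s" "s \<le> 1"
    then have s: "s > 0" using less_le_trans[OF eps_sq(1)[OF q \<epsilon>]] by blast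
    have "(W has_real_derivative x\<^sup>2 / (q + 1) * ((q + 1) * s powr (q + 1 - 1)) + 2 * x * y * 1 + y\<^sup>2 * s powr (- q)) (at s)"
      unfolding W_def[abs_def] using s
      by (intro DERIV_add DERIV_cmult DERIV_ident has_real_derivative_powr jint_has_derivative)
    moreover have "x\<^sup>2 / (q + 1) * ((q + 1) * s powr (q + 1 - 1)) + 2 * x * y * 1 + y\<^sup>2 * s powr (- q)
       = s powr q * (x + y * s powr (- q))\<^sup>2"
    proof -
      have "s powr q * s powr (- q) = 1" using s by (simp flip: powr_add)
      then have "s powr q * (x + y * s powr (- q))\<^sup>2 = x\<^sup>2 * s powr q + 2 * x * y + y\<^sup>2 * s powr (- q)"
        by (simp add: power2_eq_square algebra_simps)
      moreover have "x\<^sup>2 / (q + 1) * ((q + 1) * s powr (q + 1 - 1)) = x\<^sup>2 * s powr q"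
        using q by simp
      ultimately show ?thesis by simp
    qed
    ultimately show "\<exists>y. DERIV W s :> y \<and> y \<ge> 0" using s
      by (intro exI[of _ "s powr q * (x + y * s powr (- q))\<^sup>2"]) simp
  qed
  then have "0 \<le> (W 1 - W (\<epsilon>\<^sup>2)) / 2" by simp
  also have "(W 1 - W (\<epsilon>\<^sup>2)) / 2 = x\<^sup>2 * (1 - (\<epsilon>\<^sup>2) powr (q + 1)) / (2 * (q + 1)) + 2 * x * y * ((1 - \<epsilon>\<^sup>2) / 2) + y\<^sup>2 * ((jint q 1 - jint q (\<epsilon>\<^sup>2)) / 2)"
  proof -
    have "(x\<^sup>2 / Q * 1 + X + Y - (x\<^sup>2 / Q * p + X' + Y')) / 2 = x\<^sup>2 * (1 - p) / (2 * Q) + (X - X') / 2 + (Y - Y') / 2" for Q p X Y X' Y' :: real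
      by (simp add: diff_divide_distrib add_divide_distrib right_diff_distrib)
    then show ?thesis unfolding W_def by (simp only: powr_one_eq_one) (simp add: right_diff_distrib)
  qed
  finally show ?thesis .
qed

definition kdet :: "real \<Rightarrow> real" where
  "kdet t = entA q \<epsilon> t * entC q \<epsilon> t - (entB \<epsilon> t)\<^sup>2"

definition "mA = (1 - (\<epsilon>\<^sup>2) powr (q + 1)) / (2 * (q + 1))"
definition "mB = (1 - \<epsilon>\<^sup>2) / 2"
definition "mC = (jint q 1 - jint q (\<epsilon>\<^sup>2)) / 2"

lemma ent_affine: "entA q \<epsilon> t = entA q \<epsilon> 0 - t * mA" "entB \<epsilon> t = entB \<epsilon> 0 - t * mB" "entC q \<epsilon> t = entC q \<epsilon> 0 - t * mC"
  by (simp_all add: entA_def entB_def entC_def mA_def mB_def mC_def)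

lemma mass_form: "x\<^sup>2 * mA + 2 * x * y * mB + y\<^sup>2 * mC \<ge> 0"
  using mass_form_nonneg[of x y] by (simp add: mA_def mB_def mC_def)

lemma mA_pos: "mA > 0"
proof -
  have "(\<epsilon>\<^sup>2) powr (q + 1) < 1" using powr_less_mono'[of "\<epsilon>\<^sup>2" 0 "q + 1"] eps_sq[OF q \<epsilon>] q by simp
  then show ?thesis using q by (simp add: mA_def)
qed

lemma mC_nonneg: "mC \<ge> 0"
  using mass_form[of 0 1] by simp

lemma mass_det: "mA * mC - mB\<^sup>2 \<ge> 0"
proof -
  have "mA * (mA * mC - mB\<^sup>2) \<ge> 0"
    using mass_form[of mB "- mA"] by (simp add: power2_eq_square algebra_simps)
  then show ?thesis using mA_pos by (simp add: zero_le_mult_iff)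
qed

lemma kdet_poly: "kdet t = kdet 0 - t * (entA q \<epsilon> 0 * mC + entC q \<epsilon> 0 * mA - 2 * entB \<epsilon> 0 * mB) + t\<^sup>2 * (mA * mC - mB\<^sup>2)"
  unfolding kdet_def ent_affine[of t] by (simp add: power2_eq_square algebra_simps)

text \<open>At t = 0 only the boundary Gram matrix is left. With X Z = 1 its determinant reduces to
  \<epsilon> (X + Z - 2), nonnegative by the arithmetic-geometric mean inequality.\<close>

lemma kdet_0_nonneg: "kdet 0 \<ge> 0"
proof -
  define X where "X = (\<epsilon>\<^sup>2) powr q"
  define Z where "Z = (\<epsilon>\<^sup>2) powr (- q)"
  have XZ: "X * Z = 1" "X > 0" "Z > 0" using eps_sq[OF q \<epsilon>] by (simp_all add: X_def Z_def powr_minus)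
  have "X + Z \<ge> 2"
  proof -
    have "0 \<le> (X - 1)\<^sup>2" by simp
    also have "(X - 1)\<^sup>2 = X * (X + Z - 2)" using XZ(1) by (simp add: power2_eq_square algebra_simps)
    finally show ?thesis using XZ by (simp add: zero_le_mult_iff)
  qed
  have "kdet 0 = \<epsilon> * (X + Z - 2) + \<epsilon>\<^sup>2 * (X * Z - 1)"
  proof -
    have "entA q \<epsilon> 0 = 1 + \<epsilon> * X" "entB \<epsilon> 0 = 1 + \<epsilon>" "entC q \<epsilon> 0 = 1 + \<epsilon> * Z"
      by (simp_all add: entA_def entB_def entC_def X_def Z_def)
    then show ?thesis by (simp add: kdet_def power2_eq_square algebra_simps)
  qed
  then show ?thesis using XZ \<open>X + Z \<ge> 2\<close> \<epsilon> by simp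
qed

lemma ker_imp_kdet: "ker q \<epsilon> t \<alpha> \<beta> \<Longrightarrow> \<alpha> \<noteq> 0 \<or> \<beta> \<noteq> 0 \<Longrightarrow> kdet t = 0"
proof -
  assume k: "ker q \<epsilon> t \<alpha> \<beta>" and nz: "\<alpha> \<noteq> 0 \<or> \<beta> \<noteq> 0"
  define A where "A = entA q \<epsilon> t"
  define B where "B = entB \<epsilon> t"
  define C where "C = entC q \<epsilon> t"
  have k: "A * \<alpha> + B * \<beta> = 0" "B * \<alpha> + C * \<beta> = 0" using k by (auto simp: ker_def A_def B_def C_def)
  have "(A * C - B\<^sup>2) * \<alpha> = C * (A * \<alpha> + B * \<beta>) - B * (B * \<alpha> + C * \<beta>)"
    "(A * C - B\<^sup>2) * \<beta> = A * (B * \<alpha> + C * \<beta>) - B * (A * \<alpha> + B * \<beta>)"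
    by (simp_all add: power2_eq_square algebra_simps)
  then have "A * C - B\<^sup>2 = 0" using k nz by auto
  then show ?thesis by (simp add: kdet_def A_def B_def C_def)
qed

text \<open>Positive upper left entry and determinant make the matrix positive definite at
  \<open>T\<close>. Passing to a smaller t adds a nonnegative multiple of the mass form, so
  definiteness persists.\<close>

lemma no_kernel_below:
  assumes A: "entA q \<epsilon> T > 0" and D: "kdet T > 0" and \<eta>: "\<eta> \<le> T" and k: "ker q \<epsilon> \<eta> \<alpha> \<beta>"
  shows "\<alpha> = 0 \<and> \<beta> = 0"
proof (rule ccontr)
  assume nz: "\<not> ?thesis"
  define A B C where "A = entA q \<epsilon> T" and "B = entB \<epsilon> T" and "C = entC q \<epsilon> T"
  have "0 = \<alpha> * (entA q \<epsilon> \<eta> * \<alpha> + entB \<epsilon> \<eta> * \<beta>) + \<beta> * (entB \<epsilon> \<eta> * \<alpha> + entC q \<epsilon> \<eta> * \<beta>)"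
    using k by (simp add: ker_def)
  also have "\<dots> = (A * \<alpha>\<^sup>2 + 2 * B * \<alpha> * \<beta> + C * \<beta>\<^sup>2) + (T - \<eta>) * (\<alpha>\<^sup>2 * mA + 2 * \<alpha> * \<beta> * mB + \<beta>\<^sup>2 * mC)"
    unfolding A_def B_def C_def ent_affine[of T] ent_affine[of \<eta>] by (simp add: power2_eq_square algebra_simps)
  finally have "A * \<alpha>\<^sup>2 + 2 * B * \<alpha> * \<beta> + C * \<beta>\<^sup>2 \<le> 0"
    using mult_nonneg_nonneg[OF _ mass_form[of \<alpha> \<beta>], of "T - \<eta>"] \<eta> by linarith
  then have "A * (A * \<alpha>\<^sup>2 + 2 * B * \<alpha> * \<beta> + C * \<beta>\<^sup>2) \<le> 0"
    using A by (simp add: A_def mult_le_0_iff)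
  moreover have "A * (A * \<alpha>\<^sup>2 + 2 * B * \<alpha> * \<beta> + C * \<beta>\<^sup>2) = (A * \<alpha> + B * \<beta>)\<^sup>2 + (A * C - B\<^sup>2) * \<beta>\<^sup>2"
    by (simp add: power2_eq_square algebra_simps)
  ultimately have le: "(A * \<alpha> + B * \<beta>)\<^sup>2 + (A * C - B\<^sup>2) * \<beta>\<^sup>2 \<le> 0" by simp
  have D': "A * C - B\<^sup>2 > 0" using D by (simp add: kdet_def A_def B_def C_def)
  have "(A * C - B\<^sup>2) * \<beta>\<^sup>2 \<le> 0" using le zero_le_power2[of "A * \<alpha> + B * \<beta>"] by linarith
  then have \<beta>: "\<beta> = 0" using D' by (simp add: mult_le_0_iff)
  with le have "A * \<alpha> = 0" by simp
  then show False using A \<beta> nz by (simp add: A_def)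
qed

text \<open>The determinant is a quadratic polynomial in $t$ with nonnegative leading coefficient and nonnegative value at $0$.
  Hence a negative value at $T$ leaves exactly one root below $T$.\<close>

lemma unique_kernel_below:
  assumes D: "kdet T < 0" and T: "T > 0"
  shows "\<exists>l<T. (\<exists>\<alpha> \<beta>. (\<alpha> \<noteq> 0 \<or> \<beta> \<noteq> 0) \<and> ker q \<epsilon> l \<alpha> \<beta>
        \<and> (\<forall>\<alpha>' \<beta>'. ker q \<epsilon> l \<alpha>' \<beta>' \<longrightarrow> (\<exists>c. \<alpha>' = c * \<alpha> \<and> \<beta>' = c * \<beta>)))
      \<and> (\<forall>\<eta> \<alpha> \<beta>. \<eta> \<le> T \<longrightarrow> ker q \<epsilon> \<eta> \<alpha> \<beta> \<longrightarrow> \<alpha> \<noteq> 0 \<or> \<beta> \<noteq> 0 \<longrightarrow> \<eta> = l) \<and> 0 \<le> l"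
proof -
  define L where "L = mA * mC - mB\<^sup>2"
  define M where "M = entA q \<epsilon> 0 * mC + entC q \<epsilon> 0 * mA - 2 * entB \<epsilon> 0 * mB"
  have L: "L \<ge> 0" using mass_det by (simp add: L_def)
  have p: "kdet t = kdet 0 - t * M + t\<^sup>2 * L" for t using kdet_poly[of t] by (simp add: L_def M_def)
  have "\<exists>l\<ge>0. l \<le> T \<and> kdet l = 0"
  proof (rule IVT2)
    have "kdet = (\<lambda>t. kdet 0 - t * M + t\<^sup>2 * L)" using p by blast
    moreover have "isCont (\<lambda>t. kdet 0 - t * M + t\<^sup>2 * L) x" for x by (intro continuous_intros)
    ultimately show "\<forall>x. 0 \<le> x \<and> x \<le> T \<longrightarrow> isCont kdet x" by metis
  qed (use D T kdet_0_nonneg in auto)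
  then obtain l where l: "0 \<le> l" "l \<le> T" "kdet l = 0" by blast
  have lT: "l < T" using l D by (cases "l = T") auto
  have uniq: "\<eta> = l" if \<eta>: "\<eta> \<le> T" "kdet \<eta> = 0" for \<eta>
  proof (rule ccontr)
    assume ne: "\<eta> \<noteq> l"
    \<comment> \<open>Interpolation of the quadratic at a and b with leading coefficient
      \<open>L\<close>. Two roots not above T would make its value at T nonnegative.\<close>
    have three: "kdet T * (b - a) = kdet b * (T - a) - kdet a * (T - b) + L * (T - a) * (T - b) * (b - a)" for a b
      unfolding p[of T] p[of a] p[of b] by (simp add: power2_eq_square algebra_simps)
    define a b where "a = min \<eta> l" and "b = max \<eta> l"
    have ab: "a < b" "b \<le> T" "kdet a = 0" "kdet b = 0" using ne \<eta> l by (auto simp: a_def b_def min_def max_def)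
    have "kdet T * (b - a) = L * (T - a) * (T - b) * (b - a)" using three[of b a] ab by simp
    moreover have "L * (T - a) * (T - b) * (b - a) \<ge> 0" using L ab by (intro mult_nonneg_nonneg) auto
    moreover have "kdet T * (b - a) < 0" using D ab by (simp add: mult_neg_pos)
    ultimately show False by linarith
  qed
  define A B C where "A = entA q \<epsilon> l" and "B = entB \<epsilon> l" and "C = entC q \<epsilon> l"
  have det: "A * C = B\<^sup>2" using l(3) by (simp add: kdet_def A_def B_def C_def)
  have ker: "ker q \<epsilon> l \<alpha> \<beta> \<longleftrightarrow> A * \<alpha> + B * \<beta> = 0 \<and> B * \<alpha> + C * \<beta> = 0" for \<alpha> \<beta>
    by (simp add: ker_def A_def B_def C_def)
  \<comment> \<open>A vanishing matrix at l would make the one at T a multiple of the mass matrix,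
    with nonnegative determinant. So the rank at l is 1 and the kernel a line.\<close>
  have nz: "A \<noteq> 0 \<or> C \<noteq> 0"
  proof (rule ccontr)
    assume "\<not> ?thesis"
    then have z: "A = 0" "C = 0" "B = 0" using det by auto
    have "entA q \<epsilon> T = A - (T - l) * mA" "entB \<epsilon> T = B - (T - l) * mB" "entC q \<epsilon> T = C - (T - l) * mC"
      unfolding A_def B_def C_def ent_affine[of T] ent_affine[of l] by (simp_all add: algebra_simps)
    then have e: "entA q \<epsilon> T = - ((T - l) * mA)" "entB \<epsilon> T = - ((T - l) * mB)" "entC q \<epsilon> T = - ((T - l) * mC)"
      using z by simp_all
    have "kdet T = (T - l)\<^sup>2 * L" unfolding kdet_def e L_def by (simp add: power2_eq_square algebra_simps)
    moreover have "(T - l)\<^sup>2 * L \<ge> 0" using L by simp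
    ultimately show False using D by simp
  qed
  have "\<exists>\<alpha> \<beta>. (\<alpha> \<noteq> 0 \<or> \<beta> \<noteq> 0) \<and> ker q \<epsilon> l \<alpha> \<beta> \<and> (\<forall>\<alpha>' \<beta>'. ker q \<epsilon> l \<alpha>' \<beta>' \<longrightarrow> (\<exists>c. \<alpha>' = c * \<alpha> \<and> \<beta>' = c * \<beta>))"
  proof (cases "A = 0")
    case False
    show ?thesis
    proof (intro exI conjI allI impI)
      show "- B \<noteq> 0 \<or> A \<noteq> 0" using False by simp
      show "ker q \<epsilon> l (- B) A" unfolding ker using det by (simp add: power2_eq_square mult.commute)
      fix \<alpha>' \<beta>' assume "ker q \<epsilon> l \<alpha>' \<beta>'"
      then have "A * \<alpha>' = - B * \<beta>'" unfolding ker by linarith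
      then show "\<alpha>' = \<beta>' / A * (- B)" using False by (simp add: field_simps)
      show "\<beta>' = \<beta>' / A * A" using False by simp
    qed
  next
    case True
    then have C: "C \<noteq> 0" "B = 0" using nz det by auto
    show ?thesis
    proof (intro exI conjI allI impI)
      show "(1::real) \<noteq> 0 \<or> (0::real) \<noteq> 0" by simp
      show "ker q \<epsilon> l 1 0" unfolding ker using True C by simp
      fix \<alpha>' \<beta>' assume "ker q \<epsilon> l \<alpha>' \<beta>'"
      then have "\<beta>' = 0" unfolding ker using C by simp
      then show "\<beta>' = \<alpha>' * 0" "\<alpha>' = \<alpha>' * 1" by simp_all
    qed
  qed
  then show ?thesis using lT l(1) uniq ker_imp_kdet by blast
qed

text \<open>With a = \<epsilon>^2, s^(-q) <= a^(3/4-q) s^(-3/4) on [a,1], and s^(-3/4) has integral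
  at most 4; an exponent below 1 treats the logarithmic case along with the others. As a^(3/4) =
  \<epsilon> sqrt \<epsilon>, the bound is smaller by a factor of order sqrt \<epsilon> than the
  boundary term \<epsilon> a^(-q) of \<open>entC\<close>.\<close>

lemma jint_diff_bound: "jint q 1 - jint q (\<epsilon>\<^sup>2) \<le> 4 * (\<epsilon>\<^sup>2) powr (3/4 - q)"
proof -
  define a where "a = \<epsilon>\<^sup>2"
  have a: "0 < a" "a < 1" using eps_sq[OF q \<epsilon>] by (auto simp: a_def)
  define V where "V s = 4 * a powr (3/4 - q) * s powr (1/4) - jint q s" for s
  have "V a \<le> V 1"
  proof (rule DERIV_nonneg_imp_nondecreasing[of a 1 V])
    show "a \<le> 1" using a by simp
    fix s assume s: "a \<le> s" "s \<le> 1"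
    then have s0: "s > 0" using a by simp
    have "(V has_real_derivative 4 * a powr (3/4 - q) * (1/4 * s powr (1/4 - 1)) - s powr (- q)) (at s)"
      unfolding V_def[abs_def] using s0
      by (intro DERIV_diff DERIV_cmult has_real_derivative_powr jint_has_derivative)
    moreover have "s powr (- q) \<le> 4 * a powr (3/4 - q) * (1/4 * s powr (1/4 - 1))"
    proof -
      have "s powr (- q) = s powr (3/4 - q) * s powr (- (3/4))" by (simp flip: powr_add)
      also have "s powr (3/4 - q) \<le> a powr (3/4 - q)" using s a q by (intro powr_mono2') auto
      finally show ?thesis by (simp add: mult_right_mono)
    qed
    ultimately show "\<exists>y. DERIV V s :> y \<and> y \<ge> 0" by (metis diff_ge_0_iff_ge)
  qed
  then have "jint q 1 - jint q a \<le> 4 * a powr (3/4 - q) * (1 - a powr (1/4))"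
    by (simp add: V_def algebra_simps)
  also have "\<dots> \<le> 4 * a powr (3/4 - q) * 1" by (intro mult_left_mono) auto
  finally show ?thesis by (simp add: a_def)
qed

end

section \<open>Low eigenvalues of thin-holed annuli\<close>

lemma eps_powr_qexp:
  assumes "CARD('n::finite) \<ge> 4" "\<epsilon> > 0"
  shows "(\<epsilon>\<^sup>2) powr qexp TYPE('n) k = \<epsilon> ^ (CARD('n) - 2 + 2 * k)"
    "(\<epsilon>\<^sup>2) powr (- qexp TYPE('n) k) = 1 / \<epsilon> ^ (CARD('n) - 2 + 2 * k)"
    "(\<epsilon>\<^sup>2) powr (qexp TYPE('n) k + 1) = \<epsilon> ^ (CARD('n) + 2 * k)"
    "(\<epsilon>\<^sup>2) powr (3/4 - qexp TYPE('n) k) = \<epsilon> * sqrt \<epsilon> / \<epsilon> ^ (CARD('n) - 2 + 2 * k)"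
proof -
  have e2: "(\<epsilon>\<^sup>2) powr p = \<epsilon> powr (2 * p)" for p
    using assms by (simp add: powr_powr flip: powr_numeral)
  have "2 * qexp TYPE('n) k = real (CARD('n) - 2 + 2 * k)"
    using assms by (simp add: qexp_def)
  then show 1: "(\<epsilon>\<^sup>2) powr qexp TYPE('n) k = \<epsilon> ^ (CARD('n) - 2 + 2 * k)"
    unfolding e2 using assms by (simp only: powr_realpow)
  show "(\<epsilon>\<^sup>2) powr (- qexp TYPE('n) k) = 1 / \<epsilon> ^ (CARD('n) - 2 + 2 * k)"
    unfolding powr_minus 1 by (simp add: divide_inverse)
  have "(\<epsilon>\<^sup>2) powr (qexp TYPE('n) k + 1) = \<epsilon> ^ (CARD('n) - 2 + 2 * k) * \<epsilon>\<^sup>2"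
    unfolding powr_add 1 using assms by simp
  also have "\<dots> = \<epsilon> ^ (CARD('n) + 2 * k)"
  proof -
    have e: "CARD('n) + 2 * k = (CARD('n) - 2 + 2 * k) + 2" using assms by simp
    show ?thesis unfolding e power_add ..
  qed
  finally show "(\<epsilon>\<^sup>2) powr (qexp TYPE('n) k + 1) = \<epsilon> ^ (CARD('n) + 2 * k)" .
  have "(\<epsilon>\<^sup>2) powr (3/4) = \<epsilon> powr (1 + 1/2)" unfolding e2 by simp
  also have "\<dots> = \<epsilon> * sqrt \<epsilon>" using assms by (simp only: powr_add powr_half_sqrt less_imp_le powr_one)
  finally show "(\<epsilon>\<^sup>2) powr (3/4 - qexp TYPE('n) k) = \<epsilon> * sqrt \<epsilon> / \<epsilon> ^ (CARD('n) - 2 + 2 * k)"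
    unfolding powr_diff 1 by simp
qed

text \<open>Just below the ball eigenvalue $n + 2K$: the relative loss is at most half of the relative gain in
  $|\partial\Omega|^{1/(n-1)}$.\<close>

definition threshold :: "nat \<Rightarrow> nat \<Rightarrow> real \<Rightarrow> real" where
  "threshold n K \<epsilon> = (real n + 2 * real K) * (1 - \<epsilon> ^ (n - 1) / (4 * (real n - 1)))"

context
  fixes T :: "'n::finite itself" and \<epsilon> :: real and K :: nat
  assumes n: "CARD('n) \<ge> 4" and \<epsilon>: "0 < \<epsilon>" "\<epsilon> \<le> 1 / (16 * (real CARD('n) + 2 * real K)\<^sup>2)" and K: "K \<ge> 2"
begin

lemma limit_ge_8: "(real CARD('n) + 2 * real K) \<ge> 8" using n K by simp

text \<open>With N = n + 2K, the assumption on \<epsilon> is the square of 4 N sqrt \<epsilon> <= 1,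
  which is exactly what keeps the mass term of \<open>entC\<close> below its boundary term. The
  other bounds follow from it and N >= 8.\<close>

lemma eps_small: "\<epsilon> \<le> 1/16" "4 * (real CARD('n) + 2 * real K) * \<epsilon> < 1" "4 * (real CARD('n) + 2 * real K) * sqrt \<epsilon> \<le> 1" "\<epsilon> < 1" "128 * (real CARD('n) + 2 * real K)\<^sup>2 * \<epsilon>\<^sup>2 < 1"
proof -
  have N2: "(real CARD('n) + 2 * real K)\<^sup>2 \<ge> 8 * (real CARD('n) + 2 * real K)" unfolding power2_eq_square using limit_ge_8 by (intro mult_right_mono) auto
  have e: "16 * (real CARD('n) + 2 * real K)\<^sup>2 * \<epsilon> \<le> 1" using \<epsilon> limit_ge_8 by (simp add: field_simps)
  have "16 * (8 * (real CARD('n) + 2 * real K)) * \<epsilon> \<le> 16 * (real CARD('n) + 2 * real K)\<^sup>2 * \<epsilon>" using N2 \<epsilon> by (intro mult_right_mono) auto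
  then have e': "128 * (real CARD('n) + 2 * real K) * \<epsilon> \<le> 1" using e by simp
  have "(real CARD('n) + 2 * real K) * \<epsilon> > 0" using limit_ge_8 \<epsilon> by simp
  then show "4 * (real CARD('n) + 2 * real K) * \<epsilon> < 1" using e' by linarith
  have "128 * 8 * \<epsilon> \<le> 128 * (real CARD('n) + 2 * real K) * \<epsilon>" using limit_ge_8 \<epsilon> by (intro mult_right_mono) auto
  then show "\<epsilon> \<le> 1/16" "\<epsilon> < 1" using e' \<epsilon> by linarith+
  have "(4 * (real CARD('n) + 2 * real K) * sqrt \<epsilon>)\<^sup>2 \<le> 1\<^sup>2" unfolding power_mult_distrib using e \<epsilon> by (simp only: real_sqrt_pow2 less_imp_le) simp
  then show "4 * (real CARD('n) + 2 * real K) * sqrt \<epsilon> \<le> 1" by (rule power2_le_imp_le) simp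
  have "128 * (real CARD('n) + 2 * real K)\<^sup>2 * \<epsilon>\<^sup>2 = 8 * (16 * (real CARD('n) + 2 * real K)\<^sup>2 * \<epsilon>) * \<epsilon>" by (simp add: power2_eq_square)
  also have "\<dots> \<le> 8 * 1 * \<epsilon>" using e \<epsilon> by (intro mult_right_mono mult_left_mono) auto
  also have "\<dots> < 1" using \<open>\<epsilon> \<le> 1/16\<close> by simp
  finally show "128 * (real CARD('n) + 2 * real K)\<^sup>2 * \<epsilon>\<^sup>2 < 1" .
qed

lemma qexp_ge_1: "qexp TYPE('n) k \<ge> 1" by (rule qexp_pos[OF n])

lemma hole_area_bounds: "0 < \<epsilon> ^ (CARD('n) - 1)" "\<epsilon> ^ (CARD('n) - 1) \<le> \<epsilon>"
proof -
  show "0 < \<epsilon> ^ (CARD('n) - 1)" using \<epsilon> by simp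
  have "\<epsilon> ^ (CARD('n) - 1) \<le> \<epsilon> ^ 1" using \<epsilon> eps_small n by (intro power_decreasing) auto
  then show "\<epsilon> ^ (CARD('n) - 1) \<le> \<epsilon>" by simp
qed

lemma entA_eq: "entA (qexp TYPE('n) k) \<epsilon> t = 1 + \<epsilon> * \<epsilon> ^ (CARD('n) - 2 + 2 * k) - t * (1 - \<epsilon> ^ (CARD('n) + 2 * k)) / (real CARD('n) + 2 * real k)"
  unfolding entA_def eps_powr_qexp[OF n \<epsilon>(1)] by (simp add: qexp_def)

lemma sigma_pos: "(\<epsilon> / \<epsilon> ^ (CARD('n) - 2 + 2 * k)) > 0" using \<epsilon> by simp

text \<open>For t <= n + 2K the mass term is at most 4 (n + 2K) sqrt \<epsilon>, hence at most once,
  the boundary term \<epsilon>^(3-n-2k). So \<open>entC\<close> is of exactly that large order in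
  every degree.\<close>

lemma entC_bounds:
  assumes "0 \<le> t" "t \<le> (real CARD('n) + 2 * real K)"
  shows "entC (qexp TYPE('n) k) \<epsilon> t \<ge> (\<epsilon> / \<epsilon> ^ (CARD('n) - 2 + 2 * k)) / 2" "entC (qexp TYPE('n) k) \<epsilon> t \<le> 1 + (\<epsilon> / \<epsilon> ^ (CARD('n) - 2 + 2 * k))" "entC (qexp TYPE('n) k) \<epsilon> t > 0"
proof -
  define J where "J = jint (qexp TYPE('n) k) 1 - jint (qexp TYPE('n) k) (\<epsilon>\<^sup>2)"
  have C: "entC (qexp TYPE('n) k) \<epsilon> t = 1 + (\<epsilon> / \<epsilon> ^ (CARD('n) - 2 + 2 * k)) - t * J / 2"
    unfolding entC_def eps_powr_qexp[OF n \<epsilon>(1)] J_def by simp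
  have "J \<ge> 0" using mC_nonneg[OF qexp_ge_1 \<epsilon>(1) eps_small(4), of k] by (simp add: mC_def[OF qexp_ge_1 \<epsilon>(1) eps_small(4)] J_def)
  then show "entC (qexp TYPE('n) k) \<epsilon> t \<le> 1 + (\<epsilon> / \<epsilon> ^ (CARD('n) - 2 + 2 * k))" using C assms by simp
  have "J \<le> 4 * (sqrt \<epsilon> * (\<epsilon> / \<epsilon> ^ (CARD('n) - 2 + 2 * k)))"
    using jint_diff_bound[OF qexp_ge_1 \<epsilon>(1) eps_small(4), of k] unfolding eps_powr_qexp[OF n \<epsilon>(1)] J_def by (simp add: mult.commute)
  then have "t * J \<le> (real CARD('n) + 2 * real K) * (4 * (sqrt \<epsilon> * (\<epsilon> / \<epsilon> ^ (CARD('n) - 2 + 2 * k))))" using assms \<open>J \<ge> 0\<close> by (intro mult_mono) auto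
  also have "\<dots> = (4 * (real CARD('n) + 2 * real K) * sqrt \<epsilon>) * (\<epsilon> / \<epsilon> ^ (CARD('n) - 2 + 2 * k))" by simp
  also have "\<dots> \<le> 1 * (\<epsilon> / \<epsilon> ^ (CARD('n) - 2 + 2 * k))" using eps_small(3) sigma_pos[of k] by (intro mult_right_mono) auto
  finally have "t * J \<le> (\<epsilon> / \<epsilon> ^ (CARD('n) - 2 + 2 * k))" by simp
  moreover have half: "S / 2 \<le> 1 + S - u / 2" if "u \<le> S" for u S :: real using that by linarith
  ultimately show C1: "entC (qexp TYPE('n) k) \<epsilon> t \<ge> (\<epsilon> / \<epsilon> ^ (CARD('n) - 2 + 2 * k)) / 2"
    using C half[of "t * J" "\<epsilon> / \<epsilon> ^ (CARD('n) - 2 + 2 * k)"] by metis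
  show "entC (qexp TYPE('n) k) \<epsilon> t > 0" by (rule less_le_trans[OF half_gt_zero[OF sigma_pos] C1])
qed

lemma area_correction_bounds: "0 < \<epsilon> ^ (CARD('n) - 1) / (4 * (real CARD('n) - 1))" "\<epsilon> ^ (CARD('n) - 1) / (4 * (real CARD('n) - 1)) \<le> \<epsilon>"
proof -
  show "0 < \<epsilon> ^ (CARD('n) - 1) / (4 * (real CARD('n) - 1))" using hole_area_bounds n by (intro divide_pos_pos) auto
  have "\<epsilon> ^ (CARD('n) - 1) / (4 * (real CARD('n) - 1)) \<le> \<epsilon> ^ (CARD('n) - 1) / 1" using hole_area_bounds n by (intro divide_left_mono) auto
  then show "\<epsilon> ^ (CARD('n) - 1) / (4 * (real CARD('n) - 1)) \<le> \<epsilon>" using hole_area_bounds by simp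
qed

lemma threshold_bounds: "(real CARD('n) + 2 * real K) - 1 \<le> (threshold CARD('n) K \<epsilon>)" "(threshold CARD('n) K \<epsilon>) < (real CARD('n) + 2 * real K)" "0 < (threshold CARD('n) K \<epsilon>)"
proof -
  have eq: "threshold CARD('n) K \<epsilon> = (real CARD('n) + 2 * real K) - (real CARD('n) + 2 * real K) * (\<epsilon> ^ (CARD('n) - 1) / (4 * (real CARD('n) - 1)))" by (simp add: threshold_def right_diff_distrib)
  have "(real CARD('n) + 2 * real K) * (\<epsilon> ^ (CARD('n) - 1) / (4 * (real CARD('n) - 1))) \<le> (real CARD('n) + 2 * real K) * \<epsilon>" using area_correction_bounds limit_ge_8 by (intro mult_left_mono) auto
  moreover have "0 < (real CARD('n) + 2 * real K) * \<epsilon>" using limit_ge_8 \<epsilon> by simp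
  ultimately show "(real CARD('n) + 2 * real K) - 1 \<le> (threshold CARD('n) K \<epsilon>)" using eps_small(2) eq by linarith
  have "(real CARD('n) + 2 * real K) * (\<epsilon> ^ (CARD('n) - 1) / (4 * (real CARD('n) - 1))) > 0" using area_correction_bounds limit_ge_8 by (intro mult_pos_pos) auto
  then show "(threshold CARD('n) K \<epsilon>) < (real CARD('n) + 2 * real K)" using eq by linarith
  show "0 < (threshold CARD('n) K \<epsilon>)" using \<open>(real CARD('n) + 2 * real K) - 1 \<le> (threshold CARD('n) K \<epsilon>)\<close> limit_ge_8 by linarith
qed

text \<open>Ball eigenvalues are spaced by 2, so the threshold, at least n + 2K - 1, exceeds n + 2k
  by at least 1 for k < K. This makes \<open>entA\<close> negative while \<open>entC\<close> is
  positive, and the sign does not depend on \<open>entB\<close>.\<close>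

lemma kdet_low:
  assumes k: "k < K"
  shows "kdet (qexp TYPE('n) k) \<epsilon> (threshold CARD('n) K \<epsilon>) < 0"
proof -
  have eN: "\<epsilon> ^ (CARD('n) + 2 * k) \<le> \<epsilon>" "\<epsilon> ^ (CARD('n) - 2 + 2 * k) \<le> 1"
    using power_decreasing[of 1 "CARD('n) + 2 * k" \<epsilon>] power_le_one[of \<epsilon>] \<epsilon> eps_small(4) n by auto
  define M where "M = real CARD('n) + 2 * real k"
  have M: "M \<ge> 4" "M + 2 \<le> (real CARD('n) + 2 * real K)" using n k by (auto simp: M_def)
  have "(M + 1) * (1 - \<epsilon>) \<le> (threshold CARD('n) K \<epsilon>) * (1 - \<epsilon> ^ (CARD('n) + 2 * k))"
    using threshold_bounds M eN \<epsilon> eps_small by (intro mult_mono) auto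
  moreover have "(1 + \<epsilon>) * M < (M + 1) * (1 - \<epsilon>)"
  proof -
    have "\<epsilon> * (2 * M + 1) \<le> \<epsilon> * (4 * (real CARD('n) + 2 * real K))" using M \<epsilon> by (intro mult_left_mono) auto
    then have "\<epsilon> * (2 * M + 1) < 1" using eps_small(2) by (simp add: mult.commute mult.left_commute)
    then show ?thesis by (simp add: algebra_simps)
  qed
  ultimately have "(1 + \<epsilon>) * M < (threshold CARD('n) K \<epsilon>) * (1 - \<epsilon> ^ (CARD('n) + 2 * k))" by linarith
  then have "1 + \<epsilon> < (threshold CARD('n) K \<epsilon>) * (1 - \<epsilon> ^ (CARD('n) + 2 * k)) / M" using M by (simp add: pos_less_divide_eq)
  moreover have "\<epsilon> * \<epsilon> ^ (CARD('n) - 2 + 2 * k) \<le> \<epsilon>" using eN \<epsilon> by (simp add: mult_le_cancel_left1)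
  ultimately have "entA (qexp TYPE('n) k) \<epsilon> (threshold CARD('n) K \<epsilon>) < 0" unfolding entA_eq M_def by linarith
  moreover have "entC (qexp TYPE('n) k) \<epsilon> (threshold CARD('n) K \<epsilon>) > 0"
    using threshold_bounds by (intro entC_bounds(3)) auto
  ultimately have "entA (qexp TYPE('n) k) \<epsilon> (threshold CARD('n) K \<epsilon>) * entC (qexp TYPE('n) k) \<epsilon> (threshold CARD('n) K \<epsilon>) < 0" by (rule mult_neg_pos)
  then show ?thesis unfolding kdet_def[OF qexp_ge_1 \<epsilon>(1) eps_small(4)] using zero_le_power2[of "entB \<epsilon> (threshold CARD('n) K \<epsilon>)"] by linarith
qed

text \<open>Here \<open>entA\<close> is at least \<xi>/(4(n-1)), the margin built into the
  threshold, and \<open>entC\<close> at least half of \<epsilon>^(3-n-2k). Their product is of order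
  \<epsilon>^(2-2k), which beats the square of \<open>entB\<close>, at most (n + 2K)^2, because k >=
  2.\<close>

lemma kdet_high:
  assumes k: "k \<ge> K"
  shows "entA (qexp TYPE('n) k) \<epsilon> (threshold CARD('n) K \<epsilon>) > 0" "kdet (qexp TYPE('n) k) \<epsilon> (threshold CARD('n) K \<epsilon>) > 0"
proof -
  define M where "M = real CARD('n) + 2 * real k"
  define c where "c = 1 / (4 * (real CARD('n) - 1))"
  have c: "c > 0" using n by (simp add: c_def)
  have TKc: "(threshold CARD('n) K \<epsilon>) = (real CARD('n) + 2 * real K) * (1 - c * \<epsilon> ^ (CARD('n) - 1))" by (simp add: threshold_def c_def)
  have M: "M \<ge> (real CARD('n) + 2 * real K)" "M > 0" using k limit_ge_8 by (auto simp: M_def)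
  have "(threshold CARD('n) K \<epsilon>) * (1 - \<epsilon> ^ (CARD('n) + 2 * k)) \<le> (threshold CARD('n) K \<epsilon>)" using threshold_bounds \<epsilon> by (simp add: mult_le_cancel_left1)
  also have "(threshold CARD('n) K \<epsilon>) \<le> M * (1 - c * \<epsilon> ^ (CARD('n) - 1))" unfolding TKc
    using M area_correction_bounds eps_small by (intro mult_right_mono) (auto simp: c_def)
  finally have "(threshold CARD('n) K \<epsilon>) * (1 - \<epsilon> ^ (CARD('n) + 2 * k)) / M \<le> 1 - c * \<epsilon> ^ (CARD('n) - 1)" using M by (simp add: divide_le_eq mult.commute)
  moreover have "\<epsilon> * \<epsilon> ^ (CARD('n) - 2 + 2 * k) \<ge> 0" using \<epsilon> by simp
  ultimately have A: "entA (qexp TYPE('n) k) \<epsilon> (threshold CARD('n) K \<epsilon>) \<ge> c * \<epsilon> ^ (CARD('n) - 1)" unfolding entA_eq M_def by linarith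
  have cx: "c * \<epsilon> ^ (CARD('n) - 1) > 0" using c hole_area_bounds by simp
  show "entA (qexp TYPE('n) k) \<epsilon> (threshold CARD('n) K \<epsilon>) > 0" using A cx by linarith
  have C: "entC (qexp TYPE('n) k) \<epsilon> (threshold CARD('n) K \<epsilon>) \<ge> (\<epsilon> / \<epsilon> ^ (CARD('n) - 2 + 2 * k)) / 2" using threshold_bounds by (intro entC_bounds(1)) auto
  have "(c * \<epsilon> ^ (CARD('n) - 1)) * ((\<epsilon> / \<epsilon> ^ (CARD('n) - 2 + 2 * k)) / 2) \<le> entA (qexp TYPE('n) k) \<epsilon> (threshold CARD('n) K \<epsilon>) * entC (qexp TYPE('n) k) \<epsilon> (threshold CARD('n) K \<epsilon>)"
    using A C cx sigma_pos[of k] by (intro mult_mono) auto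
  moreover have "(real CARD('n) + 2 * real K)\<^sup>2 < (c * \<epsilon> ^ (CARD('n) - 1)) * ((\<epsilon> / \<epsilon> ^ (CARD('n) - 2 + 2 * k)) / 2)"
  proof -
    \<comment> \<open>The product of the first two factors is \<epsilon>^(2-2k), at least
      \<epsilon>^(-2) for k >= 2; in degrees 0 and 1 it would not be large.\<close>
    have "\<epsilon> ^ (CARD('n) - 1) * (\<epsilon> / \<epsilon> ^ (CARD('n) - 2 + 2 * k)) * \<epsilon>\<^sup>2 \<ge> 1"
    proof -
      have "\<epsilon> ^ (CARD('n) - 2 + 2 * k) \<le> \<epsilon> ^ (CARD('n) - 1 + 3)"
        using \<epsilon> eps_small k K n by (intro power_decreasing) auto
      also have "\<dots> = \<epsilon> ^ (CARD('n) - 1) * \<epsilon> * \<epsilon>\<^sup>2" by (simp only: power_add) (simp add: power2_eq_square power3_eq_cube)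
      finally have "1 \<le> \<epsilon> ^ (CARD('n) - 1) * \<epsilon> * \<epsilon>\<^sup>2 / \<epsilon> ^ (CARD('n) - 2 + 2 * k)" using \<epsilon> by (simp add: le_divide_eq)
      then show ?thesis by simp
    qed
    then have 1: "(c / 2) * 1 \<le> (c / 2) * (\<epsilon> ^ (CARD('n) - 1) * (\<epsilon> / \<epsilon> ^ (CARD('n) - 2 + 2 * k)) * \<epsilon>\<^sup>2)" using c by (intro mult_left_mono) auto
    \<comment> \<open>Here c/2 = 1/(8(n-1)), and n - 1 is at most (n + 2K)^2.\<close>
    have "(c / 2) * (8 * (real CARD('n) + 2 * real K)\<^sup>2) \<ge> 1"
    proof -
      have "real CARD('n) - 1 \<le> (real CARD('n) + 2 * real K)\<^sup>2" using limit_ge_8 by (smt (verit) power2_eq_square mult_le_cancel_left1 of_nat_0_le_iff)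
      then show ?thesis using n by (simp add: c_def field_simps)
    qed
    then have 2: "1 / (8 * (real CARD('n) + 2 * real K)\<^sup>2) \<le> c / 2" using limit_ge_8 by (simp add: divide_le_eq)
    have "(real CARD('n) + 2 * real K)\<^sup>2 * \<epsilon>\<^sup>2 < 1 / (8 * (real CARD('n) + 2 * real K)\<^sup>2)"
    proof -
      have e: "16 * (real CARD('n) + 2 * real K)\<^sup>2 * \<epsilon> \<le> 1" using \<epsilon> limit_ge_8 by (simp add: field_simps)
      have "(16 * (real CARD('n) + 2 * real K)\<^sup>2 * \<epsilon>) * (16 * (real CARD('n) + 2 * real K)\<^sup>2 * \<epsilon>) \<le> 1 * 1" using e \<epsilon> limit_ge_8 by (intro mult_mono) auto
      then have "256 * ((real CARD('n) + 2 * real K)\<^sup>2 * (real CARD('n) + 2 * real K)\<^sup>2 * \<epsilon>\<^sup>2) \<le> 1" by (simp add: power2_eq_square algebra_simps)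
      moreover have "(real CARD('n) + 2 * real K)\<^sup>2 * (real CARD('n) + 2 * real K)\<^sup>2 * \<epsilon>\<^sup>2 > 0" using limit_ge_8 \<epsilon> by (intro mult_pos_pos) auto
      ultimately have "8 * ((real CARD('n) + 2 * real K)\<^sup>2 * (real CARD('n) + 2 * real K)\<^sup>2 * \<epsilon>\<^sup>2) < 1" by linarith
      then show ?thesis using limit_ge_8 by (simp add: less_divide_eq mult.commute mult.left_commute)
    qed
    also have "1 / (8 * (real CARD('n) + 2 * real K)\<^sup>2) \<le> (c / 2) * (\<epsilon> ^ (CARD('n) - 1) * (\<epsilon> / \<epsilon> ^ (CARD('n) - 2 + 2 * k)) * \<epsilon>\<^sup>2)"
      using order_trans[OF 2 1[unfolded mult_1_right]] .
    also have "\<dots> = ((c * \<epsilon> ^ (CARD('n) - 1)) * ((\<epsilon> / \<epsilon> ^ (CARD('n) - 2 + 2 * k)) / 2)) * \<epsilon>\<^sup>2"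
      by (simp add: mult.commute mult.left_commute)
    finally show ?thesis by (rule mult_right_less_imp_less) (use \<epsilon> in simp)
  qed
  moreover have "(entB \<epsilon> (threshold CARD('n) K \<epsilon>))\<^sup>2 \<le> (real CARD('n) + 2 * real K)\<^sup>2"
  proof (rule power2_le_iff_abs_le[THEN iffD2])
    show "0 \<le> (real CARD('n) + 2 * real K)" using limit_ge_8 by simp
    have "0 \<le> (threshold CARD('n) K \<epsilon>) * (1 - \<epsilon>\<^sup>2)" "(threshold CARD('n) K \<epsilon>) * (1 - \<epsilon>\<^sup>2) \<le> (threshold CARD('n) K \<epsilon>) * 1"
      using threshold_bounds eps_sq[OF qexp_ge_1[of k] \<epsilon>(1) eps_small(4)] by (auto intro!: mult_nonneg_nonneg mult_left_mono)
    then show "\<bar>entB \<epsilon> (threshold CARD('n) K \<epsilon>)\<bar> \<le> (real CARD('n) + 2 * real K)"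
      using threshold_bounds eps_small(4) \<epsilon> limit_ge_8 unfolding entB_def abs_le_iff by linarith
  qed
  ultimately show "kdet (qexp TYPE('n) k) \<epsilon> (threshold CARD('n) K \<epsilon>) > 0" unfolding kdet_def[OF qexp_ge_1 \<epsilon>(1) eps_small(4)] by linarith
qed

text \<open>The last clause is how the low degrees are compared with the ball: wherever the
  determinant is negative at some t up to the threshold, a root lies below t, and by uniqueness it
  is \<open>lam k\<close>.\<close>

lemma spectrum_annulus:
  "\<exists>lam. (\<forall>k<K. 0 \<le> lam k \<and> lam k \<le> (threshold CARD('n) K \<epsilon>))
    \<and> (\<forall>t\<le>(threshold CARD('n) K \<epsilon>). eig_count (annulus \<epsilon> :: (real^'n) set) t = (\<Sum>k | k < K \<and> lam k \<le> t. card (hb k :: (real^'n \<Rightarrow> real) set)))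
    \<and> (\<forall>k<K. \<forall>t. 0 < t \<longrightarrow> t \<le> (threshold CARD('n) K \<epsilon>) \<longrightarrow> kdet (qexp TYPE('n) k) \<epsilon> t < 0 \<longrightarrow> lam k \<le> t)"
proof -
  define P where "P k l \<longleftrightarrow> l < (threshold CARD('n) K \<epsilon>) \<and> (\<exists>\<alpha> \<beta>. (\<alpha> \<noteq> 0 \<or> \<beta> \<noteq> 0) \<and> ker (qexp TYPE('n) k) \<epsilon> l \<alpha> \<beta>
        \<and> (\<forall>\<alpha>' \<beta>'. ker (qexp TYPE('n) k) \<epsilon> l \<alpha>' \<beta>' \<longrightarrow> (\<exists>c. \<alpha>' = c * \<alpha> \<and> \<beta>' = c * \<beta>)))
      \<and> (\<forall>\<eta> \<alpha> \<beta>. \<eta> \<le> (threshold CARD('n) K \<epsilon>) \<longrightarrow> ker (qexp TYPE('n) k) \<epsilon> \<eta> \<alpha> \<beta> \<longrightarrow> \<alpha> \<noteq> 0 \<or> \<beta> \<noteq> 0 \<longrightarrow> \<eta> = l) \<and> 0 \<le> l" for k l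
  define lam where "lam k = (SOME l. P k l)" for k
  have P: "P k (lam k)" if k: "k < K" for k
  proof -
    have "\<exists>l. P k l"
      using unique_kernel_below[OF qexp_ge_1 \<epsilon>(1) eps_small(4) kdet_low[OF k] threshold_bounds(3)] unfolding P_def .
    then show ?thesis unfolding lam_def by (rule someI_ex)
  qed
  have "eig_count (annulus \<epsilon> :: (real^'n) set) t = (\<Sum>k | k < K \<and> lam k \<le> t. card (hb k :: (real^'n \<Rightarrow> real) set))" if t: "t \<le> (threshold CARD('n) K \<epsilon>)" for t
  proof (rule eig_count_annulus[OF n \<epsilon>(1) eps_small(4) _ _ _ t])
    show "lam k \<le> (threshold CARD('n) K \<epsilon>) \<and> (\<exists>\<alpha> \<beta>. (\<alpha> \<noteq> 0 \<or> \<beta> \<noteq> 0) \<and> ker (qexp TYPE('n) k) \<epsilon> (lam k) \<alpha> \<beta>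
        \<and> (\<forall>\<alpha>' \<beta>'. ker (qexp TYPE('n) k) \<epsilon> (lam k) \<alpha>' \<beta>' \<longrightarrow> (\<exists>c. \<alpha>' = c * \<alpha> \<and> \<beta>' = c * \<beta>)))" if "k < K" for k
      using P[OF that] unfolding P_def by (meson less_imp_le)
    show "\<eta> = lam k" if "k < K" "\<eta> \<le> (threshold CARD('n) K \<epsilon>)" "ker (qexp TYPE('n) k) \<epsilon> \<eta> \<alpha> \<beta>" "\<alpha> \<noteq> 0 \<or> \<beta> \<noteq> 0" for k \<eta> \<alpha> \<beta>
      using P[OF that(1)] that(2-4) unfolding P_def by blast
    show "\<alpha> = 0 \<and> \<beta> = 0" if "K \<le> k" "\<eta> \<le> (threshold CARD('n) K \<epsilon>)" "ker (qexp TYPE('n) k) \<epsilon> \<eta> \<alpha> \<beta>" for k \<eta> \<alpha> \<beta>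
      by (rule no_kernel_below[OF qexp_ge_1 \<epsilon>(1) eps_small(4) kdet_high[OF that(1)] that(2,3)])
  qed
  moreover have "lam k \<le> t" if k: "k < K" and t: "0 < t" "t \<le> (threshold CARD('n) K \<epsilon>)" "kdet (qexp TYPE('n) k) \<epsilon> t < 0" for k t
  proof -
    obtain l \<alpha> \<beta> where l: "l < t" "\<alpha> \<noteq> 0 \<or> \<beta> \<noteq> 0" "ker (qexp TYPE('n) k) \<epsilon> l \<alpha> \<beta>"
      using unique_kernel_below[OF qexp_ge_1 \<epsilon>(1) eps_small(4) t(3,1)] by blast
    then have "l = lam k" using P[OF k] t(2) unfolding P_def by (meson less_imp_le order_trans)
    then show ?thesis using l by simp
  qed
  moreover have "0 \<le> lam k \<and> lam k \<le> (threshold CARD('n) K \<epsilon>)" if "k < K" for k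
    using P[OF that] unfolding P_def by (meson less_imp_le)
  ultimately show ?thesis by blast
qed

text \<open>At relative distance \<xi> below n, \<open>entA\<close> is at most 3\<xi> and
  \<open>entC\<close> about \<epsilon>^(3-n), so their product is at most 6\<epsilon>, while
  \<open>entB\<close> stays near 1 - n/2, away from 0.\<close>

lemma kdet_0_neg: "kdet (qexp TYPE('n) 0) \<epsilon> (real CARD('n) * (1 - \<epsilon> ^ (CARD('n) - 1))) < 0"
proof -
  let ?t = "real CARD('n) * (1 - \<epsilon> ^ (CARD('n) - 1))"
  have x1: "\<epsilon> ^ (CARD('n) - 1) \<le> 1/16" using hole_area_bounds eps_small by linarith
  have t: "0 \<le> ?t" "?t \<le> (real CARD('n) + 2 * real K)"
  proof -
    show "0 \<le> ?t" using x1 by simp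
    have "?t \<le> real CARD('n) * 1" using hole_area_bounds by (intro mult_left_mono) auto
    then show "?t \<le> (real CARD('n) + 2 * real K)" by linarith
  qed
  have nn: "CARD('n) - 1 = Suc (CARD('n) - 2)" using n by simp
  have p1: "\<epsilon> * \<epsilon> ^ (CARD('n) - 2 + 2 * 0) = \<epsilon> ^ (CARD('n) - 1)" unfolding nn by simp
  have p2: "\<epsilon> ^ (CARD('n) + 2 * 0) = \<epsilon> ^ (CARD('n) - 1) * \<epsilon>" by (subst power_minus_mult) (use n in auto)
  have A: "entA (qexp TYPE('n) 0) \<epsilon> ?t = 2 * \<epsilon> ^ (CARD('n) - 1) + \<epsilon> * \<epsilon> ^ (CARD('n) - 1) - \<epsilon> * \<epsilon> ^ (CARD('n) - 1) * \<epsilon> ^ (CARD('n) - 1)"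
    unfolding entA_eq p1 p2 using n by (simp add: field_simps)
  have A0: "0 \<le> entA (qexp TYPE('n) 0) \<epsilon> ?t" "entA (qexp TYPE('n) 0) \<epsilon> ?t \<le> 3 * \<epsilon> ^ (CARD('n) - 1)"
  proof -
    have "\<epsilon> * \<epsilon> ^ (CARD('n) - 1) * \<epsilon> ^ (CARD('n) - 1) \<le> \<epsilon> * \<epsilon> ^ (CARD('n) - 1) * 1" using x1 hole_area_bounds \<epsilon> by (intro mult_left_mono) auto
    moreover have "\<epsilon> * \<epsilon> ^ (CARD('n) - 1) \<le> 1 * \<epsilon> ^ (CARD('n) - 1)" using eps_small hole_area_bounds by (intro mult_right_mono) auto
    moreover have "0 \<le> \<epsilon> * \<epsilon> ^ (CARD('n) - 1) * \<epsilon> ^ (CARD('n) - 1)" using \<epsilon> hole_area_bounds by simp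
    ultimately show "0 \<le> entA (qexp TYPE('n) 0) \<epsilon> ?t" "entA (qexp TYPE('n) 0) \<epsilon> ?t \<le> 3 * \<epsilon> ^ (CARD('n) - 1)" unfolding A using hole_area_bounds by linarith+
  qed
  have C: "0 \<le> entC (qexp TYPE('n) 0) \<epsilon> ?t" "entC (qexp TYPE('n) 0) \<epsilon> ?t \<le> 1 + (\<epsilon> / \<epsilon> ^ (CARD('n) - 2 + 2 * 0))"
    using entC_bounds(2,3)[OF t, of 0] by simp_all
  have xs: "\<epsilon> ^ (CARD('n) - 1) * (\<epsilon> / \<epsilon> ^ (CARD('n) - 2 + 2 * 0)) = \<epsilon>\<^sup>2"
    unfolding p1[symmetric] using \<epsilon> by (simp add: power2_eq_square)
  have "entA (qexp TYPE('n) 0) \<epsilon> ?t * entC (qexp TYPE('n) 0) \<epsilon> ?t \<le> (3 * \<epsilon> ^ (CARD('n) - 1)) * (1 + (\<epsilon> / \<epsilon> ^ (CARD('n) - 2 + 2 * 0)))"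
    using A0 C hole_area_bounds by (intro mult_mono) auto
  also have "\<dots> = 3 * \<epsilon> ^ (CARD('n) - 1) + 3 * \<epsilon>\<^sup>2" using xs by (simp add: distrib_left)
  also have "\<dots> \<le> 3 * \<epsilon> + 3 * (\<epsilon> * 1)" unfolding power2_eq_square
    using hole_area_bounds \<epsilon> eps_small by (intro add_mono mult_left_mono) auto
  finally have AC: "entA (qexp TYPE('n) 0) \<epsilon> ?t * entC (qexp TYPE('n) 0) \<epsilon> ?t \<le> 6 * \<epsilon>" by simp
  \<comment> \<open>15/16 bounds both 1 - \<xi> and 1 - \<epsilon>^2 from below, and n >= 4.\<close>
  have B: "entB \<epsilon> ?t \<le> - (5/8)"
  proof -
    have "4 * ((15/16) * (15/16)) \<le> real CARD('n) * ((1 - \<epsilon> ^ (CARD('n) - 1)) * (1 - \<epsilon>\<^sup>2))"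
    proof -
      have "\<epsilon>\<^sup>2 \<le> 1/16 * 1" unfolding power2_eq_square using \<epsilon> eps_small by (intro mult_mono) auto
      then show ?thesis using x1 n by (intro mult_mono) auto
    qed
    then have "?t * (1 - \<epsilon>\<^sup>2) \<ge> 225/64" by (simp add: mult.assoc)
    then show ?thesis unfolding entB_def using eps_small(1) by linarith
  qed
  have "(5/8)\<^sup>2 \<le> (- entB \<epsilon> ?t)\<^sup>2" using B by (intro power_mono) auto
  then have "(entB \<epsilon> ?t)\<^sup>2 \<ge> 25/64" by (simp add: power2_eq_square)
  moreover have "6 * \<epsilon> \<le> 24/64" using eps_small(1) by simp
  ultimately show ?thesis unfolding kdet_def[OF qexp_ge_1 \<epsilon>(1) eps_small(4)] using AC by linarith
qed

text \<open>The borderline degree: \<xi> times the boundary term of \<open>entC\<close> is exactly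
  1, so no power of \<epsilon> helps and constants decide. The product of \<open>entA\<close> and
  \<open>entC\<close> is at most 10/8, against a square of \<open>entB\<close> of at least
  9/4.\<close>

lemma kdet_1_neg: "kdet (qexp TYPE('n) 1) \<epsilon> ((real CARD('n) + 2) * (1 - \<epsilon> ^ (CARD('n) - 1))) < 0"
proof -
  let ?t = "(real CARD('n) + 2) * (1 - \<epsilon> ^ (CARD('n) - 1))"
  have x1: "\<epsilon> ^ (CARD('n) - 1) \<le> 1/16" using hole_area_bounds eps_small by linarith
  have t: "0 \<le> ?t" "?t \<le> (real CARD('n) + 2 * real K)"
  proof -
    show "0 \<le> ?t" using x1 by simp
    have K2: "real K \<ge> 2" using K by simp
    have "?t \<le> (real CARD('n) + 2) * 1" using hole_area_bounds by (intro mult_left_mono) auto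
    then show "?t \<le> (real CARD('n) + 2 * real K)" by (rule order_trans) (use K2 in simp)
  qed
  have nn: "CARD('n) = Suc (CARD('n) - 1)" "CARD('n) - 2 + 2 * 1 = CARD('n)" using n by auto
  have p0: "\<epsilon> ^ (CARD('n) - 2 + 2 * 1) = \<epsilon> * \<epsilon> ^ (CARD('n) - 1)" unfolding nn(2) power_Suc[symmetric] nn(1)[symmetric] ..
  have p2: "\<epsilon> ^ (CARD('n) + 2 * 1) = \<epsilon> * \<epsilon> ^ (CARD('n) - 1) * \<epsilon>\<^sup>2"
    unfolding power_Suc[symmetric] nn(1)[symmetric] power_add by simp
  have A: "entA (qexp TYPE('n) 1) \<epsilon> ?t = \<epsilon> ^ (CARD('n) - 1) + \<epsilon> * (\<epsilon> * \<epsilon> ^ (CARD('n) - 1)) + (1 - \<epsilon> ^ (CARD('n) - 1)) * (\<epsilon> * \<epsilon> ^ (CARD('n) - 1) * \<epsilon>\<^sup>2)"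
    unfolding entA_eq p0 p2 using n by (simp add: field_simps)
  have A0: "0 \<le> entA (qexp TYPE('n) 1) \<epsilon> ?t" "entA (qexp TYPE('n) 1) \<epsilon> ?t \<le> (9/8) * \<epsilon> ^ (CARD('n) - 1)"
  proof -
    have "\<epsilon> * (\<epsilon> * \<epsilon> ^ (CARD('n) - 1)) \<le> (1/16) * (1 * \<epsilon> ^ (CARD('n) - 1))" using eps_small \<epsilon> hole_area_bounds by (intro mult_mono) auto
    moreover have "(1 - \<epsilon> ^ (CARD('n) - 1)) * (\<epsilon> * \<epsilon> ^ (CARD('n) - 1) * \<epsilon>\<^sup>2) \<le> 1 * ((1/16) * \<epsilon> ^ (CARD('n) - 1) * 1)"
      using eps_small \<epsilon> hole_area_bounds x1 by (intro mult_mono power_le_one) auto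
    moreover have "0 \<le> (1 - \<epsilon> ^ (CARD('n) - 1)) * (\<epsilon> * \<epsilon> ^ (CARD('n) - 1) * \<epsilon>\<^sup>2)" "0 \<le> \<epsilon> * (\<epsilon> * \<epsilon> ^ (CARD('n) - 1))" using x1 hole_area_bounds \<epsilon> by auto
    ultimately show "0 \<le> entA (qexp TYPE('n) 1) \<epsilon> ?t" "entA (qexp TYPE('n) 1) \<epsilon> ?t \<le> (9/8) * \<epsilon> ^ (CARD('n) - 1)" unfolding A using hole_area_bounds by linarith+
  qed
  have C: "0 \<le> entC (qexp TYPE('n) 1) \<epsilon> ?t" "entC (qexp TYPE('n) 1) \<epsilon> ?t \<le> 1 + (\<epsilon> / \<epsilon> ^ (CARD('n) - 2 + 2 * 1))"
    using entC_bounds(2,3)[OF t, of 1] by simp_all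
  have xs: "\<epsilon> ^ (CARD('n) - 1) * (\<epsilon> / \<epsilon> ^ (CARD('n) - 2 + 2 * 1)) = 1" unfolding p0 using \<epsilon> by simp
  have "entA (qexp TYPE('n) 1) \<epsilon> ?t * entC (qexp TYPE('n) 1) \<epsilon> ?t \<le> ((9/8) * \<epsilon> ^ (CARD('n) - 1)) * (1 + (\<epsilon> / \<epsilon> ^ (CARD('n) - 2 + 2 * 1)))"
    using A0 C hole_area_bounds by (intro mult_mono) auto
  also have "\<dots> = (9/8) * \<epsilon> ^ (CARD('n) - 1) + 9/8 * (\<epsilon> ^ (CARD('n) - 1) * (\<epsilon> / \<epsilon> ^ (CARD('n) - 2 + 2 * 1)))" by (simp only: distrib_left mult_1_right mult.assoc)
  finally have AC: "entA (qexp TYPE('n) 1) \<epsilon> ?t * entC (qexp TYPE('n) 1) \<epsilon> ?t \<le> 10/8" unfolding xs using x1 by linarith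
  have B: "entB \<epsilon> ?t \<le> - (3/2)"
  proof -
    have "6 * ((15/16) * (15/16)) \<le> (real CARD('n) + 2) * ((1 - \<epsilon> ^ (CARD('n) - 1)) * (1 - \<epsilon>\<^sup>2))"
    proof -
      have "\<epsilon>\<^sup>2 \<le> 1/16 * 1" unfolding power2_eq_square using \<epsilon> eps_small by (intro mult_mono) auto
      then show ?thesis using x1 n by (intro mult_mono) auto
    qed
    then have "?t * (1 - \<epsilon>\<^sup>2) \<ge> 6 * ((15/16) * (15/16))" by (simp only: mult.assoc)
    then show ?thesis unfolding entB_def using eps_small(1) by linarith
  qed
  have "(3/2)\<^sup>2 \<le> (- entB \<epsilon> ?t)\<^sup>2" using B by (intro power_mono) auto
  then have "(entB \<epsilon> ?t)\<^sup>2 \<ge> 9/4" by (simp add: power2_eq_square)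
  then show ?thesis unfolding kdet_def[OF qexp_ge_1 \<epsilon>(1) eps_small(4)] using AC by linarith
qed

end

section \<open>Comparison with the ball\<close>

text \<open>\<open>Inf\<close> on the reals is meaningful only for nonempty sets bounded below;
  \<open>t\<close> witnesses the former and \<open>b\<close> the latter.\<close>

lemma steklov_eig_le:
  assumes "\<And>s. m < eig_count \<Omega> s \<Longrightarrow> b \<le> s" "m < eig_count \<Omega> t"
  shows "steklov_eig m \<Omega> \<le> t"
  unfolding steklov_eig_def using assms by (intro cInf_lower bdd_belowI[of _ b]) auto

lemma steklov_eig_ge:
  assumes "\<And>s. m < eig_count \<Omega> s \<Longrightarrow> b \<le> s" "m < eig_count \<Omega> t"
  shows "b \<le> steklov_eig m \<Omega>"
  unfolding steklov_eig_def using assms by (intro cInf_greatest) auto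

lemma eig_count_ball_pos:
  assumes "CARD('n::finite) \<ge> 4" "m < eig_count (ball (0::real^'n) 1) s"
  shows "real CARD('n) \<le> s"
  using eig_count_ball[OF assms(1), of s 0] assms(2) by (intro leI) auto

lemma eig_count_ball_ge2:
  assumes n: "CARD('n::finite) \<ge> 4" and m: "m < eig_count (ball (0::real^'n) 1) s" "m \<ge> 1"
  shows "real CARD('n) + 2 \<le> s"
proof (rule leI, rule notI)
  assume "s < real CARD('n) + 2"
  then have "eig_count (ball (0::real^'n) 1) s
      = (\<Sum>k | k < 1 \<and> real CARD('n) + 2 * real k \<le> s. card (hb k :: (real^'n \<Rightarrow> real) set))"
    by (intro eig_count_ball[OF n]) simp
  also have "\<dots> \<le> (\<Sum>k\<in>{0}. card (hb k :: (real^'n \<Rightarrow> real) set))" by (intro sum_mono2) auto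
  also have "\<dots> = 1" using card_hb_0[where ?'n='n] n by simp
  finally show False using m by simp
qed

lemma eig_count_ball_at:
  assumes "CARD('n::finite) \<ge> 4"
  shows "eig_count (ball (0::real^'n) 1) (real CARD('n) + 2 * real K) = (\<Sum>k<Suc K. card (hb k :: (real^'n \<Rightarrow> real) set))"
proof -
  have "{k. k < Suc K \<and> real CARD('n) + 2 * real k \<le> real CARD('n) + 2 * real K} = {..<Suc K}" by auto
  then show ?thesis using eig_count_ball[OF assms, of "real CARD('n) + 2 * real K" "Suc K"] by simp
qed

lemma sum_card_hb_ge:
  assumes "CARD('n::finite) \<ge> 2"
  shows "K \<le> (\<Sum>k<K. card (hb k :: (real^'n \<Rightarrow> real) set))"
proof -
  have "(\<Sum>k<K. 1) \<le> (\<Sum>k<K. card (hb k :: (real^'n \<Rightarrow> real) set))"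
    using card_hb_pos[OF assms] by (intro sum_mono) (simp add: Suc_leI)
  then show ?thesis by simp
qed

text \<open>For p <= 1 the area gain (1 + \<xi>)^p is at most 1 + \<xi>, and (1 - \<xi>)(1 + \<xi>)
  < 1.\<close>

lemma scaled_less:
  fixes c e b S \<xi> p :: real
  assumes "c > 0" "0 < \<xi>" "\<xi> < 1" "e \<le> c * (1 - \<xi>)" "c \<le> b" "S > 0" "0 < p" "p \<le> 1"
  shows "e * (S * (1 + \<xi>)) powr p < b * S powr p"
proof -
  have "(1 + \<xi>) powr p \<le> (1 + \<xi>) powr 1" using assms by (intro powr_mono) auto
  then have p: "(1 + \<xi>) powr p \<le> 1 + \<xi>" using assms by simp
  have "e * (1 + \<xi>) powr p \<le> (c * (1 - \<xi>)) * (1 + \<xi>) powr p" using assms by (intro mult_right_mono) auto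
  also have "\<dots> \<le> (c * (1 - \<xi>)) * (1 + \<xi>)" using p assms by (intro mult_left_mono) auto
  also have "\<dots> = c - c * \<xi>\<^sup>2" by (simp add: power2_eq_square algebra_simps)
  also have "\<dots> < c" using assms by simp
  also have "c \<le> b" by fact
  finally have "(e * (1 + \<xi>) powr p) * S powr p < b * S powr p" using assms by (intro mult_strict_right_mono) auto
  then show ?thesis using assms by (simp add: powr_mult mult.assoc mult.commute[of "S powr p"])
qed

text \<open>With y = p\<xi>/4 the area gain is at least 1 + 2y while the eigenvalue loses at most
  the factor 1 - y, and (1 - y)(1 + 2y) = 1 + y (1 - 2y) > 1.\<close>

lemma scaled_greater:
  fixes N e b S \<xi> p :: real
  assumes N: "N > 0" and \<xi>: "0 < \<xi>" "\<xi> \<le> 1/2" and e: "N * (1 - p * \<xi> / 4) \<le> e" and b: "b \<le> N" and S: "S > 0"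
    and p: "0 < p" "p \<le> 1"
  shows "b * S powr p < e * (S * (1 + \<xi>)) powr p"
proof -
  define y where "y = p * \<xi> / 4"
  have "p * \<xi> \<le> 1 * (1/2)" using p \<xi> by (intro mult_mono) auto
  moreover have "p * \<xi> > 0" using p \<xi> by simp
  ultimately have y: "0 < y" "y < 1/2" unfolding y_def by linarith+
  have "\<xi> * \<xi> \<le> (1/2) * \<xi>" using \<xi> by (intro mult_right_mono) auto
  then have "\<xi> / 2 \<le> \<xi> - \<xi>\<^sup>2" by (simp add: power2_eq_square)
  also have "\<dots> \<le> ln (1 + \<xi>)" using \<xi> by (intro ln_one_plus_pos_lower_bound) auto
  finally have "p * (\<xi> / 2) \<le> p * ln (1 + \<xi>)" using p by (intro mult_left_mono) auto
  then have "1 + 2 * y \<le> 1 + p * ln (1 + \<xi>)" by (simp add: y_def mult.commute)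
  also have "\<dots> \<le> (1 + \<xi>) powr p" using \<xi> exp_ge_add_one_self[of "p * ln (1 + \<xi>)"] by (simp add: powr_def)
  finally have P: "1 + 2 * y \<le> (1 + \<xi>) powr p" .
  have "0 < y * (1 - 2 * y)" using y by simp
  then have "1 < (1 - y) * (1 + 2 * y)" by (simp add: algebra_simps)
  then have "N * 1 < N * ((1 - y) * (1 + 2 * y))" using N by (intro mult_strict_left_mono) auto
  then have "b < N * (1 - y) * (1 + 2 * y)" using b by (simp add: mult.assoc)
  also have "\<dots> \<le> e * (1 + \<xi>) powr p"
  proof (intro mult_mono P)
    show "N * (1 - y) \<le> e" using e by (simp add: y_def)
    then show "0 \<le> e" using N y by (intro order_trans[OF _ \<open>N * (1 - y) \<le> e\<close>]) simp
  qed (use y in simp)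
  finally have "b * S powr p < (e * (1 + \<xi>) powr p) * S powr p" using S by (intro mult_strict_right_mono) auto
  then show ?thesis using \<xi> S by (simp add: powr_mult mult.assoc mult.commute[of "S powr p"])
qed

theorem theorem1p6:
  assumes "CARD('n::finite) \<ge> 4"
  shows "(\<forall>m \<le> CARD('n). \<exists>\<Omega> :: (real^'n) set. smooth_bounded_domain \<Omega> \<and>
            steklov_eig m \<Omega> * boundary_area \<Omega> powr (1 / (real CARD('n) - 1))
            < steklov_eig m (ball (0::real^'n) 1) * boundary_area (ball (0::real^'n) 1) powr (1 / (real CARD('n) - 1)))
       \<and> (\<forall>m \<ge> CARD('n) + 1. \<exists>\<Omega> :: (real^'n) set. smooth_bounded_domain \<Omega> \<and>
            steklov_eig m \<Omega> * boundary_area \<Omega> powr (1 / (real CARD('n) - 1))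
            > steklov_eig m (ball (0::real^'n) 1) * boundary_area (ball (0::real^'n) 1) powr (1 / (real CARD('n) - 1)))"
proof -
  note n = assms
  define d where "d k = card (hb k :: (real^'n \<Rightarrow> real) set)" for k
  define \<nu> where "\<nu> = real CARD('n)"
  have nu: "\<nu> \<ge> 4" using n by (simp add: \<nu>_def)
  have n2: "CARD('n) \<ge> 2" using n by simp
  have p: "0 < 1 / (\<nu> - 1)" "1 / (\<nu> - 1) \<le> 1" using nu by auto
  have d0: "d 0 = 1" "d 1 = CARD('n)" using card_hb_0[OF n2] card_hb_1[where ?'n='n] by (simp_all add: d_def)
  define B where "B = ball (0::real^'n) 1"
  have S: "boundary_area B > 0" unfolding B_def by (rule boundary_area_ball_pos[OF n2])
  have ball_at: "eig_count B (\<nu> + 2 * real K) = (\<Sum>k<Suc K. d k)" for K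
    unfolding B_def \<nu>_def d_def by (rule eig_count_ball_at[OF n])
  have ball_nu: "\<nu> \<le> s" if "m < eig_count B s" for m s
    using eig_count_ball_pos[OF n] that unfolding B_def \<nu>_def by blast
  have ball_nu2: "\<nu> + 2 \<le> s" if "m < eig_count B s" "m \<ge> 1" for m s
    using eig_count_ball_ge2[OF n] that unfolding B_def \<nu>_def by blast
  have ball_ex: "\<exists>t. m < eig_count B t" for m
  proof -
    have "m < (\<Sum>k<Suc m. d k)" using sum_card_hb_ge[OF n2, of "Suc m"] unfolding d_def by (rule less_le_trans[OF lessI])
    then show ?thesis unfolding ball_at[symmetric] by blast
  qed
  define eps where "eps K = 1 / (16 * (\<nu> + 2 * real K)\<^sup>2)" for K
  have eps: "0 < eps K" "eps K \<le> 1/16" "eps K < 1" for K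
  proof -
    have "1 \<le> (\<nu> + 2 * real K)\<^sup>2" using nu by (intro one_le_power) auto
    then show "0 < eps K" "eps K \<le> 1/16" "eps K < 1" by (auto simp: eps_def divide_simps)
  qed
  define \<xi> where "\<xi> K = eps K ^ (CARD('n) - 1)" for K
  have xi: "0 < \<xi> K" "\<xi> K \<le> 1/2" for K
  proof -
    have "\<xi> K \<le> eps K ^ 1" unfolding \<xi>_def using eps[of K] n by (intro power_decreasing) auto
    then show "0 < \<xi> K" "\<xi> K \<le> 1/2" using eps[of K] by (auto simp: \<xi>_def)
  qed
  define A where "A K = (annulus (eps K) :: (real^'n) set)" for K
  have dom: "smooth_bounded_domain (A K)" for K
    unfolding A_def by (rule smooth_bounded_domain_annulus[OF eps(1,3) n2])
  have area: "boundary_area (A K) = boundary_area B * (1 + \<xi> K)" for K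
    unfolding A_def B_def \<xi>_def by (rule boundary_area_annulus[OF n2 eps(1,3)])
  \<comment> \<open>\<open>K\<close> selects the annulus and \<open>L\<close> the cut degree; in the
    second half one annulus is examined at two cuts.\<close>
  define \<tau> where "\<tau> K L = (\<nu> + 2 * real L) * (1 - \<xi> K / (4 * (\<nu> - 1)))" for K L
  have tau: "\<tau> K L = threshold CARD('n) L (eps K)" for K L
    by (simp add: \<tau>_def threshold_def \<xi>_def \<nu>_def)
  have spec: "\<exists>lam. (\<forall>k<L. 0 \<le> lam k \<and> lam k \<le> \<tau> K L)
      \<and> (\<forall>t\<le>\<tau> K L. eig_count (A K) t = (\<Sum>k | k < L \<and> lam k \<le> t. d k))
      \<and> (\<forall>k<L. \<forall>t. 0 < t \<longrightarrow> t \<le> \<tau> K L \<longrightarrow> kdet (qexp TYPE('n) k) (eps K) t < 0 \<longrightarrow> lam k \<le> t)"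
    if L: "2 \<le> L" "L \<le> K" for K L
    unfolding tau A_def d_def
  proof (rule spectrum_annulus[OF n eps(1) _ L(1)])
    have "(\<nu> + 2 * real L)\<^sup>2 \<le> (\<nu> + 2 * real K)\<^sup>2" using L nu by (intro power_mono) auto
    moreover have "0 < (\<nu> + 2 * real L)\<^sup>2" using nu by (intro zero_less_power) auto
    ultimately show "eps K \<le> 1 / (16 * (real CARD('n) + 2 * real L)\<^sup>2)"
      unfolding eps_def \<nu>_def[symmetric] by (intro divide_left_mono mult_left_mono mult_pos_pos) auto
  qed
  show ?thesis unfolding B_def[symmetric] \<nu>_def[symmetric]
  proof (intro conjI allI impI)
    fix m assume m: "m \<le> CARD('n)"
    \<comment> \<open>Cutting at degree 2 isolates degrees 0 and 1, which together carry 1 + n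
      harmonics.\<close>
    have e2: "eps 2 \<le> 1 / (16 * (real CARD('n) + 2 * real (2::nat))\<^sup>2)" by (simp add: eps_def \<nu>_def)
    obtain lam where lam: "\<forall>k<2. 0 \<le> lam k \<and> lam k \<le> \<tau> 2 2"
      "\<forall>t\<le>\<tau> 2 2. eig_count (A 2) t = (\<Sum>k | k < 2 \<and> lam k \<le> t. d k)"
      "\<forall>k<2. \<forall>t. 0 < t \<longrightarrow> t \<le> \<tau> 2 2 \<longrightarrow> kdet (qexp TYPE('n) k) (eps 2) t < 0 \<longrightarrow> lam k \<le> t"
      using spec[of 2 2] by auto
    have T: "\<nu> + 3 \<le> \<tau> 2 2"
      using threshold_bounds(1)[OF n eps(1) e2 order_refl] unfolding tau by (simp add: \<nu>_def)
    have le: "c * (1 - \<xi> 2) \<le> c" "0 < c * (1 - \<xi> 2)" if "c > 0" for c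
      using that xi[of 2] by (auto simp: mult_le_cancel_left1)
    have t0: "0 < \<nu> * (1 - \<xi> 2)" "\<nu> * (1 - \<xi> 2) \<le> \<tau> 2 2" "0 < (\<nu> + 2) * (1 - \<xi> 2)" "(\<nu> + 2) * (1 - \<xi> 2) \<le> \<tau> 2 2"
      using le[of \<nu>] le[of "\<nu> + 2"] T nu by linarith+
    have l0: "lam 0 \<le> \<nu> * (1 - \<xi> 2)"
      using lam(3) t0 kdet_0_neg[OF n eps(1) e2 order_refl] unfolding \<xi>_def \<nu>_def by (metis zero_less_numeral)
    have l1: "lam 1 \<le> (\<nu> + 2) * (1 - \<xi> 2)"
      using lam(3) t0 kdet_1_neg[OF n eps(1) e2 order_refl] unfolding \<xi>_def \<nu>_def by (metis one_less_numeral_iff semiring_norm(76))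
    have pos: "0 \<le> s" if "m < eig_count (A 2) s" for s
    proof (rule ccontr)
      assume s: "\<not> 0 \<le> s"
      have e: "{k. k < 2 \<and> lam k \<le> s} = {}" using lam(1) s by force
      have "s \<le> \<tau> 2 2" using s T nu by linarith
      then have "eig_count (A 2) s = 0" using lam(2) by (metis e sum.empty)
      then show False using that by simp
    qed
    have "steklov_eig m (A 2) * boundary_area (A 2) powr (1 / (\<nu> - 1)) < steklov_eig m B * boundary_area B powr (1 / (\<nu> - 1))"
    \<comment> \<open>The value to beat is n for m = 0 and n + 2 for 1 <= m <= n. Accordingly the
      root of degree 0 alone, or the roots of degrees 0 and 1 with 1 + n > m harmonics, must lie
      below it.\<close>
    proof (cases "m = 0")
      case True
      have "(\<Sum>k\<in>{0}. d k) \<le> (\<Sum>k | k < 2 \<and> lam k \<le> \<nu> * (1 - \<xi> 2). d k)" using l0 by (intro sum_mono2) auto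
      then have "m < eig_count (A 2) (\<nu> * (1 - \<xi> 2))" using lam(2) t0 d0 True by simp
      then have "steklov_eig m (A 2) \<le> \<nu> * (1 - \<xi> 2)" using pos by (rule steklov_eig_le[rotated])
      moreover have "\<nu> \<le> steklov_eig m B" using ball_ex[of m] ball_nu by (metis steklov_eig_ge)
      ultimately show ?thesis unfolding area using nu xi[of 2] S p by (intro scaled_less[of \<nu>]) auto
    next
      case False
      have "lam 0 \<le> (\<nu> + 2) * (1 - \<xi> 2)"
      proof -
        have "\<nu> * (1 - \<xi> 2) \<le> (\<nu> + 2) * (1 - \<xi> 2)" using xi[of 2] by (intro mult_right_mono) auto
        then show ?thesis using l0 by linarith
      qed
      then have "(\<Sum>k\<in>{0,1}. d k) \<le> (\<Sum>k | k < 2 \<and> lam k \<le> (\<nu> + 2) * (1 - \<xi> 2). d k)" using l1 by (intro sum_mono2) auto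
      then have "m < eig_count (A 2) ((\<nu> + 2) * (1 - \<xi> 2))" using lam(2) t0 d0 m by simp
      then have "steklov_eig m (A 2) \<le> (\<nu> + 2) * (1 - \<xi> 2)" using pos by (rule steklov_eig_le[rotated])
      moreover have "\<nu> + 2 \<le> steklov_eig m B" using ball_ex[of m] ball_nu2[of m] False
        by (metis steklov_eig_ge One_nat_def Suc_leI neq0_conv)
      ultimately show ?thesis unfolding area using nu xi[of 2] S p by (intro scaled_less[of "\<nu> + 2"]) auto
    qed
    then show "\<exists>\<Omega>::(real^'n) set. smooth_bounded_domain \<Omega> \<and> steklov_eig m \<Omega> * boundary_area \<Omega> powr (1 / (\<nu> - 1)) < steklov_eig m B * boundary_area B powr (1 / (\<nu> - 1))"
      using dom[of 2] by (intro exI[of _ "A 2"] conjI)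
  next
    fix m assume m: "CARD('n) + 1 \<le> m"
    \<comment> \<open>The degree to which the m-th eigenvalue of the ball belongs, counting from 0:
      degrees below K carry at most m harmonics, those up to K more than m. As m >= n + 1, this K is
      at least 2.\<close>
    define K where "K = (GREATEST K. (\<Sum>k<K. d k) \<le> m)"
    have bd: "K' \<le> m" if "(\<Sum>k<K'. d k) \<le> m" for K'
      using sum_card_hb_ge[OF n2, of K'] that unfolding d_def by (rule order_trans)
    have s2: "(\<Sum>k<2. d k) \<le> m" using m d0 by (simp add: numeral_2_eq_2)
    have K2: "2 \<le> K" unfolding K_def using s2 bd by (rule Greatest_le_nat)
    have Km: "(\<Sum>k<K. d k) \<le> m" unfolding K_def using s2 bd by (rule GreatestI_nat)
    have Km': "m < (\<Sum>k<Suc K. d k)"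
    proof (rule ccontr)
      assume "\<not> ?thesis"
      then have "(\<Sum>k<Suc K. d k) \<le> m" by simp
      then have "Suc K \<le> K" unfolding K_def using bd by (rule Greatest_le_nat)
      then show False by simp
    qed
    \<comment> \<open>Cut at K: below this threshold only degrees under K are counted, one root
      each, hence at most m in total.\<close>
    obtain lam where lam: "\<forall>t\<le>\<tau> (Suc K) K. eig_count (A (Suc K)) t = (\<Sum>k | k < K \<and> lam k \<le> t. d k)"
      using spec[OF K2, of "Suc K"] by auto
    \<comment> \<open>Cut at \<open>Suc K\<close>: up to this larger threshold more than m
      eigenvalues are counted, so the set in \<open>steklov_eig\<close> is nonempty and its infimum
      meaningful.\<close>
    obtain lam' where lam': "\<forall>k<Suc K. lam' k \<le> \<tau> (Suc K) (Suc K)"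
        "\<forall>t\<le>\<tau> (Suc K) (Suc K). eig_count (A (Suc K)) t = (\<Sum>k | k < Suc K \<and> lam' k \<le> t. d k)"
      using spec[of "Suc K" "Suc K"] K2 by auto
    have "\<tau> (Suc K) K \<le> s" if s: "m < eig_count (A (Suc K)) s" for s
    proof (rule ccontr)
      assume "\<not> ?thesis"
      then have "eig_count (A (Suc K)) s = (\<Sum>k | k < K \<and> lam k \<le> s. d k)" using lam by simp
      also have "\<dots> \<le> (\<Sum>k<K. d k)" by (intro sum_mono2) auto
      finally show False using s Km by simp
    qed
    moreover have "m < eig_count (A (Suc K)) (\<tau> (Suc K) (Suc K))"
    proof -
      have "{k. k < Suc K \<and> lam' k \<le> \<tau> (Suc K) (Suc K)} = {..<Suc K}" using lam'(1) by auto
      then show ?thesis using lam'(2) Km' by simp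
    qed
    ultimately have "\<tau> (Suc K) K \<le> steklov_eig m (A (Suc K))" by (rule steklov_eig_ge)
    moreover have "steklov_eig m B \<le> \<nu> + 2 * real K"
    proof (rule steklov_eig_le)
      show "m < eig_count B (\<nu> + 2 * real K)" unfolding ball_at by (rule Km')
    qed (rule ball_nu)
    ultimately have "steklov_eig m B * boundary_area B powr (1 / (\<nu> - 1))
        < steklov_eig m (A (Suc K)) * boundary_area (A (Suc K)) powr (1 / (\<nu> - 1))"
      unfolding area using nu xi[of "Suc K"] S p
      by (intro scaled_greater[of "\<nu> + 2 * real K"]) (auto simp: \<tau>_def mult.commute)
    then show "\<exists>\<Omega>::(real^'n) set. smooth_bounded_domain \<Omega> \<and> steklov_eig m B * boundary_area B powr (1 / (\<nu> - 1)) < steklov_eig m \<Omega> * boundary_area \<Omega> powr (1 / (\<nu> - 1))"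
      using dom[of "Suc K"] by (intro exI[of _ "A (Suc K)"] conjI)
  qed
qed

end
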